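(* Let $k\ge0$ be an integer. On a right-type group $\mathcal N_{\mathbb S}$ satisfying condition (H), the homology groups $H_0(\mathscr E(\mathcal N_{\mathbb S},\widehat{\mathscr V}_\bullet))$ and $H_0(\mathscr D'(\mathcal N_{\mathbb S},\widehat{\mathscr V}_\bullet))$ vanish. That is, the maps $\widehat{\mathscr D}_0:\mathscr E(\mathcal N_{\mathbb S},\widehat{\mathscr V}_1)\to\mathscr E(\mathcal N_{\mathbb S},\widehat{\mathscr V}_0)$ and $\widehat{\mathscr D}_0:\mathscr D'(\mathcal N_{\mathbb S},\widehat{\mathscr V}_1)\to\mathscr D'(\mathcal N_{\mathbb S},\widehat{\mathscr V}_0)$ are surjective.
   Context: Groups. Let $n\ge1$ and let $\mathbb S$ be a real symmetric $4n\times4n$ matrix. Let $I^1,I^2,I^3$ be the $4\times4$ skew matrices whose only nonzero entries above the diagonal are: $I^1_{12}=1,\ I^1_{34}=-1$; $I^2_{13}=1,\ I^2_{24}=1$; $I^3_{14}=1,\ I^3_{23}=-1$. Put $\mathbb I^\beta=\mathrm{diag}(I^\beta,\dots,I^\beta)$ and $B^\beta=\mathbb S\mathbb I^\beta+\mathbb I^\beta\mathbb S$. $\mathcal N_{\mathbb S}$ is $\mathbb R^{4n}\times\mathbb R^3$ with $(\mathbf x,\mathbf t)(\mathbf y,\mathbf s)=(\mathbf x+\mathbf y,\ t_\beta+s_\beta+2\sum_{a,b}B^\beta_{ab}x_ay_b)$; left invariant fields $X_b=\partial_{x_b}+2\sum_{\beta,a}B^\beta_{ab}x_a\partial_{t_\beta}$.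 Its Lie algebra is $\mathfrak g_1\oplus\mathfrak g_2$, $\mathfrak g_1=\mathrm{span}\{X_b\}$, $\mathfrak g_2=\mathrm{span}\{\partial_{t_\beta}\}$. Condition (H): for every $\lambda\in\mathfrak g_2^*\setminus\{0\}$ the skew form $(Y,Y')\mapsto\langle\lambda,[Y,Y']\rangle$ on $\mathfrak g_1$ is non-degenerate. Right-type. With $\nabla_{2l}^{0'}=-\partial_{x_{4l+3}}-\mathbf i\partial_{x_{4l+4}}$, $\nabla_{2l}^{1'}=-\partial_{x_{4l+1}}-\mathbf i\partial_{x_{4l+2}}$, $\nabla_{2l+1}^{0'}=\partial_{x_{4l+1}}-\mathbf i\partial_{x_{4l+2}}$, $\nabla_{2l+1}^{1'}=-\partial_{x_{4l+3}}+\mathbf i\partial_{x_{4l+4}}$ ($l=0,\dots,n-1$), $\phi(\mathbf x)=\sum_{a,b}\mathbb S_{ab}x_ax_b$, and a basis $\omega^0,\dots,\omega^{2n-1}$ of $\mathbb C^{2n}$, the group is right-type if $\sum_{A,B}(\nabla_A^{0'}\nabla_B^{1'}\phi)\,\omega^A\wedge\omega^B=0$. Operators (repeated indices summed, $A',B'\in\{0',1'\}$). $Z_{2l}^{0'}=-X_{4l+3}-\mathbf iX_{4l+4}$, $Z_{2l}^{1'}=-X_{4l+1}-\mathbf iX_{4l+2}$, $Z_{2l+1}^{0'}=X_{4l+1}-\mathbf iX_{4l+2}$, $Z_{2l+1}^{1'}=-X_{4l+3}+\mathbf iX_{4l+4}$; $\mathfrak d^{A'}f=Z_A^{A'}f_{\mathbf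 A}\omega^A\wedge\omega^{\mathbf A}$ for $f=f_{\mathbf A}\omega^{\mathbf A}$. $\mathbf T_{0'}^{0'}=-\mathbf i\partial_{t_1}$, $\mathbf T_{0'}^{1'}=-\partial_{t_2}+\mathbf i\partial_{t_3}$, $\mathbf T_{1'}^{0'}=\partial_{t_2}+\mathbf i\partial_{t_3}$, $\mathbf T_{1'}^{1'}=\mathbf i\partial_{t_1}$, $\mathbf T^{A'0'}=\mathbf T_{1'}^{A'}$, $\mathbf T^{A'1'}=-\mathbf T_{0'}^{A'}$. $\odot^\sigma\mathbb C^2$ is identified with homogeneous polynomials of degree $\sigma$ in $(s^{0'},s^{1'})$, $\partial_{A'}=\partial/\partial s^{A'}$. $\mathscr D_0$, the first operator of the boundary complex of the $k$-Cauchy-Fueter complex on a right-type group, maps $\mathscr V_0=\odot^k\mathbb C^2$-valued functions to $\mathscr V_1$-valued ones: $k\ge2$: $\mathscr V_1=(\odot^{k-1}\mathbb C^2\otimes\mathbb C^{2n})\oplus\odot^{k-2}\mathbb C^2$, $\mathscr D_0f=(\partial_{A'}\mathfrak d^{A'}f,\ -\partial_{A'}\partial_{B'}\mathbf T^{A'B'}f)$; $k=1$: $\mathscr V_1=\mathbb C^{2n}\oplus\mathbb C^{2n}$, $\mathscr D_0f=(\partial_{A'}\mathfrak d^{A'}f,\ -\partial_{A'}\mathfrak d^{B'}\mathbf T_{B'}^{A'}f)$; $k=0$: $\mathscr V_1=\wedge^2\mathbb C^{2n}$, $\mathscr D_0f=\mathfrak d^{0'}\mathfrak d^{1'}f$.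 Duals. $\widehat{\mathscr V}_j$ ($j=0,1$) is obtained from $\mathscr V_j$ by replacing each summand $\odot^\sigma\mathbb C^2\otimes\wedge^\tau\mathbb C^{2n}$ by $\odot^\sigma\mathbb C^2\otimes\wedge^{2n-\tau}\mathbb C^{2n}$. It is paired with $\mathscr V_j$ by contracting the symmetric indices and taking the wedge product into $\wedge^{2n}\mathbb C^{2n}$; a $2n$-form $f\,\omega^0\wedge\cdots\wedge\omega^{2n-1}$ is integrated as $\int f\,dV$ with $dV$ Lebesgue measure. Through this pairing $\widehat{\mathscr V}_j$-valued functions and distributions are dual to $\mathscr V_j$-valued ones, and $\widehat{\mathscr D}_0$ is the transpose of $\mathscr D_0$: $\langle\widehat{\mathscr D}_0F,f\rangle=\langle F,\mathscr D_0f\rangle$ for all compactly supported smooth $f$. $\mathscr E(\mathcal N_{\mathbb S},V)$ and $\mathscr D'(\mathcal N_{\mathbb S},V)$ are the spaces of smooth $V$-valued functions and of $V$-valued distributions, and $H_0$ denotes the quotient of the space of $\widehat{\mathscr V}_0$-valued elements by the image of $\widehat{\mathscr D}_0$. *)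

theory Defs
  imports "HOL-Analysis.Analysis"
begin

(* Conventions.  The number n >= 1 is CARD('n), the elements of 'n in increasing order standing for
   l = 0, ..., n-1.  The index 4l+j (j = 1, ..., 4) of R^4n is (l, j) :: 'n \<times> 4, where 4 = 0 in the
   type 4; likewise 3 = 0 in the type 3.  The index 2l+e (e = 0, 1) of C^2n is (l, e) :: 'n \<times> 2,
   and the primed indices 0', 1' are the elements 0, 1 of the type 2. *)

section \<open>The group\<close>

type_synonym 'n pt = "(real^('n \<times> 4)) \<times> (real^3)"

definition skew_unit :: "4 \<Rightarrow> 4 \<Rightarrow> real^4^4" where
  "skew_unit a b =
     (\<chi> i j. if i = a \<and> j = b then 1 else if i = b \<and> j = a then -1 else 0)"

definition I_mat :: "3 \<Rightarrow> real^4^4" where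
  "I_mat \<beta> =
     (if \<beta> = 1 then skew_unit 1 2 - skew_unit 3 4
      else if \<beta> = 2 then skew_unit 1 3 + skew_unit 2 4
      else skew_unit 1 4 - skew_unit 2 3)"

definition II_mat :: "3 \<Rightarrow> real^('n::finite \<times> 4)^('n \<times> 4)" where
  "II_mat \<beta> = (\<chi> i j. if fst i = fst j then I_mat \<beta> $ snd i $ snd j else 0)"

definition B_mat :: "real^('n::finite \<times> 4)^('n \<times> 4) \<Rightarrow> 3 \<Rightarrow> real^('n \<times> 4)^('n \<times> 4)" where
  "B_mat S \<beta> = S ** II_mat \<beta> + II_mat \<beta> ** S"

definition gmult :: "real^('n::finite \<times> 4)^('n \<times> 4) \<Rightarrow> 'n pt \<Rightarrow> 'n pt \<Rightarrow> 'n pt" where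
  "gmult S p q =
     (fst p + fst q,
      \<chi> \<beta>. snd p $ \<beta> + snd q $ \<beta>
            + 2 * (\<Sum>a\<in>UNIV. \<Sum>b\<in>UNIV. B_mat S \<beta> $ a $ b * fst p $ a * fst q $ b))"

definition Xfield :: "real^('n::finite \<times> 4)^('n \<times> 4) \<Rightarrow> 'n \<times> 4 \<Rightarrow> 'n pt \<Rightarrow> 'n pt" where
  "Xfield S b p = (axis b 1, \<chi> \<beta>. 2 * (\<Sum>a\<in>UNIV. B_mat S \<beta> $ a $ b * fst p $ a))"

text \<open>The fields are left invariant for the group law.\<close>

lemma Xfield_left_invariant:
  fixes S :: "real^('n::finite \<times> 4)^('n \<times> 4)"
  shows "(gmult S p has_derivative D) (at q) \<Longrightarrow> D (Xfield S b q) = Xfield S b (gmult S p q)"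
proof -
  assume D: "(gmult S p has_derivative D) (at q)"
  define L :: "'n pt \<Rightarrow> 'n pt" where
    "L v = (fst v, \<chi> \<beta>. snd v $ \<beta>
       + 2 * (\<Sum>a\<in>UNIV. \<Sum>c\<in>UNIV. B_mat S \<beta> $ a $ c * fst p $ a * fst v $ c))" for v
  have "linear L"
    by (rule linearI)
       (auto simp: L_def vec_eq_iff algebra_simps sum.distrib sum_distrib_left)
  hence "(L has_derivative L) (at q)"
    by (simp add: linear_imp_has_derivative)
  hence "((\<lambda>v. p + L v) has_derivative L) (at q)"
    using has_derivative_add[OF has_derivative_const[of p] \<open>(L has_derivative L) (at q)\<close>] by simp
  moreover have "(\<lambda>v. p + L v) = gmult S p"
    by (auto simp: fun_eq_iff L_def gmult_def prod_eq_iff vec_eq_iff)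
  ultimately have "D = L"
    using D has_derivative_unique by metis
  moreover have "(\<Sum>c\<in>UNIV. B_mat S \<beta> $ a $ c * fst p $ a * axis b 1 $ c)
      = B_mat S \<beta> $ a $ b * fst p $ a" for a \<beta>
  proof -
    have "(\<Sum>c\<in>UNIV. B_mat S \<beta> $ a $ c * fst p $ a * axis b 1 $ c)
        = (\<Sum>c\<in>UNIV. if c = b then B_mat S \<beta> $ a $ b * fst p $ a else 0)"
      by (rule sum.cong) (auto simp: axis_def)
    thus ?thesis by simp
  qed
  ultimately show ?thesis
    by (simp add: L_def Xfield_def gmult_def vec_eq_iff ring_distribs sum.distrib)
qed

definition lie_bracket ::
    "('a::real_normed_vector \<Rightarrow> 'a) \<Rightarrow> ('a \<Rightarrow> 'a) \<Rightarrow> 'a \<Rightarrow> 'a" where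
  "lie_bracket V W p = frechet_derivative W (at p) (V p) - frechet_derivative V (at p) (W p)"

definition g1 :: "real^('n::finite \<times> 4)^('n \<times> 4) \<Rightarrow> ('n pt \<Rightarrow> 'n pt) set" where
  "g1 S = range (\<lambda>y :: real^('n \<times> 4). \<lambda>p. \<Sum>b\<in>UNIV. y $ b *\<^sub>R Xfield S b p)"

text \<open>The fields in \<open>\<gg>\<^sub>2\<close> are the constant fields \<open>(0, c)\<close>; a functional on \<open>\<gg>\<^sub>2\<close> is given as a
  functional of \<open>c\<close>, and \<open>c\<close> is read off at the identity element.\<close>

definition cond_H :: "real^('n::finite \<times> 4)^('n \<times> 4) \<Rightarrow> bool" where
  "cond_H S \<longleftrightarrow>
     (\<forall>lam :: real^3 \<Rightarrow> real. linear lam \<and> lam \<noteq> (\<lambda>c. 0) \<longrightarrow>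
        (\<forall>Y\<in>g1 S. (\<forall>Y'\<in>g1 S. lam (snd (lie_bracket Y Y' 0)) = 0) \<longrightarrow> Y = (\<lambda>p. 0)))"


section \<open>Exterior algebra of \<open>\<complex>\<^sup>2\<^sup>n\<close>\<close>

text \<open>An element of the exterior algebra is given by its coefficients with respect to the
  \<open>\<omega>\<^sup>I = \<omega>\<^bsup>i\<^sub>1\<^esup> \<and> \<dots> \<and> \<omega>\<^bsup>i\<^sub>r\<^esup>\<close>, where \<open>I = {i\<^sub>1 < \<dots> < i\<^sub>r}\<close>.\<close>

type_synonym 'n form = "('n \<times> 2) set \<Rightarrow> complex"

definition idx_less :: "'n::linorder \<times> 2 \<Rightarrow> 'n \<times> 2 \<Rightarrow> bool" where
  "idx_less A B \<longleftrightarrow> fst A < fst B \<or> (fst A = fst B \<and> snd A = 0 \<and> snd B = 1)"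

text \<open>\<open>\<omega>\<^sup>I \<and> \<omega>\<^sup>J = wsign I J * \<omega>\<^bsup>I \<union> J\<^esup>\<close> for disjoint \<open>I\<close> and \<open>J\<close>.\<close>

definition wsign :: "('n::linorder \<times> 2) set \<Rightarrow> ('n \<times> 2) set \<Rightarrow> complex" where
  "wsign I J = (-1) ^ card {(i, j). i \<in> I \<and> j \<in> J \<and> idx_less j i}"

text \<open>Wedge product of forms with coefficients in two spaces that are paired by \<open>m\<close>.\<close>

definition wedge_by :: "('a \<Rightarrow> 'b \<Rightarrow> complex) \<Rightarrow> (('n::linorder \<times> 2) set \<Rightarrow> 'a) \<Rightarrow>
    (('n \<times> 2) set \<Rightarrow> 'b) \<Rightarrow> 'n form" where
  "wedge_by m F G K = (\<Sum>I\<in>Pow K. wsign I (K - I) * m (F I) (G (K - I)))"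

abbreviation wedge :: "('n::linorder) form \<Rightarrow> 'n form \<Rightarrow> 'n form" where
  "wedge \<equiv> wedge_by (*)"

definition omega :: "'n \<times> 2 \<Rightarrow> 'n form" where
  "omega A = (\<lambda>I. if I = {A} then 1 else 0)"


section \<open>Differential operators\<close>

definition dird :: "'a::real_normed_vector \<Rightarrow> ('a \<Rightarrow> complex) \<Rightarrow> 'a \<Rightarrow> complex" where
  "dird v f p = frechet_derivative f (at p) v"

text \<open>The common pattern of the \<open>\<nabla>\<^sub>A\<^bsup>A'\<^esup>\<close> and the \<open>Z\<^sub>A\<^bsup>A'\<^esup>\<close>.\<close>

definition qcomb :: "('n \<times> 4 \<Rightarrow> complex) \<Rightarrow> 'n \<times> 2 \<Rightarrow> 2 \<Rightarrow> complex" where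
  "qcomb d A A' =
     (let l = fst A in
      if snd A = 0
      then (if A' = 0 then - d (l, 3) - \<i> * d (l, 4) else - d (l, 1) - \<i> * d (l, 2))
      else (if A' = 0 then d (l, 1) - \<i> * d (l, 2) else - d (l, 3) + \<i> * d (l, 4)))"

definition nabla :: "'n::finite \<times> 2 \<Rightarrow> 2 \<Rightarrow> (real^('n \<times> 4) \<Rightarrow> complex)
    \<Rightarrow> real^('n \<times> 4) \<Rightarrow> complex" where
  "nabla A A' g x = qcomb (\<lambda>b. dird (axis b 1) g x) A A'"

definition right_type :: "real^('n::{finite,linorder} \<times> 4)^('n \<times> 4) \<Rightarrow> bool" where
  "right_type S \<longleftrightarrow>
     (let \<phi> = (\<lambda>x. complex_of_real (\<Sum>a\<in>UNIV. \<Sum>b\<in>UNIV. S $ a $ b * x $ a * x $ b))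
      in \<forall>x K. (\<Sum>A\<in>UNIV. \<Sum>B\<in>UNIV.
            nabla A 0 (nabla B 1 \<phi>) x * wedge (omega A) (omega B) K) = 0)"

definition Z_op :: "real^('n::finite \<times> 4)^('n \<times> 4) \<Rightarrow> 'n \<times> 2 \<Rightarrow> 2 \<Rightarrow>
    ('n pt \<Rightarrow> complex) \<Rightarrow> 'n pt \<Rightarrow> complex" where
  "Z_op S A A' f p = qcomb (\<lambda>b. dird (Xfield S b p) f p) A A'"

definition dt :: "3 \<Rightarrow> ('n::finite pt \<Rightarrow> complex) \<Rightarrow> 'n pt \<Rightarrow> complex" where
  "dt \<beta> f p = dird (0, axis \<beta> 1) f p"

text \<open>\<open>T_mix A' B'\<close> is \<open>\<^bold>T\<^bsub>A'\<^esub>\<^bsup>B'\<^esup>\<close> and \<open>T_up A' B'\<close> is \<open>\<^bold>T\<^bsup>A'B'\<^esup>\<close>.\<close>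

definition T_mix :: "2 \<Rightarrow> 2 \<Rightarrow> ('n::finite pt \<Rightarrow> complex) \<Rightarrow> 'n pt \<Rightarrow> complex" where
  "T_mix A' B' f p =
     (if A' = 0
      then (if B' = 0 then - \<i> * dt 1 f p else - dt 2 f p + \<i> * dt 3 f p)
      else (if B' = 0 then dt 2 f p + \<i> * dt 3 f p else \<i> * dt 1 f p))"

definition T_up :: "2 \<Rightarrow> 2 \<Rightarrow> ('n::finite pt \<Rightarrow> complex) \<Rightarrow> 'n pt \<Rightarrow> complex" where
  "T_up A' B' f p = (if B' = 0 then T_mix 1 A' f p else - T_mix 0 A' f p)"

text \<open>Forms with coefficients that are polynomials in \<open>(s\<^bsup>0'\<^esup>, s\<^bsup>1'\<^esup>)\<close>: \<open>c a b I\<close> is the coefficient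
  of \<open>(s\<^bsup>0'\<^esup>)\<^sup>a (s\<^bsup>1'\<^esup>)\<^sup>b \<omega>\<^sup>I\<close>.\<close>

type_synonym 'n spform = "nat \<Rightarrow> nat \<Rightarrow> ('n \<times> 2) set \<Rightarrow> complex"

definition lift_op :: "(('n pt \<Rightarrow> complex) \<Rightarrow> 'n pt \<Rightarrow> complex) \<Rightarrow>
    ('n pt \<Rightarrow> 'n spform) \<Rightarrow> 'n pt \<Rightarrow> 'n spform" where
  "lift_op P f = (\<lambda>p a b I. P (\<lambda>q. f q a b I) p)"

definition ds :: "2 \<Rightarrow> ('n pt \<Rightarrow> 'n spform) \<Rightarrow> 'n pt \<Rightarrow> 'n spform" where
  "ds A' f = (\<lambda>p a b I. if A' = 0 then of_nat (a + 1) * f p (a + 1) b I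
                        else of_nat (b + 1) * f p a (b + 1) I)"

definition dd :: "real^('n::{finite,linorder} \<times> 4)^('n \<times> 4) \<Rightarrow> 2 \<Rightarrow>
    ('n pt \<Rightarrow> 'n spform) \<Rightarrow> 'n pt \<Rightarrow> 'n spform" where
  "dd S A' f = (\<lambda>p a b K. \<Sum>A\<in>UNIV. wedge (omega A) (lift_op (Z_op S A A') f p a b) K)"


section \<open>The bundles and the operator \<open>\<D>\<^sub>0\<close>\<close>

text \<open>A list \<open>[(\<sigma>\<^sub>0, \<tau>\<^sub>0), (\<sigma>\<^sub>1, \<tau>\<^sub>1), \<dots>]\<close> stands for the direct sum of the
  \<open>\<odot>\<^bsup>\<sigma>\<^esup>\<complex>\<^sup>2 \<otimes> \<and>\<^bsup>\<tau>\<^esup>\<complex>\<^sup>2\<^sup>n\<close>; \<open>c r\<close> is the component of \<open>c\<close> in the \<open>r\<close>-th summand (from 0).\<close>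

type_synonym shape = "(nat \<times> nat) list"
type_synonym 'n vec_el = "nat \<Rightarrow> 'n spform"

definition in_shape :: "shape \<Rightarrow> nat \<Rightarrow> nat \<Rightarrow> nat \<Rightarrow> ('n \<times> 2) set \<Rightarrow> bool" where
  "in_shape vs r a b I \<longleftrightarrow> r < length vs \<and> a + b = fst (vs ! r) \<and> card I = snd (vs ! r)"

definition vspace :: "shape \<Rightarrow> 'n vec_el set" where
  "vspace vs = {c. \<forall>r a b I. \<not> in_shape vs r a b I \<longrightarrow> c r a b I = 0}"

definition V0 :: "nat \<Rightarrow> shape" where
  "V0 k = [(k, 0)]"

definition V1 :: "nat \<Rightarrow> shape" where
  "V1 k = (if k \<ge> 2 then [(k - 1, 1), (k - 2, 0)] else if k = 1 then [(0, 1), (0, 1)] else [(0, 2)])"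

text \<open>\<open>hat m\<close> with \<open>m = 2n\<close> passes from \<open>\<V>\<^sub>j\<close> to its dual.\<close>

definition hat :: "nat \<Rightarrow> shape \<Rightarrow> shape" where
  "hat m vs = map (\<lambda>(\<sigma>, \<tau>). (\<sigma>, m - \<tau>)) vs"

definition D0 :: "real^('n::{finite,linorder} \<times> 4)^('n \<times> 4) \<Rightarrow> nat \<Rightarrow>
    ('n pt \<Rightarrow> 'n vec_el) \<Rightarrow> 'n pt \<Rightarrow> 'n vec_el" where
  "D0 S k f = (\<lambda>p r a b I.
     let g = (\<lambda>q. f q 0) in
     if k \<ge> 2 then
       (if r = 0 then \<Sum>A'\<in>UNIV. ds A' (dd S A' g) p a b I
        else if r = 1 then
          - (\<Sum>A'\<in>UNIV. \<Sum>B'\<in>UNIV. ds A' (ds B' (lift_op (T_up A' B') g)) p a b I)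
        else 0)
     else if k = 1 then
       (if r = 0 then \<Sum>A'\<in>UNIV. ds A' (dd S A' g) p a b I
        else if r = 1 then
          - (\<Sum>A'\<in>UNIV. \<Sum>B'\<in>UNIV. ds A' (dd S B' (lift_op (T_mix B' A') g)) p a b I)
        else 0)
     else (if r = 0 then dd S 0 (dd S 1 g) p a b I else 0))"


section \<open>Smooth functions, test functions and distributions\<close>

definition iter_dird :: "'a::real_normed_vector list \<Rightarrow> ('a \<Rightarrow> complex) \<Rightarrow> 'a \<Rightarrow> complex" where
  "iter_dird vs f = foldr dird vs f"

definition smooth :: "('a::euclidean_space \<Rightarrow> complex) \<Rightarrow> bool" where
  "smooth f \<longleftrightarrow> (\<forall>vs. set vs \<subseteq> Basis \<longrightarrow> iter_dird vs f differentiable_on UNIV)"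

definition test_fun :: "('a::euclidean_space \<Rightarrow> complex) set" where
  "test_fun = {\<phi>. smooth \<phi> \<and> compact (closure {p. \<phi> p \<noteq> 0})}"

definition Cm_norm :: "nat \<Rightarrow> ('a::euclidean_space \<Rightarrow> complex) \<Rightarrow> real" where
  "Cm_norm m \<phi> =
     (SUP (vs, p) \<in> {vs. set vs \<subseteq> Basis \<and> length vs \<le> m} \<times> UNIV. cmod (iter_dird vs \<phi> p))"

text \<open>Only the values on test functions matter; the others are fixed to be 0, so that equality of
  distributions is equality of functions.\<close>

definition distr :: "(('a::euclidean_space \<Rightarrow> complex) \<Rightarrow> complex) set" where
  "distr = {u.
     (\<forall>\<phi>\<in>test_fun. \<forall>\<psi>\<in>test_fun. u (\<lambda>p. \<phi> p + \<psi> p) = u \<phi> + u \<psi>) \<and>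
     (\<forall>c. \<forall>\<phi>\<in>test_fun. u (\<lambda>p. c * \<phi> p) = c * u \<phi>) \<and>
     (\<forall>K. compact K \<longrightarrow> (\<exists>C m. \<forall>\<phi>\<in>test_fun.
        closure {p. \<phi> p \<noteq> 0} \<subseteq> K \<longrightarrow> cmod (u \<phi>) \<le> C * Cm_norm m \<phi>)) \<and>
     (\<forall>\<phi>. \<phi> \<notin> test_fun \<longrightarrow> u \<phi> = 0)}"

definition smooth_sec :: "shape \<Rightarrow> ('n::finite pt \<Rightarrow> 'n vec_el) set" where
  "smooth_sec vs = {F. (\<forall>p. F p \<in> vspace vs) \<and> (\<forall>r a b I. smooth (\<lambda>p. F p r a b I))}"

definition test_sec :: "shape \<Rightarrow> ('n::finite pt \<Rightarrow> 'n vec_el) set" where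
  "test_sec vs =
     {F \<in> smooth_sec vs. compact (closure {p. \<exists>r a b I. F p r a b I \<noteq> 0})}"

text \<open>Vector-valued distributions are given by their components, which are scalar distributions.\<close>

type_synonym 'n dist_el =
  "nat \<Rightarrow> nat \<Rightarrow> nat \<Rightarrow> ('n \<times> 2) set \<Rightarrow> ('n pt \<Rightarrow> complex) \<Rightarrow> complex"

definition dist_sec :: "shape \<Rightarrow> ('n::finite) dist_el set" where
  "dist_sec vs = {u. \<forall>r a b I. u r a b I \<in> distr \<and>
     (\<not> in_shape vs r a b I \<longrightarrow> u r a b I = (\<lambda>\<phi>. 0))}"


section \<open>Duality and the transposed operator\<close>

text \<open>Pairing of the dual of \<open>vs\<close> with \<open>vs\<close>, the coefficients being paired by \<open>m\<close>.  The polynomial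
  belonging to a symmetric tensor \<open>f\<close> is \<open>f\<^bsub>A'\<dots>B'\<^esub> s\<^bsup>A'\<^esup>\<dots>s\<^bsup>B'\<^esup>\<close>, so its coefficient at
  \<open>(s\<^bsup>0'\<^esup>)\<^sup>a (s\<^bsup>1'\<^esup>)\<^bsup>\<sigma>-a\<^esup>\<close> is \<open>\<sigma> choose a\<close> times a component of \<open>f\<close>, and this component occurs
  \<open>\<sigma> choose a\<close> times in the full contraction: this leaves the factor \<open>1 / (\<sigma> choose a)\<close>.\<close>

definition contract :: "('a \<Rightarrow> 'b \<Rightarrow> complex) \<Rightarrow> shape \<Rightarrow>
    (nat \<Rightarrow> nat \<Rightarrow> nat \<Rightarrow> ('n::{finite,linorder} \<times> 2) set \<Rightarrow> 'a) \<Rightarrow>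
    (nat \<Rightarrow> nat \<Rightarrow> nat \<Rightarrow> ('n \<times> 2) set \<Rightarrow> 'b) \<Rightarrow> complex" where
  "contract m vs F f =
     (\<Sum>r<length vs. let \<sigma> = fst (vs ! r) in
        \<Sum>a\<le>\<sigma>. wedge_by m (F r a (\<sigma> - a)) (f r a (\<sigma> - a)) UNIV / of_nat (\<sigma> choose a))"

definition pair_smooth :: "shape \<Rightarrow> ('n::{finite,linorder} pt \<Rightarrow> 'n vec_el) \<Rightarrow>
    ('n pt \<Rightarrow> 'n vec_el) \<Rightarrow> complex" where
  "pair_smooth vs F f = (LINT p|lborel. contract (*) vs (F p) (f p))"

definition pair_dist :: "shape \<Rightarrow> ('n::{finite,linorder}) dist_el \<Rightarrow>
    ('n pt \<Rightarrow> 'n vec_el) \<Rightarrow> complex" where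
  "pair_dist vs F f = contract (\<lambda>u \<phi>. u \<phi>) vs F (\<lambda>r a b I p. f p r a b I)"

definition E_hat0 :: "nat \<Rightarrow> ('n::finite pt \<Rightarrow> 'n vec_el) set" where
  "E_hat0 k = smooth_sec (hat CARD('n \<times> 2) (V0 k))"

definition E_hat1 :: "nat \<Rightarrow> ('n::finite pt \<Rightarrow> 'n vec_el) set" where
  "E_hat1 k = smooth_sec (hat CARD('n \<times> 2) (V1 k))"

definition D'_hat0 :: "nat \<Rightarrow> ('n::finite) dist_el set" where
  "D'_hat0 k = dist_sec (hat CARD('n \<times> 2) (V0 k))"

definition D'_hat1 :: "nat \<Rightarrow> ('n::finite) dist_el set" where
  "D'_hat1 k = dist_sec (hat CARD('n \<times> 2) (V1 k))"

definition D0_hat_smooth :: "real^('n::{finite,linorder} \<times> 4)^('n \<times> 4) \<Rightarrow> nat \<Rightarrow>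
    ('n pt \<Rightarrow> 'n vec_el) \<Rightarrow> 'n pt \<Rightarrow> 'n vec_el" where
  "D0_hat_smooth S k F =
     (THE G. G \<in> E_hat0 k \<and>
        (\<forall>f\<in>test_sec (V0 k). pair_smooth (V0 k) G f = pair_smooth (V1 k) F (D0 S k f)))"

definition D0_hat_dist :: "real^('n::{finite,linorder} \<times> 4)^('n \<times> 4) \<Rightarrow> nat \<Rightarrow>
    'n dist_el \<Rightarrow> 'n dist_el" where
  "D0_hat_dist S k F =
     (THE G. G \<in> D'_hat0 k \<and>
        (\<forall>f\<in>test_sec (V0 k). pair_dist (V0 k) G f = pair_dist (V1 k) F (D0 S k f)))"

text \<open>The quotient spaces, as sets of cosets.\<close>

definition H0_smooth :: "real^('n::{finite,linorder} \<times> 4)^('n \<times> 4) \<Rightarrow> nat \<Rightarrow>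
    ('n pt \<Rightarrow> 'n vec_el) set set" where
  "H0_smooth S k = E_hat0 k // {(F, G). F \<in> E_hat0 k \<and> G \<in> E_hat0 k \<and>
     (\<lambda>p r a b I. F p r a b I - G p r a b I) \<in> D0_hat_smooth S k ` E_hat1 k}"

definition H0_dist :: "real^('n::{finite,linorder} \<times> 4)^('n \<times> 4) \<Rightarrow> nat \<Rightarrow> 'n dist_el set set" where
  "H0_dist S k = D'_hat0 k // {(F, G). F \<in> D'_hat0 k \<and> G \<in> D'_hat0 k \<and>
     (\<lambda>r a b I \<phi>. F r a b I \<phi> - G r a b I \<phi>) \<in> D0_hat_dist S k ` D'_hat1 k}"

end

theory Submission
  imports Defs "HOL-Complex_Analysis.Complex_Analysis"
begin

text \<open>Right-type means that the brackets of the \<open>Z\<^sub>A\<close> with the \<open>Z\<^sub>B\<close> are symmetric in \<open>A, B\<close>. Contracting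
  two of these operators with the skew matrix \<open>EE v\<close> built from a vector \<open>v\<close> therefore gives either \<open>0\<close> or, up
  to sign, the sub-Laplacian \<open>L\<^sub>v\<close> along the image of the quaternionic Heisenberg group spanned by \<open>v\<close>, and
  surjectivity of the transposed operator reduces to solving \<open>G = \<Sum>\<^sub>i L\<^sub>i u\<^sub>i\<close> for a few such lines.
  Condition (H) provides a line whose image contains the whole centre. Cutting off the fundamental solution
  \<open>(|x|\<^sup>4 + |t|\<^sup>2)\<^sup>-\<^sup>2\<close> gives parametrices along lines, which reduce any distribution to one of order zero.
  On the nondegenerate line the translated fundamental solution has a convergent Taylor expansion in
  the dilation parameter; its partial sums are killed by \<open>L\<close>, and subtracting them makes the
  pieces of the solution decay on an exhaustion, as in the theorem of Mittag-Leffler.\<close>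

text \<open>The order of a distribution may grow towards infinity. The \<open>i\<close>-th
  Mittag-Leffler piece evaluates \<open>G\<close> on the \<open>i\<close>-th shell of the line, and
  derivatives transversal to the line fall on the test function, so for a general \<open>G\<close>
  the series could have unbounded order on one compact set. For order zero every piece is bounded by
  the supremum norm. For smooth \<open>G\<close> the kernels act on \<open>G\<close> itself and no
  reduction is made. The reduction composes smooth convolutions along spanning lines. Each absorbs
  derivatives along its own line; passing a derivative through another line leaves derivatives in
  the centre, which commute with all convolutions and are absorbed by the first line. (H) concerns
  single functionals on the centre, while a nondegenerate line needs a bijection of the whole centre
  attached to one vector. That vector is found by perturbation: (H) lets the first-order change of
  one combination of rows be prescribed, which makes the leading minors of a 3 by 3 matrix nonzero
  one after another.\<close>

no_notation fps_nth (infixl "$" 75)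

abbreviation lborel_integral (binder "LI " 10) where
 "lborel_integral f == integral\<^sup>L lborel f"

abbreviation "lint == integrable lborel"

abbreviation "cont == continuous_on UNIV"

section \<open>Smooth functions on open sets\<close>

text \<open>All directional derivatives are asked for, in place of derivatives with values in
  operator spaces: the value type never changes and inductions on the order close. The open set is a
  parameter because the fundamental solution and the kernels built from it are smooth only on parts
  of the space.\<close>

primrec nd :: "nat => 'a::real_normed_vector set => ('a => 'b::real_normed_vector) => bool" where
 "nd 0 S f \<longleftrightarrow> continuous_on S f"
| "nd (Suc n) S f \<longleftrightarrow> (ALL x:S. f differentiable (at x)) & (ALL v. nd n S (%x. frechet_derivative f (at x) v))"

definition smooth_on :: "'a::real_normed_vector set => ('a => 'b::real_normed_vector) => bool" where
 "smooth_on S f \<longleftrightarrow> (ALL n. nd n S f)"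

abbreviation "smo == smooth_on UNIV"

lemma nd_cong:
 assumes "open S" "!!x. x : S ==> f x = g x" "nd n S f"
 shows "nd n S g"
 using assms(2,3)
proof (induction n arbitrary: f g)
 case 0
 then show ?case using continuous_on_cong by force
next
 case (Suc n)
 have 1: "(g has_derivative frechet_derivative f (at x)) (at x)" if "x : S" for x
  by (rule has_derivative_transform_within_open[OF _ \<open>open S\<close> that Suc.prems(1)])
    (use Suc.prems(2) that in "auto simp: frechet_derivative_works[symmetric]")
 have 2: "frechet_derivative f (at x) = frechet_derivative g (at x)" if "x : S" for x
  using frechet_derivative_at[OF 1[OF that]] .
 have "nd n S (%x. frechet_derivative g (at x) v)" for v
  by (rule Suc.IH[of "%x. frechet_derivative f (at x) v"]) (use 2 Suc.prems(2) in auto)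
 then show ?case using 1 by (auto simp: differentiable_def)
qed

lemma nd_SucI':
 assumes "open S" "!!x. x : S ==> (f has_derivative f' x) (at x)" "!!v. nd n S (%x. f' x v)"
 shows "nd (Suc n) S f"
proof -
 have eq: "f' x = frechet_derivative f (at x)" if "x : S" for x
  using assms(2)[OF that] frechet_derivative_at by metis
 have "nd n S (%x. frechet_derivative f (at x) v)" for v
  by (rule nd_cong[OF assms(1) _ assms(3)]) (simp add: eq)
 then show ?thesis
  using assms(2) by (auto simp: differentiable_def)
qed

lemma nd_SucD: "nd (Suc n) S f ==> nd n S f"
proof (induction n arbitrary: f)
 case 0
 then show ?case by (auto intro!: differentiable_imp_continuous_on simp: differentiable_on_def differentiable_at_withinI)
next
 case (Suc n)
 then show ?case by simp
qed

lemma nd_continuous_on: "nd n S f ==> continuous_on S f"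
proof (induction n)
 case (Suc n)
 then show ?case using nd_SucD by blast
qed simp

lemma nd_has_derivative:
 "nd (Suc n) S f ==> x : S ==> (f has_derivative frechet_derivative f (at x)) (at x)"
 using frechet_derivative_works by auto

lemma nd_subset: "nd n S f ==> T <= S ==> nd n T f"
 by (induction n arbitrary: f) (auto intro: continuous_on_subset)

lemma nd_local:
 assumes "!!x. x : S ==> EX T. open T & x : T & nd n T f"
 shows "nd n S f"
 using assms
proof (induction n arbitrary: f)
 case 0
 then show ?case
  by (metis continuous_at_imp_continuous_on continuous_on_eq_continuous_at nd.simps(1))
next
 case (Suc n)
 have "nd n S (%x. frechet_derivative f (at x) v)" for v
  by (rule Suc.IH) (use Suc.prems in fastforce)
 then show ?case using Suc.prems by fastforce
qed

lemma nd_bounded_linear: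
 assumes "bounded_linear h" "open S" "nd n S f"
 shows "nd n S (%x. h (f x))"
 using assms(3)
proof (induction n arbitrary: f)
 case 0
 then show ?case using assms(1) by (simp add: bounded_linear.continuous_on)
next
 case (Suc n)
 show ?case
  by (rule nd_SucI'[OF \<open>open S\<close>, where f' = "%x v. h (frechet_derivative f (at x) v)"])
    (rule bounded_linear.has_derivative[OF assms(1)], use Suc nd_has_derivative[OF Suc.prems] in auto)
qed

lemma nd_add:
 assumes "open S" "nd n S f" "nd n S g"
 shows "nd n S (%x. f x + g x)"
 using assms(2,3)
proof (induction n arbitrary: f g)
 case 0
 then show ?case by (simp add: continuous_on_add)
next
 case (Suc n)
 show ?case
  by (rule nd_SucI'[OF \<open>open S\<close>, where f' = "%x v. frechet_derivative f (at x) v + frechet_derivative g (at x) v"])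
    (use Suc has_derivative_add[OF nd_has_derivative[OF Suc.prems(1)] nd_has_derivative[OF Suc.prems(2)]] in auto)
qed

lemma nd_bilinear:
 assumes "bounded_bilinear h" "open S" "nd n S f" "nd n S g"
 shows "nd n S (%x. h (f x) (g x))"
 using assms(3,4)
proof (induction n arbitrary: f g)
 case 0
 then show ?case using bounded_bilinear.continuous_on[OF assms(1)] by simp
next
 case (Suc n)
 have 1: "((%x. h (f x) (g x)) has_derivative
   (%v. h (f x) (frechet_derivative g (at x) v) + h (frechet_derivative f (at x) v) (g x))) (at x)"
  if "x : S" for x
  by (rule bounded_bilinear.FDERIV[OF assms(1)]) (use nd_has_derivative Suc.prems that in blast)+
 have "nd n S (%x. h (f x) (frechet_derivative g (at x) v) + h (frechet_derivative f (at x) v) (g x))" for v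
  by (intro nd_add[OF \<open>open S\<close>] Suc.IH) (use Suc.prems nd_SucD[OF Suc.prems(1)] nd_SucD[OF Suc.prems(2)] in auto)
 then show ?case
  using nd_SucI'[OF \<open>open S\<close> 1] by blast
qed

lemma nd_const: "open S ==> nd n S (%x. c)"
proof (induction n arbitrary: c)
 case (Suc n)
 then show ?case by (intro nd_SucI'[where f' = "%x v. 0"]) auto
qed auto

lemma nd_linear:
 assumes "bounded_linear h" "open S"
 shows "nd n S h"
proof (cases n)
 case 0
 then show ?thesis using assms by (simp add: linear_continuous_on)
next
 case (Suc m)
 then show ?thesis
  using nd_SucI'[OF assms(2) bounded_linear_imp_has_derivative[OF assms(1)] nd_const[OF assms(2)], of m]
  by (simp del: nd.simps)
qed

lemma nd_sum:
 assumes "open S" "!!i. i : I ==> nd n S (f i)"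
 shows "nd n S (%x. \<Sum>i\<in>I. f i x)"
 using assms(2)
 by (induction I rule: infinite_finite_induct) (auto intro!: nd_add nd_const assms(1))

text \<open>The chain rule applies the outer derivative to a vector that varies with the point.
  Expanding this vector in a basis gives a finite sum of products to which the induction hypothesis
  applies; hence the euclidean type in the middle.\<close>

lemma nd_compose:
 fixes g :: "'a::real_normed_vector => 'c::euclidean_space"
 assumes "open S" "open T" "nd n T f" "nd n S g" "g ` S <= T"
 shows "nd n S (%x. f (g x))"
 using assms(3,4)
proof (induction n arbitrary: f)
 case 0
 then show ?case using assms(5) continuous_on_compose2 by (metis nd.simps(1))
next
 case (Suc n)
 have 1: "((%x. f (g x)) has_derivative
   (%v. \<Sum>b\<in>Basis. (frechet_derivative g (at x) v \<bullet> b) *\<^sub>R frechet_derivative f (at (g x)) b)) (at x)"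
  if "x : S" for x
 proof -
  have f: "(f has_derivative frechet_derivative f (at (g x))) (at (g x))"
   by (rule nd_has_derivative[OF Suc.prems(1)]) (use assms(5) that in auto)
  have g: "(g has_derivative frechet_derivative g (at x)) (at x)"
   by (rule nd_has_derivative[OF Suc.prems(2) that])
  have "((%x. f (g x)) has_derivative
   (%v. frechet_derivative f (at (g x)) (frechet_derivative g (at x) v))) (at x)"
   using has_derivative_compose[OF g f] .
  moreover have "frechet_derivative f (at (g x)) w
    = (\<Sum>b\<in>Basis. (w \<bullet> b) *\<^sub>R frechet_derivative f (at (g x)) b)" for w
  proof -
   have l: "linear (frechet_derivative f (at (g x)))"
    using f has_derivative_linear by blast
   have "frechet_derivative f (at (g x)) w
    = frechet_derivative f (at (g x)) (\<Sum>b\<in>Basis. (w \<bullet> b) *\<^sub>R b)" by (simp add: euclidean_representation)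
   then show ?thesis using l by (simp add: linear_sum linear_scale)
  qed
  ultimately show ?thesis by (metis (no_types, lifting) ext)
 qed
 have "nd n S (%x. \<Sum>b\<in>Basis. (frechet_derivative g (at x) v \<bullet> b) *\<^sub>R frechet_derivative f (at (g x)) b)" for v
  by (intro nd_sum[OF \<open>open S\<close>] nd_bilinear[OF bounded_bilinear_scaleR \<open>open S\<close>]
    nd_bounded_linear[OF bounded_linear_inner_left \<open>open S\<close>] Suc.IH[OF _ nd_SucD[OF Suc.prems(2)]])
    (use Suc.prems in auto)
 then show ?case
  using nd_SucI'[OF \<open>open S\<close> 1] by blast
qed

lemma smooth_onD: "smooth_on S f ==> nd n S f"
 by (simp add: smooth_on_def)

lemma smooth_cont: "smooth_on S f ==> continuous_on S f"
 by (meson nd_continuous_on smooth_onD)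

lemma smooth_diff: "smooth_on S f ==> x : S ==> f differentiable (at x)"
 using smooth_onD[of S f 1] by auto

lemma smooth_on_frechet: "smooth_on S f ==> smooth_on S (%x. frechet_derivative f (at x) v)"
 unfolding smooth_on_def using nd.simps(2) by blast

lemma smooth_on_subset: "smooth_on S f ==> T <= S ==> smooth_on T f"
 unfolding smooth_on_def using nd_subset by blast

lemma smooth_on_cong: "open S ==> smooth_on S f ==> (!!x. x : S ==> f x = g x) ==> smooth_on S g"
 unfolding smooth_on_def using nd_cong by metis

lemma smooth_on_local:
 "(!!x. x : S ==> EX T. open T & x : T & smooth_on T f) ==> smooth_on S f"
 unfolding smooth_on_def by (metis nd_local)

named_theorems smooth_intros

lemma smooth_on_const [smooth_intros]: "open S ==> smooth_on S (%x. c)"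
 by (simp add: smooth_on_def nd_const)

lemma smooth_on_add [smooth_intros]:
 "open S ==> smooth_on S f ==> smooth_on S g ==> smooth_on S (%x. f x + g x)"
 by (simp add: smooth_on_def nd_add)

lemma smooth_on_sum [smooth_intros]:
 "open S ==> (!!i. i : I ==> smooth_on S (f i)) ==> smooth_on S (%x. \<Sum>i\<in>I. f i x)"
 by (simp add: smooth_on_def nd_sum)

lemma smooth_bl:
 "bounded_linear h ==> open S ==> smooth_on S f ==> smooth_on S (%x. h (f x))"
 by (simp add: smooth_on_def nd_bounded_linear)

lemma smooth_on_bilinear:
 "bounded_bilinear h ==> open S ==> smooth_on S f ==> smooth_on S g ==> smooth_on S (%x. h (f x) (g x))"
 by (simp add: smooth_on_def nd_bilinear)

lemma smooth_on_linear: "bounded_linear h ==> open S ==> smooth_on S h"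
 by (simp add: smooth_on_def nd_linear)

lemma smooth_on_compose:
 fixes g :: "'a::real_normed_vector => 'c::euclidean_space"
 shows "open S ==> open T ==> smooth_on T f ==> smooth_on S g ==> g ` S <= T ==> smooth_on S (%x. f (g x))"
 by (simp add: smooth_on_def nd_compose)

lemma smooth_comp:
 fixes g :: "'a::real_normed_vector => 'c::euclidean_space"
 shows "smo f ==> open S ==> smooth_on S g ==> smooth_on S (%x. f (g x))"
 by (rule smooth_on_compose[where T = UNIV]) auto

lemma smooth_on_ident [smooth_intros]: "open S ==> smooth_on S (%x. x)"
 by (rule smooth_on_linear[OF bounded_linear_ident])

lemmas smooth_on_fst [smooth_intros] = smooth_bl[OF bounded_linear_fst]
lemmas smooth_on_snd [smooth_intros] = smooth_bl[OF bounded_linear_snd]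
lemmas smooth_on_of_real [smooth_intros] = smooth_bl[OF bounded_linear_of_real]
lemmas smooth_on_nth [smooth_intros] = smooth_bl[OF bounded_linear_vec_nth]
lemmas smooth_on_mult [smooth_intros] = smooth_on_bilinear[OF bounded_bilinear_mult]
lemmas smooth_on_inner [smooth_intros] = smooth_on_bilinear[OF bounded_bilinear_inner]
lemmas smooth_on_scaleR [smooth_intros] = smooth_on_bilinear[OF bounded_bilinear_scaleR]

lemma smooth_on_minus [smooth_intros]: "open S ==> smooth_on S f ==> smooth_on S (%x. - f x)"
 by (rule smooth_bl[OF bounded_linear_minus[OF bounded_linear_ident]])

lemma smooth_on_diff [smooth_intros]:
 "open S ==> smooth_on S f ==> smooth_on S g ==> smooth_on S (%x. f x - g x)"
 using smooth_on_add[of S f "%x. - g x"] smooth_on_minus by auto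

lemma smooth_on_power [smooth_intros]:
 fixes f :: "'a::real_normed_vector => 'b::real_normed_algebra_1"
 shows "open S ==> smooth_on S f ==> smooth_on S (%x. f x ^ n)"
 by (induction n) (auto intro: smooth_intros)

lemma smooth_on_Pair [smooth_intros]:
 assumes "open S" "smooth_on S f" "smooth_on S g"
 shows "smooth_on S (%x. (f x, g x))"
proof -
 have "bounded_linear (%y::'b. (y, 0::'c))" "bounded_linear (%y::'c. (0::'b, y))"
  by (auto intro!: bounded_linear_Pair bounded_linear_ident bounded_linear_zero)
 then have "smooth_on S (%x. (f x, 0) + (0, g x))"
  by (intro smooth_on_add assms) (use assms in "auto intro: smooth_bl")
 then show ?thesis by simp
qed

lemma smooth_on_inverse_id: "smooth_on (- {0}) (inverse :: 'b::real_normed_field => 'b)"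
proof -
 have "nd n (- {0}) (inverse :: 'b => 'b)" for n
 proof (induction n)
  case 0
  then show ?case by (auto intro!: continuous_intros)
 next
  case (Suc n)
  have o: "open (- {0 :: 'b})" by auto
  show ?case
   by (rule nd_SucI'[OF o, where f' = "%x v. - (inverse x * v * inverse x)"])
     (auto intro!: has_derivative_inverse' nd_bounded_linear[OF bounded_linear_minus[OF bounded_linear_ident] o]
      nd_bilinear[OF bounded_bilinear_mult o] Suc nd_const o simp: has_derivative_inverse')
 qed
 then show ?thesis by (simp add: smooth_on_def)
qed

lemma smooth_on_inverse [smooth_intros]:
 fixes f :: "'a::real_normed_vector => 'b::{real_normed_field,euclidean_space}"
 assumes "open S" "smooth_on S f" "!!x. x : S ==> f x ~= 0"
 shows "smooth_on S (%x. inverse (f x))"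
 by (rule smooth_on_compose[OF assms(1) _ smooth_on_inverse_id assms(2)]) (use assms(3) in auto)

lemma smooth_on_divide [smooth_intros]:
 fixes f g :: "'a::real_normed_vector => 'b::{real_normed_field,euclidean_space}"
 assumes "open S" "smooth_on S f" "smooth_on S g" "!!x. x : S ==> g x ~= 0"
 shows "smooth_on S (%x. f x / g x)"
 unfolding divide_inverse by (intro smooth_intros assms)

lemma smooth_on_exp_id: "smo (exp :: 'b::{real_normed_field,banach} => 'b)"
proof -
 have "nd n UNIV (exp :: 'b => 'b)" for n
 proof (induction n)
  case 0
  then show ?case by (auto intro!: continuous_intros)
 next
  case (Suc n)
  show ?case
   by (rule nd_SucI'[where f' = "%x v. v * exp x"])
     (auto intro!: nd_bilinear[OF bounded_bilinear_mult] Suc nd_const derivative_eq_intros)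
 qed
 then show ?thesis by (simp add: smooth_on_def)
qed

lemma smooth_on_exp [smooth_intros]:
 fixes f :: "'a::real_normed_vector => 'b::{real_normed_field,euclidean_space}"
 shows "open S ==> smooth_on S f ==> smooth_on S (%x. exp (f x))"
 by (rule smooth_comp[OF smooth_on_exp_id])

lemma smooth_on_dird [smooth_intros]: "smooth_on S f ==> smooth_on S (dird v f)"
 unfolding dird_def by (rule smooth_on_frechet)

lemma smooth_iter_dird: "smooth_on S f ==> smooth_on S (iter_dird vs f)"
 by (induction vs) (auto simp: iter_dird_def intro: smooth_intros)

lemma iter_dird_Nil [simp]: "iter_dird [] f = f"
 by (simp add: iter_dird_def)

lemma iter_dird_Cons: "iter_dird (v # vs) f = dird v (iter_dird vs f)"
 by (simp add: iter_dird_def)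

lemma iter_dird_append: "iter_dird (vs @ ws) f = iter_dird vs (iter_dird ws f)"
 by (simp add: iter_dird_def)

lemma smooth_dird_Basis: "smooth f ==> b : Basis ==> smooth (dird b f)"
 unfolding smooth_def
 by (metis (no_types, lifting) Un_subset_iff empty_set empty_subsetI insert_subset
   iter_dird_Nil iter_dird_Cons iter_dird_append list.simps(15) set_append)

lemma dird_linear:
 assumes "f differentiable (at x)"
 shows "linear (%v. dird v f x)"
 using assms has_derivative_linear frechet_derivative_works unfolding dird_def by blast

lemma linear_Basis_expand:
 fixes L :: "'a::euclidean_space => 'b::real_vector"
 assumes "linear L" shows "L v = (\<Sum>b\<in>Basis. (v \<bullet> b) *\<^sub>R L b)"
proof -
 have "L v = L (\<Sum>b\<in>Basis. (v \<bullet> b) *\<^sub>R b)" by (simp add: euclidean_representation)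
 then show ?thesis using assms by (simp add: linear_sum linear_scale)
qed

text \<open>\<open>smooth\<close> demands total differentiability of the iterated basis derivatives.
  This suffices, because a derivative in any direction is then a constant linear combination of
  basis derivatives.\<close>

lemma smooth_iff: "smooth f \<longleftrightarrow> smo f"
proof
 assume f: "smooth f"
 have "nd n UNIV f" for n using f
 proof (induction n arbitrary: f)
  case 0
  then have "f differentiable_on UNIV"
   unfolding smooth_def by (metis empty_set empty_subsetI iter_dird_Nil)
  then show ?case by (simp add: differentiable_imp_continuous_on)
 next
  case (Suc n)
  then have d: "f differentiable (at x)" for x
   unfolding smooth_def by (metis UNIV_I differentiable_on_def empty_set empty_subsetI iter_dird_Nil)
  show ?case
  proof (rule nd_SucI'[where f' = "%x v. \<Sum>b\<in>Basis. (v \<bullet> b) *\<^sub>R dird b f x"])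
   show "(f has_derivative (%v. \<Sum>b\<in>Basis. (v \<bullet> b) *\<^sub>R dird b f x)) (at x)" for x
    unfolding linear_Basis_expand[OF dird_linear[OF d[of x]], symmetric]
    using d[of x] frechet_derivative_works unfolding dird_def by (metis (no_types, lifting) ext)
   show "nd n UNIV (%x. \<Sum>b\<in>Basis. (v \<bullet> b) *\<^sub>R dird b f x)" for v
    by (intro nd_sum nd_bounded_linear[OF bounded_linear_scaleR_right]) (use Suc smooth_dird_Basis in auto)
  qed simp
 qed
 then show "smo f" by (simp add: smooth_on_def)
next
 assume "smo f"
 then show "smooth f" unfolding smooth_def
  using smooth_diff smooth_iter_dird
  by (metis UNIV_I differentiable_at_imp_differentiable_on)
qed

section \<open>Calculus of directional derivatives\<close>

lemma has_derivative_dird: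
 "f differentiable (at x) ==> (f has_derivative (%v. dird v f x)) (at x)"
 unfolding dird_def using frechet_derivative_works by blast

lemma dird_eqI: "(f has_derivative f') (at x) ==> dird v f x = f' v"
 unfolding dird_def using frechet_derivative_at by metis

lemma dird_cong:
 assumes "open S" "x : S" "!!y. y : S ==> f y = g y" "f differentiable (at x)"
 shows "dird v f x = dird v g x"
 using dird_eqI[OF has_derivative_transform_within_open[OF has_derivative_dird[OF assms(4)] assms(1,2,3)]]
 by simp

lemma dird_const [simp]: "dird v (%x. c) = (%x. 0)"
 by (rule ext, rule dird_eqI) simp

lemma dird_add:
 "f differentiable (at x) ==> g differentiable (at x) ==> dird v (%x. f x + g x) x = dird v f x + dird v g x"
 by (rule dird_eqI) (intro has_derivative_add has_derivative_dird)

lemma dird_diff: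
 "f differentiable (at x) ==> g differentiable (at x) ==> dird v (%x. f x - g x) x = dird v f x - dird v g x"
 by (rule dird_eqI) (intro has_derivative_diff has_derivative_dird)

lemma dird_minus:
 "f differentiable (at x) ==> dird v (%x. - f x) x = - dird v f x"
 by (rule dird_eqI) (intro has_derivative_minus has_derivative_dird)

lemma dird_mult:
 "f differentiable (at x) ==> g differentiable (at x) ==>
  dird v (%x. f x * g x) x = dird v f x * g x + f x * dird v g x"
 by (rule dird_eqI) (auto intro!: derivative_eq_intros has_derivative_dird simp: algebra_simps)

lemma dird_cmult:
 "f differentiable (at x) ==> dird v (%x. c * f x) x = c * dird v f x"
 by (rule dird_eqI) (auto intro!: derivative_eq_intros has_derivative_dird)

lemma dird_sum:
 "(!!i. i : I ==> f i differentiable (at x)) ==>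
  dird v (%x. \<Sum>i\<in>I. f i x) x = (\<Sum>i\<in>I. dird v (f i) x)"
 by (rule dird_eqI) (auto intro!: derivative_eq_intros has_derivative_dird)

lemma dird_compose:
 assumes "f differentiable (at (g x))" "(g has_derivative g') (at x)"
 shows "dird v (%x. f (g x)) x = dird (g' v) f (g x)"
 by (rule dird_eqI) (use has_derivative_compose[OF assms(2) has_derivative_dird[OF assms(1)]] in simp)

lemma dird_dir_add:
 "f differentiable (at x) ==> dird (v + w) f x = dird v f x + dird w f x"
 using linear_add[OF dird_linear] by blast

lemma dird_dir_scale:
 "f differentiable (at x) ==> dird (c *\<^sub>R v) f x = of_real c * dird v f x"
 using linear_scale[OF dird_linear] by (metis scaleR_conv_of_real)

lemma dird_dir_zero: "f differentiable (at x) ==> dird 0 f x = 0"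
 using linear_0[OF dird_linear] by blast

section \<open>Integrals depending on a parameter\<close>

text \<open>The weight is merely integrable, so that the cut-off fundamental solution qualifies;
  \<open>f\<close> is needed only where the weight lives, since later it comes from kernels that are
  smooth only there.\<close>

lemma lint_mult_compact:
 fixes w f :: "'b::euclidean_space => complex"
 assumes w: "lint w" and w0: "!!h. h ~: H ==> w h = 0" and H: "compact H" and f: "continuous_on H f"
 shows "lint (%h. w h * f h)"
proof -
 obtain B where B: "!!h. h : H ==> norm (f h) <= B"
  using compact_continuous_image[OF f H] compact_imp_bounded bounded_iff by (metis imageI)
 have e: "(%h. w h * f h) = (%h. w h * (indicator H h *\<^sub>R f h))"
  by (auto simp: fun_eq_iff w0 indicator_def)
 have "(%h. indicator H h *\<^sub>R f h) : borel_measurable lborel"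
  using borel_measurable_continuous_on_indicator[OF _ f] H
  by (simp add: borel_compact)
 then have m: "(%h. w h * f h) : borel_measurable lborel"
  unfolding e by (rule borel_measurable_times[OF borel_measurable_integrable[OF w]])
 show ?thesis
 proof (rule Bochner_Integration.integrable_bound[OF _ m])
  show "lint (%h. B * norm (w h))" using w by simp
  show "AE h in lborel. norm (w h * f h) <= norm (B * norm (w h))"
  proof (rule AE_I2)
   fix h
   show "norm (w h * f h) <= norm (B * norm (w h))"
    using w0[of h] B[of h] order_trans[OF mult_right_mono[of "norm (f h)" B "norm (w h)"] abs_ge_self]
    by (cases "h : H") (auto simp: norm_mult mult.commute)
  qed
 qed
qed

lemma norm_integral_mult_le:
 fixes w f :: "'b::euclidean_space => complex"
 assumes w: "lint w" and wf: "lint (%h. w h * f h)"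
  and le: "!!h. w h ~= 0 ==> norm (f h) <= e"
 shows "norm (LI h. w h * f h) <= e * (LI h. norm (w h))"
proof -
 have "norm (LI h. w h * f h) <= (LI h. norm (w h * f h))"
  by (rule integral_norm_bound)
 also have "... <= (LI h. e * norm (w h))"
 proof (rule integral_mono)
  show "norm (w h * f h) <= e * norm (w h)" for h
   using le[of h] by (cases "w h = 0") (auto simp: norm_mult mult.commute intro!: mult_right_mono)
 qed (use w wf in auto)
 finally show ?thesis by simp
qed

text \<open>All derivatives go to \<open>Ph\<close>; the possibly singular weight is never
  differentiated. Uniform continuity of the basis derivatives of \<open>Ph\<close> on a compact
  product bounds the linearisation error uniformly in \<open>h\<close>, and the error is then
  integrated against \<open>w\<close>.\<close>

lemma param_integral_has_derivative:
 fixes Ph :: "'a::euclidean_space \<times> 'b::euclidean_space => complex"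
 assumes U: "open U" and W: "open W" and UH: "U \<times> H <= W" and Ph: "smooth_on W Ph"
  and w: "lint w" and w0: "!!h. h ~: H ==> w h = 0" and H: "compact H" and p0: "p0 : U"
 shows "((%p. LI h. w h * Ph (p, h)) has_derivative
      (%v. LI h. w h * dird (v, 0) Ph (p0, h))) (at p0)"
proof -
 have cont: "continuous_on H (%h. f (p, h))" if "p : U" "smooth_on W f" for f :: "'a * 'b => complex" and p
  by (rule continuous_on_compose2[OF smooth_cont[OF that(2)]])
    (use UH that in "auto intro!: continuous_intros")
 have int: "lint (%h. w h * f (p, h))" if "p : U" "smooth_on W f" for f :: "'a * 'b => complex" and p
  by (rule lint_mult_compact[OF w w0 H cont[OF that]])
 have dsm: "smooth_on W (dird v Ph)" for v using Ph by (rule smooth_on_dird)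
 have diff: "Ph differentiable (at z)" if "z : W" for z
  using Ph that by (rule smooth_diff)
 let ?D = "%v p h. dird (v, 0) Ph (p, h)"
 have lin: "linear (%v. ?D v p h)" if "p : U" "h : H" for p h
 proof -
  have "linear (%v. dird v Ph (p, h))" by (rule dird_linear) (use that UH diff in auto)
  moreover have "linear (%v::'a. (v, 0::'b))" by (simp add: linear_iff)
  ultimately show ?thesis using linear_compose by (fastforce simp: o_def)
 qed
 define N where "N = (LI h. norm (w h))"
 have N0: "N >= 0" unfolding N_def by simp
 obtain r where r: "r > 0" "cball p0 r <= U" using U p0 open_contains_cball by blast
 have C: "compact (cball p0 r \<times> H)" using H by (simp add: compact_Times)
 have CW: "cball p0 r \<times> H <= W" using r UH by blast
 have blin: "bounded_linear (%v. LI h. w h * ?D v p0 h)"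
 proof -
  have "linear (%v. LI h. w h * ?D v p0 h)"
  proof (rule linearI)
   fix v v' :: 'a and c :: real
   have "w h * ?D (v + v') p0 h = w h * ?D v p0 h + w h * ?D v' p0 h" for h
    using linear_add[OF lin[OF p0]] w0 by (cases "h : H") (auto simp: algebra_simps)
   then show "(LI h. w h * ?D (v + v') p0 h) = (LI h. w h * ?D v p0 h) + (LI h. w h * ?D v' p0 h)"
    using int[OF p0 dsm] by simp
   have "w h * ?D (c *\<^sub>R v) p0 h = c *\<^sub>R (w h * ?D v p0 h)" for h
    using linear_scale[OF lin[OF p0]] w0 by (cases "h : H") auto
   then show "(LI h. w h * ?D (c *\<^sub>R v) p0 h) = c *\<^sub>R (LI h. w h * ?D v p0 h)"
    by simp
  qed
  then show ?thesis by (simp add: linear_conv_bounded_linear)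
 qed
 show ?thesis
  unfolding has_derivative_at_alt
 proof (intro conjI allI impI blin)
  fix e :: real assume e: "e > 0"
  \<comment> \<open>The allowance is divided among the basis directions and by the mass of the
    weight; adding 1 guards against the weight zero.\<close>
  define e' where "e' = e / (N + 1) / DIM('a)"
  have e': "e' > 0" using e N0 by (simp add: e'_def)
  have "EX d>0. ALL p:cball p0 r. ALL h:H. dist p p0 < d --> norm (?D b p h - ?D b p0 h) < e'" for b
  proof -
   have "uniformly_continuous_on (cball p0 r \<times> H) (dird (b, 0) Ph)"
    by (intro compact_uniformly_continuous[OF _ C] continuous_on_subset[OF smooth_cont[OF dsm] CW])
   then obtain d where d: "d > 0" "!!x y. x : cball p0 r \<times> H ==> y : cball p0 r \<times> H ==> dist y x < d
     ==> dist (dird (b, 0) Ph y) (dird (b, 0) Ph x) < e'"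
    using e' unfolding uniformly_continuous_on_def by metis
   show ?thesis
   proof (rule exI[of _ d], intro conjI ballI impI)
    show "0 < d" by (rule d(1))
    fix p h assume "p : cball p0 r" "h : H" "dist p p0 < d"
    then show "norm (?D b p h - ?D b p0 h) < e'"
     using d(2)[of "(p0, h)" "(p, h)"] r(1) by (simp add: dist_Pair_Pair dist_norm)
   qed
  qed
  then obtain d where d: "!!b. d b > 0"
   "!!b p h. p : cball p0 r ==> h : H ==> dist p p0 < d b ==> norm (?D b p h - ?D b p0 h) < e'"
   by metis
  define d0 where "d0 = min r (Min (d ` Basis))"
  have d0: "d0 > 0" using r d by (simp add: d0_def)
  have est: "norm (Ph (p, h) - Ph (p0, h) - ?D (p - p0) p0 h) <= e / (N + 1) * norm (p - p0)"
   if p: "norm (p - p0) < d0" and h: "h : H" for p h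
  proof -
   define g where "g q = Ph (q, h) - ?D (q - p0) p0 h" for q
   have bD: "bounded_linear (%v. ?D v p0 h)"
    using lin[OF p0 h] by (simp add: linear_conv_bounded_linear)
   have g': "(g has_derivative (%v. ?D v q h - ?D v p0 h)) (at q within ball p0 d0)" if q: "q : ball p0 d0" for q
   proof -
    have "(q, h) : W" using that CW h by (auto simp: d0_def)
    then have "(Ph has_derivative (%v. dird v Ph (q, h))) (at (q, h))"
     using diff has_derivative_dird by blast
    moreover have "((%q. (q, h)) has_derivative (%v. (v, 0))) (at q)"
     by (auto intro!: derivative_eq_intros)
    ultimately have 1: "((%q. Ph (q, h)) has_derivative (%v. ?D v q h)) (at q)"
     using has_derivative_compose by fastforce
    have 2: "((%q. ?D (q - p0) p0 h) has_derivative (%v. ?D v p0 h)) (at q)"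
     by (rule bounded_linear.has_derivative[OF bD]) (auto intro!: derivative_eq_intros)
    show ?thesis unfolding g_def
     by (rule has_derivative_at_withinI) (rule has_derivative_diff[OF 1 2])
   qed
   have "norm (g p - g p0) <= e / (N + 1) * norm (p - p0)"
   proof (rule differentiable_bound[OF convex_ball[of p0 d0] g'])
    fix q assume q: "q : ball p0 d0"
    then have qU: "q : U" using r by (auto simp: d0_def)
    show "onorm (%v. ?D v q h - ?D v p0 h) <= e / (N + 1)"
    proof (rule onorm_le)
     fix v
     have "?D v q h - ?D v p0 h = (\<Sum>b\<in>Basis. (v \<bullet> b) *\<^sub>R (?D b q h - ?D b p0 h))"
      using linear_Basis_expand[OF lin[OF qU h], of v] linear_Basis_expand[OF lin[OF p0 h], of v]
      by (simp add: sum_subtractf scaleR_right_diff_distrib)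
     also have "norm ... <= (\<Sum>b\<in>(Basis::'a set). norm v * e')"
     proof (rule sum_norm_le)
      fix b :: 'a assume b: "b : Basis"
      have "dist q p0 < d b" using q b by (auto simp: d0_def dist_commute)
      then have "norm (?D b q h - ?D b p0 h) <= e'"
       using d(2)[of q h b] q h by (auto simp: d0_def dist_commute)
      then show "norm ((v \<bullet> b) *\<^sub>R (?D b q h - ?D b p0 h)) <= norm v * e'"
       using b by (simp add: Basis_le_norm mult_mono)
     qed
     also have "... = e / (N + 1) * norm v" by (simp add: e'_def)
     finally show "norm (?D v q h - ?D v p0 h) <= e / (N + 1) * norm v" .
    qed
   qed (use p d0 in "auto simp: dist_norm norm_minus_commute")
   moreover have "?D 0 p0 h = 0" using linear_0[OF lin[OF p0 h]] .
   ultimately show ?thesis by (simp add: g_def algebra_simps)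
  qed
  show "EX d>0. ALL p. norm (p - p0) < d \<longrightarrow>
   norm ((LI h. w h * Ph (p, h)) - (LI h. w h * Ph (p0, h)) - (LI h. w h * ?D (p - p0) p0 h))
    <= e * norm (p - p0)"
  proof (rule exI[of _ d0], intro conjI allI impI)
   show "0 < d0" by (rule d0)
   fix p assume p: "norm (p - p0) < d0"
   then have pU: "p : U" using r by (auto simp: d0_def dist_norm norm_minus_commute)
   have "norm (LI h. w h * (Ph (p, h) - Ph (p0, h) - ?D (p - p0) p0 h))
     <= e / (N + 1) * norm (p - p0) * N" unfolding N_def[symmetric]
   proof (subst N_def, rule norm_integral_mult_le[OF w])
    show "lint (%h. w h * (Ph (p, h) - Ph (p0, h) - ?D (p - p0) p0 h))"
     using int[OF pU Ph] int[OF p0 Ph] int[OF p0 dsm] by (simp add: algebra_simps)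
   qed (use est[OF p] w0 in auto)
   also have "... <= e * norm (p - p0)"
    using N0 e by (simp add: divide_simps mult_left_mono algebra_simps)
   finally show "norm ((LI h. w h * Ph (p, h)) - (LI h. w h * Ph (p0, h)) - (LI h. w h * ?D (p - p0) p0 h))
    <= e * norm (p - p0)"
    using int[OF pU Ph] int[OF p0 Ph] int[OF p0 dsm] by (simp add: algebra_simps)
  qed
 qed
qed

lemma dird_param_integral:
 fixes Ph :: "'a::euclidean_space \<times> 'b::euclidean_space => complex"
 assumes "open U" "open W" "U \<times> H <= W" "smooth_on W Ph"
  "lint w" "!!h. h ~: H ==> w h = 0" "compact H" "p : U"
 shows "dird v (%p. LI h. w h * Ph (p, h)) p = (LI h. w h * dird (v, 0) Ph (p, h))"
 by (rule dird_eqI[OF param_integral_has_derivative[OF assms]])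

lemma smooth_param:
 fixes Ph :: "'a::euclidean_space \<times> 'b::euclidean_space => complex"
 assumes "open U" "open W" "U \<times> H <= W" "smooth_on W Ph"
  "lint w" "!!h. h ~: H ==> w h = 0" "compact H"
 shows "smooth_on U (%p. LI h. w h * Ph (p, h))"
proof -
 note hd = param_integral_has_derivative[OF assms(1-3) _ assms(5-7)]
 have "nd n U (%p. LI h. w h * Ph (p, h))" for n
  using assms(4)
 proof (induction n arbitrary: Ph)
  case 0
  show ?case unfolding nd.simps
   by (rule continuous_at_imp_continuous_on) (use hd[OF 0] has_derivative_continuous in blast)
 next
  case (Suc n)
  show ?case
   by (rule nd_SucI'[OF assms(1) hd[OF Suc.prems]]) (use Suc smooth_on_dird in auto)
 qed
 then show ?thesis by (simp add: smooth_on_def)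
qed

lemma iter_dird_param_integral:
 fixes Ph :: "'a::euclidean_space \<times> 'b::euclidean_space => complex"
 assumes "open U" "open W" "U \<times> H <= W" "smooth_on W Ph"
  "lint w" "!!h. h ~: H ==> w h = 0" "compact H" "p : U"
 shows "iter_dird vs (%p. LI h. w h * Ph (p, h)) p
  = (LI h. w h * iter_dird (map (%v. (v, 0)) vs) Ph (p, h))"
 using assms(8)
proof (induction vs arbitrary: p)
 case (Cons v vs)
 have s: "smooth_on W (iter_dird (map (%v. (v, 0)) vs) Ph)"
  by (rule smooth_iter_dird[OF assms(4)])
 have "smooth_on U (%p. LI h. w h * iter_dird (map (%v. (v, 0)) vs) Ph (p, h))"
  by (rule smooth_param[OF assms(1-3) s assms(5-7)])
 then have "dird v (%p. LI h. w h * iter_dird (map (%v. (v, 0)) vs) Ph (p, h)) p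
   = dird v (iter_dird vs (%p. LI h. w h * Ph (p, h))) p"
  by (intro dird_cong[OF assms(1) Cons.prems]) (use Cons smooth_diff in auto)
 then show ?case
  using dird_param_integral[OF assms(1-3) s assms(5-7) Cons.prems]
  by (simp add: iter_dird_Cons)
qed simp

definition loc_integrable :: "('b::euclidean_space => complex) => bool" where
 "loc_integrable w \<longleftrightarrow> (ALL K. compact K --> lint (%h. indicator K h *\<^sub>R w h))"

lemma loc_integrable_continuous: "cont w ==> loc_integrable w"
 unfolding loc_integrable_def using borel_integrable_compact continuous_on_subset by blast

text \<open>Locally in \<open>p\<close> the integrand lives over one compact set \<open>H\<close>,
  so the locally integrable weight may be cut off there and \<open>smooth_param\<close>
  applies.\<close>

lemma smooth_param_loc:
 fixes Ph :: "'a::euclidean_space \<times> 'b::euclidean_space => complex"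
 assumes U: "open U" and Ph: "smooth_on (U \<times> UNIV) Ph" and w: "loc_integrable w"
  and supp: "!!p. p : U ==> EX V H. open V & p : V & compact H & (ALL q:V. ALL h. h ~: H --> Ph (q, h) = 0)"
 shows "smooth_on U (%p. LI h. w h * Ph (p, h))"
proof (rule smooth_on_local)
 fix p assume p: "p : U"
 obtain V H where V: "open V" "p : V" and H: "compact H" and VH: "!!q h. q : V ==> h ~: H ==> Ph (q, h) = 0"
  using supp[OF p] by blast
 have o: "open (U \<inter> V)" using U V by auto
 have "smooth_on (U \<inter> V) (%p. LI h. (indicator H h *\<^sub>R w h) * Ph (p, h))"
  by (rule smooth_param[OF o _ _ Ph]) (use U w H in "auto simp: loc_integrable_def open_Times")
 moreover have "(LI h. (indicator H h *\<^sub>R w h) * Ph (q, h)) = (LI h. w h * Ph (q, h))" if "q : U \<inter> V" for q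
  by (rule Bochner_Integration.integral_cong) (use VH that in "auto simp: indicator_def")
 ultimately show "EX T. open T & p : T & smooth_on T (%p. LI h. w h * Ph (p, h))"
  using o p V smooth_on_cong[OF o] by (metis (no_types, lifting) IntI)
qed

section \<open>Test functions\<close>

lemma test_funI:
 assumes "smo ph" "compact K" "!!p. p ~: K ==> ph p = 0"
 shows "ph : test_fun"
proof -
 have "closure {p. ph p ~= 0} <= K"
  by (rule closure_minimal) (use assms compact_imp_closed in auto)
 then have "compact (closure {p. ph p ~= 0})"
  using compact_Int_closed[OF assms(2) closed_closure, of "{p. ph p ~= 0}"] by (simp add: Int_absorb1)
 then show ?thesis using assms(1) by (simp add: test_fun_def smooth_iff)
qed

lemma test_funD: "ph : test_fun ==> smo ph"
 by (simp add: test_fun_def smooth_iff)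

lemma test_funE:
 assumes "ph : test_fun"
 obtains K where "compact K" "!!p. p ~: K ==> ph p = 0"
proof (rule that)
 show "compact (closure {p. ph p ~= 0})" using assms by (simp add: test_fun_def)
 show "ph p = 0" if "p ~: closure {p. ph p ~= 0}" for p
  using that closure_subset[of "{p. ph p ~= 0}"] by auto
qed

lemma closure_suppD: "closure {p. ph p ~= 0} <= K ==> p ~: K ==> ph p = 0"
 using closure_subset[of "{p. ph p ~= 0}"] by auto

lemma test_fun_diff: "ph : test_fun ==> ph differentiable (at x)"
 using test_funD smooth_diff by blast

lemma test_fun_add: "ph : test_fun ==> ps : test_fun ==> (%p. ph p + ps p) : test_fun"
proof -
 assume a: "ph : test_fun" "ps : test_fun"
 obtain K L where "compact K" "compact L" "!!p. p ~: K ==> ph p = 0" "!!p. p ~: L ==> ps p = 0"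
  using a test_funE by metis
 then show ?thesis
  by (intro test_funI[of _ "K \<union> L"] smooth_on_add test_funD[OF a(1)] test_funD[OF a(2)]) auto
qed

lemma test_fun_mult: "smo a ==> ph : test_fun ==> (%p. a p * ph p) : test_fun"
 by (rule test_funE[of ph], assumption, rule test_funI[OF smooth_on_mult]) (auto simp: test_funD)

lemma test_fun_cmult: "ph : test_fun ==> (%p. c * ph p) : test_fun"
 by (rule test_fun_mult) (auto intro: smooth_intros)

lemma test_fun_minus: "ph : test_fun ==> (%p. - ph p) : test_fun"
 using test_fun_cmult[of ph "-1"] by simp

lemma test_fun_zero: "(%p. 0) : test_fun"
 by (rule test_funI[of _ "{}"]) (auto intro: smooth_intros)

lemma test_fun_sum: "(!!i. i : I ==> f i : test_fun) ==> (%p. \<Sum>i\<in>I. f i p) : test_fun"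
 by (induction I rule: infinite_finite_induct) (auto intro!: test_fun_add test_fun_zero)

lemma dird_zero_outside: "closed K ==> (!!p. p ~: K ==> f p = 0) ==> p ~: K ==> dird v f p = 0"
 using dird_cong[of "- K" p "%x. 0" f v] by auto

lemma test_fun_dird: "ph : test_fun ==> dird v ph : test_fun"
 by (rule test_funE[of ph], assumption, rule test_funI[OF smooth_on_dird])
   (auto simp: test_funD intro: dird_zero_outside compact_imp_closed)

lemma test_fun_lint:
 assumes "ph : test_fun"
 shows "lint ph"
proof -
 obtain K where K: "compact K" "!!p. p ~: K ==> ph p = 0" using assms test_funE by metis
 with assms have "continuous_on K ph" using continuous_on_subset[OF smooth_cont[OF test_funD[OF assms]]] by simp
 then have "lint (%x. indicator K x *\<^sub>R ph x)"
  by (rule borel_integrable_compact[OF K(1)])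
 moreover have "(%x. indicator K x *\<^sub>R ph x) = ph" using K(2) by (auto simp: indicator_def)
 ultimately show ?thesis by simp
qed

lemma integral_translate:
 fixes f :: "'a::euclidean_space => 'b::{banach,second_countable_topology}"
 assumes "f : borel_measurable borel"
 shows "(LI h. f (h + c)) = (LI h. f h)"
proof -
 have "(LINT h|Measure_Space.distr lborel borel ((+) c). f h) = (LI h. f (c + h))"
  using assms by (intro integral_distr) auto
 then show ?thesis by (simp add: lborel_distr_plus add.commute)
qed

text \<open>By translation invariance the integral of \<open>f (h + s *\<^sub>R v)\<close> over
  \<open>h\<close> does not depend on \<open>s\<close>; its derivative at \<open>s = 0\<close> is
  the integral in question.\<close>

lemma integral_dird_test_fun:
 fixes f :: "'a::euclidean_space => complex"
 assumes f: "f : test_fun"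
 shows "(LI p. dird v f p) = 0"
proof -
 obtain K where K: "compact K" "!!p. p ~: K ==> f p = 0" using f test_funE by metis
 \<comment> \<open>\<open>H\<close> contains the translates of the support for all \<open>s\<close>
   of modulus at most 1, so its indicator can serve as the compactly supported weight.\<close>
 define H where "H = (%(s, q). q - s *\<^sub>R v) ` (cball (0::real) 1 \<times> K)"
 have H: "compact H" unfolding H_def case_prod_unfold
  by (intro compact_continuous_image compact_Times K continuous_intros) auto
 have KH: "h : H" if "h + s *\<^sub>R v : K" "\<bar>s\<bar> <= 1" for h s
  unfolding H_def image_iff using that by (intro bexI[of _ "(s, h + s *\<^sub>R v)"]) auto
 let ?w = "%h::'a. of_real (indicator H h) :: complex"
 let ?Ph = "%(s::real, h). f (h + s *\<^sub>R v)"
 have w: "lint ?w"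
  using borel_integrable_compact[OF H, of "%x. 1 :: complex"] by (simp add: scaleR_conv_of_real)
 have Ph: "smo ?Ph" unfolding case_prod_unfold
  by (rule smooth_comp[OF test_funD[OF f]]) (auto intro!: smooth_intros)
 have 1: "((%s. LI h. ?w h * ?Ph (s, h)) has_derivative
   (%u. LI h. ?w h * dird (u, 0) ?Ph (0, h))) (at 0)"
  by (rule param_integral_has_derivative[where U = UNIV and W = UNIV and H = H, OF _ _ _ Ph w _ H]) auto
 have 2: "(LI h. ?w h * ?Ph (s, h)) = (LI h. f h)" if "s : ball 0 1" for s
 proof -
  have "(LI h. ?w h * ?Ph (s, h)) = (LI h. f (h + s *\<^sub>R v))"
   by (rule Bochner_Integration.integral_cong) (use that KH K in "force simp: indicator_def")+
  also have "... = (LI h. f h)"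
   by (intro integral_translate borel_measurable_continuous_onI smooth_cont test_funD f)
  finally show ?thesis .
 qed
 have "((%s::real. LI h. f h) has_derivative (%u. LI h. ?w h * dird (u, 0) ?Ph (0, h))) (at 0)"
  by (rule has_derivative_transform_within_open[OF 1, of "ball 0 1"]) (use 2 in auto)
 then have "(LI h. ?w h * dird (1, 0) ?Ph (0, h)) = 0"
  by (drule_tac has_derivative_unique[OF _ has_derivative_const]) (drule fun_cong[of _ _ 1], simp)
 moreover have "?w h * dird (1, 0) ?Ph (0, h) = dird v f h" for h
 proof -
  have "dird (1, 0) ?Ph (0, h) = dird ((%(s, y). y + s *\<^sub>R v) (1, 0)) f ((%(s, y). y + s *\<^sub>R v) (0, h))"
   unfolding case_prod_unfold
   by (rule dird_compose) (auto intro!: derivative_eq_intros test_fun_diff f)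
  moreover have "dird v f h = 0" if "h ~: H"
   using dird_zero_outside[OF compact_imp_closed[OF H], of f h v] that KH[of _ 0] K by auto
  ultimately show ?thesis by (auto simp: indicator_def)
 qed
 ultimately show ?thesis by simp
qed

lemma test_fun_times_smooth: "ph : test_fun ==> smo a ==> (%p. ph p * a p) : test_fun"
 using test_fun_mult[of a ph] by (simp add: mult.commute)

lemma integral_by_parts:
 assumes "smo f" "ph : test_fun"
 shows "(LI p. f p * dird v ph p) = - (LI p. dird v f p * ph p)"
proof -
 have "(LI p. dird v (%p. f p * ph p) p) = 0"
  by (rule integral_dird_test_fun[OF test_fun_mult[OF assms]])
 moreover have "dird v (%p. f p * ph p) p = dird v f p * ph p + f p * dird v ph p" for p
  by (rule dird_mult) (use assms test_fun_diff smooth_diff[OF assms(1)] in auto)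
 moreover have "lint (%p. dird v f p * ph p)" "lint (%p. f p * dird v ph p)"
  using assms by (auto intro!: test_fun_lint test_fun_mult smooth_on_dird test_fun_dird)
 ultimately show ?thesis by (simp add: add_eq_0_iff)
qed

section \<open>Bump functions\<close>

text \<open>The powers of \<open>1 / x\<close> close the family under differentiation, so that
  smoothness follows by one induction for all \<open>k\<close> together.\<close>

definition flat :: "nat => real => real" where
 "flat k x = (if x <= 0 then 0 else inverse x ^ k * exp (- inverse x))"

text \<open>A quadratic bound gives derivative 0 at the origin. With \<open>y = 1 / x\<close> it
  says that \<open>y ^ (k + 2)\<close> is at most a constant times \<open>exp y\<close>, which
  follows from \<open>(1 + y / n) ^ n <= exp y\<close> for \<open>n = k + 2\<close>.\<close>

lemma flat_bound: "\<bar>flat k x\<bar> <= real (k + 2) ^ (k + 2) * x\<^sup>2"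
proof (cases "x <= 0")
 case False
 define y where "y = inverse x"
 have y: "y > 0" using False by (simp add: y_def)
 have "(y / real (k + 2)) ^ (k + 2) <= (1 + y / real (k + 2)) ^ (k + 2)"
  using y by (intro power_mono) auto
 also have "... <= exp y"
  by (rule exp_ge_one_plus_x_over_n_power_n) (use y in auto)
 finally have "y ^ (k + 2) <= real (k + 2) ^ (k + 2) * exp y"
  by (simp add: power_divide divide_le_eq mult.commute del: power_Suc of_nat_add)
 then have "y ^ k * exp (- y) <= real (k + 2) ^ (k + 2) / y\<^sup>2"
  using y by (simp add: exp_minus field_simps power_add power2_eq_square del: of_nat_add)
 then show ?thesis using False y by (simp add: flat_def y_def field_simps del: of_nat_add)
qed (simp add: flat_def)

lemma flat_has_derivative:
 "(flat k has_derivative (%v. v * (flat (k + 2) x - real k * flat (k + 1) x))) (at x)"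
proof -
 consider "x < 0" | "x = 0" | "x > 0" by linarith
 then show ?thesis
 proof cases
  case 1
  have "((%x::real. 0::real) has_derivative (%v. 0)) (at x)" by simp
  then have "(flat k has_derivative (%v. 0)) (at x)"
   by (rule has_derivative_transform_within_open[of _ _ _ _ "{..<0}"]) (use 1 in "auto simp: flat_def")
  then show ?thesis using 1 by (simp add: flat_def)
 next
  case 2
  have "(flat k has_derivative (%v. 0)) (at 0)"
   unfolding has_derivative_at_alt
  proof (intro conjI allI impI)
   fix e :: real assume e: "e > 0"
   define M where "M = real (k + 2) ^ (k + 2)"
   have M: "M > 0" by (simp add: M_def)
   show "EX d>0. ALL y. norm (y - 0) < d --> norm (flat k y - flat k 0 - 0) <= e * norm (y - 0)"
   proof (rule exI[of _ "e / M"], intro conjI allI impI)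
    fix y :: real assume y: "norm (y - 0) < e / M"
    have "\<bar>flat k y\<bar> <= M * y\<^sup>2" using flat_bound[of k y] by (simp only: M_def)
    also have "... = (M * \<bar>y\<bar>) * \<bar>y\<bar>" by (simp add: power2_eq_square)
    also have "... <= e * \<bar>y\<bar>" using y M by (intro mult_right_mono) (auto simp: field_simps)
    finally show "norm (flat k y - flat k 0 - 0) <= e * norm (y - 0)" by (simp add: flat_def)
   qed (use e M in auto)
  qed simp
  then show ?thesis using 2 by (simp add: flat_def)
 next
  case 3
  have "((%x::real. inverse x ^ k * exp (- inverse x)) has_real_derivative
    (flat (k + 2) x - real k * flat (k + 1) x)) (at x)"
  proof (cases k)
   case 0
   show ?thesis using 3
    by (auto intro!: derivative_eq_intros simp: 0 flat_def power2_eq_square)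
  next
   case (Suc j)
   have j: "inverse x ^ j = inverse x * inverse x ^ (j - Suc 0) | j = 0" by (cases j) auto
   show ?thesis using 3 j
    by (auto intro!: derivative_eq_intros simp: Suc flat_def power2_eq_square algebra_simps)
  qed
  then have "((%x::real. inverse x ^ k * exp (- inverse x)) has_derivative
    (%v. v * (flat (k + 2) x - real k * flat (k + 1) x))) (at x)"
   by (simp add: has_field_derivative_def mult_commute_abs)
  then show ?thesis
   by (rule has_derivative_transform_within_open[of _ _ _ _ "{0<..}"]) (use 3 in "auto simp: flat_def")
 qed
qed

lemma smooth_on_flat: "smo (flat k)"
proof -
 have "nd n UNIV (flat k)" for n
 proof (induction n arbitrary: k)
  case 0
  show ?case unfolding nd.simps
   by (rule continuous_at_imp_continuous_on) (use flat_has_derivative has_derivative_continuous in blast)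
 next
  case (Suc n)
  have "nd n UNIV (%x. v * (flat (k + 2) x + (- real k) * flat (k + 1) x))" for v
   by (intro nd_bilinear[OF bounded_bilinear_mult] nd_add nd_const Suc) auto
  then show ?case
   by (intro nd_SucI'[OF _ flat_has_derivative]) auto
 qed
 then show ?thesis by (simp add: smooth_on_def)
qed

definition smooth_step :: "real => real" where
 "smooth_step x = flat 0 x / (flat 0 x + flat 0 (1 - x))"

lemma flat_pos: "x > 0 ==> flat 0 x > 0" and flat_nonneg: "flat 0 x >= 0" and flat_zero: "x <= 0 ==> flat 0 x = 0"
 by (auto simp: flat_def)

lemma flat_sum_pos: "flat 0 x + flat 0 (1 - x) > 0"
 using flat_pos[of x] flat_pos[of "1 - x"] flat_nonneg[of x] flat_nonneg[of "1 - x"] by (cases "x > 0") auto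

lemma smooth_on_smooth_step: "smo smooth_step"
proof -
 have "smo (%x. flat 0 x / (flat 0 x + flat 0 (1 - x)))"
  by (intro smooth_intros smooth_on_flat smooth_comp[OF smooth_on_flat] open_UNIV
    less_imp_neq[OF flat_sum_pos, symmetric])
 then show ?thesis by (simp add: smooth_step_def[abs_def])
qed

lemma smooth_step_0: "x <= 0 ==> smooth_step x = 0"
 by (simp add: smooth_step_def flat_zero)

lemma smooth_step_1: "x >= 1 ==> smooth_step x = 1"
 using flat_pos[of x] by (simp add: smooth_step_def flat_zero)

lemma smooth_step_range: "0 <= smooth_step x" "smooth_step x <= 1"
 using flat_sum_pos[of x] flat_nonneg[of x] flat_nonneg[of "1 - x"] by (auto simp: smooth_step_def)

lemma smooth_step_compose [smooth_intros]:
 "open S ==> smooth_on S f ==> smooth_on S (%x. smooth_step (f x))"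
 by (rule smooth_comp[OF smooth_on_smooth_step])

lemma bump_exists:
 fixes p0 :: "'a::euclidean_space"
 assumes "r > 0"
 obtains b :: "'a => real" where "(%p. of_real (b p)) : test_fun" "!!p. 0 <= b p" "b p0 > 0"
  "!!p. p ~: ball p0 r ==> b p = 0"
proof
 let ?b = "%p. flat 0 (r\<^sup>2 - (p - p0) \<bullet> (p - p0))"
 have z: "?b p = 0" if "p ~: ball p0 r" for p
 proof (rule flat_zero)
  have "r <= norm (p - p0)" using that by (simp add: dist_norm norm_minus_commute)
  then have "r\<^sup>2 <= (norm (p - p0))\<^sup>2" using assms by (intro power_mono) auto
  then show "r\<^sup>2 - (p - p0) \<bullet> (p - p0) <= 0" by (simp add: power2_norm_eq_inner)
 qed
 show "?b p = 0" if "p ~: ball p0 r" for p using z that .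
 show "(%p. of_real (?b p)) : test_fun"
 proof (rule test_funI[of _ "cball p0 r"])
  show "smo (%p. complex_of_real (?b p))"
   by (intro smooth_intros smooth_comp[OF smooth_on_flat]) auto
 qed (use z in auto)
 show "?b p0 > 0" using assms by (simp add: flat_pos)
qed (simp add: flat_nonneg)

lemma cutoff_exists:
 fixes K :: "'a::euclidean_space set"
 assumes "bounded K"
 obtains c :: "'a => real" where "(%p. of_real (c p)) : test_fun" "!!p. p : K ==> c p = 1"
  "!!p. 0 <= c p" "!!p. c p <= 1"
proof -
 obtain R where R: "!!p. p : K ==> norm p <= R" using assms bounded_iff by blast
 let ?c = "%p::'a. smooth_step (R\<^sup>2 + 1 - p \<bullet> p)"
 have "(%p. complex_of_real (?c p)) : test_fun"
 proof (rule test_funI[of _ "cball 0 (\<bar>R\<bar> + 1)"])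
  show "smo (%p. complex_of_real (?c p))" by (intro smooth_intros) auto
  show "complex_of_real (?c p) = 0" if "p ~: cball 0 (\<bar>R\<bar> + 1)" for p
  proof -
   have "(\<bar>R\<bar> + 1)\<^sup>2 <= (norm p)\<^sup>2" using that by (intro power_mono) auto
   then have "R\<^sup>2 + 1 - p \<bullet> p <= 0" by (simp add: power2_norm_eq_inner power2_sum)
   then show ?thesis by (simp add: smooth_step_0)
  qed
 qed auto
 moreover have "?c p = 1" if "p : K" for p
 proof -
  have "(norm p)\<^sup>2 <= R\<^sup>2" using R[OF that] norm_ge_zero by (intro power_mono) auto
  then show ?thesis by (simp add: power2_norm_eq_inner smooth_step_1)
 qed
 ultimately show thesis using that[of ?c] smooth_step_range by blast
qed

text \<open>If \<open>G p0 ~= 0\<close>, the real part of \<open>cnj (G p0) * G\<close> is positive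
  near \<open>p0\<close>. Its product with a bump supported there is continuous, nonnegative and
  positive at \<open>p0\<close>, yet has integral 0.\<close>

lemma continuous_zero_if_test_integrals_zero:
 fixes G :: "'a::euclidean_space => complex"
 assumes G: "cont G" and z: "!!ph. ph : test_fun ==> (LI p. G p * ph p) = 0"
 shows "G p0 = 0"
proof (rule ccontr)
 assume n: "G p0 ~= 0"
 define g where "g p = Re (cnj (G p0) * G p)" for p
 have cg: "cont g" unfolding g_def by (intro continuous_intros G)
 have "g p0 > 0" using n by (simp add: g_def complex_eq_iff sum_power2_gt_zero_iff flip: power2_eq_square)
 then have "\<forall>\<^sub>F p in at p0. g p > 0"
  using cg by (auto simp: continuous_on_eq_continuous_at isCont_def intro: order_tendstoD)
 then obtain r where r: "r > 0" "!!p. dist p p0 < r ==> g p > 0"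
  using \<open>g p0 > 0\<close> unfolding eventually_at by (metis UNIV_I)
 obtain b where b: "(%p. complex_of_real (b p)) : test_fun" "!!p. 0 <= b p" "b p0 > 0"
  "!!p. p ~: ball p0 r ==> b p = 0" using bump_exists[OF r(1)] by metis
 define f where "f p = g p * b p" for p
 have cb: "cont b"
  using smooth_cont[OF test_funD[OF b(1)]] continuous_on_Re by fastforce
 have cf: "cont f" unfolding f_def by (intro continuous_intros cg cb)
 have f0: "f p >= 0" for p using r(2)[of p] b(2)[of p] b(4)[of p]
  by (cases "p : ball p0 r") (auto simp: f_def dist_commute)
 have Gb: "lint (%p. cnj (G p0) * (G p * complex_of_real (b p)))"
 proof -
  obtain K where K: "compact K" "!!p. p ~: K ==> complex_of_real (b p) = 0"
   using b(1) test_funE by metis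
  have "lint (%p. complex_of_real (b p) * (cnj (G p0) * G p))"
   by (rule lint_mult_compact[OF test_fun_lint[OF b(1)] K(2) K(1)])
     (auto intro!: continuous_intros continuous_on_subset[OF G])
  then show ?thesis by (simp add: algebra_simps)
 qed
 have fe: "f p = Re (cnj (G p0) * (G p * complex_of_real (b p)))" for p
  by (simp add: f_def g_def algebra_simps)
 have fi: "lint f" unfolding fe[abs_def] using Gb by (rule integrable_Re)
 have "(LI p. f p) = Re (LI p. cnj (G p0) * (G p * complex_of_real (b p)))"
  unfolding fe[abs_def] using Gb by (rule integral_Re)
 also have "... = 0" using z[OF b(1)] by simp
 finally have "AE p in lborel. f p = 0"
  using integral_nonneg_eq_0_iff_AE[OF fi] f0 by simp
 moreover have o: "open {p. f p ~= 0}"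
 proof -
  have "open (f -` (- {0}))" by (rule open_vimage[OF _ cf]) auto
  moreover have "f -` (- {0}) = {p. f p ~= 0}" by auto
  ultimately show ?thesis by simp
 qed
 ultimately have "{p. f p ~= 0} : null_sets lborel"
  by (simp add: AE_iff_null borel_open)
 then have "negligible {p. f p ~= 0}"
  using negligible_iff_null_sets null_sets_completionI by blast
 moreover have "p0 : {p. f p ~= 0}" using \<open>g p0 > 0\<close> b(3) by (simp add: f_def)
 ultimately show False using open_not_negligible[OF o] by auto
qed

section \<open>Operators on test functions and distributions\<close>

lemma Cm_norm_upper:
 assumes "ph : test_fun" "set vs <= Basis" "length vs <= m"
 shows "cmod (iter_dird vs ph p) <= Cm_norm m ph"
proof -
 have fin: "finite {vs :: 'a list. set vs <= Basis & length vs <= m}"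
  by (rule finite_lists_length_le) simp
 obtain K where K: "compact K" "!!p. p ~: K ==> ph p = 0" using assms(1) test_funE by metis
 have "EX B. ALL p. cmod (iter_dird ws ph p) <= B" for ws
 proof -
  have t: "iter_dird ws ph : test_fun"
   by (induction ws) (auto simp: iter_dird_Cons assms(1) test_fun_dird)
  then obtain L where L: "compact L" "!!p. p ~: L ==> iter_dird ws ph p = 0" using test_funE by metis
  have "bounded (iter_dird ws ph ` L)"
   using compact_continuous_image[OF continuous_on_subset[OF smooth_cont[OF test_funD[OF t]]] L(1)]
   by (auto intro: compact_imp_bounded)
  then obtain B where "!!p. p : L ==> cmod (iter_dird ws ph p) <= B" by (auto simp: bounded_iff)
  then show ?thesis using L(2) by (intro exI[of _ "max B 0"] allI) (metis max.coboundedI1 max.coboundedI2 norm_zero order_refl)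
 qed
 then obtain B where B: "!!ws p. cmod (iter_dird ws ph p) <= B ws" by metis
 define M where "M = Max (B ` {vs :: 'a list. set vs <= Basis & length vs <= m})"
 have "bdd_above ((%(vs, p). cmod (iter_dird vs ph p)) ` ({vs. set vs <= Basis & length vs <= m} \<times> UNIV))"
 proof (rule bdd_aboveI[of _ M])
  fix x assume "x : (%(vs, p). cmod (iter_dird vs ph p)) ` ({vs. set vs <= Basis & length vs <= m} \<times> UNIV)"
  then obtain vs p where "set vs <= Basis" "length vs <= m" "x = cmod (iter_dird vs ph p)" by auto
  then show "x <= M" unfolding M_def using B[of vs p] fin
   by (intro order_trans[OF _ Max_ge[of _ "B vs"]]) auto
 qed
 then show ?thesis unfolding Cm_norm_def
  using cSUP_upper[of "(vs, p)" _ "%(vs, p). cmod (iter_dird vs ph p)"] assms(2,3) by auto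
qed

lemma ne_emptyI: "x : A ==> A ~= {}"
 by auto

lemma Cm_norm_least:
 assumes "!!vs p. set vs <= Basis ==> length vs <= m ==> cmod (iter_dird vs ph p) <= B"
 shows "Cm_norm m ph <= B"
 unfolding Cm_norm_def
proof (rule cSUP_least)
 have "([], undefined) : {vs. set vs <= Basis & length vs <= m} \<times> UNIV" by auto
 then show "{vs. set vs <= Basis & length vs <= m} \<times> UNIV ~= {}" by (rule ne_emptyI)
qed (use assms in auto)

lemma Cm_norm_ge: "ph : test_fun ==> cmod (ph p) <= Cm_norm m ph"
 using Cm_norm_upper[of ph "[]" m p] by simp

lemma Cm_norm_nonneg: "ph : test_fun ==> 0 <= Cm_norm m ph"
 using Cm_norm_ge[of ph undefined m] norm_ge_zero order_trans by blast

lemma Cm_norm_mono: "ph : test_fun ==> m <= m' ==> Cm_norm m ph <= Cm_norm m' ph"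
 by (rule Cm_norm_least) (auto intro: Cm_norm_upper)

text \<open>Supports are bounded without taking closures; for compact sets this agrees with the
  condition in \<open>distr\<close>.\<close>

definition test_in :: "'a::euclidean_space set => ('a => complex) set" where
 "test_in K = {ph:test_fun. ALL p. p ~: K --> ph p = 0}"

lemma test_in_iff: "compact K ==> ph : test_in K \<longleftrightarrow> ph : test_fun & closure {p. ph p ~= 0} <= K"
proof -
 assume "compact K"
 then have "closure {p. ph p ~= 0} <= K \<longleftrightarrow> (ALL p. p ~: K --> ph p = 0)"
  using closure_suppD[of ph K] closure_minimal[of "{p. ph p ~= 0}" K] compact_imp_closed
  by (metis (mono_tags, lifting) mem_Collect_eq subsetI)
 then show ?thesis by (simp add: test_in_def)
qed

lemma test_in_test: "ph : test_in K ==> ph : test_fun"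
 by (simp add: test_in_def)

lemma test_fun_test_inE:
 assumes "ph : test_fun" obtains K where "compact K" "ph : test_in K"
proof -
 obtain K where "compact K" "!!p. p ~: K ==> ph p = 0" using test_funE[OF assms] by metis
 then show thesis using assms that[of K] by (simp add: test_in_def)
qed

definition test_linear :: "(('a::euclidean_space => complex) => 'b::euclidean_space => complex) => bool" where
 "test_linear P \<longleftrightarrow> (ALL ph:test_fun. P ph : test_fun) \<and>
   (ALL ph:test_fun. ALL ps:test_fun. P (%p. ph p + ps p) = (%p. P ph p + P ps p)) \<and>
   (ALL c. ALL ph:test_fun. P (%p. c * ph p) = (%p. c * P ph p))"

text \<open>\<open>cb 0\<close> are bounds by the supremum norm, \<open>cb 1\<close> bounds by any of the norms \<open>Cm_norm m\<close>.\<close>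

definition cb :: "nat => (('a::euclidean_space => complex) => 'b => complex) => bool" where
 "cb j A \<longleftrightarrow> (ALL K. compact K --> (EX C>=0. EX m. ALL ph:test_in K. ALL p. cmod (A ph p) <= C * Cm_norm (j * m) ph))"

text \<open>Continuity for the inductive limit topology: supports over one compact set stay in
  another one, and every derivative of the image is bounded by finitely many derivatives of the
  argument. The transposes of these operators act on distributions.\<close>

definition test_cont :: "(('a::euclidean_space => complex) => 'b::euclidean_space => complex) => bool" where
 "test_cont P \<longleftrightarrow> test_linear P & (ALL K. compact K --> (EX K'. compact K' & (ALL ph:test_in K. P ph : test_in K')))
   & (ALL vs. set vs <= Basis --> cb 1 (%ph. iter_dird vs (P ph)))"

lemma test_contI:
 assumes "test_linear P"
  and "!!K. compact K ==> EX K'. compact K' & (ALL ph:test_in K. P ph : test_in K')"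
  and "!!vs. set vs <= Basis ==> cb 1 (%ph. iter_dird vs (P ph))"
 shows "test_cont P"
 unfolding test_cont_def using assms by meson

lemma test_contD:
 assumes "test_cont P"
 shows "ph : test_fun ==> P ph : test_fun"
  "ph : test_fun ==> ps : test_fun ==> P (%p. ph p + ps p) = (%p. P ph p + P ps p)"
  "ph : test_fun ==> P (%p. c * ph p) = (%p. c * P ph p)"
 using assms unfolding test_cont_def test_linear_def by auto

lemma test_contE1:
 assumes "test_cont P" "compact K"
 obtains K' where "compact K'" "!!ph. ph : test_in K ==> P ph : test_in K'"
 using assms unfolding test_cont_def by meson

text \<open>Constants and orders of the finitely many derivatives up to order \<open>m\<close> are
  added up. With \<open>j = 0\<close> the right-hand side stays the supremum norm, which is how
  order zero is obtained later.\<close>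

lemma Cm_norm_bound:
 fixes P :: "('a::euclidean_space => complex) => 'b::euclidean_space => complex"
 assumes b: "!!vs. set vs <= Basis ==> cb j (%ph. iter_dird vs (P ph))" and "compact K"
 obtains C m' where "C >= 0" "!!ph. ph : test_in K ==> Cm_norm m (P ph) <= C * Cm_norm (j * m') ph"
proof -
 let ?L = "{vs :: 'b list. set vs <= Basis & length vs <= m}"
 have fin: "finite ?L" by (rule finite_lists_length_le) simp
 have "EX C m. set vs <= Basis --> C >= 0 & (ALL ph:test_in K. ALL p. cmod (iter_dird vs (P ph) p) <= C * Cm_norm (j * m) ph)" for vs
  using b[of vs] assms(2) unfolding cb_def by meson
 then obtain C m' where C: "!!vs. set vs <= Basis ==> C vs >= 0"
  "!!vs ph p. set vs <= Basis ==> ph : test_in K ==> cmod (iter_dird vs (P ph) p) <= C vs * Cm_norm (j * m' vs) ph"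
  by metis
 have "Cm_norm m (P ph) <= (\<Sum>vs\<in>?L. C vs) * Cm_norm (j * (\<Sum>vs\<in>?L. m' vs)) ph" if "ph : test_in K" for ph
 proof (rule Cm_norm_least)
  fix vs :: "'b list" and p assume "set vs <= Basis" "length vs <= m"
  then show "cmod (iter_dird vs (P ph) p) <= (\<Sum>vs\<in>?L. C vs) * Cm_norm (j * (\<Sum>vs\<in>?L. m' vs)) ph"
   using C that
   by (intro order_trans[OF C(2)] mult_mono mult_le_mono2 member_le_sum fin Cm_norm_mono sum_nonneg Cm_norm_nonneg) (auto simp: test_in_def)
 qed
 then show ?thesis using C(1) by (intro that[of "\<Sum>vs\<in>?L. C vs"] sum_nonneg) auto
qed

lemma test_contE2:
 assumes "test_cont P" "compact K"
 obtains C m' where "C >= 0" "!!ph. ph : test_in K ==> Cm_norm m (P ph) <= C * Cm_norm m' ph"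
 using Cm_norm_bound[of 1 P K m] assms by (auto simp: test_cont_def)

lemma cb_zeroE:
 assumes "cb 0 A" "compact K"
 obtains C where "C >= 0" "!!ph p. ph : test_in K ==> cmod (A ph p) <= C * Cm_norm 0 ph"
 using assms unfolding cb_def by auto

lemma cb_zeroI:
 assumes "!!K. compact K ==> EX C>=0. ALL ph:test_in K. ALL p. cmod (A ph p) <= C * Cm_norm 0 ph"
 shows "cb 0 A"
 using assms unfolding cb_def by simp

text \<open>The transpose of \<open>P\<close>. The value 0 off the test functions is forced by the
  normalisation in \<open>distr\<close>.\<close>

definition dist_pull :: "(('a::euclidean_space => complex) => 'b::euclidean_space => complex) =>
  (('b => complex) => complex) => ('a => complex) => complex" where
 "dist_pull P u = (%ph. if ph : test_fun then u (P ph) else 0)"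

lemma distrI:
 assumes "!!ph ps. ph : test_fun ==> ps : test_fun ==> u (%p. ph p + ps p) = u ph + u ps"
  and "!!c ph. ph : test_fun ==> u (%p. c * ph p) = c * u ph"
  and "!!K. compact K ==> EX C m. ALL ph:test_in K. cmod (u ph) <= C * Cm_norm m ph"
  and "!!ph. ph ~: test_fun ==> u ph = 0"
 shows "u : distr"
proof -
 have "EX C m. ALL ph:test_fun. closure {p. ph p ~= 0} <= K --> cmod (u ph) <= C * Cm_norm m ph" if K: "compact K" for K
  using assms(3)[OF K] unfolding Ball_def test_in_iff[OF K] by metis
 then show ?thesis using assms(1,2,4) by (simp add: distr_def)
qed

lemma distrD:
 assumes "u : distr"
 shows "ph : test_fun ==> ps : test_fun ==> u (%p. ph p + ps p) = u ph + u ps"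
  "ph : test_fun ==> u (%p. c * ph p) = c * u ph"
  "ph ~: test_fun ==> u ph = 0"
 using assms unfolding distr_def by auto

lemma distrE:
 assumes "u : distr" "compact K"
 obtains C m where "C >= 0" "!!ph. ph : test_in K ==> cmod (u ph) <= C * Cm_norm m ph"
proof -
 obtain C m where C: "!!ph. ph : test_in K ==> cmod (u ph) <= C * Cm_norm m ph"
  using assms unfolding distr_def by (auto simp: test_in_iff) meson
 have "cmod (u ph) <= \<bar>C\<bar> * Cm_norm m ph" if "ph : test_in K" for ph
  using C[OF that] Cm_norm_nonneg[OF test_in_test[OF that], of m]
  by (meson abs_ge_self mult_right_mono order_trans)
 then show ?thesis using that[of "\<bar>C\<bar>" m] by simp
qed

lemma distr_sum:
 assumes "u : distr" "!!i. i : I ==> f i : test_fun"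
 shows "u (%p. \<Sum>i\<in>I. f i p) = (\<Sum>i\<in>I. u (f i))"
 using assms(2)
proof (induction I rule: infinite_finite_induct)
 case (insert i I)
 then show ?case using distrD(1)[OF assms(1), of "f i" "%p. \<Sum>i\<in>I. f i p"] by (auto intro!: test_fun_sum)
qed (use distrD(2)[OF assms(1) test_fun_zero, of 0] in auto)

lemma dist_pull_distr:
 assumes P: "test_cont P" and u: "u : distr"
 shows "dist_pull P u : distr"
proof (rule distrI)
 fix K :: "'a set" assume K: "compact K"
 obtain K' where K': "compact K'" "!!ph. ph : test_in K ==> P ph : test_in K'" using test_contE1[OF P K] by blast
 obtain C m where C: "C >= 0" "!!ph. ph : test_in K' ==> cmod (u ph) <= C * Cm_norm m ph"
  using distrE[OF u K'(1)] by metis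
 obtain D m' where D: "D >= 0" "!!ph. ph : test_in K ==> Cm_norm m (P ph) <= D * Cm_norm m' ph"
  using test_contE2[OF P K] by metis
 have "cmod (dist_pull P u ph) <= (C * D) * Cm_norm m' ph" if "ph : test_in K" for ph
  using C(2)[OF K'(2)[OF that]] mult_left_mono[OF D(2)[OF that] C(1)] test_in_test[OF that]
  by (simp add: dist_pull_def mult.assoc)
 then show "EX C m. ALL ph:test_in K. cmod (dist_pull P u ph) <= C * Cm_norm m ph" by blast
qed (simp_all add: dist_pull_def test_contD[OF P] distrD[OF u] test_fun_add test_fun_cmult)

lemma test_cont_comp: "test_cont P ==> test_cont Q ==> test_cont (%ph. P (Q ph))"
proof (rule test_contI)
 assume P: "test_cont P" and Q: "test_cont Q"
 show "test_linear (%ph. P (Q ph))"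
  unfolding test_linear_def using test_contD[OF P] test_contD[OF Q] by simp
 show "cb 1 (%ph. iter_dird vs (P (Q ph)))" if vs: "set vs <= Basis" for vs
  unfolding cb_def mult_1
 proof (intro allI impI)
  fix K :: "'c set" assume K: "compact K"
  obtain K' where K': "compact K'" "!!ph. ph : test_in K ==> Q ph : test_in K'" using test_contE1[OF Q K] by blast
  obtain C m where C: "C >= 0" "!!ph p. ph : test_in K' ==> cmod (iter_dird vs (P ph) p) <= C * Cm_norm m ph"
   using P vs K'(1) unfolding test_cont_def cb_def mult_1 by meson
  obtain D m' where D: "D >= 0" "!!ph. ph : test_in K ==> Cm_norm m (Q ph) <= D * Cm_norm m' ph"
   using test_contE2[OF Q K] by metis
  have "cmod (iter_dird vs (P (Q ph)) p) <= (C * D) * Cm_norm m' ph" if "ph : test_in K" for ph p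
   using order_trans[OF C(2)[OF K'(2)[OF that]] mult_left_mono[OF D(2)[OF that] C(1)]] by (simp add: mult.assoc)
  then show "EX C>=0. EX m. ALL ph:test_in K. ALL p. cmod (iter_dird vs (P (Q ph)) p) <= C * Cm_norm m ph"
   using C(1) D(1) by (metis mult_nonneg_nonneg)
 qed
 show "EX K'. compact K' & (ALL ph:test_in K. P (Q ph) : test_in K')" if "compact K" for K
  using test_contE1[OF Q that] test_contE1[OF P] by metis
qed

lemma iter_dird_lin:
 assumes "ph : test_fun" "ps : test_fun"
 shows "iter_dird vs (%p. ph p + ps p) = (%p. iter_dird vs ph p + iter_dird vs ps p)"
  "iter_dird vs (%p. c * ph p) = (%p. c * iter_dird vs ph p)"
  "iter_dird vs ph : test_fun"
proof -
 have t: "iter_dird vs ph : test_fun" if "ph : test_fun" for ph :: "'a => complex" and vs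
  using that by (induction vs) (auto simp: iter_dird_Cons test_fun_dird)
 show "iter_dird vs ph : test_fun" using t[OF assms(1)] .
 show "iter_dird vs (%p. ph p + ps p) = (%p. iter_dird vs ph p + iter_dird vs ps p)"
  by (induction vs) (simp_all add: iter_dird_Cons dird_add test_fun_diff t assms)
 show "iter_dird vs (%p. c * ph p) = (%p. c * iter_dird vs ph p)"
  by (induction vs) (simp_all add: iter_dird_Cons dird_cmult test_fun_diff t assms)
qed

lemma cb_cong: "cb j B ==> (!!ph. ph : test_fun ==> A ph = B ph) ==> cb j A"
 unfolding cb_def using test_in_test by metis

lemma cb_add:
 assumes "cb j A" "cb j B" shows "cb j (%ph p. A ph p + B ph p)"
 unfolding cb_def
proof (intro allI impI)
 fix K :: "'a set" assume K: "compact K"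
 obtain C m where C: "C >= 0" "!!ph p. ph : test_in K ==> cmod (A ph p) <= C * Cm_norm (j * m) ph"
  using assms(1) K unfolding cb_def by meson
 obtain D n where D: "D >= 0" "!!ph p. ph : test_in K ==> cmod (B ph p) <= D * Cm_norm (j * n) ph"
  using assms(2) K unfolding cb_def by meson
 have "cmod (A ph p + B ph p) <= C * Cm_norm (j * max m n) ph + D * Cm_norm (j * max m n) ph" if "ph : test_in K" for ph p
  using order_trans[OF C(2)[OF that] mult_left_mono[OF Cm_norm_mono[OF test_in_test[OF that]] C(1)]]
   order_trans[OF D(2)[OF that] mult_left_mono[OF Cm_norm_mono[OF test_in_test[OF that]] D(1)]]
  by (intro norm_triangle_le add_mono) (auto simp: mult_le_mono2)
 then show "EX C>=0. EX m. ALL ph:test_in K. ALL p. cmod (A ph p + B ph p) <= C * Cm_norm (j * m) ph"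
  using C(1) D(1) by (metis add_nonneg_nonneg distrib_right)
qed

lemma cb_sum: "finite I ==> (!!i. i : I ==> cb j (A i)) ==> cb j (%ph p. \<Sum>i\<in>I. A i ph p)"
proof (induction I rule: finite_induct)
 case empty
 show ?case unfolding cb_def using Cm_norm_nonneg[OF test_in_test] by (auto intro!: exI[of _ 0])
qed (simp add: cb_add)

lemma iter_dird_sum:
 assumes "finite I" "!!i. f i : test_fun"
 shows "iter_dird vs (%p. \<Sum>i\<in>I. f i p) = (%p. \<Sum>i\<in>I. iter_dird vs (f i) p)"
 using assms(1)
proof (induction I)
 case empty
 show ?case using iter_dird_lin(2)[OF test_fun_zero test_fun_zero, of vs 0] by simp
qed (simp add: iter_dird_lin(1) test_fun_sum assms(2))

lemma dird_test_in: "compact K ==> ph : test_in K ==> dird b ph : test_in K"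
 using dird_zero_outside[OF compact_imp_closed] by (auto simp: test_in_def test_fun_dird)

lemma cb_dird:
 assumes A: "cb 1 A" and b: "b : Basis" shows "cb 1 (%ph. A (dird b ph))"
 unfolding cb_def mult_1
proof (intro allI impI)
 fix K :: "'a set" assume K: "compact K"
 obtain C m where C: "C >= 0" "!!ph p. ph : test_in K ==> cmod (A ph p) <= C * Cm_norm m ph"
  using A K unfolding cb_def mult_1 by meson
 have "Cm_norm m (dird b ph) <= Cm_norm (Suc m) ph" if "ph : test_in K" for ph
 proof (rule Cm_norm_least)
  fix vs :: "'a list" and p :: 'a
  assume "set vs <= Basis" "length vs <= m"
  then have "cmod (iter_dird (vs @ [b]) ph p) <= Cm_norm (Suc m) ph"
   using b that by (intro Cm_norm_upper) (auto simp: test_in_def)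
  then show "cmod (iter_dird vs (dird b ph) p) <= Cm_norm (Suc m) ph"
   by (simp add: iter_dird_append iter_dird_Cons)
 qed
 then show "EX C>=0. EX m. ALL ph:test_in K. ALL p. cmod (A (dird b ph) p) <= C * Cm_norm m ph"
  using C dird_test_in[OF K] by (meson mult_left_mono order_trans)
qed

lemma test_cont_add:
 assumes P: "test_cont P" and Q: "test_cont Q"
 shows "test_cont (%ph p. P ph p + Q ph p)"
proof (rule test_contI)
 show "test_linear (%ph p. P ph p + Q ph p)"
  unfolding test_linear_def using test_contD[OF P] test_contD[OF Q] by (auto simp: test_fun_add algebra_simps)
 fix K :: "'a set" assume K: "compact K"
 obtain K1 where K1: "compact K1" "!!ph. ph : test_in K ==> P ph : test_in K1" using test_contE1[OF P K] by blast
 obtain K2 where K2: "compact K2" "!!ph. ph : test_in K ==> Q ph : test_in K2" using test_contE1[OF Q K] by blast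
 have "(%p. P ph p + Q ph p) : test_in (K1 \<union> K2)" if "ph : test_in K" for ph
  using K1(2)[OF that] K2(2)[OF that] by (auto simp: test_in_def test_fun_add)
 then show "EX K'. compact K' & (ALL ph:test_in K. (%p. P ph p + Q ph p) : test_in K')"
  using K1(1) K2(1) compact_Un by blast
next
 fix vs :: "'b list" assume "set vs <= Basis"
 then have "cb 1 (%ph. iter_dird vs (P ph))" "cb 1 (%ph. iter_dird vs (Q ph))" using P Q by (auto simp: test_cont_def)
 from cb_add[OF this] show "cb 1 (%ph. iter_dird vs (%p. P ph p + Q ph p))"
  by (rule cb_cong) (simp add: iter_dird_lin(1) test_contD(1)[OF P] test_contD(1)[OF Q])
qed

lemma cb_iter_dird: "set vs <= Basis ==> cb 1 (iter_dird vs)"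
 unfolding cb_def mult_1 using Cm_norm_upper[OF test_in_test _ order_refl] by (metis mult_1 zero_le_one)

lemma test_cont_dird_Basis:
 assumes b: "b : Basis" shows "test_cont (dird b)"
proof (rule test_contI)
 show "test_linear (dird b :: ('a => complex) => _)"
  unfolding test_linear_def by (auto simp: test_fun_dird dird_add dird_cmult test_fun_diff fun_eq_iff)
 show "cb 1 (%ph. iter_dird vs (dird b ph))" if "set vs <= Basis" for vs
  by (rule cb_dird[OF cb_iter_dird[OF that] b])
qed (use dird_test_in in blast)

lemma test_cont_mult:
 fixes a :: "'a::euclidean_space => complex"
 assumes a: "smo a" shows "test_cont (%ph p. a p * ph p)"
proof (rule test_contI)
 show "test_linear (%ph p. a p * ph p)"
  unfolding test_linear_def by (simp add: test_fun_mult a ring_distribs mult.left_commute)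
 show "EX K'. compact K' & (ALL ph:test_in K. (%p. a p * ph p) : test_in K')" if "compact K" for K
  using that by (auto simp: test_in_def test_fun_mult a)
 show "cb 1 (%ph. iter_dird vs (%p. a p * ph p))" if "set vs <= Basis" for vs
  using that a
 \<comment> \<open>The product rule acts on the innermost derivative, so lists are taken apart at
   the end; the factor may turn into its derivative, hence \<open>a\<close> is generalised.\<close>
 proof (induction vs arbitrary: a rule: rev_induct)
  case Nil
  show ?case unfolding cb_def mult_1
  proof (intro allI impI)
   fix K :: "'a set" assume K: "compact K"
   have "bounded (a ` K)"
    using compact_continuous_image[OF continuous_on_subset[OF smooth_cont[OF Nil(2)]] K]
    by (auto intro: compact_imp_bounded)
   then obtain B where B: "!!p. p : K ==> cmod (a p) <= B" by (auto simp: bounded_iff)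
   have "cmod (a p * ph p) <= \<bar>B\<bar> * Cm_norm 0 ph" if "ph : test_in K" for ph p
   proof (cases "p : K")
    case True
    then show ?thesis unfolding norm_mult using B[OF True] Cm_norm_ge[OF test_in_test[OF that]]
     by (intro mult_mono) auto
   qed (use that Cm_norm_nonneg[OF test_in_test[OF that]] in "auto simp: test_in_def")
   then show "EX C>=0. EX m. ALL ph:test_in K. ALL p. cmod (iter_dird [] (%p. a p * ph p) p) <= C * Cm_norm m ph"
    by (intro exI[of _ "\<bar>B\<bar>"] conjI exI[of _ 0]) auto
  qed
 next
  case (snoc b vs)
  have "cb 1 (%ph p. iter_dird vs (%p. dird b a p * ph p) p + iter_dird vs (%p. a p * dird b ph p) p)"
   using snoc.prems by (intro cb_add cb_dird[of "%ph. iter_dird vs (%p. a p * ph p)"] snoc.IH smooth_on_dird) auto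
  then show ?case
  proof (rule cb_cong)
   fix ph :: "'a => complex" assume t: "ph : test_fun"
   have "dird b (%p. a p * ph p) = (%p. dird b a p * ph p + a p * dird b ph p)"
    by (intro ext dird_mult) (use t test_fun_diff smooth_diff[OF snoc.prems(2)] in auto)
   then show "iter_dird (vs @ [b]) (%p. a p * ph p)
     = (%p. iter_dird vs (%p. dird b a p * ph p) p + iter_dird vs (%p. a p * dird b ph p) p)"
    using snoc.prems(2) t
    by (simp add: iter_dird_append iter_dird_Cons iter_dird_lin(1) test_fun_mult smooth_on_dird test_fun_dird)
  qed
 qed
qed

section \<open>Left invariant fields on step two groups\<close>

text \<open>On \<open>'x \<times> 't\<close> with the product \<open>(x, t) (y, s) = (x + y, t + s + 2 be x y)\<close>, this is the derivative
  along the left invariant field equal to \<open>(w, 0)\<close> at the origin.\<close>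

definition Xf :: "('x::euclidean_space => 'x => 't::euclidean_space) => 'x => ('x * 't => complex) => 'x * 't => complex" where
 "Xf be w f p = dird (w, 2 *\<^sub>R be (fst p) w) f p"

lemma Xf_eqI: "(f has_derivative f') (at p) ==> Xf be w f p = f' (w, 2 *\<^sub>R be (fst p) w)"
 unfolding Xf_def by (rule dird_eqI)

lemma Xf_cong: "open S ==> p : S ==> (!!q. q : S ==> f q = g q) ==> f differentiable (at p) ==> Xf be w f p = Xf be w g p"
 unfolding Xf_def by (rule dird_cong)

lemma Xf_add: "f differentiable (at p) ==> g differentiable (at p) ==> Xf be w (%x. f x + g x) p = Xf be w f p + Xf be w g p"
 unfolding Xf_def by (rule dird_add)

lemma Xf_cmult: "f differentiable (at p) ==> Xf be w (%x. c * f x) p = c * Xf be w f p"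
 unfolding Xf_def by (rule dird_cmult)

lemma Xf_mult: "f differentiable (at p) ==> g differentiable (at p) ==>
  Xf be w (%x. f x * g x) p = Xf be w f p * g p + f p * Xf be w g p"
 unfolding Xf_def by (rule dird_mult)

lemma Xf_sum: "(!!i. i : I ==> f i differentiable (at p)) ==> Xf be w (%x. \<Sum>i\<in>I. f i x) p = (\<Sum>i\<in>I. Xf be w (f i) p)"
 unfolding Xf_def by (rule dird_sum)

lemma Xf_const [simp]: "Xf be w (%x. c) = (%p. 0)"
 by (simp add: Xf_def fun_eq_iff)

text \<open>The direction of the field varies with the point. With constant directions and variable
  coefficients, smoothness, continuity on test functions and integration by parts reduce to the
  constant case.\<close>

lemma Xf_expand:
 assumes "f differentiable (at p)"
 shows "Xf be w f p = (\<Sum>b\<in>Basis. of_real (w \<bullet> b) * dird (b, 0) f p)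
   + (\<Sum>b\<in>Basis. of_real (2 * (be (fst p) w \<bullet> b)) * dird (0, b) f p)"
proof -
 have l: "linear (%v. dird v f p)" using dird_linear[OF assms] .
 have l1: "linear (%v. dird (v, 0) f p)" "linear (%v. dird (0, v) f p)"
  by (rule linearI; use linear_add[OF l] linear_scale[OF l] in \<open>metis (no_types, lifting) add.right_neutral add_Pair scaleR_Pair scaleR_zero_right\<close>)+
 have "Xf be w f p = dird (w, 0) f p + dird (0, 2 *\<^sub>R be (fst p) w) f p"
  unfolding Xf_def using linear_add[OF l, of "(w, 0)" "(0, 2 *\<^sub>R be (fst p) w)"] by simp
 then show ?thesis
  using linear_Basis_expand[OF l1(1), of w] linear_Basis_expand[OF l1(2), of "2 *\<^sub>R be (fst p) w"]
  by (simp add: scaleR_conv_of_real)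
qed

lemma smooth_on_Xf:
 assumes be: "bounded_bilinear be" and S: "open S" and f: "smooth_on S f"
 shows "smooth_on S (Xf be w f)"
proof -
 have b: "bounded_linear (%x. be x w)" by (rule bounded_bilinear.bounded_linear_left[OF be])
 have "smooth_on S (%p. (\<Sum>b\<in>Basis. of_real (w \<bullet> b) * dird (b, 0) f p)
   + (\<Sum>b\<in>Basis. of_real (2 * (be (fst p) w \<bullet> b)) * dird (0, b) f p))"
  by (intro smooth_intros S f smooth_bl[OF b])
 then show ?thesis
  by (rule smooth_on_cong[OF S]) (simp add: Xf_expand smooth_diff[OF f])
qed

lemma test_cont_cong:
 assumes P: "test_cont P" and e: "!!ph. ph : test_fun ==> P ph = Q ph"
 shows "test_cont Q"
proof (rule test_contI)
 show "test_linear Q"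
  unfolding test_linear_def using test_contD[OF P] by (simp add: e[symmetric] test_fun_add test_fun_cmult)
 show "EX K'. compact K' & (ALL ph:test_in K. Q ph : test_in K')" if "compact K" for K
  using test_contE1[OF P that] e test_in_test by metis
 show "cb 1 (%ph. iter_dird vs (Q ph))" if "set vs <= Basis" for vs
  by (rule cb_cong[of 1 "%ph. iter_dird vs (P ph)"]) (use P that e in "auto simp: test_cont_def")
qed

lemma test_cont_zero: "test_cont (%(ph :: 'a::euclidean_space => complex) (p :: 'a). 0)"
 using test_cont_mult[OF smooth_on_const[of UNIV "0::complex"]] by simp

lemma test_cont_sum:
 fixes P :: "'i => ('a::euclidean_space => complex) => 'a => complex"
 shows "(!!i. i : I ==> test_cont (P i)) ==> test_cont (%ph p. \<Sum>i\<in>I. P i ph p)"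
 by (induction I rule: infinite_finite_induct) (auto intro: test_cont_add test_cont_zero)

lemma test_cont_cmult: "test_cont P ==> test_cont (%ph p. c * P ph p)"
 using test_cont_comp[OF test_cont_mult[OF smooth_on_const[of UNIV c]], of P] by simp

lemma test_cont_Xf:
 assumes be: "bounded_bilinear be"
 shows "test_cont (Xf be w)"
proof -
 have b: "bounded_linear (%x. be x w)" by (rule bounded_bilinear.bounded_linear_left[OF be])
 have "test_cont (%f p. (\<Sum>b\<in>Basis. of_real (w \<bullet> b) * dird (b, 0) f p)
   + (\<Sum>b\<in>Basis. of_real (2 * (be (fst p) w \<bullet> b)) * dird (0, b) f p))"
  by (intro test_cont_add test_cont_sum test_cont_cmult test_cont_dird_Basis
    test_cont_comp[OF test_cont_mult, of _ "dird _"] smooth_intros smooth_bl[OF b]) (auto simp: Basis_prod_def)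
 then show ?thesis
  by (rule test_cont_cong) (simp add: fun_eq_iff Xf_expand test_fun_diff)
qed

text \<open>The field is free of divergence: its variable coefficients depend on
  \<open>fst p\<close> only and multiply central derivatives, which is the content of
  \<open>ad\<close> below.\<close>

lemma integral_by_parts_Xf:
 assumes be: "bounded_bilinear be" and f: "smo f" and ph: "ph : test_fun"
 shows "(LI p. f p * Xf be w ph p) = - (LI p. Xf be w f p * ph p)"
proof -
 have b: "bounded_linear (%x. be x w)" by (rule bounded_bilinear.bounded_linear_left[OF be])
 have fd: "f differentiable (at p)" for p using smooth_diff[OF f] by simp
 define a where "a b p = complex_of_real (2 * (be (fst p) w \<bullet> b))" for b and p :: "'a * 'b"
 have a: "smo (a b)" for b
  unfolding a_def[abs_def] by (intro smooth_intros smooth_bl[OF b]) auto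
 have ad: "dird (0, c) (a b) p = 0" for b c p
 proof -
  have "((%p. be (fst p) w) has_derivative (%v. be (fst v) w)) (at p)"
   by (rule bounded_linear.has_derivative[OF b]) (auto intro!: derivative_eq_intros)
  then have "(a b has_derivative (%v. of_real (2 * (be (fst v) w \<bullet> b)))) (at p)"
   unfolding a_def[abs_def]
   by (intro has_derivative_of_real has_derivative_mult_right has_derivative_inner_left)
  from dird_eqI[OF this] show ?thesis by (simp add: bounded_bilinear.zero_left[OF be])
 qed
 have i: "lint (%p. g p * ps p)" if "smo g" "ps : test_fun" for g ps :: "'a * 'b => complex"
  using that by (intro test_fun_lint test_fun_mult)
 have 1: "(LI p. (f p * a b p) * dird (0, b) ph p) = - (LI p. (a b p * dird (0, b) f p) * ph p)" for b
 proof -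
  have "dird (0, b) (%p. f p * a b p) p = a b p * dird (0, b) f p" for p
   using dird_mult[OF fd smooth_diff[OF a]] ad by (simp add: mult.commute)
  then show ?thesis
   using integral_by_parts[OF smooth_on_mult[OF open_UNIV f a[of b]] ph, of "(0, b)"] by simp
 qed
 have "f p * Xf be w ph p = (\<Sum>b\<in>Basis. of_real (w \<bullet> b) * (f p * dird (b, 0) ph p))
   + (\<Sum>b\<in>Basis. (f p * a b p) * dird (0, b) ph p)" for p
  by (simp add: Xf_expand test_fun_diff[OF ph] a_def algebra_simps sum_distrib_left)
 then have "(LI p. f p * Xf be w ph p) = (\<Sum>b\<in>Basis. of_real (w \<bullet> b) * (LI p. f p * dird (b, 0) ph p))
   + (\<Sum>b\<in>Basis. LI p. (f p * a b p) * dird (0, b) ph p)"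
  by (simp add: i f a ph test_fun_dird smooth_on_mult)
 also have "... = - ((\<Sum>b\<in>Basis. of_real (w \<bullet> b) * (LI p. dird (b, 0) f p * ph p))
   + (\<Sum>b\<in>Basis. LI p. (a b p * dird (0, b) f p) * ph p))"
  by (simp add: 1 integral_by_parts[OF f ph] sum_negf)
 also have "... = - (LI p. (\<Sum>b\<in>Basis. of_real (w \<bullet> b) * (dird (b, 0) f p * ph p))
   + (\<Sum>b\<in>Basis. (a b p * dird (0, b) f p) * ph p))"
  by (simp add: i f a ph smooth_on_dird smooth_on_mult)
 also have "... = - (LI p. Xf be w f p * ph p)"
  by (simp add: Xf_expand fd a_def algebra_simps sum_distrib_left)
 finally show ?thesis .
qed

section \<open>The quaternionic Heisenberg group\<close>

type_synonym hN = "(real^4) * (real^3)"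

text \<open>The components of the imaginary part of the quaternion product of \<open>y\<close> with
  the conjugate of \<open>x\<close>. The ring is a parameter because complexified arguments occur in
  the Taylor expansion.\<close>

definition omv :: "3 => (4 => 'a::comm_ring_1) => (4 => 'a) => 'a" where
 "omv ga x y = (if ga = 1 then x 1 * y 2 - x 2 * y 1 + x 3 * y 4 - x 4 * y 3
   else if ga = 2 then x 1 * y 3 - x 3 * y 1 + x 4 * y 2 - x 2 * y 4
   else x 1 * y 4 - x 4 * y 1 + x 2 * y 3 - x 3 * y 2)"

lemma smooth_on_omv:
 fixes x :: "4 => 'b::real_normed_vector => 'a::real_normed_field"
 assumes "open S" "!!i. smooth_on S (x i)" "!!i. smooth_on S (y i)"
 shows "smooth_on S (%p. omv ga (%i. x i p) (%i. y i p))"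
 unfolding omv_def by (cases "ga = 1"; cases "ga = 2") (auto intro!: smooth_intros assms)

definition om :: "real^4 => real^4 => real^3" where
 "om x y = (\<chi> ga. omv ga (vec_nth x) (vec_nth y))"

lemma om_nth: "om x y $ ga = omv ga (vec_nth x) (vec_nth y)"
 by (simp add: om_def)

lemma bb_om: "bounded_bilinear om"
proof -
 have "bilinear om"
  unfolding bilinear_def linear_iff
  by (auto simp: vec_eq_iff om_nth omv_def algebra_simps)
 then show ?thesis by (simp add: bilinear_conv_bounded_bilinear)
qed

lemma om_self [simp]: "om x x = 0"
 by (simp add: vec_eq_iff om_nth omv_def algebra_simps)

lemma om_skew: "om x y = - om y x"
 by (simp add: vec_eq_iff om_nth omv_def algebra_simps)

definition LN :: "(hN => complex) => hN => complex" where
 "LN f p = (\<Sum>j\<in>UNIV. Xf om (axis j 1) (Xf om (axis j 1) f) p)"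

lemma smooth_on_LN: "open S ==> smooth_on S f ==> smooth_on S (LN f)"
 unfolding LN_def[abs_def] by (intro smooth_intros smooth_on_Xf bb_om)

lemma LN_cong:
 assumes "open S" "p : S" "!!q. q : S ==> f q = g q" "smooth_on S f"
 shows "LN f p = LN g p"
 unfolding LN_def
proof (rule sum.cong[OF refl])
 fix j :: 4
 show "Xf om (axis j 1) (Xf om (axis j 1) f) p = Xf om (axis j 1) (Xf om (axis j 1) g) p"
 proof (rule Xf_cong[OF assms(1,2)])
  show "Xf om (axis j 1) f q = Xf om (axis j 1) g q" if "q : S" for q
   by (rule Xf_cong[OF assms(1) that assms(3) smooth_diff[OF assms(4) that]])
  show "Xf om (axis j 1) f differentiable at p"
   by (rule smooth_diff[OF smooth_on_Xf[OF bb_om assms(1,4)] assms(2)])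
 qed
qed

text \<open>Both the regularised fundamental solution and the Taylor expansion of its translates rest on
  this computation, in which \<open>Q = A\<^sup>2 + |D|\<^sup>2\<close> with \<open>A = z \<cdot> z + e\<close>.\<close>

lemma LN_inverse_square:
 fixes z :: "4 => hN => complex" and D :: "3 => hN => complex" and e s :: complex
 defines "A \<equiv> %p. (\<Sum>i\<in>UNIV. (z i p)\<^sup>2) + e"
 defines "Q \<equiv> %p. (A p)\<^sup>2 + (\<Sum>ga\<in>UNIV. (D ga p)\<^sup>2)"
 assumes S: "open S" and p: "p : S" and zS: "!!i. smooth_on S (z i)" and DS: "!!ga. smooth_on S (D ga)"
  and zX: "!!i j p. p : S ==> Xf om (axis j 1) (z i) p = (if i = j then s else 0)"
  and DX: "!!ga j p. p : S ==> Xf om (axis j 1) (D ga) p = 2 * s * omv ga (%i. z i p) (%i. if i = j then 1 else 0)"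
  and Q0: "!!p. p : S ==> Q p ~= 0"
 shows "LN (%p. inverse (Q p) ^ 2) p = - 32 * s\<^sup>2 * e * inverse (Q p) ^ 3"
proof -
 note bb = bb_om
 have AS: "smooth_on S A" unfolding A_def by (intro smooth_intros S zS)
 have QS: "smooth_on S Q" unfolding Q_def by (intro smooth_intros S AS DS)
 have d: "f differentiable (at p)" if "smooth_on S f" "p : S" for f :: "hN => complex" and p
  using that by (rule smooth_diff)
 let ?X = "%j. Xf om (axis j 1)"
 let ?e = "%j i. if i = j then 1 else (0::complex)"
 have sq: "?X j (%p. (f p)\<^sup>2) p = 2 * f p * ?X j f p" if "smooth_on S f" "p : S" for f p j
  unfolding power2_eq_square using Xf_mult[OF d d, of f p f] that by simp
 have XS: "?X j (%p. \<Sum>i\<in>I. f i p) p = (\<Sum>i\<in>I. ?X j (f i) p)"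
  if "!!i. smooth_on S (f i)" "p : S" for f :: "'i => hN => complex" and I p j
  by (rule Xf_sum) (rule d[OF that])
 have XA: "?X j A p = 2 * s * z j p" if p: "p : S" for j p
 proof -
  have "?X j A p = (\<Sum>i\<in>UNIV. ?X j (%p. (z i p)\<^sup>2) p)"
   unfolding A_def using p by (subst Xf_add) (auto intro!: d smooth_intros S zS XS)
  also have "... = (\<Sum>i\<in>UNIV. if i = j then 2 * z i p * s else 0)"
   by (rule sum.cong) (auto simp: sq zS p zX)
  finally show ?thesis by simp
 qed
 \<comment> \<open>Chosen so that the \<open>j\<close>-th field applied to \<open>Q\<close> gives
   \<open>4 * s * W j\<close>.\<close>
 define W where "W j p = A p * z j p + (\<Sum>ga\<in>UNIV. D ga p * omv ga (%i. z i p) (?e j))" for j p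
 have omS: "smooth_on S (%p. omv ga (%i. z i p) (?e j))" for ga j
  by (rule smooth_on_omv[OF S zS smooth_on_const[OF S]])
 have WS: "smooth_on S (W j)" for j unfolding W_def[abs_def] by (intro smooth_intros S AS zS DS omS)
 have XQ: "?X j Q p = 4 * s * W j p" if p: "p : S" for j p
 proof -
  have "?X j Q p = ?X j (%p. (A p)\<^sup>2) p + (\<Sum>ga\<in>UNIV. ?X j (%p. (D ga p)\<^sup>2) p)"
   unfolding Q_def using p by (subst Xf_add) (auto intro!: d smooth_intros S AS DS XS)
  then show ?thesis
   by (simp add: sq AS DS p XA DX W_def algebra_simps sum_distrib_left)
 qed
 have Xom: "?X j (%p. omv ga (%i. z i p) (?e j)) p = 0" if p: "p : S" for ga j p
 proof -
  have c: "?X j (%p. f p * c) p = ?X j f p * c" "?X j (%p. f p - g p) p = ?X j f p - ?X j g p"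
   if "smooth_on S f" "smooth_on S g" for f g :: "hN => complex" and c
   using Xf_cmult[OF d[OF that(1) p], of om "axis j 1" c] Xf_add[OF d[OF that(1) p] d[OF smooth_on_minus[OF S that(2)] p], of om "axis j 1"]
    Xf_cmult[OF d[OF that(2) p], of om "axis j 1" "-1"] by (simp_all add: mult.commute)
  have pl: "?X j (%p. f p + g p) p = ?X j f p + ?X j g p"
   if "smooth_on S f" "smooth_on S g" for f g :: "hN => complex"
   using Xf_add[OF d[OF that(1) p] d[OF that(2) p]] .
  note sm = smooth_on_mult[OF S] smooth_on_const[OF S] smooth_on_add[OF S] smooth_on_diff[OF S] zS
  have "j = 1 | j = 2 | j = 3 | j = 4" using exhaust_4 by auto
  then show ?thesis
   unfolding omv_def by (cases "ga = 1"; cases "ga = 2"; simp only: if_True if_False)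
    (auto simp: c pl sm zX p)
 qed
 have XW: "?X j (W j) p = s * (A p + 2 * (z j p)\<^sup>2 + 2 * (\<Sum>ga\<in>UNIV. (omv ga (%i. z i p) (?e j))\<^sup>2))" if p: "p : S" for j p
 proof -
  have "?X j (W j) p = ?X j (%p. A p * z j p) p + (\<Sum>ga\<in>UNIV. ?X j (%p. D ga p * omv ga (%i. z i p) (?e j)) p)"
   unfolding W_def[abs_def] using p
   by (subst Xf_add) (auto intro!: d smooth_on_mult smooth_on_sum S AS zS DS omS XS)
  also have "?X j (%p. A p * z j p) p = ?X j A p * z j p + A p * ?X j (z j) p"
   by (rule Xf_mult) (auto intro!: d AS zS p)
  also have "(\<Sum>ga\<in>UNIV. ?X j (%p. D ga p * omv ga (%i. z i p) (?e j)) p)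
    = (\<Sum>ga\<in>UNIV. ?X j (D ga) p * omv ga (%i. z i p) (?e j))"
  proof (rule sum.cong[OF refl])
   fix ga :: 3
   show "?X j (%p. D ga p * omv ga (%i. z i p) (?e j)) p = ?X j (D ga) p * omv ga (%i. z i p) (?e j)"
    using Xf_mult[OF d[OF DS p] d[OF omS p]] Xom[OF p] by simp
  qed
  finally show ?thesis
   by (simp add: XA DX zX p power2_eq_square algebra_simps sum_distrib_left)
 qed
 have inv: "?X j (%p. inverse (Q p) ^ n) p = - of_nat n * inverse (Q p) ^ Suc n * ?X j Q p" if p: "p : S" for j p n
 proof -
  have "(Q has_derivative (%v. dird v Q p)) (at p)" by (rule has_derivative_dird[OF d[OF QS p]])
  then have "((%p. inverse (Q p) ^ n) has_derivative (%v. - of_nat n * inverse (Q p) ^ Suc n * dird v Q p)) (at p)"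
  proof -
   assume Q: "(Q has_derivative (%v. dird v Q p)) (at p)"
   have "((%y. inverse y ^ n) has_field_derivative - of_nat n * inverse (Q p) ^ Suc n) (at (Q p))"
    using DERIV_power[OF DERIV_inverse[OF Q0[OF p]], of n] by (cases n) (simp_all add: algebra_simps)
   from has_derivative_compose[OF Q this[unfolded has_field_derivative_def]] show ?thesis by simp
  qed
  from Xf_eqI[OF this] show ?thesis by (simp add: Xf_def)
 qed
 have IS: "smooth_on S (%p. inverse (Q p) ^ n)" for n by (intro smooth_intros S QS Q0)
 have "?X j (?X j (%p. inverse (Q p) ^ 2)) p
   = 96 * s\<^sup>2 * inverse (Q p) ^ 4 * (W j p)\<^sup>2 - 8 * s * inverse (Q p) ^ 3 * ?X j (W j) p" for j
 proof -
  have "?X j (?X j (%p. inverse (Q p) ^ 2)) p = ?X j (%p. - 8 * s * (inverse (Q p) ^ 3 * W j p)) p"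
  proof (rule Xf_cong[OF S p])
   show "?X j (%p. inverse (Q p) ^ 2) q = - 8 * s * (inverse (Q q) ^ 3 * W j q)" if "q : S" for q
    unfolding inv[OF that] XQ[OF that] by (simp add: eval_nat_numeral)
   show "?X j (%p. inverse (Q p) ^ 2) differentiable at p"
    by (rule d[OF smooth_on_Xf[OF bb S IS] p])
  qed
  also have "... = - 8 * s * ?X j (%p. inverse (Q p) ^ 3 * W j p) p"
   by (rule Xf_cmult) (rule d[OF smooth_on_mult[OF S IS WS] p])
  also have "?X j (%p. inverse (Q p) ^ 3 * W j p) p = ?X j (%p. inverse (Q p) ^ 3) p * W j p + inverse (Q p) ^ 3 * ?X j (W j) p"
   by (rule Xf_mult) (rule d[OF IS p] d[OF WS p])+
  finally show ?thesis unfolding inv[OF p] XQ[OF p] by (simp add: power2_eq_square eval_nat_numeral algebra_simps)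
 qed
 then have L: "LN (%p. inverse (Q p) ^ 2) p = 96 * s\<^sup>2 * inverse (Q p) ^ 4 * (\<Sum>j\<in>UNIV. (W j p)\<^sup>2)
   - 8 * s * inverse (Q p) ^ 3 * (\<Sum>j\<in>UNIV. ?X j (W j) p)"
  unfolding LN_def by (simp add: sum_subtractf sum_distrib_left)
 have ie: "omv ga x (?e 1) = (if ga = 1 then - x 2 else if ga = 2 then - x 3 else - x 4)"
  "omv ga x (?e 2) = (if ga = 1 then x 1 else if ga = 2 then x 4 else - x 3)"
  "omv ga x (?e 3) = (if ga = 1 then - x 4 else if ga = 2 then x 1 else x 2)"
  "omv ga x (?e 4) = (if ga = 1 then x 3 else if ga = 2 then - x 2 else x 1)" for ga and x :: "4 => complex"
  by (auto simp: omv_def)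
 define ze where "ze = (\<Sum>i\<in>UNIV. (z i p)\<^sup>2)"
 \<comment> \<open>\<open>W\<close> is \<open>A\<close> times \<open>z\<close> plus the
   \<open>D ga\<close> times the three vectors that the quaternion units make of \<open>z\<close>.
   These four vectors are mutually orthogonal with the same square \<open>ze\<close>, also over the
   complex numbers.\<close>
 have W2: "(\<Sum>j\<in>UNIV. (W j p)\<^sup>2) = ze * Q p"
  unfolding W_def Q_def ze_def sum_4 sum_3 ie
  by (simp add: power2_eq_square algebra_simps)
 \<comment> \<open>The 8 is 2 from \<open>z\<close> itself and 2 from each of the three forms. For
   the exponent 2 of \<open>inverse (Q p)\<close> everything then adds up to
   \<open>32 * ze - 32 * A p\<close>, that is \<open>- 32 * e\<close>, up to a common
   factor.\<close>
 have XW2: "(\<Sum>j\<in>UNIV. ?X j (W j) p) = s * (4 * A p + 8 * ze)"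
  unfolding XW[OF p] sum_4 ze_def sum_3 ie
  by (simp add: power2_eq_square algebra_simps)
 have "inverse (Q p) ^ 4 * Q p = inverse (Q p) ^ 3" using Q0[OF p] by (simp add: eval_nat_numeral)
 then have "96 * s\<^sup>2 * inverse (Q p) ^ 4 * (ze * Q p) = 96 * s\<^sup>2 * ze * inverse (Q p) ^ 3"
  by (metis (no_types, lifting) mult.assoc mult.commute)
 moreover have "A p = ze + e" by (simp add: A_def ze_def)
 ultimately show ?thesis
  unfolding L W2 XW2 by (simp add: power2_eq_square algebra_simps)
qed

section \<open>The fundamental solution\<close>

text \<open>For \<open>e = 0\<close> the fourth power of a homogeneous gauge. Shifting only the
  square of \<open>fst h\<close> keeps the function in the form covered by
  \<open>LN_inverse_square\<close>.\<close>

definition fR :: "real => hN => real" where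
 "fR e h = (fst h \<bullet> fst h + e)\<^sup>2 + snd h \<bullet> snd h"

text \<open>The exponent is fixed by homogeneity: the homogeneous dimension is 4 + 2 * 3 = 10, and a
  fundamental solution of a second-order operator has degree 2 - 10 = -8.\<close>

definition GR :: "real => hN => real" where
 "GR e h = inverse (fR e h) ^ 2"

definition GamR :: "hN => complex" where
 "GamR h = of_real (GR 0 h)"

lemma fR_nonneg: "fR e h >= 0"
 by (simp add: fR_def)

lemma fR_pos: "e >= 0 ==> e > 0 | h ~= 0 ==> fR e h > 0"
proof (cases "snd h = 0")
 case True
 assume a: "e >= 0" "e > 0 | h ~= 0"
 then have "fst h \<bullet> fst h + e > 0"
  using True by (cases "e > 0") (auto simp: prod_eq_iff add_nonneg_pos add_pos_nonneg)
 then show ?thesis by (simp add: fR_def add_pos_nonneg)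
next
 case False
 then show ?thesis by (simp add: fR_def add_nonneg_pos)
qed

lemma fR_mono: "0 <= e ==> e <= e' ==> fR e h <= fR e' h"
 by (auto simp: fR_def intro!: power_mono)

lemma fR_continuous: "continuous_on S (fR e)"
 unfolding fR_def[abs_def] by (intro continuous_intros)

lemma GR_nonneg: "GR e h >= 0"
 by (simp add: GR_def)

lemma GR_antimono: "0 <= e ==> e <= e' ==> e > 0 | h ~= 0 ==> GR e' h <= GR e h"
 unfolding GR_def using fR_mono[of e e' h] fR_pos[of e h] fR_nonneg[of e' h]
 by (intro power_mono le_imp_inverse_le) auto

lemma smooth_on_GR:
 assumes "open S" "e >= 0" "e > 0 | 0 ~: S"
 shows "smooth_on S (%h. complex_of_real (GR e h))"
proof -
 have sm: "smooth_on S (fR e)" unfolding fR_def[abs_def] by (intro smooth_intros assms(1))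
 have nz: "fR e h ~= 0" if "h : S" for h
  using fR_pos[of e h] assms(2,3) that by fastforce
 show ?thesis unfolding GR_def
  by (intro smooth_on_of_real smooth_on_power smooth_on_inverse assms(1) sm nz)
qed

lemma Xf_fst_nth: "Xf om (axis j 1) (%h. of_real (fst h $ i)) p = (if i = j then 1 else 0)"
proof -
 have "((%h::hN. complex_of_real (fst h $ i)) has_derivative (%v. of_real (fst v $ i))) (at p)"
  by (intro has_derivative_of_real bounded_linear.has_derivative[OF bounded_linear_vec_nth] has_derivative_fst has_derivative_ident)
 from Xf_eqI[OF this] show ?thesis by (simp add: axis_def)
qed

lemma of_real_omv: "of_real (omv ga x y) = omv ga (%i. of_real (x i)) (%i. of_real (y i))"
 by (simp add: omv_def)

lemma Xf_snd_nth:
 "Xf om (axis j 1) (%h. of_real (snd h $ ga)) p = 2 * omv ga (%i. of_real (fst p $ i)) (%i. if i = j then 1 else 0)"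
proof -
 have "((%h::hN. complex_of_real (snd h $ ga)) has_derivative (%v. of_real (snd v $ ga))) (at p)"
  by (intro has_derivative_of_real bounded_linear.has_derivative[OF bounded_linear_vec_nth] has_derivative_snd has_derivative_ident)
 from Xf_eqI[OF this] have "Xf om (axis j 1) (%h. of_real (snd h $ ga)) p = of_real (2 * omv ga (%i. fst p $ i) (%i. axis j 1 $ i))"
  by (simp add: om_nth)
 also have "... = 2 * omv ga (%i. of_real (fst p $ i)) (%i. of_real (axis j (1::real) $ i))"
  by (simp add: of_real_omv)
 also have "(%i. complex_of_real (axis j (1::real) $ i)) = (%i. if i = j then 1 else 0)"
  by (auto simp: axis_def)
 finally show ?thesis .
qed

lemma fR_complex:
 "complex_of_real (fR e h) = ((\<Sum>i\<in>UNIV. (of_real (fst h $ i))\<^sup>2) + of_real e)\<^sup>2 + (\<Sum>ga\<in>UNIV. (of_real (snd h $ ga))\<^sup>2)"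
 by (simp add: fR_def inner_vec_def power2_eq_square)

lemma LN_GR:
 assumes "e >= 0" "e > 0 | p ~= 0"
 shows "LN (%h. of_real (GR e h)) p = of_real (- 32 * e * inverse (fR e p) ^ 3)"
proof -
 define S :: "hN set" where "S = (if e > 0 then UNIV else - {0})"
 have S: "open S" "p : S" using assms by (auto simp: S_def)
 have "LN (%h. inverse (complex_of_real (fR e h)) ^ 2) p
   = - 32 * 1\<^sup>2 * complex_of_real e * inverse (complex_of_real (fR e p)) ^ 3"
  unfolding fR_complex
 proof (rule LN_inverse_square[OF S])
  fix q assume q: "q : S"
  have "fR e q > 0" using fR_pos[of e q] assms q by (auto simp: S_def split: if_splits)
  then show "((\<Sum>i\<in>UNIV. (of_real (fst q $ i))\<^sup>2) + complex_of_real e)\<^sup>2 + (\<Sum>ga\<in>UNIV. (of_real (snd q $ ga))\<^sup>2) ~= 0"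
   unfolding fR_complex[symmetric] by simp
 qed (simp_all add: Xf_fst_nth Xf_snd_nth S smooth_on_of_real smooth_on_nth smooth_on_fst smooth_on_snd smooth_on_ident)
 then show ?thesis by (simp add: GR_def)
qed

lemma test_fun_Xf: "bounded_bilinear be ==> ph : test_fun ==> Xf be w ph : test_fun"
 using test_contD(1)[OF test_cont_Xf] by blast

lemma test_fun_LN: "ph : test_fun ==> LN ph : test_fun"
 unfolding LN_def[abs_def] by (intro test_fun_sum test_fun_Xf bb_om)

lemma integral_LN_transpose:
 assumes f: "smo f" and ph: "ph : test_fun"
 shows "(LI p. f p * LN ph p) = (LI p. LN f p * ph p)"
proof -
 note bb = bb_om
 let ?X = "%j. Xf om (axis j 1)"
 have 1: "(LI p. f p * ?X j (?X j ph) p) = (LI p. ?X j (?X j f) p * ph p)" for j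
  using integral_by_parts_Xf[OF bb f test_fun_Xf[OF bb ph]] integral_by_parts_Xf[OF bb smooth_on_Xf[OF bb open_UNIV f] ph]
  by simp
 have i: "lint (%p. g p * ps p)" if "smo g" "ps : test_fun" for g ps :: "hN => complex"
  using that by (intro test_fun_lint test_fun_mult)
 have "(LI p. f p * LN ph p) = (\<Sum>j\<in>UNIV. LI p. f p * ?X j (?X j ph) p)"
  unfolding LN_def sum_distrib_left
  by (rule Bochner_Integration.integral_sum) (intro i f test_fun_Xf bb ph)
 also have "... = (\<Sum>j\<in>UNIV. LI p. ?X j (?X j f) p * ph p)" by (simp add: 1)
 also have "... = (LI p. LN f p * ph p)"
  unfolding LN_def sum_distrib_right
  by (rule Bochner_Integration.integral_sum[symmetric]) (intro i ph smooth_on_Xf bb f open_UNIV)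
 finally show ?thesis .
qed

lemma integral_GR_LN:
 assumes "e > 0" "ph : test_fun"
 shows "(LI h. of_real (GR e h) * LN ph h) = (LI h. of_real (- 32 * e * inverse (fR e h) ^ 3) * ph h)"
proof -
 have "smo (%h. complex_of_real (GR e h))" using assms by (intro smooth_on_GR) auto
 from integral_LN_transpose[OF this assms(2)] show ?thesis using assms(1) by (simp add: LN_GR)
qed

lemma LN_rho: "LN (%h. of_real (fst h \<bullet> fst h)) p = 8"
proof -
 note bb = bb_om
 have sm: "smo (%h::hN. complex_of_real (fst h $ i))" for i
  by (intro smooth_intros) auto
 have d: "f differentiable (at p)" if "smo f" for f :: "hN => complex" and p
  using smooth_diff[OF that] by simp
 have 1: "Xf om (axis j 1) (%h. complex_of_real (fst h \<bullet> fst h)) = (%h. 2 * of_real (fst h $ j))" for j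
 proof
  fix q :: hN
  have "(%h::hN. complex_of_real (fst h \<bullet> fst h)) = (%h. \<Sum>i\<in>UNIV. of_real (fst h $ i) * of_real (fst h $ i))"
   by (simp add: inner_vec_def)
  then have "Xf om (axis j 1) (%h. complex_of_real (fst h \<bullet> fst h)) q
    = (\<Sum>i\<in>UNIV. Xf om (axis j 1) (%h. of_real (fst h $ i) * of_real (fst h $ i)) q)"
   using Xf_sum[of UNIV "%i h. of_real (fst h $ i) * of_real (fst h $ i)" q om "axis j 1"]
    d[OF smooth_on_mult[OF open_UNIV sm sm]] by simp
  also have "... = (\<Sum>i\<in>UNIV. if i = j then 2 * of_real (fst q $ i) else 0)"
   by (rule sum.cong) (auto simp: Xf_mult[OF d[OF sm] d[OF sm]] Xf_fst_nth)
  finally show "Xf om (axis j 1) (%h. complex_of_real (fst h \<bullet> fst h)) q = 2 * of_real (fst q $ j)" by simp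
 qed
 show ?thesis
  unfolding LN_def 1 by (simp add: Xf_cmult[OF d[OF sm]] Xf_fst_nth)
qed

lemma integrable_singular_bounded:
 fixes g r :: "hN => real"
 assumes g: "continuous_on (- {0}) g" and r: "cont r" and K: "compact K"
  and out: "!!h. h ~: K ==> r h = 0" and inn: "!!h. norm h < d ==> r h = 0" and d: "d > 0"
 shows "lint (%h. g h * r h)"
proof -
 have c: "compact (K - ball 0 d)" using K by (simp add: compact_diff)
 have "continuous_on (K - ball 0 d) (%h. g h * r h)"
  using d by (intro continuous_on_mult continuous_on_subset[OF g] continuous_on_subset[OF r]) auto
 from borel_integrable_compact[OF c this]
 have "lint (%h. indicator (K - ball 0 d) h *\<^sub>R (g h * r h))" .
 moreover have "(%h. indicator (K - ball 0 d) h *\<^sub>R (g h * r h)) = (%h. g h * r h)"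
 proof
  fix h show "indicator (K - ball 0 d) h *\<^sub>R (g h * r h) = g h * r h"
   using out[of h] inn[of h] by (auto simp: indicator_def)
 qed
 ultimately show ?thesis by simp
qed

lemma GR_continuous: "continuous_on (- {0}) (GR 0)"
 unfolding GR_def[abs_def] using fR_pos[of 0] by (auto intro!: continuous_intros fR_continuous) (metis less_irrefl)

lemma GR_measurable: "GR e : borel_measurable borel"
 unfolding GR_def[abs_def] using borel_measurable_continuous_onI[OF fR_continuous] by measurable

lemma AE_nonzero: "AE h in (lborel :: hN measure). h ~= 0"
 using AE_not_in[of "{0::hN}" lborel] finite_imp_null_set_lborel[of "{0::hN}"] by auto

lemma GR_tendsto: "h ~= 0 ==> (%n. GR (inverse (Suc n)) h) \<longlonglongrightarrow> GR 0 h"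
proof -
 assume "h ~= 0"
 then have "fR 0 h ~= 0" using fR_pos[of 0 h] by simp
 moreover have "(%n. fR (inverse (Suc n)) h) \<longlonglongrightarrow> fR 0 h" unfolding fR_def
  by (intro tendsto_intros LIMSEQ_inverse_real_of_nat)
 ultimately show ?thesis unfolding GR_def by (intro tendsto_intros)
qed

text \<open>Testing \<open>L(c \<bar>x\<bar>\<^sup>2) = 8 c + \<dots>\<close> against \<open>GR e\<close> bounds \<open>\<integral> GR e \<cdot> c\<close> uniformly in \<open>e\<close>, since the
  main term on the other side, \<open>\<integral> L(GR e) c \<bar>x\<bar>\<^sup>2\<close>, is negative.\<close>

lemma integrable_GR_cutoff:
 fixes c :: "hN => real"
 assumes ct: "(%h. of_real (c h)) : test_fun" and c1: "!!h. norm h < d ==> c h = 1" and d: "d > 0"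
  and c0: "!!h. 0 <= c h"
 shows "lint (%h. GR 0 h * c h)"
proof -
 let ?c = "%h. complex_of_real (c h)"
 define ps where "ps h = complex_of_real (fst h \<bullet> fst h) * ?c h" for h :: hN
 have ps: "ps : test_fun" unfolding ps_def[abs_def]
  by (intro test_fun_mult ct smooth_intros) auto
 \<comment> \<open>\<open>r\<close> gathers the terms in which a derivative hits the cutoff. It
   vanishes near 0, so its integral against the singular \<open>GR 0\<close> is finite and bounds
   all the regularised ones.\<close>
 define r where "r h = LN ps h - 8 * ?c h" for h
 have rt: "r : test_fun" unfolding r_def[abs_def]
  using test_fun_add[OF test_fun_LN[OF ps] test_fun_cmult[OF ct, of "- 8"]] by simp
 have r0: "r h = 0" if h: "norm h < d" for h
 proof -
  have "LN (%h. complex_of_real (fst h \<bullet> fst h)) h = LN ps h"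
   by (rule LN_cong[of "ball 0 d"]) (use h c1 in "auto simp: ps_def intro!: smooth_intros")
  then show ?thesis using LN_rho[of h] c1[OF h] by (simp add: r_def)
 qed
 obtain K where K: "compact K" "!!h. h ~: K ==> r h = 0" using test_funE[OF rt] by metis
 have rc: "cont (%h. cmod (r h))"
  by (intro continuous_intros smooth_cont test_funD rt)
 have Ci: "lint (%h. GR 0 h * cmod (r h))"
  by (rule integrable_singular_bounded[OF GR_continuous rc K(1) _ _ d]) (use K r0 in auto)
 define C where "C = (LI h. GR 0 h * cmod (r h))"
 have bound: "lint (%h. GR e h * c h) & 8 * (LI h. GR e h * c h) <= C" if e: "e > 0" for e
 proof -
  have G: "smo (%h. complex_of_real (GR e h))" using e by (intro smooth_on_GR) auto
  have I: "lint (%h. complex_of_real (GR e h) * ph h)" if "ph : test_fun" for ph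
   by (intro test_fun_lint test_fun_mult G that)
  have Ic: "lint (%h. GR e h * c h)"
   using integrable_Re[OF I[OF ct]] by simp
  have "of_real (GR e h) * LN ps h = 8 * (of_real (GR e h) * ?c h) + of_real (GR e h) * r h" for h
   by (simp add: r_def algebra_simps)
  then have "(LI h. of_real (GR e h) * LN ps h) = 8 * (LI h. of_real (GR e h) * ?c h) + (LI h. of_real (GR e h) * r h)"
   using I[OF ct] I[OF rt] by simp
  moreover have "(LI h. of_real (GR e h) * LN ps h) = of_real (LI h. - 32 * e * inverse (fR e h) ^ 3 * ((fst h \<bullet> fst h) * c h))"
   unfolding integral_GR_LN[OF e ps] integral_complex_of_real[symmetric] by (simp add: ps_def mult.assoc)
  moreover have "(LI h. of_real (GR e h) * ?c h) = complex_of_real (LI h. GR e h * c h)"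
   unfolding integral_complex_of_real[symmetric] by simp
  ultimately have eq: "complex_of_real (8 * (LI h. GR e h * c h))
    = of_real (LI h. - 32 * e * inverse (fR e h) ^ 3 * ((fst h \<bullet> fst h) * c h)) - (LI h. of_real (GR e h) * r h)"
   by simp
  have "8 * (LI h. GR e h * c h)
    = (LI h. - 32 * e * inverse (fR e h) ^ 3 * ((fst h \<bullet> fst h) * c h)) - Re (LI h. of_real (GR e h) * r h)"
   using arg_cong[OF eq, of Re] by simp
  moreover have "(LI h. - 32 * e * inverse (fR e h) ^ 3 * ((fst h \<bullet> fst h) * c h)) <= 0"
  proof -
   have "(LI h. 32 * e * inverse (fR e h) ^ 3 * ((fst h \<bullet> fst h) * c h)) >= 0"
    by (rule integral_nonneg_AE) (use e c0 fR_nonneg in auto)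
   then show ?thesis by simp
  qed
  moreover have "- Re (LI h. of_real (GR e h) * r h) <= C"
  proof -
   have "- Re (LI h. of_real (GR e h) * r h) <= cmod (LI h. of_real (GR e h) * r h)"
    using abs_Re_le_cmod[of "LI h. of_real (GR e h) * r h"] by linarith
   also have "... <= (LI h. cmod (of_real (GR e h) * r h))" by (rule integral_norm_bound)
   also have "... <= C" unfolding C_def
   proof (rule integral_mono_AE[OF integrable_norm[OF I[OF rt]] Ci])
    show "AE h in lborel. cmod (of_real (GR e h) * r h) <= GR 0 h * cmod (r h)"
     using AE_nonzero
    proof eventually_elim
     case (elim h)
     then show ?case using GR_antimono[of 0 e h] e GR_nonneg[of e h]
      by (auto simp: norm_mult intro!: mult_right_mono)
    qed
   qed
   finally show ?thesis .
  qed
  ultimately show ?thesis using Ic by linarith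
 qed
 define I where "I n = (LI h. GR (inverse (Suc n)) h * c h)" for n :: nat
 have mono: "GR (inverse (Suc m)) h * c h <= GR (inverse (Suc n)) h * c h" if "m <= n" for m n h
  using that c0 by (intro mult_right_mono GR_antimono) auto
 have "incseq I" unfolding I_def
  by (intro incseq_def[THEN iffD2] allI impI integral_mono mono) (use bound in auto)
 moreover have "I n <= C / 8" for n using bound[of "inverse (Suc n)"] by (simp add: I_def)
 ultimately obtain L where L: "I \<longlonglongrightarrow> L"
  using incseq_convergent by blast
 \<comment> \<open>The regularised integrands increase as \<open>e\<close> decreases to 0, and their
   integrals are bounded by \<open>C / 8\<close>.\<close>
 show ?thesis
 proof (rule integrable_monotone_convergence[where f = "%n h. GR (inverse (Suc n)) h * c h"])
  show "lint (%h. GR (inverse (Suc n)) h * c h)" for n using bound[of "inverse (Suc n)"] by simp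
  show "AE h in lborel. mono (%n. GR (inverse (Suc n)) h * c h)" using mono by (auto simp: mono_def)
  show "AE h in lborel. (%n. GR (inverse (Suc n)) h * c h) \<longlonglongrightarrow> GR 0 h * c h"
   using AE_nonzero by eventually_elim (intro tendsto_intros GR_tendsto)
  show "(%n. LI h. GR (inverse (Suc n)) h * c h) \<longlonglongrightarrow> L" using L unfolding I_def .
  have "c : borel_measurable borel"
   using borel_measurable_continuous_onI[OF continuous_on_Re[OF smooth_cont[OF test_funD[OF ct]]]] by simp
  then show "(%h. GR 0 h * c h) : borel_measurable lborel"
   using GR_measurable[of 0] by simp
 qed
qed

lemma loc_integrable_GamR: "loc_integrable GamR"
 unfolding loc_integrable_def
proof (intro allI impI)
 fix K :: "hN set" assume K: "compact K"
 obtain c :: "hN => real" where c: "(%h. of_real (c h)) : test_fun" "!!h. h : K \<union> ball 0 1 ==> c h = 1" "!!h. 0 <= c h"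
  using cutoff_exists[of "K \<union> ball 0 1"] K compact_imp_bounded by (metis bounded_Un bounded_ball)
 have i: "lint (%h. GR 0 h * c h)"
  by (rule integrable_GR_cutoff[OF c(1), of 1]) (use c in auto)
 have m: "(%h. indicator K h *\<^sub>R GamR h) : borel_measurable lborel"
  using GR_measurable[of 0] borel_compact[OF K] unfolding GamR_def by simp
 show "lint (%h. indicator K h *\<^sub>R GamR h)"
  by (rule Bochner_Integration.integrable_bound[OF i m])
    (use c(2,3) GR_nonneg[of 0] in "auto simp: GamR_def indicator_def abs_mult")
qed

lemma GamR_mult_integrable:
 assumes ph: "ph : test_fun"
 shows "lint (%h. GamR h * ph h)"
proof -
 obtain K where K: "compact K" "!!h. h ~: K ==> ph h = 0" using test_funE[OF ph] by metis
 have "lint (%h. (indicator K h *\<^sub>R GamR h) * ph h)"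
  by (rule lint_mult_compact[OF _ _ K(1)])
    (use loc_integrable_GamR K continuous_on_subset[OF smooth_cont[OF test_funD[OF ph]]] in "auto simp: loc_integrable_def")
 moreover have "(%h. (indicator K h *\<^sub>R GamR h) * ph h) = (%h. GamR h * ph h)"
  using K(2) by (auto simp: indicator_def)
 ultimately show ?thesis by simp
qed

text \<open>By \<open>LN_GR\<close> this is minus \<open>LN\<close> of the solution regularised with
  \<open>e = 1 / (n + 1)\<close>: a nonnegative approximate identity, up to a constant
  factor.\<close>

definition kR :: "nat => hN => real" where
 "kR n h = 32 * inverse (Suc n) * inverse (fR (inverse (Suc n)) h) ^ 3"

lemma kR_nonneg: "kR n h >= 0"
 using fR_nonneg[of "inverse (Suc n)" h] by (simp add: kR_def)

lemma kR_integrable: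
 assumes "ph : test_fun" shows "lint (%h. of_real (kR n h) * ph h)"
proof -
 have "fR (inverse (Suc n)) h ~= 0" for h using fR_pos[of "inverse (Suc n)" h] by simp
 then have "smo (%h. complex_of_real (kR n h))"
  unfolding kR_def fR_def by (intro smooth_intros) auto
 then show ?thesis using assms by (intro test_fun_lint test_fun_mult)
qed

lemma kR_real:
 assumes "(%h. complex_of_real (c h)) : test_fun"
 shows "lint (%h. kR n h * c h)"
  "(LI h. kR n h * c h) <= cmod (LI h. of_real (kR n h) * of_real (c h))"
proof -
 show "lint (%h. kR n h * c h)" using integrable_Re[OF kR_integrable[OF assms, of n]] by simp
 have "(LI h. of_real (kR n h) * of_real (c h)) = complex_of_real (LI h. kR n h * c h)"
  unfolding integral_complex_of_real[symmetric] by simp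
 then show "(LI h. kR n h * c h) <= cmod (LI h. of_real (kR n h) * of_real (c h))" by simp
qed

lemma kR_tendsto:
 assumes ph: "ph : test_fun"
 shows "(%n. LI h. of_real (kR n h) * ph h) \<longlonglongrightarrow> - (LI h. GamR h * LN ph h)"
proof -
 note i = GamR_mult_integrable[OF test_fun_LN[OF ph]]
 have mL: "LN ph : borel_measurable borel"
  by (rule borel_measurable_continuous_onI[OF smooth_cont[OF test_funD[OF test_fun_LN[OF ph]]]])
 have "(%n. LI h. of_real (GR (inverse (Suc n)) h) * LN ph h) \<longlonglongrightarrow> (LI h. GamR h * LN ph h)"
 proof (rule integral_dominated_convergence[OF _ _ integrable_norm[OF i]])
  show "AE h in lborel. (%n. of_real (GR (inverse (Suc n)) h) * LN ph h) \<longlonglongrightarrow> GamR h * LN ph h"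
   using AE_nonzero by eventually_elim (unfold GamR_def, intro tendsto_intros GR_tendsto)
  show "AE h in lborel. norm (of_real (GR (inverse (Suc n)) h) * LN ph h) <= norm (GamR h * LN ph h)" for n
   using AE_nonzero
  proof eventually_elim
   case (elim h)
   then show ?case using GR_antimono[of 0 "inverse (Suc n)" h] GR_nonneg[of "inverse (Suc n)" h] GR_nonneg[of 0 h]
    by (auto simp: norm_mult GamR_def intro!: mult_right_mono)
  qed
 qed (use GR_measurable mL in "auto simp: GamR_def")
 moreover have "(LI h. of_real (kR n h) * ph h) = - (LI h. of_real (GR (inverse (Suc n)) h) * LN ph h)" for n
  using integral_GR_LN[OF _ ph, of "inverse (Suc n)"] by (simp add: kR_def)
 ultimately show ?thesis by (simp add: tendsto_minus_cancel_left)
qed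

text \<open>The integral is, up to sign, the limit of the integrals of \<open>kR n\<close> against
  \<open>et\<close>. In a small ball \<open>et\<close> is small and the mass of \<open>kR n\<close>
  is controlled by its integral against a cutoff, which converges; elsewhere \<open>kR n\<close> is
  at most \<open>1 / (n + 1)\<close> times a function that is bounded on the rest of the
  support.\<close>

lemma integral_GamR_LN_zero:
 assumes et: "et : test_fun" and et0: "et 0 = 0"
 shows "(LI h. GamR h * LN et h) = 0"
proof -
 obtain K where K: "compact K" "!!h. h ~: K ==> et h = 0" using test_funE[OF et] by metis
 obtain c :: "hN => real" where c: "(%h. of_real (c h)) : test_fun" "!!h. h : cball 0 1 ==> c h = 1" "!!h. 0 <= c h"
  using cutoff_exists[of "cball 0 1"] by (metis bounded_cball)
 define J where "J ps = - (LI h. GamR h * LN ps h)" for ps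
 let ?c = "%h. complex_of_real (c h)"
 have cont: "cont et" by (intro smooth_cont test_funD et)
 have "cmod (J et) <= de * (cmod (J ?c) + 1)" if de: "de > 0" for de
 proof -
  obtain r where r: "r > 0" "!!h. norm h < r ==> cmod (et h) <= de" "r <= 1"
  proof -
   obtain r0 where "r0 > 0" "!!h. dist h 0 < r0 ==> dist (et h) (et 0) < de"
    using cont de unfolding continuous_on_iff by (metis UNIV_I)
   then show thesis using that[of "min r0 1"] et0 by (auto simp: dist_norm less_imp_le)
  qed
  define E where "E = K - ball 0 r"
  have E: "compact E" using K(1) by (simp add: E_def compact_diff)
  have "continuous_on E (%h. inverse (fR 0 h) ^ 3 * cmod (et h))"
  proof (intro continuous_intros fR_continuous continuous_on_subset[OF cont])
   show "ALL h:E. fR 0 h ~= 0"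
   proof
    fix h assume "h : E"
    then have "h ~= 0" using r(1) by (auto simp: E_def)
    then show "fR 0 h ~= 0" using fR_pos[of 0 h] by simp
   qed
  qed auto
  from borel_integrable_compact[OF E this]
  have gi: "lint (%h. indicator E h *\<^sub>R (inverse (fR 0 h) ^ 3 * cmod (et h)))" .
  define M where "M = (LI h. indicator E h *\<^sub>R (inverse (fR 0 h) ^ 3 * cmod (et h)))"
  have le: "cmod (LI h. of_real (kR n h) * et h) <= de * cmod (LI h. of_real (kR n h) * ?c h) + 32 * inverse (Suc n) * M" for n
  proof -
   note kc = kR_real(1)[OF c(1), of n]
   have "cmod (LI h. of_real (kR n h) * et h) <= (LI h. cmod (of_real (kR n h) * et h))"
    by (rule integral_norm_bound)
   also have "... <= (LI h. de * (kR n h * c h) + 32 * inverse (Suc n) * (indicator E h *\<^sub>R (inverse (fR 0 h) ^ 3 * cmod (et h))))"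
   proof (rule integral_mono)
    fix h
    have nn: "0 <= de * (kR n h * c h)" using de kR_nonneg[of n h] c(3)[of h] by simp
    have nn2: "0 <= 32 * inverse (Suc n) * (indicator E h *\<^sub>R (inverse (fR 0 h) ^ 3 * cmod (et h)))"
     using fR_nonneg[of 0 h] by simp
    show "cmod (of_real (kR n h) * et h) <= de * (kR n h * c h) + 32 * inverse (Suc n) * (indicator E h *\<^sub>R (inverse (fR 0 h) ^ 3 * cmod (et h)))"
    proof (cases "norm h < r")
     case True
     then have "cmod (of_real (kR n h) * et h) <= de * (kR n h * c h)"
      using mult_left_mono[OF r(2)[OF True] kR_nonneg[of n h]] r(3) c(2)[of h] kR_nonneg[of n h] by (simp add: norm_mult mult.commute)
     then show ?thesis using nn2 by linarith
    next
     case False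
     show ?thesis
     proof (cases "h : K")
      case True
      then have hE: "h : E" using False by (simp add: E_def)
      have h0: "h ~= 0" using False r(1) by auto
      have "inverse (fR (inverse (Suc n)) h) ^ 3 <= inverse (fR 0 h) ^ 3"
       using fR_mono[of 0 "inverse (Suc n)" h] fR_pos[of 0 h] h0 fR_nonneg[of "inverse (Suc n)" h]
       by (intro power_mono le_imp_inverse_le) auto
      then have "kR n h * cmod (et h) <= 32 * inverse (Suc n) * (inverse (fR 0 h) ^ 3 * cmod (et h))"
       unfolding kR_def by (simp add: mult_right_mono mult_left_mono mult.assoc)
      then show ?thesis using nn hE kR_nonneg[of n h] by (simp add: norm_mult)
     next
      case False
      then show ?thesis using K(2)[OF False] nn nn2 by simp
     qed
    qed
   qed (use integrable_norm[OF kR_integrable[OF et]] kc gi in auto)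
   also have "... = de * (LI h. kR n h * c h) + 32 * inverse (Suc n) * M"
    using kc gi by (simp add: M_def)
   also have "(LI h. kR n h * c h) <= cmod (LI h. of_real (kR n h) * ?c h)" by (rule kR_real(2)[OF c(1)])
   finally show ?thesis using de by simp
  qed
  have "(%n. de * cmod (LI h. of_real (kR n h) * ?c h) + 32 * inverse (Suc n) * M) \<longlonglongrightarrow> de * cmod (J ?c) + 32 * 0 * M"
   by (intro tendsto_intros kR_tendsto[folded J_def] c LIMSEQ_inverse_real_of_nat)
  with tendsto_norm[OF kR_tendsto[OF et, folded J_def]] have "cmod (J et) <= de * cmod (J ?c) + 32 * 0 * M"
   by (rule LIMSEQ_le) (use le in auto)
  then show ?thesis using de by (simp add: algebra_simps)
 qed
 then have "cmod (J et) <= 0"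
 proof -
  assume a: "!!de. de > 0 ==> cmod (J et) <= de * (cmod (J ?c) + 1)"
  have p: "cmod (J ?c) + 1 > 0" by (simp add: add_nonneg_pos)
  show ?thesis
  proof (rule field_le_epsilon)
   fix e :: real assume "e > 0"
   then show "cmod (J et) <= 0 + e" using a[of "e / (cmod (J ?c) + 1)"] p by simp
  qed
 qed
 then show ?thesis by (simp add: J_def)
qed

text \<open>Subtracting \<open>ph 0\<close> times a cutoff gives a function vanishing at 0, so the
  functional is a multiple of the evaluation at 0. The factor is nonzero because the nonnegative
  kernels \<open>kR n\<close> keep a fixed amount of mass.\<close>

lemma fundamental_solution:
 obtains c0 :: complex where "c0 ~= 0" "!!ph. ph : test_fun ==> (LI h. GamR h * LN ph h) = c0 * ph 0"
proof -
 \<comment> \<open>All boxes \<open>B\<close> used below lie in the ball of radius 7, so the radius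
   20 leaves room.\<close>
 obtain c :: "hN => real" where c: "(%h. of_real (c h)) : test_fun" "!!h. h : cball 0 20 ==> c h = 1" "!!h. 0 <= c h"
  using cutoff_exists[of "cball 0 20"] by (metis bounded_cball)
 let ?c = "%h. complex_of_real (c h)"
 define J where "J ps = (LI h. GamR h * LN ps h)" for ps
 note GL = GamR_mult_integrable[OF test_fun_LN]
 have LNlin: "LN (%h. ph h + a * ps h) = (%h. LN ph h + a * LN ps h)" if "ph : test_fun" "ps : test_fun" for ph ps :: "hN => complex" and a
 proof -
  have "Xf om w (%h. ph h + a * ps h) = (%h. Xf om w ph h + a * Xf om w ps h)"
   if "ph : test_fun" "ps : test_fun" for ph ps :: "hN => complex" and w
   by (rule ext) (simp add: Xf_add Xf_cmult test_fun_diff that test_fun_cmult)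
  then show ?thesis
   unfolding LN_def using that by (simp add: test_fun_Xf bb_om sum.distrib sum_distrib_left)
 qed
 have eq: "J ph = J ?c * ph 0" if ph: "ph : test_fun" for ph
 proof -
  let ?et = "%h. ph h + (- ph 0) * ?c h"
  have "?et : test_fun" by (intro test_fun_add test_fun_cmult c ph)
  moreover have "?et 0 = 0" using c(2)[of 0] by simp
  ultimately have "J ?et = 0" unfolding J_def by (rule integral_GamR_LN_zero)
  moreover have "J ?et = J ph + (- ph 0) * J ?c"
   unfolding J_def LNlin[OF ph c(1)] distrib_left mult.left_commute[of "GamR _"]
   using GL[OF ph] GL[OF c(1)] by simp
  ultimately show ?thesis by (simp add: mult.commute)
 qed
 have "J ?c ~= 0"
 proof
  assume J0: "J ?c = 0"
  have lim: "(%n. LI h. of_real (kR n h) * ?c h) \<longlonglongrightarrow> 0"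
   using kR_tendsto[OF c(1)] J0 by (simp add: J_def)
  \<comment> \<open>\<open>B\<close> is the unit box dilated by the square root of \<open>e\<close>;
    on it \<open>fR e\<close> is at most
    \<open>(5 * e)\<^sup>2 + 3 * e\<^sup>2 = 28 * e\<^sup>2\<close>. The volume
    \<open>2 ^ 7 * e ^ 5\<close> cancels the power of \<open>e\<close> in the resulting lower bound
    for \<open>kR n\<close>.\<close>
  have low: "32 / 28 ^ 3 * 2 ^ 7 <= cmod (LI h. of_real (kR n h) * ?c h)" for n
  proof -
   define e where "e = inverse (real (Suc n))"
   define d where "d = sqrt e"
   have e: "0 < e" "e <= 1" by (auto simp: e_def field_simps)
   have d: "0 < d" "d <= 1" "d\<^sup>2 = e" using e by (auto simp: d_def)
   define B where "B = cbox ((\<chi> i. - d) :: real^4, (\<chi> i. - e) :: real^3) ((\<chi> i. d), (\<chi> i. e))"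
   have inB: "\<bar>fst h $ i\<bar> <= d & \<bar>snd h $ j\<bar> <= e" if "h : B" for h i j
    using that unfolding B_def cbox_Pair_eq by (auto simp: mem_box_cart abs_le_iff minus_le_iff)
   have B1: "norm h <= 20" if "h : B" for h
   proof -
    have "norm (fst h) <= (\<Sum>i\<in>UNIV. \<bar>fst h $ i\<bar>)" "norm (snd h) <= (\<Sum>i\<in>UNIV. \<bar>snd h $ i\<bar>)"
     by (rule norm_le_l1_cart)+
    moreover have "\<bar>fst h $ i\<bar> <= 1" "\<bar>snd h $ j\<bar> <= 1" for i j
     using inB[OF that, of i j] d e by auto
    ultimately have "norm (fst h) <= 4" "norm (snd h) <= 3"
     using sum_bounded_above[of "UNIV::4 set" "%i. \<bar>fst h $ i\<bar>" 1] sum_bounded_above[of "UNIV::3 set" "%i. \<bar>snd h $ i\<bar>" 1]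
     by (auto intro: order_trans)
    then show ?thesis using norm_fst_le[of "fst h" "snd h"] norm_Pair_le[of "fst h" "snd h"] by simp
   qed
   have fB: "fR e h <= 28 * e\<^sup>2" if "h : B" for h
   proof -
    have "(fst h $ i)\<^sup>2 <= e" "(snd h $ j)\<^sup>2 <= e\<^sup>2" for i j
     using inB[OF that, of i j] d abs_le_square_iff[of "fst h $ i" d] abs_le_square_iff[of "snd h $ j" e] by auto
    then have "fst h \<bullet> fst h <= 4 * e" "snd h \<bullet> snd h <= 3 * e\<^sup>2"
     unfolding inner_vec_def power2_eq_square[symmetric] sum_4 sum_3 inner_real_def by (smt (verit))+
    then have "fR e h <= (4 * e + e)\<^sup>2 + 3 * e\<^sup>2"
     unfolding fR_def using e by (intro add_mono power_mono) auto
    then show ?thesis by (simp add: power2_eq_square)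
   qed
   have kB: "32 / 28 ^ 3 * inverse e ^ 5 <= kR n h" if "h : B" for h
   proof -
    have "inverse (28 * e\<^sup>2) ^ 3 <= inverse (fR e h) ^ 3"
     using fB[OF that] fR_pos[of e h] e by (intro power_mono le_imp_inverse_le) auto
    then have "32 * e * inverse (28 * e\<^sup>2) ^ 3 <= kR n h"
     unfolding kR_def e_def[symmetric] using e by (intro mult_left_mono) auto
    moreover have "32 * e * inverse (28 * e\<^sup>2) ^ 3 = 32 / 28 ^ 3 * inverse e ^ 5"
     using e by (simp add: power_mult_distrib field_simps eval_nat_numeral)
    ultimately show ?thesis by simp
   qed
   have mB: "measure lborel B = 2 ^ 7 * e ^ 5"
   proof -
    have "measure lborel B = (2 * d) ^ 4 * (2 * e) ^ 3"
    proof -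
     have "cbox ((\<chi> i. - d) :: real^4) (\<chi> i. d) ~= {}" "cbox ((\<chi> i. - e) :: real^3) (\<chi> i. e) ~= {}"
      using d e by (auto simp: interval_ne_empty_cart)
     then show ?thesis unfolding B_def by (simp add: content_Pair content_cbox_cart)
    qed
    also have "... = 2 ^ 7 * ((d\<^sup>2)\<^sup>2 * e ^ 3)" by (simp add: power_mult_distrib)
    finally show ?thesis by (simp add: d(3) power_add[symmetric])
   qed
   note kc = kR_real[OF c(1), of n]
   have "32 / 28 ^ 3 * 2 ^ 7 = 32 / 28 ^ 3 * inverse e ^ 5 * measure lborel B"
    using e by (simp add: mB field_simps)
   also have "... = (LI h. indicator B h *\<^sub>R (32 / 28 ^ 3 * inverse e ^ 5))"
    by (simp add: B_def)
   also have "... <= (LI h. kR n h * c h)"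
   proof (rule integral_mono[OF _ kc(1)])
    show "lint (%h. indicator B h *\<^sub>R (32 / 28 ^ 3 * inverse e ^ 5))"
     by (rule borel_integrable_compact) (auto simp: B_def)
    show "indicator B h *\<^sub>R (32 / 28 ^ 3 * inverse e ^ 5) <= kR n h * c h" for h
    proof (cases "h : B")
     case True
     then show ?thesis using kB[OF True] B1[OF True] c(2)[of h] by simp
    next
     case False
     then show ?thesis using c(3)[of h] kR_nonneg[of n h] by simp
    qed
   qed
   also note kc(2)
   finally show ?thesis .
  qed
  have "32 / 28 ^ 3 * 2 ^ 7 <= cmod (0::complex)"
   by (rule LIMSEQ_le_const[OF tendsto_norm[OF lim]]) (use low in auto)
  then show False by simp
 qed
 then show thesis using that[of "J ?c"] eq by (simp add: J_def)
qed

section \<open>Parametrix\<close>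

lemma test_in_zero: "ph : test_in K ==> p ~: K ==> ph p = 0"
 unfolding test_in_def by blast

text \<open>The weights of the convolutions: test functions as well as the cut-off fundamental
  solution, which is only integrable.\<close>

definition cw :: "('b::euclidean_space => complex) => bool" where
 "cw w \<longleftrightarrow> lint w & (EX H. compact H & (ALL h. h ~: H --> w h = 0))"

lemma cw_test_fun: "ph : test_fun ==> cw ph"
 unfolding cw_def using test_fun_lint test_funE by metis

lemma cw_mult_continuous: "cw w ==> cont f ==> cw (%h. w h * f h)"
proof -
 assume w: "cw w" and f: "cont f"
 obtain H where H: "compact H" "!!h. h ~: H ==> w h = 0" using w unfolding cw_def by metis
 have "lint (%h. w h * f h)"
  by (rule lint_mult_compact[OF _ H(2,1) continuous_on_subset[OF f]]) (use w in "auto simp: cw_def")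
 then show ?thesis unfolding cw_def using H by (metis mult_zero_left)
qed

lemma cw_loc: "loc_integrable w ==> \<chi>' : test_fun ==> cw (%h. w h * \<chi>' h)"
proof -
 assume w: "loc_integrable w" and c: "\<chi>' : test_fun"
 obtain H where H: "compact H" "!!h. h ~: H ==> \<chi>' h = 0" using test_funE[OF c] by metis
 have "lint (%h. (indicator H h *\<^sub>R w h) * \<chi>' h)"
  by (rule lint_mult_compact[OF _ _ H(1) continuous_on_subset[OF smooth_cont[OF test_funD[OF c]]]])
    (use w H in "auto simp: loc_integrable_def")
 moreover have "(%h. (indicator H h *\<^sub>R w h) * \<chi>' h) = (%h. w h * \<chi>' h)"
  using H(2) by (auto simp: indicator_def)
 ultimately show ?thesis unfolding cw_def using H by (metis (no_types, lifting) mult_zero_right)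
qed

lemma smooth_on_GamR: "smooth_on (- {0}) GamR"
 unfolding GamR_def[abs_def] by (rule smooth_on_GR) auto

lemma GamR_mult_smooth:
 assumes f: "smo f" and d: "d > 0" and f0: "!!h. norm h < d ==> f h = 0"
 shows "smo (%h. GamR h * f h)"
proof (rule smooth_on_local)
 fix h :: hN
 show "EX T. open T & h : T & smooth_on T (%h. GamR h * f h)"
 proof (cases "h = 0")
  case True
  have "smooth_on (ball 0 d) (%h. GamR h * f h)"
   by (rule smooth_on_cong[OF _ smooth_on_const]) (use f0 in auto)
  then show ?thesis using True d by (intro exI[of _ "ball 0 d"]) auto
 next
  case False
  have "smooth_on (- {0}) (%h. GamR h * f h)"
   by (intro smooth_on_mult smooth_on_GamR smooth_on_subset[OF f]) auto
  then show ?thesis using False by (intro exI[of _ "- {0}"]) auto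
 qed
qed

lemma LN_mult:
 assumes "smo f" "smo g"
 shows "LN (%h. f h * g h) h = f h * LN g h + 2 * (\<Sum>j\<in>UNIV. Xf om (axis j 1) f h * Xf om (axis j 1) g h) + g h * LN f h"
proof -
 have d: "f differentiable (at p)" if "smo f" for f :: "hN => complex" and p
  using smooth_diff[OF that] by simp
 let ?X = "%j. Xf om (axis j 1)"
 have X: "smo (?X j f)" "smo (?X j g)" for j
  by (intro smooth_on_Xf bb_om open_UNIV assms)+
 have 1: "?X j (%h. f h * g h) = (%h. ?X j f h * g h + f h * ?X j g h)" for j
  by (rule ext, rule Xf_mult) (intro d assms)+
 have "?X j (?X j (%h. f h * g h)) h = f h * ?X j (?X j g) h + 2 * (?X j f h * ?X j g h) + g h * ?X j (?X j f) h" for j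
  unfolding 1
  by (simp add: Xf_add Xf_mult d assms X smooth_on_mult algebra_simps)
 then show ?thesis unfolding LN_def by (simp add: sum.distrib sum_distrib_left)
qed

lemma parametrix:
 obtains w rh where "cw w" "rh : test_fun"
  "!!ps. smo ps ==> (LI h. w h * LN ps h) = ps 0 + (LI h. rh h * ps h)"
proof -
 note bb = bb_om
 obtain c0 :: complex where c0: "c0 ~= 0" "!!ph. ph : test_fun ==> (LI h. GamR h * LN ph h) = c0 * ph 0"
  using fundamental_solution by blast
 obtain cr :: "hN => real" where cr: "(%h. of_real (cr h)) : test_fun" "!!h. h : ball 0 1 ==> cr h = 1"
  using cutoff_exists[of "ball 0 1"] by (metis bounded_ball)
 define c where "c h = complex_of_real (cr h)" for h
 have c: "c : test_fun" "smo c" and c1: "!!h. h : ball 0 1 ==> c h = 1"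
  using cr test_funD[OF cr(1)] by (auto simp: c_def[abs_def])
 let ?X = "%j. Xf om (axis j 1)"
 have Xc: "?X j c h = 0" if "norm h < 1" for j h
  using Xf_cong[of "ball 0 1" h "%_. 1" c om "axis j 1"] that c1 by auto
 have Lc: "LN c h = 0" if "norm h < 1" for h
  using LN_cong[of "ball 0 1" h "%_. 1" c] that c1 by (auto simp: smooth_on_const LN_def)
 define g where "g j h = GamR h * ?X j c h" for j h
 define l where "l h = GamR h * LN c h" for h
 have test: "(%h. GamR h * f h) : test_fun" if f: "f : test_fun" and z: "!!h. norm h < 1 ==> f h = 0" for f
 proof -
  obtain K where K: "compact K" "!!h. h ~: K ==> f h = 0" using test_funE[OF f] by metis
  show ?thesis
   by (rule test_funI[OF GamR_mult_smooth[OF test_funD[OF f] zero_less_one z] K(1)]) (use K in auto)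
 qed
 have gt: "g j : test_fun" for j unfolding g_def[abs_def] by (intro test test_fun_Xf bb c Xc)
 have lt: "l : test_fun" unfolding l_def[abs_def] by (intro test test_fun_LN c Lc)
 define rh where "rh h = inverse c0 * (2 * (\<Sum>j\<in>UNIV. ?X j (g j) h) + (- 1) * l h)" for h
 have rh: "rh : test_fun" unfolding rh_def[abs_def]
  by (intro test_fun_cmult test_fun_add test_fun_sum test_fun_Xf bb gt lt)
 have w: "cw (%h. GamR h * (inverse c0 * c h))"
  by (intro cw_loc loc_integrable_GamR test_fun_cmult c)
 show thesis
 proof (rule that[OF w rh])
  fix ps :: "hN => complex" assume ps: "smo ps"
  have i: "lint (%h. f h * ph h)" if "f : test_fun" "smo ph" for f ph :: "hN => complex"
   using test_fun_lint[OF test_fun_times_smooth[OF that]] .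
  have Gi: "lint (%h. GamR h * f h)" if "f : test_fun" for f
   using cw_loc[OF loc_integrable_GamR that] by (simp add: cw_def)
  have cps: "(%h. c h * ps h) : test_fun" by (rule test_fun_times_smooth[OF c(1) ps])
  have Xps: "smo (?X j ps)" for j by (rule smooth_on_Xf[OF bb open_UNIV ps])
  have Lps: "smo (LN ps)" by (rule smooth_on_LN[OF open_UNIV ps])
  have e: "GamR h * LN (%h. c h * ps h) h
    = GamR h * (c h * LN ps h) + 2 * (\<Sum>j\<in>UNIV. g j h * ?X j ps h) + l h * ps h" for h
   unfolding LN_mult[OF c(2) ps] g_def l_def by (simp add: algebra_simps sum_distrib_left)
  have "c0 * ps 0 = (LI h. GamR h * LN (%h. c h * ps h) h)"
   using c0(2)[OF cps] c1[of 0] by simp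
  also have "... = (LI h. GamR h * (c h * LN ps h)) + 2 * (\<Sum>j\<in>UNIV. LI h. g j h * ?X j ps h) + (LI h. l h * ps h)"
   unfolding e using i[OF gt Xps] i[OF lt ps] Gi[OF test_fun_times_smooth[OF c(1) Lps]] by simp
  also have "(\<Sum>j\<in>UNIV. LI h. g j h * ?X j ps h) = - (\<Sum>j\<in>UNIV. LI h. ?X j (g j) h * ps h)"
   unfolding sum_negf[symmetric]
  proof (rule sum.cong[OF refl])
   fix j :: 4
   show "(LI h. g j h * ?X j ps h) = - (LI h. ?X j (g j) h * ps h)"
    using integral_by_parts_Xf[OF bb ps gt[of j], of "axis j 1"] by (simp add: mult.commute)
  qed
  finally have f: "(LI h. GamR h * (c h * LN ps h))
    = c0 * ps 0 + 2 * (\<Sum>j\<in>UNIV. LI h. ?X j (g j) h * ps h) - (LI h. l h * ps h)"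
   by (simp add: sum_negf)
  have "rh h * ps h = inverse c0 * (2 * (\<Sum>j\<in>UNIV. ?X j (g j) h * ps h) - l h * ps h)" for h
   unfolding rh_def by (simp add: algebra_simps sum_distrib_left)
  then have "(LI h. rh h * ps h) = inverse c0 * (2 * (\<Sum>j\<in>UNIV. LI h. ?X j (g j) h * ps h) - (LI h. l h * ps h))"
   using i[OF test_fun_Xf[OF bb gt] ps] i[OF lt ps] by simp
  moreover have "(LI h. GamR h * (inverse c0 * c h) * LN ps h) = inverse c0 * (LI h. GamR h * (c h * LN ps h))"
   unfolding integral_mult_right_zero[symmetric] by (simp add: algebra_simps)
  ultimately show "(LI h. GamR h * (inverse c0 * c h) * LN ps h) = ps 0 + (LI h. rh h * ps h)"
   unfolding f using c0(1) by (simp add: distrib_left right_diff_distrib)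
 qed
qed

section \<open>Lines\<close>

definition hm :: "hN => hN => hN" where
 "hm h k = (fst h + fst k, snd h + snd k + 2 *\<^sub>R om (fst h) (fst k))"

definition hinv :: "hN => hN" where
 "hinv h = (- fst h, - snd h)"

text \<open>A homomorphism \<open>(E, C)\<close> from the quaternionic Heisenberg group into the group of \<open>be\<close> makes the
  former act from the right on the latter.\<close>

locale line =
 fixes be :: "'x::euclidean_space => 'x => 't::euclidean_space"
  and E :: "real^4 => 'x" and C :: "real^3 => 't"
 assumes bb: "bounded_bilinear be" and E: "bounded_linear E" and C: "bounded_linear C"
  and hom: "be (E x) (E y) = C (om x y)"
begin

definition act :: "'x * 't => hN => 'x * 't" where
 "act p h = (fst p + E (fst h), snd p + C (snd h) + 2 *\<^sub>R be (fst p) (E (fst h)))"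

lemmas add_simps = bounded_bilinear.add_left[OF bb] bounded_bilinear.add_right[OF bb]
 bounded_bilinear.minus_left[OF bb] bounded_bilinear.minus_right[OF bb]
 bounded_bilinear.zero_left[OF bb] bounded_bilinear.zero_right[OF bb]
 bounded_bilinear.scaleR_left[OF bb] bounded_bilinear.scaleR_right[OF bb]
 linear_add[OF bounded_linear.linear[OF E]] linear_add[OF bounded_linear.linear[OF C]]
 linear_scale[OF bounded_linear.linear[OF E]] linear_scale[OF bounded_linear.linear[OF C]]
 linear_neg[OF bounded_linear.linear[OF E]] linear_neg[OF bounded_linear.linear[OF C]]
 linear_0[OF bounded_linear.linear[OF E]] linear_0[OF bounded_linear.linear[OF C]]

lemma act_hm: "act (act p h) k = act p (hm h k)"
 by (simp add: act_def hm_def add_simps hom scaleR_add_right)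

lemma act_0 [simp]: "act p 0 = p"
 by (simp add: act_def add_simps prod_eq_iff)

lemma act_hinv [simp]: "act (act p h) (hinv h) = p"
proof -
 have "hm h (hinv h) = 0"
  using bounded_bilinear.minus_right[OF bb_om]
  by (simp add: hm_def hinv_def prod_eq_iff)
 then show ?thesis by (simp add: act_hm)
qed

lemma act_hinv2 [simp]: "act (act p (hinv h)) h = p"
 using act_hinv[of p "hinv h"] by (simp add: hinv_def)

lemma smooth_act: "open S ==> smooth_on S f ==> smooth_on S g ==> smooth_on S (%q. act (f q) (g q))"
 unfolding act_def
 by (intro smooth_intros smooth_bl[OF E] smooth_bl[OF C] smooth_on_bilinear[OF bb])

lemma continuous_act: "continuous_on S f ==> continuous_on S g ==> continuous_on S (%q. act (f q) (g q))"
 unfolding act_def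
 by (intro continuous_intros bounded_linear.continuous_on[OF E] bounded_linear.continuous_on[OF C] bounded_bilinear.continuous_on[OF bb])

definition LM :: "('x * 't => complex) => 'x * 't => complex" where
 "LM ph p = (\<Sum>j\<in>UNIV. Xf be (E (axis j 1)) (Xf be (E (axis j 1)) ph) p)"

lemma test_cont_LM: "test_cont LM"
 unfolding LM_def[abs_def] by (intro test_cont_sum test_cont_comp[OF test_cont_Xf[OF bb] test_cont_Xf[OF bb]])

text \<open>Left invariant fields generate the right translations, and the homomorphism property
  matches the central components.\<close>

lemma Xf_act:
 assumes "f differentiable (at (act p h))"
 shows "Xf om w (%h. f (act p h)) h = Xf be (E w) f (act p h)"
proof -
 have "(act p has_derivative (%v. (E (fst v), C (snd v) + 2 *\<^sub>R be (fst p) (E (fst v))))) (at h)"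
  unfolding act_def
  by (rule has_derivative_eq_rhs, (rule derivative_intros bounded_linear.has_derivative[OF E] bounded_linear.has_derivative[OF C]
    bounded_linear.has_derivative[OF bounded_bilinear.bounded_linear_right[OF bb]])+) (auto simp: fun_eq_iff)
 from dird_compose[OF assms this] show ?thesis
  by (simp add: Xf_def act_def add_simps hom scaleR_add_right algebra_simps)
qed

lemma LN_act:
 assumes "smo f"
 shows "LN (%h. f (act p h)) h = LM f (act p h)"
proof -
 have d: "f differentiable (at p)" if "smo f" for f :: "'x * 't => complex" and p
  using smooth_diff[OF that] by simp
 have 1: "Xf om w (%h. f (act p h)) = (%h. Xf be (E w) f (act p h))" for w
  by (rule ext, rule Xf_act, rule d[OF assms])
 show ?thesis unfolding LN_def LM_def 1
  by (rule sum.cong[OF refl], rule Xf_act, rule d[OF smooth_on_Xf[OF bb open_UNIV assms]])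
qed

text \<open>Convolution along the line, acting on test functions; distributions only meet its
  transpose.\<close>

definition Rop :: "(hN => complex) => ('x * 't => complex) => 'x * 't => complex" where
 "Rop w ph p = (LI h. w h * ph (act p h))"

lemma Rop_integrable:
 assumes "cw w" "cont ph"
 shows "lint (%h. w h * ph (act p h))"
proof -
 have "cont (%h. ph (act p h))"
  by (intro continuous_on_compose2[OF assms(2)] continuous_act continuous_intros) auto
 from cw_mult_continuous[OF assms(1) this] show ?thesis unfolding cw_def by blast
qed

lemma smooth_on_Rop:
 assumes w: "cw w" and ph: "smo ph"
 shows "smo (Rop w ph)"
proof -
 obtain H where H: "compact H" "!!h. h ~: H ==> w h = 0" using w unfolding cw_def by metis
 have s: "smo (%z. ph (act (fst z) (snd z)))"
  by (intro smooth_comp[OF ph] smooth_act smooth_intros) auto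
 show ?thesis
  unfolding Rop_def[abs_def]
  using smooth_param[of UNIV UNIV H "%z. ph (act (fst z) (snd z))" w] H w s
  by (auto simp: cw_def)
qed

text \<open>A constant direction \<open>v\<close> at \<open>p\<close> becomes at
  \<open>act p h\<close> the direction \<open>v\<close> plus the central vector
  \<open>2 *\<^sub>R be (fst v) (E (fst h))\<close>. Its components are linear in \<open>h\<close>
  and are moved into the weights.\<close>

lemma dird_Rop:
 assumes w: "cw w" and ph: "smo ph"
 shows "dird v (Rop w ph) p = Rop w (dird v ph) p
  + (\<Sum>ta\<in>Basis. Rop (%h. w h * of_real (2 * (be (fst v) (E (fst h)) \<bullet> ta))) (dird (0, ta) ph) p)"
proof -
 obtain H where H: "compact H" "!!h. h ~: H ==> w h = 0" using w unfolding cw_def by metis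
 have s: "smo (%z. ph (act (fst z) (snd z)))"
  by (intro smooth_comp[OF ph] smooth_act smooth_intros) auto
 have d: "ph differentiable (at p)" for p using smooth_diff[OF ph] by simp
 have lin: "linear (%v. dird v ph p)" for p by (rule dird_linear[OF d])
 have lin2: "linear (%t. dird (0, t) ph p)" for p
  by (rule linearI; use linear_add[OF lin] linear_scale[OF lin] in \<open>metis (no_types, lifting) add.right_neutral add_Pair scaleR_Pair scaleR_zero_right\<close>)
 have D: "dird (v, 0) (%z. ph (act (fst z) (snd z))) (p, h)
   = dird v ph (act p h) + (\<Sum>ta\<in>Basis. of_real (2 * (be (fst v) (E (fst h)) \<bullet> ta)) * dird (0, ta) ph (act p h))" for h
 proof -
  have "((%z. act (fst z) (snd z)) has_derivative (%u. (fst (fst u) + E (fst (snd u)),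
    snd (fst u) + C (snd (snd u)) + 2 *\<^sub>R (be p1 (E (fst (snd u))) + be (fst (fst u)) (E (fst h)))))) (at (p, h))"
   if "p1 = fst p" for p1
   unfolding act_def
   by (rule has_derivative_eq_rhs, (rule derivative_intros bounded_linear.has_derivative[OF E] bounded_linear.has_derivative[OF C]
    bounded_bilinear.FDERIV[OF bb])+) (auto simp: fun_eq_iff that)
  from dird_compose[OF d this[OF refl], of "(v, 0)"]
  have "dird (v, 0) (%z. ph (act (fst z) (snd z))) (p, h) = dird (v + (0, 2 *\<^sub>R be (fst v) (E (fst h)))) ph (act p h)"
   by (simp add: add_simps plus_prod_def)
  also have "... = dird v ph (act p h) + dird (0, 2 *\<^sub>R be (fst v) (E (fst h))) ph (act p h)"
   by (rule linear_add[OF lin])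
  finally show ?thesis
   using linear_Basis_expand[OF lin2, of "2 *\<^sub>R be (fst v) (E (fst h))"] by (simp add: scaleR_conv_of_real)
 qed
 have ct: "cont (%h. complex_of_real (2 * (be (fst v) (E (fst h)) \<bullet> ta)))" for ta
  by (intro continuous_intros bounded_linear.continuous_on[OF E] bounded_linear.continuous_on[OF bounded_bilinear.bounded_linear_right[OF bb]])
 have "dird v (Rop w ph) p = (LI h. w h * dird (v, 0) (%z. ph (act (fst z) (snd z))) (p, h))"
  unfolding Rop_def[abs_def]
  using dird_param_integral[of UNIV UNIV H "%z. ph (act (fst z) (snd z))" w p v] H w s by (auto simp: cw_def)
 also have "... = (LI h. w h * dird v ph (act p h)
   + (\<Sum>ta\<in>Basis. (w h * of_real (2 * (be (fst v) (E (fst h)) \<bullet> ta))) * dird (0, ta) ph (act p h)))"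
  unfolding D by (simp add: algebra_simps sum_distrib_left)
 also have "... = Rop w (dird v ph) p
  + (\<Sum>ta\<in>Basis. Rop (%h. w h * of_real (2 * (be (fst v) (E (fst h)) \<bullet> ta))) (dird (0, ta) ph) p)"
 proof -
  have i1: "lint (%h. w h * dird v ph (act p h))"
   by (intro Rop_integrable w smooth_cont smooth_on_dird ph)
  have i2: "lint (%h. (w h * of_real (2 * (be (fst v) (E (fst h)) \<bullet> ta))) * dird (0, ta) ph (act p h))" for ta
   by (intro Rop_integrable cw_mult_continuous[OF w ct] smooth_cont smooth_on_dird ph)
  show ?thesis unfolding Rop_def
   by (subst Bochner_Integration.integral_add[OF i1 Bochner_Integration.integrable_sum[OF i2]],
     subst Bochner_Integration.integral_sum[OF i2]) simp
 qed
 finally show ?thesis .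
qed

lemma Rop_bound:
 assumes "cw w" "cont ph" "!!p. cmod (ph p) <= B"
 shows "cmod (Rop w ph p) <= B * (LI h. cmod (w h))"
 unfolding Rop_def
 by (rule norm_integral_mult_le) (use assms Rop_integrable in "auto simp: cw_def")

lemma Rop_zero_outside:
 assumes "!!h. h ~: H ==> w h = 0" "!!p. p ~: K ==> ph p = 0" "p ~: (%z. act (fst z) (hinv (snd z))) ` (K \<times> H)"
 shows "Rop w ph p = 0"
proof -
 have "w h * ph (act p h) = 0" for h
 proof (cases "h : H")
  case True
  have "act p h ~: K"
  proof
   assume "act p h : K"
   then have "(act p h, h) : K \<times> H" using True by simp
   then show False using assms(3) act_hinv[of p h] by (metis (no_types, lifting) fst_conv image_eqI snd_conv)
  qed
  then show ?thesis using assms(2) by simp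
 qed (use assms in simp)
 then have "(%h. w h * ph (act p h)) = (%h. 0)" by blast
 then show ?thesis by (simp add: Rop_def)
qed

lemma Rop_test_in:
 assumes w: "cw w" and K: "compact K"
 shows "EX K'. compact K' & (ALL ph:test_in K. Rop w ph : test_in K')"
proof -
 obtain H where H: "compact H" "!!h. h ~: H ==> w h = 0" using w unfolding cw_def by metis
 define K' where "K' = (%z. act (fst z) (hinv (snd z))) ` (K \<times> H)"
 have K': "compact K'" unfolding K'_def hinv_def
  by (intro compact_continuous_image compact_Times K H continuous_act continuous_intros)
 have "Rop w ph : test_in K'" if ph: "ph : test_in K" for ph
 proof -
  have z: "Rop w ph p = 0" if "p ~: K'" for p
   by (rule Rop_zero_outside[OF H(2) test_in_zero[OF ph] that[unfolded K'_def]])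
  have "Rop w ph : test_fun"
   by (rule test_funI[OF smooth_on_Rop[OF w test_funD[OF test_in_test[OF ph]]] K' z])
  then show ?thesis using z unfolding test_in_def by blast
 qed
 then show ?thesis using K' by blast
qed

lemma Rop_test_fun: "cw w ==> ph : test_fun ==> Rop w ph : test_fun"
 by (rule test_fun_test_inE, assumption) (use Rop_test_in test_in_test in metis)

lemma test_cont_Rop:
 assumes "cw w"
 shows "test_cont (Rop w)"
proof (rule test_contI)
 show "!!K. compact K ==> EX K'. compact K' & (ALL ph:test_in K. Rop w ph : test_in K')"
  by (rule Rop_test_in[OF assms])
 have c: "cont ph" if "ph : test_fun" for ph :: "'x * 't => complex"
  using smooth_cont[OF test_funD[OF that]] .
 show "test_linear (Rop w)"
  unfolding test_linear_def
 proof (intro conjI ballI allI Rop_test_fun[OF assms])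
  fix ph ps :: "'x * 't => complex" and a :: complex
  assume ph: "ph : test_fun"
  show "Rop w (%p. a * ph p) = (%p. a * Rop w ph p)"
   unfolding Rop_def by (simp add: mult.left_commute)
  assume ps: "ps : test_fun"
  show "Rop w (%p. ph p + ps p) = (%p. Rop w ph p + Rop w ps p)"
   unfolding Rop_def using Rop_integrable[OF assms c[OF ph]] Rop_integrable[OF assms c[OF ps]]
   by (simp add: distrib_left)
 qed
 fix vs :: "('x * 't) list" assume "set vs <= Basis"
 then show "cb 1 (%ph. iter_dird vs (Rop w ph))" using assms
 \<comment> \<open>By \<open>dird_Rop\<close> an innermost derivative replaces the weight by others
   of the same class, hence the induction over all \<open>w\<close>.\<close>
 proof (induction vs arbitrary: w rule: rev_induct)
  case Nil
  have "cmod (Rop w ph p) <= (LI h. cmod (w h)) * Cm_norm 0 ph" if "ph : test_fun" for ph p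
   using Rop_bound[OF Nil(2) c[OF that] Cm_norm_ge[OF that]] by (simp add: mult.commute)
  then show ?case unfolding cb_def mult_1
   by (intro allI impI exI[of _ "LI h. cmod (w h)"] conjI exI[of _ 0]) (auto simp: test_in_test)
 next
  case (snoc v vs)
  define w' where "w' ta h = w h * of_real (2 * (be (fst v) (E (fst h)) \<bullet> ta))" for ta h
  have w': "cw (w' ta)" for ta unfolding w'_def[abs_def]
   by (intro cw_mult_continuous snoc.prems continuous_intros bounded_linear.continuous_on[OF E]
     bounded_linear.continuous_on[OF bounded_bilinear.bounded_linear_right[OF bb]])
  have "cb 1 (%ph p. iter_dird vs (Rop w (dird v ph)) p + (\<Sum>ta\<in>Basis. iter_dird vs (Rop (w' ta) (dird (0, ta) ph)) p))"
   using snoc.prems w' by (intro cb_add cb_sum cb_dird[of "%ph. iter_dird vs (Rop _ ph)"] snoc.IH) (auto simp: Basis_prod_def)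
  then show ?case
  proof (rule cb_cong)
   fix ph :: "'x * 't => complex" assume ph: "ph : test_fun"
   have "dird v (Rop w ph) = (%p. Rop w (dird v ph) p + (\<Sum>ta\<in>Basis. Rop (w' ta) (dird (0, ta) ph) p))"
    unfolding w'_def[abs_def] by (rule ext, rule dird_Rop[OF snoc.prems(2) test_funD[OF ph]])
   then show "iter_dird (vs @ [v]) (Rop w ph)
     = (%p. iter_dird vs (Rop w (dird v ph)) p + (\<Sum>ta\<in>Basis. iter_dird vs (Rop (w' ta) (dird (0, ta) ph)) p))"
    by (simp add: iter_dird_append iter_dird_Cons iter_dird_lin(1) iter_dird_sum Rop_test_fun snoc.prems(2) w' test_fun_dird ph test_fun_sum)
  qed
 qed
qed

end

section \<open>Reduction to distributions of order zero\<close>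

context line
begin

lemma dird_center:
 fixes f :: "'x * 't => complex"
 assumes "f differentiable (at p)"
 shows "dird (0, t) f p = (\<Sum>ta\<in>Basis. of_real (t \<bullet> ta) * dird (0, ta) f p)"
proof -
 have lin: "linear (%v. dird v f p)" by (rule dird_linear[OF assms])
 have "linear (%t. dird (0, t) f p)"
  by (rule linearI; use linear_add[OF lin] linear_scale[OF lin] in "metis (no_types, lifting) add.right_neutral add_Pair scaleR_Pair scaleR_zero_right")
 from linear_Basis_expand[OF this, of t] show ?thesis by (simp add: scaleR_conv_of_real)
qed

lemma Rop_dird_center:
 assumes w: "cw w" and ph: "smo ph"
 shows "dird (0, t) (Rop w ph) p = Rop w (dird (0, t) ph) p"
 unfolding dird_Rop[OF assms] by (simp add: add_simps Rop_def)

text \<open>The central components of the difference between the direction \<open>w\<close> carried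
  from \<open>p\<close> to \<open>act p h\<close> and the left invariant field at
  \<open>act p h\<close>.\<close>

definition kappa :: "'x => 't => hN => complex" where
 "kappa w ta h = of_real (2 * ((be w (E (fst h)) - be (E (fst h)) w) \<bullet> ta))"

lemma smooth_on_kappa: "smo (kappa w ta)"
 unfolding kappa_def[abs_def]
 by (intro smooth_intros smooth_bl[OF bounded_bilinear.bounded_linear_left[OF bb]]
   smooth_bl[OF bounded_bilinear.bounded_linear_right[OF bb]] smooth_bl[OF E] open_UNIV)

text \<open>In a group of step two a left invariant field and a right translation commute up to a
  central field, whose coefficients go into the weight.\<close>

lemma Xf_Rop:
 assumes w: "cw u" and ph: "smo ph"
 shows "Xf be w (Rop u ph) p = Rop u (Xf be w ph) p
  + (\<Sum>ta\<in>Basis. Rop (%h. u h * kappa w ta h) (dird (0, ta) ph) p)"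
proof -
 have d: "ph differentiable (at p)" for p using smooth_diff[OF ph] by simp
 let ?v = "(w, 2 *\<^sub>R be (fst p) w)"
 let ?a = "%ta h. complex_of_real (2 * (be w (E (fst h)) \<bullet> ta))"
 let ?b = "%ta h. complex_of_real (2 * (be (E (fst h)) w \<bullet> ta))"
 have ca: "cont (?a ta)" and cb: "cont (?b ta)" for ta
  by (intro continuous_intros bounded_linear.continuous_on[OF E] bounded_linear.continuous_on[OF bounded_bilinear.bounded_linear_right[OF bb]]
    bounded_linear.continuous_on[OF bounded_bilinear.bounded_linear_left[OF bb]])+
 have i: "lint (%h. u' h * ps (act p h))" if "cw u'" "smo ps" for u' ps
  by (rule Rop_integrable[OF that(1) smooth_cont[OF that(2)]])
 have X: "Xf be w ph (act p h) = dird ?v ph (act p h) + (\<Sum>ta\<in>Basis. ?b ta h * dird (0, ta) ph (act p h))" for h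
 proof -
  have "Xf be w ph (act p h) = dird (?v + (0, 2 *\<^sub>R be (E (fst h)) w)) ph (act p h)"
   by (simp add: Xf_def act_def add_simps scaleR_add_right)
  also have "... = dird ?v ph (act p h) + dird (0, 2 *\<^sub>R be (E (fst h)) w) ph (act p h)"
   by (rule linear_add[OF dird_linear[OF d]])
  also have "dird (0, 2 *\<^sub>R be (E (fst h)) w) ph (act p h) = (\<Sum>ta\<in>Basis. ?b ta h * dird (0, ta) ph (act p h))"
   by (subst dird_center[OF d]) simp
  finally show ?thesis .
 qed
 have bi: "cw (%h. u h * ?b ta h)" and ai: "cw (%h. u h * ?a ta h)" for ta
  by (intro cw_mult_continuous w ca cb)+
 have "Rop u (Xf be w ph) p = (LI h. u h * dird ?v ph (act p h) + (\<Sum>ta\<in>Basis. (u h * ?b ta h) * dird (0, ta) ph (act p h)))"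
  unfolding Rop_def X by (simp add: algebra_simps sum_distrib_left)
 also have "... = Rop u (dird ?v ph) p + (\<Sum>ta\<in>Basis. Rop (%h. u h * ?b ta h) (dird (0, ta) ph) p)"
  unfolding Rop_def
  by (subst Bochner_Integration.integral_add[OF i[OF w smooth_on_dird[OF ph]] Bochner_Integration.integrable_sum[OF i[OF bi smooth_on_dird[OF ph]]]],
    subst Bochner_Integration.integral_sum[OF i[OF bi smooth_on_dird[OF ph]]]) simp
 finally have R: "Rop u (dird ?v ph) p = Rop u (Xf be w ph) p - (\<Sum>ta\<in>Basis. Rop (%h. u h * ?b ta h) (dird (0, ta) ph) p)"
  by simp
 have k: "Rop (%h. u h * kappa w ta h) (dird (0, ta) ph) p
   = Rop (%h. u h * ?a ta h) (dird (0, ta) ph) p - Rop (%h. u h * ?b ta h) (dird (0, ta) ph) p" for ta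
  unfolding Rop_def
  by (subst Bochner_Integration.integral_diff[OF i[OF ai smooth_on_dird[OF ph]] i[OF bi smooth_on_dird[OF ph]], symmetric])
    (simp add: kappa_def inner_diff_left algebra_simps)
 show ?thesis
  unfolding Xf_def[of be w "Rop u ph"] dird_Rop[OF w ph] R k by (simp add: sum_subtractf)
qed

text \<open>A field tangent to the line differentiates \<open>act p h\<close> by multiplying
  \<open>h\<close> from the left. As a function of \<open>h\<close> this is a right invariant field,
  that is \<open>Xf\<close> for the flipped form \<open>om'\<close>, and integration by parts puts
  it on the smooth weight.\<close>

lemma Xf_Rop_absorb:
 assumes rh: "rh : test_fun"
 shows "EX rh':test_fun. ALL ph. smo ph --> Xf be (E ze) (Rop rh ph) = Rop rh' ph"
proof -
 define om' where "om' x y = om y x" for x y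
 have bb': "bounded_bilinear om'" unfolding om'_def by (rule bounded_bilinear.flip[OF bb_om])
 define rh' where "rh' h = - Xf om' ze rh h" for h
 have rh': "rh' : test_fun" unfolding rh'_def[abs_def] by (intro test_fun_minus test_fun_Xf bb' rh)
 have "Xf be (E ze) (Rop rh ph) p = Rop rh' ph p" if ph: "smo ph" for ph p
 proof -
  have d: "ph differentiable (at p)" for p using smooth_diff[OF ph] by simp
  have sm: "smo (%h. ph (act p h))"
   by (intro smooth_comp[OF ph] smooth_act smooth_intros) auto
  let ?a = "%ta h. complex_of_real (2 * (be (E ze) (E (fst h)) \<bullet> ta))"
  have ca: "cont (?a ta)" for ta
   by (intro continuous_intros bounded_linear.continuous_on[OF E] bounded_linear.continuous_on[OF bounded_bilinear.bounded_linear_right[OF bb]])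
  let ?v = "(E ze, 2 *\<^sub>R be (fst p) (E ze))"
  have X: "Xf om' ze (%h. ph (act p h)) h = dird ?v ph (act p h) + (\<Sum>ta\<in>Basis. ?a ta h * dird (0, ta) ph (act p h))" for h
  proof -
   have "(act p has_derivative (%v. (E (fst v), C (snd v) + 2 *\<^sub>R be (fst p) (E (fst v))))) (at h)"
    unfolding act_def
    by (rule has_derivative_eq_rhs, (rule derivative_intros bounded_linear.has_derivative[OF E] bounded_linear.has_derivative[OF C]
      bounded_linear.has_derivative[OF bounded_bilinear.bounded_linear_right[OF bb]])+) (auto simp: fun_eq_iff)
   from dird_compose[OF d this]
   have "Xf om' ze (%h. ph (act p h)) h = dird (?v + (0, 2 *\<^sub>R be (E ze) (E (fst h)))) ph (act p h)"
    by (simp add: Xf_def om'_def hom add_simps add.commute)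
   also have "... = dird ?v ph (act p h) + dird (0, 2 *\<^sub>R be (E ze) (E (fst h))) ph (act p h)"
    by (rule linear_add[OF dird_linear[OF d]])
   also have "dird (0, 2 *\<^sub>R be (E ze) (E (fst h))) ph (act p h) = (\<Sum>ta\<in>Basis. ?a ta h * dird (0, ta) ph (act p h))"
    by (subst dird_center[OF d]) simp
   finally show ?thesis .
  qed
  have i: "lint (%h. u' h * ps (act p h))" if "cw u'" "smo ps" for u' ps
   by (rule Rop_integrable[OF that(1) smooth_cont[OF that(2)]])
  have ai: "cw (%h. rh h * ?a ta h)" for ta by (intro cw_mult_continuous cw_test_fun rh ca)
  have "Xf be (E ze) (Rop rh ph) p = Rop rh (dird ?v ph) p + (\<Sum>ta\<in>Basis. Rop (%h. rh h * ?a ta h) (dird (0, ta) ph) p)"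
   unfolding Xf_def dird_Rop[OF cw_test_fun[OF rh] ph] by simp
  also have "... = (LI h. rh h * dird ?v ph (act p h) + (\<Sum>ta\<in>Basis. (rh h * ?a ta h) * dird (0, ta) ph (act p h)))"
   unfolding Rop_def
   by (subst Bochner_Integration.integral_add[OF i[OF cw_test_fun[OF rh] smooth_on_dird[OF ph]] Bochner_Integration.integrable_sum[OF i[OF ai smooth_on_dird[OF ph]]]],
     subst Bochner_Integration.integral_sum[OF i[OF ai smooth_on_dird[OF ph]]]) simp
  also have "... = (LI h. Xf om' ze (%h. ph (act p h)) h * rh h)"
   unfolding X by (simp add: algebra_simps sum_distrib_left)
  also have "... = - (LI h. ph (act p h) * Xf om' ze rh h)"
   using integral_by_parts_Xf[OF bb' sm rh, of ze] by simp
  also have "... = Rop rh' ph p" by (simp add: Rop_def rh'_def mult.commute)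
  finally show ?thesis .
 qed
 then show ?thesis using rh' by blast
qed

text \<open>A central direction in the range of \<open>C\<close> is a central derivative in
  \<open>h\<close>, which integration by parts puts on the weight.\<close>

lemma dird_Rop_absorb:
 assumes rh: "rh : test_fun" and Ci: "C s = t"
 shows "EX rh':test_fun. ALL ph. smo ph --> dird (0, t) (Rop rh ph) = Rop rh' ph"
proof -
 define rh' where "rh' h = - dird (0, s) rh h" for h
 have rh': "rh' : test_fun" unfolding rh'_def[abs_def] by (intro test_fun_minus test_fun_dird rh)
 have "dird (0, t) (Rop rh ph) p = Rop rh' ph p" if ph: "smo ph" for ph p
 proof -
  have d: "ph differentiable (at p)" for p using smooth_diff[OF ph] by simp
  have sm: "smo (%h. ph (act p h))"
   by (intro smooth_comp[OF ph] smooth_act smooth_intros) auto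
  have X: "dird (0, s) (%h. ph (act p h)) h = dird (0, t) ph (act p h)" for h
  proof -
   have "(act p has_derivative (%v. (E (fst v), C (snd v) + 2 *\<^sub>R be (fst p) (E (fst v))))) (at h)"
    unfolding act_def
    by (rule has_derivative_eq_rhs, (rule derivative_intros bounded_linear.has_derivative[OF E] bounded_linear.has_derivative[OF C]
      bounded_linear.has_derivative[OF bounded_bilinear.bounded_linear_right[OF bb]])+) (auto simp: fun_eq_iff)
   from dird_compose[OF d this] show ?thesis by (simp add: add_simps Ci)
  qed
  have "dird (0, t) (Rop rh ph) p = (LI h. dird (0, s) (%h. ph (act p h)) h * rh h)"
   unfolding Rop_dird_center[OF cw_test_fun[OF rh] ph] X by (simp add: Rop_def mult.commute)
  also have "... = - (LI h. ph (act p h) * dird (0, s) rh h)"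
   using integral_by_parts[OF sm rh, of "(0, s)"] by simp
  also have "... = Rop rh' ph p" by (simp add: Rop_def rh'_def mult.commute)
  finally show ?thesis .
 qed
 then show ?thesis using rh' by blast
qed

end

text \<open>Products of one smooth convolution per line, the first line outermost, and their sums.
  Sums and zero are included because commuting a field through a product produces sums with altered
  weights.\<close>

inductive RR :: "('x::euclidean_space => 'x => 't::euclidean_space) => ((real^4 => 'x) * (real^3 => 't)) list =>
  (('x * 't => complex) => 'x * 't => complex) => bool" for be where
 RR_zero: "RR be ls (%ph p. 0)"
| RR_Nil: "RR be [] (%ph p. c * ph p)"
| RR_Cons: "rh : test_fun ==> RR be ls T ==> RR be (l # ls) (%ph. line.Rop be (fst l) (snd l) rh (T ph))"
| RR_add: "RR be ls T ==> RR be ls T' ==> RR be ls (%ph p. T ph p + T' ph p)"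

definition all_lines :: "('x::euclidean_space => 'x => 't::euclidean_space) => ((real^4 => 'x) * (real^3 => 't)) list => bool" where
 "all_lines be ls \<longleftrightarrow> (ALL l:set ls. line be (fst l) (snd l))"

lemma RR_sum: "finite I ==> (!!i. i : I ==> RR be ls (T i)) ==> RR be ls (%ph p. \<Sum>i\<in>I. T i ph p)"
 by (induction I rule: finite_induct) (auto intro: RR_zero RR_add)

lemma Rop_cmult: "line be E C ==> line.Rop be E C rh (%p. c * ph p) = (%p. c * line.Rop be E C rh ph p)"
 by (rule ext) (simp add: line.Rop_def mult.left_commute)

lemma RR_cmult: "RR be ls T ==> all_lines be ls ==> RR be ls (%ph p. c * T ph p)"
proof (induction rule: RR.induct)
 case (RR_zero ls)
 show ?case using RR.RR_zero by simp
next
 case (RR_Nil c')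
 show ?case using RR.RR_Nil[of be "c * c'"] by (simp add: mult.assoc)
next
 case (RR_Cons rh ls T l)
 then have "line be (fst l) (snd l)" "RR be ls (%ph p. c * T ph p)" by (auto simp: all_lines_def)
 then show ?case using RR.RR_Cons[OF RR_Cons.hyps(1), of be ls "%ph p. c * T ph p" l] by (simp add: Rop_cmult)
next
 case (RR_add ls T T')
 then show ?case using RR.RR_add by (fastforce simp: distrib_left)
qed

lemma RR_test_cont: "RR be ls T ==> all_lines be ls ==> test_cont T"
proof (induction rule: RR.induct)
 case (RR_Nil c)
 show ?case by (rule test_cont_mult) (auto intro: smooth_intros)
next
 case (RR_Cons rh ls T l)
 then have l: "line be (fst l) (snd l)" and T: "test_cont T" by (auto simp: all_lines_def)
 show ?case by (rule test_cont_comp[OF line.test_cont_Rop[OF l cw_test_fun[OF RR_Cons.hyps(1)]] T])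
qed (auto intro: test_cont_zero test_cont_add)

lemma RR_cb: "RR be ls T ==> all_lines be ls ==> cb 0 T"
proof (induction rule: RR.induct)
 case (RR_zero ls)
 show ?case by (rule cb_zeroI, intro exI[of _ 0]) auto
next
 case (RR_Nil c)
 show ?case
  by (rule cb_zeroI, intro exI[of _ "cmod c"]) (auto simp: norm_mult intro!: mult_left_mono Cm_norm_ge test_in_test)
next
 case (RR_Cons rh ls T l)
 then have l: "line be (fst l) (snd l)" and al: "all_lines be ls" by (auto simp: all_lines_def)
 show ?case
 proof (rule cb_zeroI)
  fix K :: "('a * 'b) set" assume "compact K"
  then obtain B where B: "B >= 0" "!!ph p. ph : test_in K ==> cmod (T ph p) <= B * Cm_norm 0 ph"
   using cb_zeroE[OF RR_Cons.IH[OF al]] by metis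
  let ?N = "LI h. cmod (rh h)"
  have "cmod (line.Rop be (fst l) (snd l) rh (T ph) p) <= (B * ?N) * Cm_norm 0 ph" if "ph : test_in K" for ph p
   using line.Rop_bound[OF l cw_test_fun[OF RR_Cons.hyps(1)]
     smooth_cont[OF test_funD[OF test_contD(1)[OF RR_test_cont[OF RR_Cons.hyps(2) al] test_in_test[OF that]]]]
     B(2)[OF that], of p] by (simp add: mult_ac)
  then show "EX C>=0. ALL ph:test_in K. ALL p. cmod (line.Rop be (fst l) (snd l) rh (T ph) p) <= C * Cm_norm 0 ph"
   using B(1) by (intro exI[of _ "B * ?N"]) auto
 qed
qed (auto intro: cb_add)

text \<open>Central translations commute with all right translations, hence with every
  layer.\<close>

lemma RR_center:
 "RR be ls T ==> all_lines be ls ==> ph : test_fun ==> dird (0, t) (T ph) = T (dird (0, t) ph)"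
proof (induction arbitrary: ph rule: RR.induct)
 case (RR_Nil c)
 then show ?case by (simp add: dird_cmult test_fun_diff fun_eq_iff)
next
 case (RR_Cons rh ls T l)
 then have l: "line be (fst l) (snd l)" and al: "all_lines be ls" by (auto simp: all_lines_def)
 have T: "smo (T ph)"
  by (intro test_funD test_contD(1)[OF RR_test_cont[OF RR_Cons.hyps(2) al]] RR_Cons.prems)
 show ?case
  using line.Rop_dird_center[OF l cw_test_fun[OF RR_Cons.hyps(1)] T] RR_Cons.IH[OF al RR_Cons.prems(2)] by auto
next
 case (RR_add ls T T')
 have "T ph : test_fun" "T' ph : test_fun"
  using RR_add.hyps RR_add.prems RR_test_cont test_contD(1) by blast+
 then show ?case using RR_add by (simp add: dird_add test_fun_diff fun_eq_iff)
qed simp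

lemma Rop_add_sum:
 assumes l: "line be E C" and w: "cw w" and f: "f : test_fun" and g: "!!i. i : I ==> g i : test_fun"
 shows "line.Rop be E C w (%p. f p + (\<Sum>i\<in>I. g i p)) = (%p. line.Rop be E C w f p + (\<Sum>i\<in>I. line.Rop be E C w (g i) p))"
proof -
 note R = test_contD(2)[OF line.test_cont_Rop[OF l w]]
 have z: "line.Rop be E C w (%p. 0) = (%p. 0)" using Rop_cmult[OF l, of w 0 "%p. 0"] by simp
 have "line.Rop be E C w (%p. \<Sum>i\<in>I. g i p) = (%p. \<Sum>i\<in>I. line.Rop be E C w (g i) p)"
  using g by (induction I rule: infinite_finite_induct) (auto simp: z R test_fun_sum)
 then show ?thesis using R[OF f test_fun_sum[of I g, OF g]] by simp
qed

text \<open>Passing the field through the outermost layer adds central derivatives with the weights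
  \<open>rh * kappa\<close>, again test functions. By \<open>RR_center\<close> the central
  derivatives can be moved to the argument.\<close>

lemma RR_Xf_step:
 assumes l: "line be (fst l) (snd l)" and rh: "rh : test_fun" and al: "all_lines be ls" and T: "RR be ls T"
  and T0: "RR be ls T0" and P: "!!ph. ph : test_fun ==> P ph : test_fun"
  and T': "!!ta. RR be ls (T' ta)"
  and X: "!!ph. ph : test_fun ==> Xf be w (T ph) = (%p. T0 (P ph) p + (\<Sum>ta\<in>Basis. T' ta (dird (0, ta) ph) p))"
 shows "EX T''. (ALL ta. RR be (l # ls) (T'' ta)) & (ALL ph:test_fun.
   Xf be w (line.Rop be (fst l) (snd l) rh (T ph))
    = (%p. line.Rop be (fst l) (snd l) rh (T0 (P ph)) p + (\<Sum>ta\<in>Basis. T'' ta (dird (0, ta) ph) p)))"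
proof -
 let ?R = "line.Rop be (fst l) (snd l)"
 let ?k = "%ta h. rh h * line.kappa be (fst l) w ta h"
 note tc = test_contD(1)[OF RR_test_cont[OF _ al]]
 have k: "?k ta : test_fun" for ta
  by (rule test_fun_times_smooth[OF rh line.smooth_on_kappa[OF l]])
 define T'' where "T'' ta ph p = ?R rh (T' ta ph) p + ?R (?k ta) (T ph) p" for ta ph p
 have "RR be (l # ls) (T'' ta)" for ta
  unfolding T''_def[abs_def] by (intro RR_add RR_Cons rh k T T')
 moreover have "Xf be w (?R rh (T ph)) = (%p. ?R rh (T0 (P ph)) p + (\<Sum>ta\<in>Basis. T'' ta (dird (0, ta) ph) p))"
  if ph: "ph : test_fun" for ph
 proof
  fix p
  have "Xf be w (?R rh (T ph)) p = ?R rh (Xf be w (T ph)) p + (\<Sum>ta\<in>Basis. ?R (?k ta) (dird (0, ta) (T ph)) p)"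
   by (rule line.Xf_Rop[OF l cw_test_fun[OF rh] test_funD[OF tc[OF T ph]]])
  also have "?R rh (Xf be w (T ph)) p = ?R rh (T0 (P ph)) p + (\<Sum>ta\<in>Basis. ?R rh (T' ta (dird (0, ta) ph)) p)"
   unfolding X[OF ph]
   by (subst Rop_add_sum[OF l cw_test_fun[OF rh] tc[OF T0 P[OF ph]] tc[OF T' test_fun_dird[OF ph]]]) simp
  finally show "Xf be w (?R rh (T ph)) p = ?R rh (T0 (P ph)) p + (\<Sum>ta\<in>Basis. T'' ta (dird (0, ta) ph) p)"
   by (simp add: T''_def sum.distrib RR_center[OF T al ph])
 qed
 ultimately show ?thesis by blast
qed

text \<open>The field is passed inwards to a layer of the line \<open>l0\<close>, which absorbs it;
  every layer passed on the way leaves central derivatives.\<close>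

lemma RR_absorb:
 assumes bb: "bounded_bilinear be"
 shows "RR be ls T ==> all_lines be ls ==> l0 : set ls ==> EX T0 T'. RR be ls T0 & (ALL ta. RR be ls (T' ta)) \<and>
  (ALL ph:test_fun. Xf be (fst l0 ze) (T ph) = (%p. T0 ph p + (\<Sum>ta\<in>Basis. T' ta (dird (0, ta) ph) p)))"
proof (induction rule: RR.induct)
 case (RR_zero ls)
 show ?case by (intro exI[of _ "%ph p. 0"] exI[of _ "%ta ph p. 0"]) (auto intro: RR.RR_zero)
next
 case (RR_Nil c)
 then show ?case by simp
next
 case (RR_Cons rh ls T l)
 then have l: "line be (fst l) (snd l)" and al: "all_lines be ls" by (auto simp: all_lines_def)
 note tc = test_contD(1)[OF RR_test_cont[OF RR_Cons.hyps(2) al]]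
 show ?case
 proof (cases "l0 = l")
  case True
  obtain rh' where "rh' : test_fun"
   "!!ph. smo ph ==> Xf be (fst l ze) (line.Rop be (fst l) (snd l) rh ph) = line.Rop be (fst l) (snd l) rh' ph"
   using line.Xf_Rop_absorb[OF l RR_Cons.hyps(1)] by metis
  then show ?thesis using True
   by (intro exI[of _ "%ph. line.Rop be (fst l) (snd l) rh' (T ph)"] exI[of _ "%ta ph p. 0"])
     (auto intro: RR.RR_zero RR.RR_Cons RR_Cons.hyps simp: tc test_funD)
 next
  case False
  then have "l0 : set ls" using RR_Cons.prems by simp
  then obtain T0 T' where T0: "RR be ls T0" and T': "!!ta. RR be ls (T' ta)"
   "!!ph. ph : test_fun ==> Xf be (fst l0 ze) (T ph) = (%p. T0 ph p + (\<Sum>ta\<in>Basis. T' ta (dird (0, ta) ph) p))"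
   using RR_Cons.IH[OF al] by blast
  from RR_Xf_step[where P = "%ph. ph" and w = "fst l0 ze", OF l RR_Cons.hyps(1) al RR_Cons.hyps(2) T0 _ T']
  obtain T'' where "!!ta. RR be (l # ls) (T'' ta)" "!!ph. ph : test_fun ==>
   Xf be (fst l0 ze) (line.Rop be (fst l) (snd l) rh (T ph))
    = (%p. line.Rop be (fst l) (snd l) rh (T0 ph) p + (\<Sum>ta\<in>Basis. T'' ta (dird (0, ta) ph) p))"
   by auto
  then show ?thesis
   by (intro exI[of _ "%ph. line.Rop be (fst l) (snd l) rh (T0 ph)"] exI[of _ T''])
     (auto intro: RR.RR_Cons RR_Cons.hyps T0)
 qed
next
 case (RR_add ls T T')
 obtain V U where U: "RR be ls V" "!!ta. RR be ls (U ta)"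
  "!!ph. ph : test_fun ==> Xf be (fst l0 ze) (T ph) = (%p. V ph p + (\<Sum>ta\<in>Basis. U ta (dird (0, ta) ph) p))"
  using RR_add.IH(1)[OF RR_add.prems] by blast
 obtain V' U' where U': "RR be ls V'" "!!ta. RR be ls (U' ta)"
  "!!ph. ph : test_fun ==> Xf be (fst l0 ze) (T' ph) = (%p. V' ph p + (\<Sum>ta\<in>Basis. U' ta (dird (0, ta) ph) p))"
  using RR_add.IH(2)[OF RR_add.prems] by blast
 note tc = test_fun_diff[OF test_contD(1)[OF RR_test_cont]]
 show ?case
  using U U' RR_add.hyps RR_add.prems
  by (intro exI[of _ "%ph p. V ph p + V' ph p"] exI[of _ "%ta ph p. U ta ph p + U' ta ph p"])
    (auto intro!: RR.RR_add simp: Xf_add tc sum.distrib fun_eq_iff)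
qed

text \<open>The outermost layer takes the derivative, which is why the first line of the list must
  reach the direction. The list is the variable \<open>lls\<close> so that rule induction applies to
  \<open>RR\<close>.\<close>

lemma RR_center_absorb:
 assumes l: "line be (fst l) (snd l)" and onto: "snd l s = t"
 shows "RR be lls T ==> lls = l # ls ==> all_lines be lls ==>
  EX T1. RR be lls T1 & (ALL ph:test_fun. dird (0, t) (T ph) = T1 ph)"
proof (induction rule: RR.induct)
 case (RR_zero ls)
 show ?case by (intro exI[of _ "%ph p. 0"]) (auto intro: RR.RR_zero)
next
 case (RR_Cons rh ls' T l')
 then have e: "l' = l" "ls' = ls" and al: "all_lines be ls" by (auto simp: all_lines_def)
 note tc = test_contD(1)[OF RR_test_cont[OF RR_Cons.hyps(2)[unfolded e] al]]
 obtain rh' where "rh' : test_fun"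
  "!!ph. smo ph ==> dird (0, t) (line.Rop be (fst l) (snd l) rh ph) = line.Rop be (fst l) (snd l) rh' ph"
  using line.dird_Rop_absorb[OF l RR_Cons.hyps(1) onto] by metis
 then show ?case
  by (intro exI[of _ "%ph. line.Rop be (fst l) (snd l) rh' (T ph)"])
    (use RR_Cons.hyps in "auto intro!: RR.RR_Cons simp: e tc test_funD")
next
 case (RR_add ls T T')
 obtain U where "RR be ls U" "!!ph. ph : test_fun ==> dird (0, t) (T ph) = U ph" using RR_add by metis
 moreover obtain U' where "RR be ls U'" "!!ph. ph : test_fun ==> dird (0, t) (T' ph) = U' ph" using RR_add by metis
 moreover note tc = test_fun_diff[OF test_contD(1)[OF RR_test_cont]]
 ultimately show ?case using RR_add.hyps RR_add.prems
  by (intro exI[of _ "%ph p. U ph p + U' ph p"]) (auto intro!: RR.RR_add simp: dird_add tc fun_eq_iff)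
qed simp

text \<open>If the first line reaches the whole centre and all lines together span, then every derivative
  of an operator in \<open>RR be ls\<close> is again of this form, without derivatives of the argument.\<close>

definition good_lines :: "('x::euclidean_space => 'x => 't::euclidean_space) => ((real^4 => 'x) * (real^3 => 't)) list => bool" where
 "good_lines be ls \<longleftrightarrow> bounded_bilinear be & all_lines be ls & ls ~= [] & surj (snd (hd ls)) & span (\<Union>l\<in>set ls. range (fst l)) = UNIV"

lemma good_lines_center:
 assumes g: "good_lines be ls" and T: "RR be ls T"
 shows "EX T1. RR be ls T1 & (ALL ph:test_fun. dird (0, t) (T ph) = T1 ph)"
proof -
 obtain s where s: "snd (hd ls) s = t" using g unfolding good_lines_def surj_def by metis
 have ls: "ls = hd ls # tl ls" using g by (simp add: good_lines_def)
 have l: "line be (fst (hd ls)) (snd (hd ls))" using g by (simp add: good_lines_def all_lines_def)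
 show ?thesis
  by (rule RR_center_absorb[OF l s T ls]) (use g in "simp add: good_lines_def")
qed

text \<open>The central derivatives left by \<open>RR_absorb\<close> are moved outside by
  \<open>RR_center\<close> and absorbed by the first line. Since the lines span, every direction
  \<open>w\<close> is reached.\<close>

lemma good_lines_Xf:
 assumes g: "good_lines be ls" and T: "RR be ls T"
 shows "EX T1. RR be ls T1 & (ALL ph:test_fun. Xf be w (T ph) = T1 ph)"
proof -
 have bb: "bounded_bilinear be" and al: "all_lines be ls" using g by (auto simp: good_lines_def)
 have Td: "T ph differentiable (at p)" if "ph : test_fun" for ph p
  by (rule test_fun_diff[OF test_contD(1)[OF RR_test_cont[OF T al] that]])
 have Xlin: "Xf be (c *\<^sub>R x + y) f p = of_real c * Xf be x f p + Xf be y f p" if "f differentiable (at p)" for c x y f p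
 proof -
  have "(c *\<^sub>R x + y, 2 *\<^sub>R be (fst p) (c *\<^sub>R x + y)) = c *\<^sub>R (x, 2 *\<^sub>R be (fst p) x) + (y, 2 *\<^sub>R be (fst p) y)"
   by (simp add: bounded_bilinear.add_right[OF bb] bounded_bilinear.scaleR_right[OF bb] scaleR_add_right)
  then show ?thesis unfolding Xf_def using that by (simp only: dird_dir_add dird_dir_scale)
 qed
 have "w : span (\<Union>l\<in>set ls. range (fst l))" using g by (simp add: good_lines_def)
 then show ?thesis
 proof (induction w rule: span_induct_alt)
  case base
  have "Xf be 0 (T ph) = (%p. 0)" if "ph : test_fun" for ph
   using dird_dir_zero[OF Td[OF that]] by (simp add: Xf_def bounded_bilinear.zero_right[OF bb] fun_eq_iff zero_prod_def)
  then show ?case by (intro exI[of _ "%ph p. 0"]) (auto intro: RR_zero)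
 next
  case (step c x y)
  obtain l ze where l: "l : set ls" and x: "x = fst l ze" using step.hyps by auto
  obtain T0 T' where T0: "RR be ls T0" and T': "!!ta. RR be ls (T' ta)"
   and X: "!!ph. ph : test_fun ==> Xf be x (T ph) = (%p. T0 ph p + (\<Sum>ta\<in>Basis. T' ta (dird (0, ta) ph) p))"
   using RR_absorb[OF bb T al l, of ze] unfolding x by blast
  have "EX U. RR be ls U & (ALL ph:test_fun. dird (0, ta) (T' ta ph) = U ph)" for ta
   by (rule good_lines_center[OF g T'])
  then obtain U where U: "!!ta. RR be ls (U ta)" "!!ta ph. ph : test_fun ==> dird (0, ta) (T' ta ph) = U ta ph" by metis
  obtain V where V: "RR be ls V" "!!ph. ph : test_fun ==> Xf be y (T ph) = V ph" using step.IH by metis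
  have "Xf be (c *\<^sub>R x + y) (T ph) = (%p. of_real c * (T0 ph p + (\<Sum>ta\<in>Basis. U ta ph p)) + V ph p)" if ph: "ph : test_fun" for ph
   using X[OF ph] V(2)[OF ph] U(2)[OF ph] RR_center[OF T' al ph] by (simp add: Xlin[OF Td[OF ph]] fun_eq_iff)
  then show ?case
   by (intro exI[of _ "%ph p. of_real c * (T0 ph p + (\<Sum>ta\<in>Basis. U ta ph p)) + V ph p"])
     (auto intro!: RR_add RR_cmult RR_sum T0 U V al)
 qed
qed

text \<open>Constant directions are combinations of left invariant fields and central ones with
  coefficients depending on the point. The smooth factors make the class closed under the ordinary
  derivatives that define the norms.\<close>

inductive AA :: "('x::euclidean_space => 'x => 't::euclidean_space) => ((real^4 => 'x) * (real^3 => 't)) list =>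
  (('x * 't => complex) => 'x * 't => complex) => bool" for be ls where
 AA_base: "smo a ==> RR be ls T ==> AA be ls (%ph p. a p * T ph p)"
| AA_add: "AA be ls P ==> AA be ls Q ==> AA be ls (%ph p. P ph p + Q ph p)"

lemma AA_sum: "finite I ==> (!!i. i : I ==> AA be ls (P i)) ==> AA be ls (%ph p. \<Sum>i\<in>I. P i ph p)"
proof (induction I rule: finite_induct)
 case empty
 show ?case using AA_base[OF smooth_on_const[of UNIV 0] RR_zero, of be ls] by simp
qed (auto intro: AA_add)

lemma AA_smooth: "AA be ls P ==> all_lines be ls ==> ph : test_fun ==> smo (P ph)"
proof (induction rule: AA.induct)
 case (AA_base a T)
 then show ?case using test_funD[OF test_contD(1)[OF RR_test_cont[OF AA_base(2)]]] by (auto intro: smooth_intros)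
qed (auto intro: smooth_intros)

lemma AA_dird:
 assumes g: "good_lines be ls"
 shows "AA be ls P ==> EX Q. AA be ls Q & (ALL ph:test_fun. dird v (P ph) = Q ph)"
proof (induction rule: AA.induct)
 case (AA_base a T)
 have bb: "bounded_bilinear be" and al: "all_lines be ls" using g by (auto simp: good_lines_def)
 obtain U where U: "RR be ls U" "!!ph. ph : test_fun ==> Xf be (fst v) (T ph) = U ph"
  using good_lines_Xf[OF g AA_base(2)] by metis
 obtain V where V: "!!ta. RR be ls (V ta)" "!!ta ph. ph : test_fun ==> dird (0, ta) (T ph) = V ta ph"
  using good_lines_center[OF g AA_base(2)] by metis
 define b where "b ta p = complex_of_real ((snd v - 2 *\<^sub>R be (fst p) (fst v)) \<bullet> ta)" for ta and p :: "'a * 'b"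
 have b: "smo (b ta)" for ta unfolding b_def[abs_def]
  by (intro smooth_intros smooth_bl[OF bounded_bilinear.bounded_linear_left[OF bb]]) auto
 define Q where "Q ph p = dird v a p * T ph p + (a p * U ph p + (\<Sum>ta\<in>Basis. (a p * b ta p) * V ta ph p))" for ph p
 have "dird v (%p. a p * T ph p) p = Q ph p" if ph: "ph : test_fun" for ph p
 proof -
  have d: "T ph differentiable (at p)"
   by (rule test_fun_diff[OF test_contD(1)[OF RR_test_cont[OF AA_base(2) al] ph]])
  have lin: "linear (%v. dird v (T ph) p)" by (rule dird_linear[OF d])
  have lin2: "linear (%t. dird (0, t) (T ph) p)"
   by (rule linearI; use linear_add[OF lin] linear_scale[OF lin] in \<open>metis (no_types, lifting) add.right_neutral add_Pair scaleR_Pair scaleR_zero_right\<close>)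
  have "dird v (T ph) p = Xf be (fst v) (T ph) p + dird (0, snd v - 2 *\<^sub>R be (fst p) (fst v)) (T ph) p"
   unfolding Xf_def using linear_add[OF lin, of "(fst v, 2 *\<^sub>R be (fst p) (fst v))" "(0, snd v - 2 *\<^sub>R be (fst p) (fst v))"] by simp
  then have "dird v (T ph) p = U ph p + (\<Sum>ta\<in>Basis. b ta p * V ta ph p)"
   using linear_Basis_expand[OF lin2, of "snd v - 2 *\<^sub>R be (fst p) (fst v)"] U(2)[OF ph] V(2)[OF ph]
   by (simp add: b_def scaleR_conv_of_real)
  then show ?thesis
   by (subst dird_mult) (use smooth_diff[OF AA_base(1)] d in "auto simp: Q_def algebra_simps sum_distrib_left")
 qed
 moreover have "AA be ls Q" unfolding Q_def[abs_def]
  by (intro AA_add AA.AA_base AA_sum smooth_on_dird smooth_on_mult b U V AA_base open_UNIV finite_Basis)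
 ultimately show ?case by blast
next
 case (AA_add P Q)
 have al: "all_lines be ls" using g by (auto simp: good_lines_def)
 obtain P' where P': "AA be ls P'" "!!ph. ph : test_fun ==> dird v (P ph) = P' ph" using AA_add.IH by metis
 obtain Q' where Q': "AA be ls Q'" "!!ph. ph : test_fun ==> dird v (Q ph) = Q' ph" using AA_add.IH by metis
 have "dird v (%p. P ph p + Q ph p) = (%p. P' ph p + Q' ph p)" if ph: "ph : test_fun" for ph
  using P'(2)[OF ph] Q'(2)[OF ph]
  by (simp add: fun_eq_iff dird_add smooth_diff[OF AA_smooth[OF AA_add.hyps(1) al ph]]
    smooth_diff[OF AA_smooth[OF AA_add.hyps(2) al ph]])
 then show ?case using AA.AA_add[OF P'(1) Q'(1)] by blast
qed

lemma AA_cb: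
 assumes al: "all_lines be ls"
 shows "AA be ls P ==> cb 0 P"
proof (induction rule: AA.induct)
 case (AA_base a T)
 show ?case
 proof (rule cb_zeroI)
  fix K :: "('a * 'b) set" assume K: "compact K"
  obtain B where B: "B >= 0" "!!ph p. ph : test_in K ==> cmod (T ph p) <= B * Cm_norm 0 ph"
   using cb_zeroE[OF RR_cb[OF AA_base(2) al] K] by metis
  obtain K' where K': "compact K'" "!!ph. ph : test_in K ==> T ph : test_in K'"
   using test_contE1[OF RR_test_cont[OF AA_base(2) al] K] by metis
  have "bounded (a ` K')"
   using compact_continuous_image[OF continuous_on_subset[OF smooth_cont[OF AA_base(1)]] K'(1)]
   by (auto intro: compact_imp_bounded)
  then obtain A where A: "!!p. p : K' ==> cmod (a p) <= A" by (auto simp: bounded_iff)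
  have "cmod (a p * T ph p) <= (\<bar>A\<bar> * B) * Cm_norm 0 ph" if ph: "ph : test_in K" for ph p
  proof (cases "p : K'")
   case True
   show ?thesis unfolding norm_mult mult.assoc using A[OF True] B(2)[OF ph] by (intro mult_mono) auto
  qed (use test_in_zero[OF K'(2)[OF ph]] B(1) Cm_norm_nonneg[OF test_in_test[OF ph]] in simp)
  then show "EX C>=0. ALL ph:test_in K. ALL p. cmod (a p * T ph p) <= C * Cm_norm 0 ph"
   using B(1) by (intro exI[of _ "\<bar>A\<bar> * B"]) auto
 qed
qed (rule cb_add)

definition order0 :: "(('a::euclidean_space => complex) => complex) => bool" where
 "order0 u \<longleftrightarrow> u : distr & (ALL K. compact K --> (EX B>=0. ALL ph:test_in K. cmod (u ph) <= B * Cm_norm 0 ph))"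

text \<open>Every derivative of \<open>T ph\<close> lies in the class \<open>AA\<close> applied to
  \<open>ph\<close>, hence is bounded by the supremum norm of \<open>ph\<close>. Whatever the order
  of \<open>G\<close> on the enlarged compact set, \<open>G\<close> after \<open>T\<close> has order
  zero.\<close>

lemma order0_pull:
 assumes g: "good_lines be ls" and T: "RR be ls T" and G: "G : distr"
 shows "order0 (dist_pull T G)"
 unfolding order0_def
proof (intro conjI allI impI)
 have bb: "bounded_bilinear be" and al: "all_lines be ls" using g by (auto simp: good_lines_def)
 note tc = RR_test_cont[OF T al]
 show "dist_pull T G : distr" by (rule dist_pull_distr[OF tc G])
 fix K :: "('a * 'b) set" assume K: "compact K"
 obtain K' where K': "compact K'" "!!ph. ph : test_in K ==> T ph : test_in K'" using test_contE1[OF tc K] by metis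
 obtain C m where C: "C >= 0" "!!ph. ph : test_in K' ==> cmod (G ph) <= C * Cm_norm m ph" using distrE[OF G K'(1)] by metis
 have "EX Q. AA be ls Q & (ALL ph:test_fun. iter_dird vs (T ph) = Q ph)" for vs
 proof (induction vs)
  case Nil
  show ?case using AA_base[OF smooth_on_const[of UNIV 1] T] by (intro exI[of _ T]) simp
 next
  case (Cons v vs)
  then obtain Q where "AA be ls Q" "!!ph. ph : test_fun ==> iter_dird vs (T ph) = Q ph" by blast
  then show ?case using AA_dird[OF g, of Q v] by (metis iter_dird_Cons)
 qed
 then have "cb 0 (%ph. iter_dird vs (T ph))" for vs using AA_cb[OF al] cb_cong by metis
 from Cm_norm_bound[OF this K, of m] obtain D where D: "D >= 0" "!!ph. ph : test_in K ==> Cm_norm m (T ph) <= D * Cm_norm 0 ph"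
  by auto
 have "cmod (dist_pull T G ph) <= (C * D) * Cm_norm 0 ph" if ph: "ph : test_in K" for ph
  using C(2)[OF K'(2)[OF ph]] mult_left_mono[OF D(2)[OF ph] C(1)] test_in_test[OF ph] by (simp add: dist_pull_def mult.assoc)
 then show "EX B>=0. ALL ph:test_in K. cmod (dist_pull T G ph) <= B * Cm_norm 0 ph"
  using C(1) D(1) by (intro exI[of _ "C * D"]) auto
qed

lemma line_parametrix:
 assumes l: "line be E C" and par: "cw w" "rh : test_fun"
  "!!ps. smo ps ==> (LI h. w h * LN ps h) = ps 0 + (LI h. rh h * ps h)"
  and ph: "ph : test_fun"
 shows "ph p = line.Rop be E C w (line.LM be E ph) p - line.Rop be E C rh ph p"
proof -
 have sm: "smo (%h. ph (line.act be E C p h))"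
  by (intro smooth_comp[OF test_funD[OF ph]] line.smooth_act[OF l] smooth_intros) auto
 show ?thesis
  using par(3)[OF sm] line.LN_act[OF l test_funD[OF ph]] line.act_0[OF l] by (simp add: line.Rop_def[OF l])
qed

text \<open>The parametrix of the first line splits \<open>G\<close> into a term in the
  sub-Laplacian of that line and a smooth remainder, which is treated in the same way with the next
  line. What is left in the end is \<open>G\<close> after the composed remainders.\<close>

lemma reduce_to_order0:
 assumes al: "all_lines be ls" and G: "G : distr"
 shows "EX us T. length us = length ls & set us <= distr & RR be ls T \<and>
  (ALL ph:test_fun. G ph = (\<Sum>i<length ls. (us ! i) (line.LM be (fst (ls ! i)) ph)) + dist_pull T G ph)"
 using assms
proof (induction ls arbitrary: G)
 case Nil
 show ?case
  by (intro exI[of _ "[]"] exI[of _ "%ph p. 1 * ph p"] conjI RR_Nil) (auto simp: dist_pull_def)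
next
 case (Cons l ls)
 have l: "line be (fst l) (snd l)" and al: "all_lines be ls" using Cons.prems by (auto simp: all_lines_def)
 obtain w rh where par: "cw w" "rh : test_fun"
  "!!ps. smo ps ==> (LI h. w h * LN ps h) = ps 0 + (LI h. rh h * ps h)"
  using parametrix by blast
 let ?R = "line.Rop be (fst l) (snd l)"
 have Rw: "test_cont (?R w)" and Rrh: "test_cont (?R rh)"
  by (intro line.test_cont_Rop[OF l] par(1) cw_test_fun[OF par(2)])+
 define u where "u = dist_pull (?R w) G"
 \<comment> \<open>The minus sign of the remainder goes into the weight, so that the composed
   operator stays in \<open>RR\<close>.\<close>
 define G1 where "G1 = dist_pull (%ph. ?R (%h. (- 1) * rh h) ph) G"
 have mrh: "(%h. (- 1) * rh h) : test_fun" by (rule test_fun_cmult[OF par(2)])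
 have Rm: "test_cont (?R (%h. (- 1) * rh h))" by (rule line.test_cont_Rop[OF l cw_test_fun[OF mrh]])
 have u: "u : distr" and G1: "G1 : distr"
  unfolding u_def G1_def by (intro dist_pull_distr Rw Rm Cons.prems)+
 obtain us T where us: "length us = length ls" "set us <= distr" and T: "RR be ls T"
  and e: "!!ph. ph : test_fun ==> G1 ph = (\<Sum>i<length ls. (us ! i) (line.LM be (fst (ls ! i)) ph)) + dist_pull T G1 ph"
  using Cons.IH[OF al G1] by blast
 define T2 where "T2 ph = ?R (%h. (- 1) * rh h) (T ph)" for ph
 have T2: "RR be (l # ls) T2" unfolding T2_def[abs_def] by (rule RR_Cons[OF mrh T])
 have "G ph = (\<Sum>i<length (l # ls). ((u # us) ! i) (line.LM be (fst ((l # ls) ! i)) ph)) + dist_pull T2 G ph"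
  if ph: "ph : test_fun" for ph
 proof -
  have LM: "line.LM be (fst l) ph : test_fun" by (rule test_contD(1)[OF line.test_cont_LM[OF l] ph])
  have "(%p. ?R w (line.LM be (fst l) ph) p + ?R (%h. (- 1) * rh h) ph p) = ph"
  proof
   fix p
   show "?R w (line.LM be (fst l) ph) p + ?R (%h. (- 1) * rh h) ph p = ph p"
    using line_parametrix[OF l par(1,2) par(3) ph, of p] by (simp add: line.Rop_def[OF l, of "%h. - _ h"] line.Rop_def[OF l, of rh])
  qed
  then have "G ph = G (?R w (line.LM be (fst l) ph)) + G (?R (%h. (- 1) * rh h) ph)"
   using distrD(1)[OF Cons.prems(2) test_contD(1)[OF Rw LM] test_contD(1)[OF Rm ph]] by (simp only:)
  also have "... = u (line.LM be (fst l) ph) + G1 ph" using LM ph by (simp add: u_def G1_def dist_pull_def)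
  also have "... = u (line.LM be (fst l) ph) + ((\<Sum>i<length ls. (us ! i) (line.LM be (fst (ls ! i)) ph)) + dist_pull T G1 ph)"
   by (simp only: e[OF ph])
  also have "dist_pull T G1 ph = dist_pull T2 G ph"
   using ph test_contD(1)[OF RR_test_cont[OF T al] ph] by (simp add: dist_pull_def G1_def T2_def)
  finally show ?thesis by (simp add: sum.lessThan_Suc_shift del: sum.lessThan_Suc)
 qed
 then show ?case using us u T2
  by (intro exI[of _ "u # us"] exI[of _ T2]) auto
qed

section \<open>Taylor expansion of the translated fundamental solution\<close>

text \<open>The first four components of the product of the inverse of \<open>k\<close> with the
  dilated \<open>g\<close>, for a complex dilation parameter \<open>s\<close>; \<open>Dc\<close>
  gives the other three.\<close>

definition zc :: "hN => hN => complex => 4 => complex" where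
 "zc k g s i = s * of_real (fst g $ i) - of_real (fst k $ i)"

definition Dc :: "hN => hN => complex => 3 => complex" where
 "Dc k g s ga = s\<^sup>2 * of_real (snd g $ ga) - of_real (snd k $ ga) - 2 * s * of_real (om (fst k) (fst g) $ ga)"

text \<open>For real \<open>s\<close> this is \<open>fR 0\<close> of \<open>k\<^sup>-\<^sup>1 \<delta>\<^sub>s g\<close>, where \<open>\<delta>\<^sub>s (x, t) = (s x, s\<^sup>2 t)\<close>.\<close>

definition QC :: "hN => hN => complex => complex" where
 "QC k g s = (\<Sum>i\<in>UNIV. (zc k g s i)\<^sup>2)\<^sup>2 + (\<Sum>ga\<in>UNIV. (Dc k g s ga)\<^sup>2)"

definition GC :: "hN => hN => complex => complex" where
 "GC k g s = inverse (QC k g s) ^ 2"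

lemma QC_one: "QC k g 1 = of_real (fR 0 (hm (hinv k) g))"
proof -
 have "om (- fst k) (fst g) = - om (fst k) (fst g)"
  by (rule bounded_bilinear.minus_left[OF bb_om])
 then show ?thesis
  unfolding QC_def fR_complex by (simp add: zc_def Dc_def hm_def hinv_def algebra_simps)
qed

lemma smooth_on_QC:
 fixes k g :: "'a::real_normed_vector => hN" and s :: "'a => complex"
 assumes "open S" "smooth_on S k" "smooth_on S g" "smooth_on S s"
 shows "smooth_on S (%x. QC (k x) (g x) (s x))"
 unfolding QC_def zc_def Dc_def
 by (intro smooth_intros smooth_on_bilinear[OF bb_om] assms)

lemma smooth_on_GC:
 fixes k g :: "'a::real_normed_vector => hN" and s :: "'a => complex"
 assumes "open S" "smooth_on S k" "smooth_on S g" "smooth_on S s" "!!x. x : S ==> QC (k x) (g x) (s x) ~= 0"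
 shows "smooth_on S (%x. GC (k x) (g x) (s x))"
 unfolding GC_def by (intro smooth_intros smooth_on_QC assms)

text \<open>Let \<open>ny\<close> be the gauge of \<open>k\<close> and \<open>a\<close> that of the
  dilated \<open>g\<close>. Since \<open>a <= ny / 1000\<close>, every entry of
  \<open>QC k g s\<close> differs from its value at \<open>s = 0\<close> by a small multiple of the
  matching power of \<open>ny\<close>, and the errors add up to less than
  \<open>fR 0 k = ny ^ 4\<close>.\<close>

lemma QC_nonzero:
 assumes le: "cmod s ^ 4 * fR 0 g <= (1 / 1000) ^ 4 * fR 0 k" and k: "k ~= 0"
 shows "QC k g s ~= 0"
proof -
 have pos: "fR 0 k > 0" using fR_pos[of 0 k] k by simp
 define ny where "ny = sqrt (sqrt (fR 0 k))"
 define my where "my = sqrt (sqrt (fR 0 g))"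
 have r4: "sqrt (sqrt a) ^ 4 = a" if "a >= 0" for a :: real
 proof -
  have "sqrt (sqrt a) ^ 4 = ((sqrt (sqrt a))\<^sup>2)\<^sup>2" unfolding power_mult[symmetric] by simp
  then show ?thesis using that by simp
 qed
 have ny: "ny > 0" "ny ^ 4 = fR 0 k" using pos by (auto simp: ny_def r4)
 have my: "my >= 0" "my ^ 4 = fR 0 g" using fR_nonneg[of 0 g] by (auto simp: my_def r4)
 have bnd: "\<bar>fst h $ i\<bar> <= n & \<bar>snd h $ ga\<bar> <= n\<^sup>2 & fst h \<bullet> fst h <= n\<^sup>2" if n: "n >= 0" "n ^ 4 = fR 0 h" for h n i ga
 proof -
  have n4: "(n\<^sup>2)\<^sup>2 = (fst h \<bullet> fst h)\<^sup>2 + snd h \<bullet> snd h" using n(2) by (simp add: fR_def)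
  have x: "fst h \<bullet> fst h <= n\<^sup>2"
   by (rule power2_le_imp_le) (use n4 inner_ge_zero[of "snd h"] in auto)
  have xi: "(fst h $ i)\<^sup>2 <= fst h \<bullet> fst h"
   unfolding inner_vec_def using member_le_sum[of i UNIV "%i. fst h $ i * fst h $ i"] by (simp add: power2_eq_square)
  have t: "(snd h $ ga)\<^sup>2 <= snd h \<bullet> snd h"
   unfolding inner_vec_def using member_le_sum[of ga UNIV "%ga. snd h $ ga * snd h $ ga"] by (simp add: power2_eq_square)
  have "\<bar>fst h $ i\<bar> <= n"
  proof -
   have "(fst h $ i)\<^sup>2 <= n\<^sup>2" using xi x by linarith
   then have "\<bar>fst h $ i\<bar> <= \<bar>n\<bar>" by (simp only: abs_le_square_iff)
   then show ?thesis using n(1) by simp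
  qed
  moreover have "\<bar>snd h $ ga\<bar> <= n\<^sup>2"
  proof -
   have "(snd h $ ga)\<^sup>2 <= (n\<^sup>2)\<^sup>2" using t n4 zero_le_power2[of "fst h \<bullet> fst h"] by linarith
   then have "\<bar>snd h $ ga\<bar> <= \<bar>n\<^sup>2\<bar>" by (simp only: abs_le_square_iff)
   then show ?thesis by simp
  qed
  ultimately show ?thesis using x by simp
 qed
 define a where "a = cmod s * my"
 have a: "0 <= a" "a <= 1 / 1000 * ny"
 proof -
  show "0 <= a" using my by (simp add: a_def)
  have "a ^ 4 <= (1 / 1000 * ny) ^ 4" using le by (simp only: a_def power_mult_distrib my(2) ny(2))
  then show "a <= 1 / 1000 * ny" by (rule power_le_imp_le_base[of _ 3, simplified]) (use ny in auto)
 qed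
 have av: "a <= ny" using a ny by linarith
 have any: "a * ny <= 1 / 1000 * ny\<^sup>2" using mult_right_mono[OF a(2), of ny] ny(1) by (simp add: power2_eq_square)
 have k1: "\<bar>fst k $ i\<bar> <= ny" "\<bar>snd k $ ga\<bar> <= ny\<^sup>2" "fst k \<bullet> fst k <= ny\<^sup>2" for i ga
  using bnd[of ny k i ga] ny by auto
 have g1: "cmod (s * of_real (fst g $ i)) <= a" "cmod (s\<^sup>2 * of_real (snd g $ ga)) <= a\<^sup>2" for i ga
  using bnd[of my g i ga] my by (auto simp: a_def norm_mult norm_power power_mult_distrib intro!: mult_left_mono)
 \<comment> \<open>Squaring a number of size at most \<open>Y\<close> turns an error
   \<open>d <= Y\<close> into one of at most \<open>3 * (d * Y)\<close>.\<close>
 have sqd: "cmod (u\<^sup>2 - of_real (y\<^sup>2)) <= 3 * (d * Y)" if "cmod (u - of_real y) <= d" "\<bar>y\<bar> <= Y" "d <= Y" for u y d Y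
 proof -
  have "u\<^sup>2 - of_real (y\<^sup>2) = (u - of_real y) * ((u - of_real y) + 2 * of_real y)" by (simp add: power2_eq_square algebra_simps)
  moreover have "cmod ((u - of_real y) + 2 * of_real y) <= 3 * Y"
   using norm_triangle_ineq[of "u - of_real y" "2 * of_real y"] that by (simp add: norm_mult)
  ultimately have "cmod (u\<^sup>2 - of_real (y\<^sup>2)) <= d * (3 * Y)"
   unfolding norm_mult by (simp only:) (use that in "auto simp: norm_mult intro!: mult_mono order_trans[OF norm_ge_zero]")
  then show ?thesis by simp
 qed
 have sq: "cmod ((zc k g s i)\<^sup>2 - of_real ((fst k $ i)\<^sup>2)) <= 3 * (a * ny)" for i
  using sqd[of "zc k g s i" "- fst k $ i" a ny] g1(1)[of i] k1(1)[of i] av by (simp add: zc_def)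
 define A where "A = (\<Sum>i\<in>UNIV. (zc k g s i)\<^sup>2)"
 define ka where "ka = fst k \<bullet> fst k"
 have A1: "cmod (A - of_real ka) <= 12 * (a * ny)"
 proof -
  have "A - of_real ka = (\<Sum>i\<in>UNIV. (zc k g s i)\<^sup>2 - of_real ((fst k $ i)\<^sup>2))"
   by (simp add: A_def ka_def inner_vec_def sum_subtractf power2_eq_square)
  also have "cmod ... <= (\<Sum>i\<in>(UNIV::4 set). 3 * (a * ny))" by (rule sum_norm_le) (rule sq)
  finally show ?thesis by simp
 qed
 have ka0: "0 <= ka" "ka <= ny\<^sup>2" using k1 by (auto simp: ka_def)
 have A2: "cmod (A\<^sup>2 - of_real (ka\<^sup>2)) <= 36 / 1000 * ny ^ 4"
  using sqd[of A ka "12 / 1000 * ny\<^sup>2" "ny\<^sup>2"] A1 any ka0 by (simp add: power4_eq_xxxx power2_eq_square)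
 have D2: "cmod ((Dc k g s ga)\<^sup>2 - of_real ((snd k $ ga)\<^sup>2)) <= 27 / 1000 * ny ^ 4" for ga
 proof -
  have om: "cmod (s * of_real (om (fst k) (fst g) $ ga)) <= 4 * (a * ny)"
  proof -
   have t: "cmod (of_real (fst k $ i) * (s * of_real (fst g $ j))) <= ny * a" for i j
    unfolding norm_mult[of "of_real (fst k $ i)"] using k1(1)[of i] g1(1)[of j] ny by (intro mult_mono) auto
   have "s * of_real (om (fst k) (fst g) $ ga) = omv ga (%i. of_real (fst k $ i)) (%i. s * of_real (fst g $ i))"
    by (simp add: om_nth of_real_omv omv_def algebra_simps)
   also have "cmod ... <= 4 * (ny * a)"
   proof -
    have "cmod (x * y - z * w + u * v - p * q) <= 4 * c"
     if "cmod (x * y) <= c" "cmod (z * w) <= c" "cmod (u * v) <= c" "cmod (p * q) <= c" for x y z w u v p q c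
     using norm_triangle_ineq4[of "x * y - z * w + u * v" "p * q"] norm_triangle_ineq[of "x * y - z * w" "u * v"]
      norm_triangle_ineq4[of "x * y" "z * w"] that by linarith
    then show ?thesis unfolding omv_def using t by (cases "ga = 1"; cases "ga = 2") auto
   qed
   finally show ?thesis by (simp add: mult.commute)
  qed
  define d where "d = s\<^sup>2 * of_real (snd g $ ga) - 2 * (s * of_real (om (fst k) (fst g) $ ga))"
  have "cmod d <= a\<^sup>2 + 8 * (a * ny)"
   using norm_triangle_ineq4[of "s\<^sup>2 * of_real (snd g $ ga)" "2 * (s * of_real (om (fst k) (fst g) $ ga))"] g1(2)[of ga] om
   by (simp add: d_def norm_mult)
  moreover have "a\<^sup>2 <= a * ny" using av a by (simp add: power2_eq_square mult_left_mono)
  ultimately have d: "cmod d <= 9 / 1000 * ny\<^sup>2" using any by simp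
  moreover have e: "Dc k g s ga - of_real (- snd k $ ga) = d" by (simp add: Dc_def d_def)
  moreover have "ny ^ 4 = ny\<^sup>2 * ny\<^sup>2" by (simp add: power2_eq_square power4_eq_xxxx)
  ultimately show ?thesis
   using sqd[of "Dc k g s ga" "- snd k $ ga" "9 / 1000 * ny\<^sup>2" "ny\<^sup>2", unfolded e] k1(2)[of ga] by simp
 qed
 \<comment> \<open>36 thousandths come from the square of \<open>A\<close> and 27 from each of the
   three central components; the sum 117 is far below 1000.\<close>
 have "cmod (QC k g s - of_real (fR 0 k)) <= 117 / 1000 * ny ^ 4"
 proof -
  have e: "QC k g s - of_real (fR 0 k) = (A\<^sup>2 - of_real (ka\<^sup>2)) + (\<Sum>ga\<in>UNIV. (Dc k g s ga)\<^sup>2 - of_real ((snd k $ ga)\<^sup>2))"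
   by (simp add: QC_def A_def ka_def fR_def sum_subtractf inner_vec_def power2_eq_square)
  have "cmod (\<Sum>ga\<in>UNIV. (Dc k g s ga)\<^sup>2 - of_real ((snd k $ ga)\<^sup>2)) <= (\<Sum>ga\<in>(UNIV::3 set). 27 / 1000 * ny ^ 4)"
   by (rule sum_norm_le) (rule D2)
  then show ?thesis unfolding e using A2
    norm_triangle_ineq[of "A\<^sup>2 - of_real (ka\<^sup>2)" "\<Sum>ga\<in>UNIV. (Dc k g s ga)\<^sup>2 - of_real ((snd k $ ga)\<^sup>2)"] by simp
 qed
 moreover have "ny ^ 4 > 0" by (rule zero_less_power[OF ny(1)])
 ultimately show ?thesis using ny(2) by (auto simp: norm_minus_commute)
qed

text \<open>The circle of radius \<open>r\<close> over the unit interval. Contour integrals are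
  rewritten as Lebesgue integrals with the weight \<open>unit_ind\<close>, so that the lemmas on
  parameter integrals apply to them.\<close>

definition cir :: "real => real => complex" where
 "cir r x = of_real r * exp (2 * of_real pi * \<i> * of_real x)"

lemma cmod_cir: "cmod (cir r x) = \<bar>r\<bar>"
proof -
 have "cmod (exp (2 * complex_of_real pi * \<i> * of_real x)) = 1"
  using norm_exp_i_times[of "2 * pi * x"] by (simp add: algebra_simps)
 then show ?thesis by (simp add: cir_def norm_mult)
qed

lemma cir_nonzero: "r ~= 0 ==> cir r x ~= 0"
 by (simp add: cir_def)

lemma smooth_on_cir: "open S ==> smooth_on S f ==> smooth_on S (%x. cir r (f x))"
 unfolding cir_def by (intro smooth_intros)

definition unit_ind :: "real => complex" where
 "unit_ind x = of_real (indicator {0..1} x)"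

lemma cw_unit_ind: "cont f ==> cw (%x. unit_ind x * f x)"
proof (rule cw_mult_continuous)
 have "lint unit_ind"
  using borel_integrable_compact[of "{0..1::real}" "%x. 1::complex"] by (simp add: unit_ind_def[abs_def] scaleR_conv_of_real)
 then show "cw unit_ind"
  unfolding cw_def by (intro conjI exI[of _ "{0..1}"]) (auto simp: unit_ind_def)
qed

lemma contour_integral_circle:
 assumes f: "(f has_contour_integral I) (circlepath 0 r)" and r: "r > 0" and c: "continuous_on (sphere 0 r) f"
 shows "(LI x. unit_ind x * (f (cir r x) * (2 * of_real pi * \<i> * cir r x))) = I"
proof -
 have e: "circlepath 0 r x = cir r x" for x by (simp add: circlepath cir_def)
 have vd: "vector_derivative (circlepath 0 r) (at x within {0..1}) = 2 * of_real pi * \<i> * cir r x" if "x : {0..1}" for x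
  using vector_derivative_circlepath01[of x 0 r] that by (simp add: cir_def)
 have "((%x. f (circlepath 0 r x) * vector_derivative (circlepath 0 r) (at x within {0..1})) has_integral I) {0..1}"
  using f by (simp add: has_contour_integral_def)
 then have HI: "((%x. f (cir r x) * (2 * of_real pi * \<i> * cir r x)) has_integral I) {0..1}"
  by (rule has_integral_eq[rotated]) (simp add: e vd)
 have ci: "cont (cir r)"
  using smooth_cont[OF smooth_on_cir[OF open_UNIV smooth_on_ident]] by simp
 have cf: "continuous_on {0..1} (%x. f (cir r x) * (2 * of_real pi * \<i> * cir r x))"
  by (intro continuous_intros continuous_on_compose2[OF c] continuous_on_subset[OF ci])
    (use r in "auto simp: cmod_cir")
 have "set_integrable lborel {0..1} (%x. f (cir r x) * (2 * of_real pi * \<i> * cir r x))"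
  unfolding set_integrable_def by (rule borel_integrable_compact[OF _ cf]) auto
 from set_borel_integral_eq_integral(2)[OF this] HI show ?thesis
  by (simp add: set_lebesgue_integral_def unit_ind_def scaleR_conv_of_real integral_unique)
qed

definition tc :: "nat => hN => hN => complex" where
 "tc j k g = (deriv ^^ j) (GC k g) 0 / fact j"

lemma GC_holomorphic:
 assumes "!!s. s : S ==> QC k g s ~= 0" shows "GC k g holomorphic_on S"
proof -
 have "(%s. QC k g s) holomorphic_on S" unfolding QC_def zc_def Dc_def by (intro holomorphic_intros)
 then show ?thesis unfolding GC_def[abs_def] using assms by (intro holomorphic_intros) auto
qed

text \<open>Cauchy's formula. The admissible radius depends on \<open>k\<close> and
  \<open>g\<close>, which is why \<open>tc\<close> itself is defined by derivatives at 0; the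
  integral is the form that can be differentiated in \<open>k\<close> and \<open>g\<close>.\<close>

lemma tc_integral:
 assumes r: "r > 0" and Q: "!!s. cmod s <= r ==> QC k g s ~= 0"
 shows "tc j k g = (LI x. unit_ind x * (GC k g (cir r x) * inverse (cir r x) ^ j))"
proof -
 have hol: "GC k g holomorphic_on cball 0 r" by (rule GC_holomorphic) (use Q in auto)
 have "((%u. GC k g u / (u - 0) ^ Suc j) has_contour_integral ((2 * pi * \<i>) / fact j * (deriv ^^ j) (GC k g) 0)) (circlepath 0 r)"
  by (rule Cauchy_has_contour_integral_higher_derivative_circlepath)
    (use r hol holomorphic_on_imp_continuous_on holomorphic_on_subset ball_subset_cball in auto)
 then have "(LI x. unit_ind x * (GC k g (cir r x) / (cir r x - 0) ^ Suc j * (2 * of_real pi * \<i> * cir r x)))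
   = (2 * pi * \<i>) / fact j * (deriv ^^ j) (GC k g) 0"
  by (rule contour_integral_circle[OF _ r])
    (use r hol in "auto intro!: continuous_intros continuous_on_subset[OF holomorphic_on_imp_continuous_on[OF hol]]")
 moreover have "GC k g (cir r x) / (cir r x - 0) ^ Suc j * (2 * of_real pi * \<i> * cir r x)
   = (2 * of_real pi * \<i>) * (GC k g (cir r x) * inverse (cir r x) ^ j)" for x
  using cmod_cir[of r x] r by (auto simp: field_simps)
 ultimately have "(2 * of_real pi * \<i>) * (LI x. unit_ind x * (GC k g (cir r x) * inverse (cir r x) ^ j))
   = (2 * pi * \<i>) * tc j k g"
  by (simp add: tc_def mult.left_commute[of "unit_ind _"])
 then show ?thesis by simp
qed

text \<open>The weight of the Cauchy remainder of degree \<open>m\<close> at the point 1, on the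
  circle of radius 2. The differential of the contour contributes a factor \<open>cir 2 x\<close>,
  so the exponent is \<open>m\<close> in place of \<open>m + 1\<close>. The radius 2 produces the
  decay \<open>(1 / 2) ^ m\<close>.\<close>

definition rw :: "nat => real => complex" where
 "rw m x = unit_ind x * (inverse (cir 2 x) ^ m * inverse (cir 2 x - 1))"

lemma cir2_nonzero: "cir 2 x ~= 0" "cir 2 x - 1 ~= 0" "cmod (inverse (cir 2 x - 1)) <= 1" "cmod (inverse (cir 2 x)) = 1 / 2"
proof -
 show "cir 2 x ~= 0" using cmod_cir[of 2 x] by auto
 have "1 <= cmod (cir 2 x - 1)" using norm_triangle_ineq2[of "cir 2 x" 1] cmod_cir[of 2 x] by simp
 then show "cir 2 x - 1 ~= 0" "cmod (inverse (cir 2 x - 1)) <= 1"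
  by (auto simp: norm_inverse inverse_le_1_iff)
 show "cmod (inverse (cir 2 x)) = 1 / 2" by (simp add: norm_inverse cmod_cir)
qed

lemma continuous_cir: "continuous_on S (cir r)"
 using continuous_on_subset[OF smooth_cont[OF smooth_on_cir[OF open_UNIV smooth_on_ident]]] by simp

lemma cw_rw: "cw (rw m)"
 unfolding rw_def[abs_def] by (intro cw_unit_ind continuous_intros continuous_cir) (use cir2_nonzero in auto)

lemma rw_bound: "cmod (rw m x) <= indicator {0..1} x * (1 / 2) ^ m"
proof -
 have "cmod (inverse (cir 2 x) ^ m * inverse (cir 2 x - 1)) <= (1 / 2) ^ m * 1"
  unfolding norm_mult norm_power cir2_nonzero(4) using cir2_nonzero(3) by (intro mult_left_mono) auto
 then show ?thesis by (auto simp: rw_def unit_ind_def norm_mult indicator_def)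
qed

lemma rw_norm: "(LI x. cmod (rw m x)) <= (1 / 2) ^ m"
proof -
 have "(LI x. cmod (rw m x)) <= (LI x. indicator {0..1 :: real} x *\<^sub>R (1 / 2 :: real) ^ m)"
 proof (rule integral_mono)
  show "lint (%x. cmod (rw m x))" using cw_rw[of m] by (simp add: cw_def)
  show "lint (%x. indicator {0..1 :: real} x *\<^sub>R (1 / 2 :: real) ^ m)"
   by (rule borel_integrable_compact) auto
 qed (use rw_bound in simp)
 then show ?thesis by (simp add: content_real)
qed

lemma remainder_integral:
 assumes Q: "!!s. cmod s <= 2 ==> QC k g s ~= 0"
 shows "GC k g 1 - (\<Sum>j\<le>m. tc j k g) = (LI x. rw m x * GC k g (cir 2 x))"
proof -
 have hol: "GC k g holomorphic_on cball 0 2" by (rule GC_holomorphic) (use Q in auto)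
 have cG: "continuous_on S (%x. GC k g (cir 2 x))" for S
  by (rule continuous_on_compose2[OF holomorphic_on_imp_continuous_on[OF hol] continuous_cir]) (auto simp: cmod_cir)
 have "((%u. GC k g u / (u - 1)) has_contour_integral (2 * of_real pi * \<i> * GC k g 1)) (circlepath 0 2)"
  by (rule Cauchy_integral_circlepath_simple[OF hol]) simp
 then have "(LI x. unit_ind x * (GC k g (cir 2 x) / (cir 2 x - 1) * (2 * of_real pi * \<i> * cir 2 x))) = 2 * of_real pi * \<i> * GC k g 1"
 proof (rule contour_integral_circle)
  have "u - 1 ~= 0" if "u : sphere (0::complex) 2" for u using that by auto
  then show "continuous_on (sphere 0 2) (%u. GC k g u / (u - 1))"
   by (intro continuous_intros continuous_on_subset[OF holomorphic_on_imp_continuous_on[OF hol]]) auto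
 qed simp
 moreover have "unit_ind x * (GC k g (cir 2 x) / (cir 2 x - 1) * (2 * of_real pi * \<i> * cir 2 x))
   = (2 * of_real pi * \<i>) * (unit_ind x * (GC k g (cir 2 x) * (cir 2 x * inverse (cir 2 x - 1))))" for x
  by (simp add: divide_inverse)
 ultimately have G1: "GC k g 1 = (LI x. unit_ind x * (GC k g (cir 2 x) * (cir 2 x * inverse (cir 2 x - 1))))"
  by simp
 have i: "lint (%x. unit_ind x * f x)" if "cont f" for f
  using cw_unit_ind[OF that] by (simp add: cw_def)
 have i1: "lint (%x. unit_ind x * (GC k g (cir 2 x) * (cir 2 x * inverse (cir 2 x - 1))))"
  by (intro i continuous_intros cG continuous_cir) (use cir2_nonzero in auto)
 have i2: "lint (%x. unit_ind x * (GC k g (cir 2 x) * inverse (cir 2 x) ^ j))" for j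
  by (intro i continuous_intros cG continuous_cir) (use cir2_nonzero in auto)
 have "GC k g 1 - (\<Sum>j\<le>m. tc j k g) = (LI x. unit_ind x * (GC k g (cir 2 x) * (cir 2 x * inverse (cir 2 x - 1)))
   - (\<Sum>j\<le>m. unit_ind x * (GC k g (cir 2 x) * inverse (cir 2 x) ^ j)))"
  using i1 i2 by (simp add: G1 tc_integral[of 2, OF _ Q])
 also have "... = (LI x. rw m x * GC k g (cir 2 x))"
 proof (rule Bochner_Integration.integral_cong[OF refl])
  fix x
  have g: "cir 2 x * inverse (cir 2 x - 1) - (\<Sum>j\<le>m. inverse (cir 2 x) ^ j) = inverse (cir 2 x) ^ m * inverse (cir 2 x - 1)"
  proof -
   define u v w where "u = cir 2 x" and "v = inverse (cir 2 x)" and "w = inverse (cir 2 x - 1)"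
   have uv: "u * v = 1" "u * w = w + 1"
    using cir2_nonzero(1,2)[of x] by (auto simp: u_def v_def w_def field_simps)
   have "u * w - (\<Sum>j\<le>m. v ^ j) = v ^ m * w"
   proof (induction m)
    case (Suc m)
    have "u * w - (\<Sum>j\<le>Suc m. v ^ j) = v ^ m * w - v ^ Suc m" using Suc by simp
    also have "v ^ m = v ^ Suc m * u" using uv(1) by (simp add: mult.commute mult.left_commute)
    also have "v ^ Suc m * u * w = v ^ Suc m * (w + 1)" unfolding mult.assoc uv(2) ..
    finally show ?case by (simp add: algebra_simps)
   qed (use uv in simp)
   then show ?thesis by (simp add: u_def v_def w_def)
  qed
  have "unit_ind x * (GC k g (cir 2 x) * (cir 2 x * inverse (cir 2 x - 1))) - (\<Sum>j\<le>m. unit_ind x * (GC k g (cir 2 x) * inverse (cir 2 x) ^ j))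
    = unit_ind x * GC k g (cir 2 x) * (cir 2 x * inverse (cir 2 x - 1) - (\<Sum>j\<le>m. inverse (cir 2 x) ^ j))"
   by (simp add: right_diff_distrib sum_distrib_left mult.assoc)
  then show "unit_ind x * (GC k g (cir 2 x) * (cir 2 x * inverse (cir 2 x - 1))) - (\<Sum>j\<le>m. unit_ind x * (GC k g (cir 2 x) * inverse (cir 2 x) ^ j))
    = rw m x * GC k g (cir 2 x)" unfolding g rw_def by (simp add: mult_ac)
 qed
 finally show ?thesis .
qed

text \<open>The pairs \<open>(k, g)\<close> for which \<open>GC k g\<close> is holomorphic near the disc of radius \<open>r\<close>.\<close>

definition regT :: "real => (hN * hN) set" where
 "regT r = {z. fst z ~= 0 & r ^ 4 * fR 0 (snd z) < (1 / 1000) ^ 4 * fR 0 (fst z)}"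

lemma fR_continuous2: "continuous_on S f ==> continuous_on S (%x. fR e (f x))"
 unfolding fR_def by (intro continuous_intros)

lemma open_regT: "open (regT r)"
proof -
 have "open {z::hN * hN. fst z ~= 0}"
  by (rule open_Collect_neq) (auto intro!: continuous_intros)
 moreover have "open {z::hN * hN. r ^ 4 * fR 0 (snd z) < (1 / 1000) ^ 4 * fR 0 (fst z)}"
  by (intro open_Collect_less continuous_intros fR_continuous2)
 ultimately show ?thesis unfolding regT_def by (simp add: open_Collect_conj)
qed

lemma regT_nonzero: "r >= 0 ==> (k, g) : regT r ==> cmod s <= r ==> QC k g s ~= 0"
proof (rule QC_nonzero)
 assume a: "r >= 0" "(k, g) : regT r" "cmod s <= r"
 have "cmod s ^ 4 * fR 0 g <= r ^ 4 * fR 0 g" using a by (intro mult_right_mono power_mono fR_nonneg) auto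
 then show "cmod s ^ 4 * fR 0 g <= (1 / 1000) ^ 4 * fR 0 k" using a by (simp add: regT_def)
qed (simp add: regT_def)

lemma regT_ex:
 assumes "k ~= 0" obtains r where "r > 0" "(k, g) : regT r"
proof -
 have "((%r. r ^ 4 * fR 0 g) \<longlongrightarrow> 0 ^ 4 * fR 0 g) (at_right 0)" by (intro tendsto_intros)
 moreover have "0 ^ 4 * fR 0 g < (1 / 1000) ^ 4 * fR 0 k" using fR_pos[of 0 k] assms by simp
 ultimately have "\<forall>\<^sub>F r in at_right 0. r ^ 4 * fR 0 g < (1 / 1000) ^ 4 * fR 0 k" by (rule order_tendstoD(2))
 moreover have "\<forall>\<^sub>F r in at_right 0. r > (0::real)" by (rule eventually_at_right_less)
 ultimately have "\<forall>\<^sub>F r in at_right 0. r > 0 & r ^ 4 * fR 0 g < (1 / 1000) ^ 4 * fR 0 k" by (rule eventually_conj[rotated])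
 then obtain r where "r > 0 & r ^ 4 * fR 0 g < (1 / 1000) ^ 4 * fR 0 k"
  using eventually_happens'[OF trivial_limit_at_right_real] by blast
 then show thesis using that[of r] assms by (simp add: regT_def)
qed

lemma smooth_on_circle_kernel:
 assumes "r > 0"
 shows "smooth_on (regT r \<times> UNIV) (%z. GC (fst (fst z)) (snd (fst z)) (cir r (snd z)) * inverse (cir r (snd z)) ^ j)"
 by (intro smooth_intros smooth_on_GC smooth_on_cir open_Times open_regT open_UNIV)
   (use regT_nonzero[of r] cmod_cir[of r] cir_nonzero[of r] assms in "auto simp: less_imp_le")

lemma smooth_on_tc: "smooth_on {z. fst z ~= 0} (%z. tc j (fst z) (snd z))"
proof (rule smooth_on_local)
 fix z :: "hN * hN" assume "z : {z. fst z ~= 0}"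
 then have z0: "fst z ~= 0" by simp
 obtain r where r: "r > 0" "z : regT r" using regT_ex[OF z0, of "snd z"] unfolding prod.collapse by blast
 have "cw (%x. unit_ind x * 1)" by (rule cw_unit_ind) simp
 then have iu: "lint unit_ind" by (simp add: cw_def)
 have "smooth_on (regT r) (%z. LI x. unit_ind x * (%z. GC (fst (fst z)) (snd (fst z)) (cir r (snd z)) * inverse (cir r (snd z)) ^ j) (z, x))"
  by (rule smooth_param[where H = "{0..1}", OF open_regT _ _ smooth_on_circle_kernel[OF r(1)] iu])
    (auto simp: unit_ind_def open_Times open_regT)
 then have "smooth_on (regT r) (%z. tc j (fst z) (snd z))"
  by (rule smooth_on_cong[OF open_regT]) (use tc_integral[OF r(1) regT_nonzero[of r]] r in "auto simp: less_imp_le")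
 then show "EX T. open T & z : T & smooth_on T (%z. tc j (fst z) (snd z))"
  using r(2) open_regT by blast
qed

lemma LN_param_integral:
 fixes Ph :: "hN * 'b::euclidean_space => complex"
 assumes U: "open U" and W: "open W" and UH: "U \<times> H <= W" and Ph: "smooth_on W Ph"
  and w: "lint w" and w0: "!!x. x ~: H ==> w x = 0" and H: "compact H" and g: "g : U"
 shows "LN (%g. LI x. w x * Ph (g, x)) g = (LI x. w x * LN (%g. Ph (g, x)) g)"
proof -
 \<comment> \<open>The field lifted to the product: its direction varies with the point but has no
   component in the integration variable.\<close>
 let ?X = "%v (Ps :: hN * 'b => complex) z. dird ((v, 2 *\<^sub>R om (fst (fst z)) v), 0) Ps z"
 have slice: "dird (u, 0) Ps (q, x) = dird u (%q. Ps (q, x)) q" if "smooth_on W Ps" "(q, x) : W" for Ps :: "hN * 'b => complex" and q x u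
 proof -
  have "((%q. (q, x)) has_derivative (%v. (v, 0))) (at q)" by (auto intro!: derivative_eq_intros)
  from dird_compose[OF _ this, of Ps u] show ?thesis using smooth_diff[OF that] by simp
 qed
 have Xs: "smooth_on W (?X v Ps)" if "smooth_on W Ps" for v Ps
 proof -
  have b: "bounded_linear (%x. om x v)" by (rule bounded_bilinear.bounded_linear_left[OF bb_om])
  have "smooth_on W (%z. (\<Sum>b\<in>Basis. of_real (v \<bullet> b) * dird ((b, 0), 0) Ps z)
   + (\<Sum>b\<in>Basis. of_real (2 * (om (fst (fst z)) v \<bullet> b)) * dird ((0, b), 0) Ps z))"
   by (intro smooth_intros W that smooth_bl[OF b])
  then show ?thesis
  proof (rule smooth_on_cong[OF W])
   fix z assume z: "z : W"
   obtain q x where zq: "z = (q, x)" by (cases z)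
   have d: "(%q. Ps (q, x)) differentiable (at q)"
   proof -
    have "((%q. (q, x)) has_derivative (%v. (v, 0))) (at q)" by (auto intro!: derivative_eq_intros)
    moreover have "(Ps has_derivative (%v. dird v Ps (q, x))) (at (q, x))"
     using has_derivative_dird smooth_diff[OF that] z zq by blast
    ultimately show ?thesis using has_derivative_compose differentiable_def by blast
   qed
   show "(\<Sum>b\<in>Basis. of_real (v \<bullet> b) * dird ((b, 0), 0) Ps z)
    + (\<Sum>b\<in>Basis. of_real (2 * (om (fst (fst z)) v \<bullet> b)) * dird ((0, b), 0) Ps z) = ?X v Ps z"
    using Xf_expand[OF d, of om v] slice[OF that, of q x] z zq by (simp add: Xf_def)
  qed
 qed
 have XI: "Xf om v (%g. LI x. w x * Ps (g, x)) q = (LI x. w x * ?X v Ps (q, x))"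
  if "smooth_on W Ps" "q : U" for v Ps q
  unfolding Xf_def using dird_param_integral[OF U W UH that(1) w w0 H that(2)] by simp
 have XX: "Xf om v (Xf om v (%g. LI x. w x * Ph (g, x))) g = (LI x. w x * ?X v (?X v Ph) (g, x))" for v
 proof -
  have sI: "smooth_on U (%g. LI x. w x * Ph (g, x))"
   by (rule smooth_param[OF U W UH Ph w w0 H])
  have "Xf om v (Xf om v (%g. LI x. w x * Ph (g, x))) g = Xf om v (%q. LI x. w x * ?X v Ph (q, x)) g"
   by (rule Xf_cong[OF U g XI[OF Ph]])
     (use smooth_diff[OF smooth_on_Xf[OF bb_om U sI] g] in auto)
  then show ?thesis using XI[OF Xs[OF Ph] g] by simp
 qed
 have pt: "?X v (?X v Ph) (g, x) = Xf om v (Xf om v (%g. Ph (g, x))) g" if x: "x : H" for v x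
 proof -
  have gW: "(q, x) : W" if "q : U" for q using UH x that by auto
  have "?X v (?X v Ph) (g, x) = Xf om v (%q. ?X v Ph (q, x)) g"
   using slice[OF Xs[OF Ph] gW[OF g]] by (simp add: Xf_def)
  also have "... = Xf om v (Xf om v (%g. Ph (g, x))) g"
  proof (rule Xf_cong[OF U g])
   show "?X v Ph (q, x) = Xf om v (%g. Ph (g, x)) q" if "q : U" for q
    using slice[OF Ph gW[OF that]] by (simp add: Xf_def)
   have "((%q. (q, x)) has_derivative (%v. (v, 0))) (at g)" by (auto intro!: derivative_eq_intros)
   moreover have "(?X v Ph has_derivative (%u. dird u (?X v Ph) (g, x))) (at (g, x))"
    using has_derivative_dird smooth_diff[OF Xs[OF Ph] gW[OF g]] by blast
   ultimately show "(%q. ?X v Ph (q, x)) differentiable at g"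
    using has_derivative_compose differentiable_def by blast
  qed
  finally show ?thesis .
 qed
 have i: "lint (%x. w x * Ps (g, x))" if "smooth_on W Ps" for Ps :: "hN * 'b => complex"
  by (rule lint_mult_compact[OF w _ H], erule w0,
    rule continuous_on_compose2[OF smooth_cont[OF that]]) (use UH g in "auto intro!: continuous_intros")
 have "LN (%g. LI x. w x * Ph (g, x)) g = (LI x. (\<Sum>j\<in>UNIV. w x * ?X (axis j 1) (?X (axis j 1) Ph) (g, x)))"
  unfolding LN_def XX using i[OF Xs[OF Xs[OF Ph]]] by simp
 also have "... = (LI x. w x * LN (%g. Ph (g, x)) g)"
 proof (rule Bochner_Integration.integral_cong[OF refl])
  fix x show "(\<Sum>j\<in>UNIV. w x * ?X (axis j 1) (?X (axis j 1) Ph) (g, x)) = w x * LN (%g. Ph (g, x)) g"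
   using pt[of x] w0[of x] by (cases "x : H") (auto simp: LN_def sum_distrib_left)
 qed
 finally show ?thesis .
qed

text \<open>For each complex \<open>s\<close> this is the case \<open>e = 0\<close> of
  \<open>LN_inverse_square\<close>, whose functions may be complex-valued; thus nothing has to be
  continued analytically from real \<open>s\<close>.\<close>

lemma LN_GC:
 assumes S: "open S" and g: "g : S" and Q: "!!q. q : S ==> QC k q s ~= 0"
 shows "LN (%q. GC k q s) g = 0"
proof -
 have z: "Xf om (axis j 1) (%q. zc k q s i) p = (if i = j then s else 0)" for i j p
 proof -
  have d: "(%q::hN. complex_of_real (fst q $ i)) differentiable (at p)"
   by (rule smooth_diff[of UNIV]) (auto intro!: smooth_intros)
  have "Xf om (axis j 1) (%q. s * of_real (fst q $ i) + - of_real (fst k $ i)) p = s * Xf om (axis j 1) (%q. of_real (fst q $ i)) p"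
   by (subst Xf_add) (use d in "auto simp: Xf_cmult differentiable_mult")
  then show ?thesis by (simp add: zc_def Xf_fst_nth)
 qed
 have D: "Xf om (axis j 1) (%q. Dc k q s ga) p = 2 * s * omv ga (%i. zc k p s i) (%i. if i = j then 1 else 0)" for ga j p
 proof -
  have "((%q. Dc k q s ga) has_derivative (%v. s\<^sup>2 * of_real (snd v $ ga) - 0 - 2 * s * of_real (om (fst k) (fst v) $ ga))) (at p)"
   unfolding Dc_def
   by (intro has_derivative_diff has_derivative_const has_derivative_mult_right has_derivative_of_real
     bounded_linear.has_derivative[OF bounded_linear_vec_nth] has_derivative_fst has_derivative_snd has_derivative_ident
     bounded_linear.has_derivative[OF bounded_bilinear.bounded_linear_right[OF bb_om]])
  from Xf_eqI[OF this] have "Xf om (axis j 1) (%q. Dc k q s ga) p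
    = 2 * s\<^sup>2 * of_real (omv ga (vec_nth (fst p)) (vec_nth (axis j 1))) - 2 * s * of_real (omv ga (vec_nth (fst k)) (vec_nth (axis j 1)))"
   by (simp add: om_nth)
  also have "... = 2 * s * omv ga (%i. zc k p s i) (%i. of_real (axis j (1::real) $ i))"
   by (cases "ga = 1"; cases "ga = 2") (simp_all add: omv_def zc_def power2_eq_square algebra_simps)
  also have "(%i. complex_of_real (axis j (1::real) $ i)) = (%i. if i = j then 1 else 0)"
   by (auto simp: axis_def)
  finally show ?thesis .
 qed
 have "LN (%q. inverse (((\<Sum>i\<in>UNIV. (zc k q s i)\<^sup>2) + 0)\<^sup>2 + (\<Sum>ga\<in>UNIV. (Dc k q s ga)\<^sup>2)) ^ 2) g
   = - 32 * s\<^sup>2 * 0 * inverse (((\<Sum>i\<in>UNIV. (zc k g s i)\<^sup>2) + 0)\<^sup>2 + (\<Sum>ga\<in>UNIV. (Dc k g s ga)\<^sup>2)) ^ 3"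
 proof (rule LN_inverse_square[OF S g])
  show "smooth_on S (%q. zc k q s i)" for i unfolding zc_def by (intro smooth_intros S)
  show "smooth_on S (%q. Dc k q s ga)" for ga unfolding Dc_def by (intro smooth_intros smooth_on_bilinear[OF bb_om] S)
 qed (use z D Q in "auto simp: QC_def")
 then show ?thesis by (simp add: GC_def[abs_def] QC_def)
qed

text \<open>Near \<open>g\<close> the coefficient is a contour integral, over a fixed circle, of
  functions of \<open>g\<close> that are killed by \<open>LN\<close>.\<close>

lemma LN_tc:
 assumes k: "k ~= 0" shows "LN (tc j k) g = 0"
proof -
 obtain r where r: "r > 0" "(k, g) : regT r" using regT_ex[OF k, of g] by blast
 define U where "U = (%q. (k, q)) -` regT r"
 have U: "open U" "g : U" unfolding U_def using r open_regT by (auto intro!: open_vimage continuous_intros)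
 have "cw (%x. unit_ind x * 1)" by (rule cw_unit_ind) simp
 then have iu: "lint unit_ind" by (simp add: cw_def)
 let ?Ph = "%z. GC k (fst z) (cir r (snd z)) * inverse (cir r (snd z)) ^ j"
 have Ph: "smooth_on (U \<times> UNIV) ?Ph"
  by (intro smooth_intros smooth_on_GC smooth_on_cir open_Times U open_UNIV)
    (use regT_nonzero[of r] cmod_cir[of r] cir_nonzero[of r] r in "auto simp: U_def")
 have t: "smooth_on U (tc j k)"
 proof -
  have "smooth_on U (%q. (%z. tc j (fst z) (snd z)) (k, q))"
  proof (rule smooth_on_compose[OF U(1) _ smooth_on_tc])
   show "open {z::hN * hN. fst z ~= 0}" by (rule open_Collect_neq) (auto intro!: continuous_intros)
  qed (use k U in "auto intro!: smooth_intros")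
  then show ?thesis by simp
 qed
 have "LN (tc j k) g = LN (%q. LI x. unit_ind x * ?Ph (q, x)) g"
  by (rule LN_cong[OF U _ t]) (use tc_integral[OF r(1) regT_nonzero[of r]] r in "auto simp: U_def")
 also have "... = (LI x. unit_ind x * LN (%q. ?Ph (q, x)) g)"
  by (rule LN_param_integral[OF U(1) _ _ Ph iu, of "{0..1}"]) (auto simp: unit_ind_def open_Times U)
 also have "... = 0"
 proof -
  have "LN (%q. ?Ph (q, x)) g = 0" for x
  proof -
   have nz: "QC k q (cir r x) ~= 0" if "q : U" for q
    using regT_nonzero[of r k q "cir r x"] cmod_cir[of r x] r that by (auto simp: U_def)
   have G: "smooth_on U (%q. GC k q (cir r x))"
    by (rule smooth_on_GC) (use nz U in "auto intro: smooth_intros")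
   have c: "Xf om v (%q. f q * c) p = Xf om v f p * c" if "smooth_on U f" "p : U" for f p c v
    using Xf_cmult[OF smooth_diff[OF that], of om v c] by (simp add: mult.commute)
   have X1: "smooth_on U (Xf om v (%q. GC k q (cir r x)))" for v
    by (rule smooth_on_Xf[OF bb_om U(1) G])
   have "Xf om v (Xf om v (%q. ?Ph (q, x))) g = Xf om v (Xf om v (%q. GC k q (cir r x))) g * inverse (cir r x) ^ j" for v
   proof -
    have "Xf om v (Xf om v (%q. ?Ph (q, x))) g = Xf om v (%q. Xf om v (%q. GC k q (cir r x)) q * inverse (cir r x) ^ j) g"
    proof (rule Xf_cong[OF U])
     have "smooth_on U (Xf om v (%q. ?Ph (q, x)))"
      by (intro smooth_on_Xf bb_om U) (use G U in "auto intro!: smooth_intros")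
     then show "Xf om v (%q. ?Ph (q, x)) differentiable at g" using smooth_diff U by blast
    qed (use c[OF G] in auto)
    then show ?thesis using c[OF X1 U(2)] by simp
   qed
   then have "LN (%q. ?Ph (q, x)) g = LN (%q. GC k q (cir r x)) g * inverse (cir r x) ^ j"
    by (simp add: LN_def sum_distrib_right)
   also have "LN (%q. GC k q (cir r x)) g = 0" by (rule LN_GC[OF U nz])
   finally show ?thesis by simp
  qed
  then show ?thesis by simp
 qed
 finally show ?thesis .
qed

section \<open>Nondegenerate lines\<close>

lemma cont_compact_integrable:
 fixes f :: "'a::euclidean_space => complex"
 assumes f: "cont f" and K: "compact K" "!!p. p ~: K ==> f p = 0"
 shows "lint f"
proof -
 have "lint (%p. indicator K p *\<^sub>R f p)"
  by (rule borel_integrable_compact[OF K(1) continuous_on_subset[OF f]]) simp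
 moreover have "(%p. indicator K p *\<^sub>R f p) = f" using K(2) by (auto simp: indicator_def)
 ultimately show ?thesis by simp
qed

text \<open>In the central variable the action is a translation depending on the other coordinates;
  once the centre is integrated out, a plain translation remains. Fubini gives the
  invariance.\<close>

lemma (in line) integral_act:
 fixes f :: "'x * 't => complex"
 assumes f: "cont f" and K: "compact K" "!!p. p ~: K ==> f p = 0"
 shows "(LI p. f (act p h)) = (LI p. f p)"
proof -
 have fub: "(LI p. g p) = (LI x. LI t. g (x, t))"
  if "cont g" "compact K'" "!!p. p ~: K' ==> g p = 0" for g :: "'x * 't => complex" and K'
 proof -
  have "integrable (lborel \<Otimes>\<^sub>M lborel) g" using cont_compact_integrable[OF that] by (simp add: lborel_prod)
  from lborel_pair.integral_fst'[OF this] show ?thesis by (simp add: lborel_prod)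
 qed
 have ca: "cont (%p. f (act p h))"
  by (rule continuous_on_compose2[OF f]) (auto intro!: continuous_act continuous_intros)
 have c1: "continuous_on K (%p. act p (hinv h))" by (intro continuous_act continuous_intros)
 have K1: "f (act p h) = 0" if "p ~: (%p. act p (hinv h)) ` K" for p
 proof (rule K(2), rule)
  assume "act p h : K"
  then have "act (act p h) (hinv h) : (%p. act p (hinv h)) ` K" by (rule imageI)
  then show False using that by simp
 qed
 have cx: "cont (%t. f (x, t))" for x
  by (rule continuous_on_compose2[OF f]) (auto intro!: continuous_intros)
 have inner: "(LI t. f (act (x, t) h)) = (LI t. f (x + E (fst h), t))" for x
  using integral_translate[OF borel_measurable_continuous_onI[OF cx[of "x + E (fst h)"]], of "C (snd h) + 2 *\<^sub>R be x (E (fst h))"]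
  by (simp add: act_def add.assoc)
 have m: "(%x. LI t. f (x, t)) : borel_measurable borel"
 proof -
  have "integrable (lborel \<Otimes>\<^sub>M lborel) f" using cont_compact_integrable[OF f K] by (simp add: lborel_prod)
  from lborel_pair.integrable_fst'[OF this] show ?thesis using borel_measurable_integrable by fastforce
 qed
 have "(LI p. f (act p h)) = (LI x. LI t. f (x + E (fst h), t))"
  unfolding inner[symmetric] by (rule fub[OF ca compact_continuous_image[OF c1 K(1)] K1])
 also have "... = (LI x. LI t. f (x, t))"
  by (rule integral_translate[OF m])
 also have "... = (LI p. f p)" by (rule fub[OF f K, symmetric])
 finally show ?thesis .
qed

lemma loc_integrable_pair:
 fixes w :: "'b::euclidean_space => complex" and Ph :: "'a::euclidean_space \<times> 'b => complex"
 assumes w: "loc_integrable w" and Ph: "cont Ph" and P: "compact P" and H: "compact H"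
  and supp: "!!p h. p ~: P | h ~: H ==> Ph (p, h) = 0"
 shows "integrable (lborel \<Otimes>\<^sub>M lborel) (case_prod (%h p. w h * Ph (p, h)))"
proof -
 define w' where "w' h = indicator H h *\<^sub>R w h" for h
 have w': "lint w'" using w H by (simp add: loc_integrable_def w'_def[abs_def])
 have e: "w h * Ph (p, h) = w' h * Ph (p, h)" for h p
  using supp[of p h] by (auto simp: w'_def indicator_def)
 have cp: "cont (%p. Ph (p, h))" for h
  by (rule continuous_on_compose2[OF Ph]) (auto intro!: continuous_intros)
 have ip: "lint (%p. Ph (p, h))" for h
  by (rule cont_compact_integrable[OF cp P]) (simp add: supp)
 have "compact (P \<times> H)" by (intro compact_Times P H)
 then have "bounded (Ph ` (P \<times> H))" by (intro compact_imp_bounded compact_continuous_image continuous_on_subset[OF Ph]) auto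
 then obtain B where B: "!!z. z : P \<times> H ==> cmod (Ph z) <= B" unfolding bounded_iff by blast
 have B0: "cmod (Ph (p, h)) <= indicator P p * \<bar>B\<bar>" for p h
  using B[of "(p, h)"] supp[of p h] by (cases "p : P & h : H") auto
 have iP: "lint (%p. indicator P p * \<bar>B\<bar>)"
  using borel_integrable_compact[OF P, of "%_. \<bar>B\<bar>"] by simp
 have measPh: "(%z. Ph (snd z, fst z)) : borel_measurable (lborel \<Otimes>\<^sub>M lborel)"
 proof -
  have "cont (%z. Ph (snd z, fst z))"
   by (rule continuous_on_compose2[OF Ph]) (auto intro!: continuous_intros)
  then have "(%z. Ph (snd z, fst z)) : borel_measurable borel" by (rule borel_measurable_continuous_onI)
  then show ?thesis by (simp add: lborel_prod)
 qed
 have mw: "w' : borel_measurable lborel" by (rule borel_measurable_integrable[OF w'])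
 have "integrable (lborel \<Otimes>\<^sub>M lborel) (%z. w' (fst z) * Ph (snd z, fst z))"
 proof (rule lborel_pair.Fubini_integrable)
  show "(%z. w' (fst z) * Ph (snd z, fst z)) : borel_measurable (lborel \<Otimes>\<^sub>M lborel)"
   by (intro borel_measurable_times measPh measurable_compose[OF measurable_fst mw])
  show "AE h in lborel. lint (%p. w' (fst (h, p)) * Ph (snd (h, p), fst (h, p)))"
   using ip by simp
  show "lint (%h. LI p. cmod (w' (fst (h, p)) * Ph (snd (h, p), fst (h, p))))"
  proof (rule Bochner_Integration.integrable_bound)
   show "lint (%h. cmod (w' h) * (LI p. indicator P p * \<bar>B\<bar>))"
    using w' by simp
   have "(%z. cmod (w' (fst z) * Ph (snd z, fst z))) : borel_measurable (lborel \<Otimes>\<^sub>M lborel)"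
    by (rule measurable_compose[OF _ borel_measurable_norm], intro borel_measurable_times measPh measurable_compose[OF measurable_fst mw])
   then show "(%h. LI p. cmod (w' (fst (h, p)) * Ph (snd (h, p), fst (h, p)))) : borel_measurable lborel"
    by (intro lborel.borel_measurable_lebesgue_integral) (simp add: case_prod_beta')
   show "AE h in lborel. norm (LI p. cmod (w' (fst (h, p)) * Ph (snd (h, p), fst (h, p))))
     <= norm (cmod (w' h) * (LI p. indicator P p * \<bar>B\<bar>))"
   proof (rule AE_I2)
    fix h
    have "(LI p. cmod (Ph (p, h))) <= (LI p. indicator P p * \<bar>B\<bar>)"
     by (rule integral_mono[OF _ iP]) (use ip B0 in auto)
    then show "norm (LI p. cmod (w' (fst (h, p)) * Ph (snd (h, p), fst (h, p))))
     <= norm (cmod (w' h) * (LI p. indicator P p * \<bar>B\<bar>))"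
     by (auto simp: norm_mult abs_mult intro!: mult_left_mono)
   qed
  qed
 qed
 then show ?thesis by (simp add: e case_prod_beta')
qed

text \<open>Nondegenerate means that \<open>C\<close> is bijective: the orbits then contain whole
  cosets of the centre, and the space splits into a transversal and a copy of the quaternionic
  Heisenberg group.\<close>

locale nline = line be E C
 for be :: "'x::euclidean_space => 'x => 't::euclidean_space" and E C +
 fixes Ep :: "'x => real^4" and Ci :: "'t => real^3"
 assumes Ep: "bounded_linear Ep" and Ci: "bounded_linear Ci"
  and EpE [simp]: "Ep (E x) = x" and CiC [simp]: "Ci (C s) = s" and CCi [simp]: "C (Ci t) = t"
begin

lemmas nadd_simps = add_simps
 linear_add[OF bounded_linear.linear[OF Ep]] linear_add[OF bounded_linear.linear[OF Ci]]
 linear_diff[OF bounded_linear.linear[OF Ep]] linear_diff[OF bounded_linear.linear[OF Ci]]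
 linear_scale[OF bounded_linear.linear[OF Ep]] linear_scale[OF bounded_linear.linear[OF Ci]]
 linear_diff[OF bounded_linear.linear[OF C]] linear_diff[OF bounded_linear.linear[OF E]]
 bounded_bilinear.diff_left[OF bb] bounded_bilinear.diff_right[OF bb]

definition yy :: "'x * 't => 'x" where
 "yy p = fst p - E (Ep (fst p))"

text \<open>The coordinate along the orbit, normalised by \<open>act (yy p, 0) (kk p) = p\<close>.
  The subtracted term is the central part that \<open>act\<close> creates, since \<open>yy p\<close>
  need not commute with the line.\<close>

definition kk :: "'x * 't => hN" where
 "kk p = (Ep (fst p), Ci (snd p - 2 *\<^sub>R be (yy p) (E (Ep (fst p)))))"

lemma act_kk: "act (yy p, 0) (kk p) = p"
 by (simp add: act_def kk_def nadd_simps prod_eq_iff) (simp add: yy_def)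

lemma yy_act [simp]: "yy (act p h) = yy p"
 by (simp add: yy_def act_def nadd_simps)

lemma kk_act: "kk (act p h) = hm (kk p) h"
proof -
 have C1: "Ci (be (E x) (E y)) = om x y" for x y by (simp add: hom)
 have "yy p = fst p - E (Ep (fst p))" by (simp add: yy_def)
 then show ?thesis
  by (simp add: kk_def hm_def) (simp add: act_def nadd_simps C1 algebra_simps scaleR_add_right)
qed

lemma smooth_on_kk: "open S ==> smooth_on S f ==> smooth_on S (%x. kk (f x))"
 unfolding kk_def yy_def
 by (intro smooth_intros smooth_bl[OF Ep] smooth_bl[OF Ci] smooth_bl[OF E]
   smooth_on_bilinear[OF bb])

lemma continuous_kk: "continuous_on S f ==> continuous_on S (%x. kk (f x))"
 unfolding kk_def yy_def
 by (intro continuous_intros bounded_linear.continuous_on[OF Ep] bounded_linear.continuous_on[OF Ci] bounded_linear.continuous_on[OF E]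
   bounded_bilinear.continuous_on[OF bb])

lemma continuous_yy: "continuous_on S f ==> continuous_on S (%x. yy (f x))"
 unfolding yy_def
 by (intro continuous_intros bounded_linear.continuous_on[OF Ep] bounded_linear.continuous_on[OF E])

end

lemma continuous_hm: "continuous_on S f ==> continuous_on S g ==> continuous_on S (%x. hm (f x) (g x))"
 unfolding hm_def by (intro continuous_intros bounded_bilinear.continuous_on[OF bb_om])

lemma smooth_hm: "open S ==> smooth_on S f ==> smooth_on S g ==> smooth_on S (%x. hm (f x) (g x))"
 unfolding hm_def by (intro smooth_intros smooth_on_bilinear[OF bb_om])

lemma continuous_hinv: "continuous_on S f ==> continuous_on S (%x. hinv (f x))"
 unfolding hinv_def by (intro continuous_intros)

lemma smooth_hinv: "open S ==> smooth_on S f ==> smooth_on S (%x. hinv (f x))"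
 unfolding hinv_def by (intro smooth_intros)

lemma om_simps [simp]: "om (- x) y = - om x y" "om x (- y) = - om x y" "om (x + y) z = om x z + om y z"
  "om x (y + z) = om x y + om x z" "om (x - y) z = om x z - om y z" "om x (y - z) = om x y - om x z"
 using bounded_bilinear.minus_left[OF bb_om] bounded_bilinear.minus_right[OF bb_om]
  bounded_bilinear.add_left[OF bb_om] bounded_bilinear.add_right[OF bb_om]
  bounded_bilinear.diff_left[OF bb_om] bounded_bilinear.diff_right[OF bb_om] by auto

lemma hm_hinv_cancel: "hm (hinv k) (hm k h) = h" "hm k (hm (hinv k) h) = h" "hm (hm k (hinv h)) h = k" "hm (hm k h) (hinv h) = k"
  "hinv (hinv k) = k" "hm (hinv (hm k (hinv h))) k = h"
 by (auto simp: hm_def hinv_def prod_eq_iff algebra_simps om_self om_skew[of "fst h" "fst k"])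

lemma compact_shell: "compact {k. fR 0 k <= c}"
proof (rule compact_eq_bounded_closed[THEN iffD2], rule conjI)
 show "closed {k. fR 0 k <= c}" by (intro closed_Collect_le fR_continuous2 continuous_intros)
 show "bounded {k::hN. fR 0 k <= c}"
 proof (rule boundedI)
  fix k :: hN assume "k : {k. fR 0 k <= c}"
  then have k: "((norm (fst k))\<^sup>2)\<^sup>2 + (norm (snd k))\<^sup>2 <= c" by (simp add: fR_def power2_norm_eq_inner)
  have 1: "x <= 1 + x\<^sup>2" for x :: real
   using zero_le_power2[of "x - 1 / 2"] by (simp add: power2_eq_square algebra_simps)
  show "norm k <= 3 + c"
   using 1[of "norm (fst k)"] 1[of "(norm (fst k))\<^sup>2"] 1[of "norm (snd k)"] k norm_Pair_le[of "fst k" "snd k"] by simp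
 qed
qed

context nline
begin

text \<open>Substituting \<open>act p (hinv h)\<close> for \<open>p\<close> preserves the measure;
  this is what transposes the convolution operators on smooth functions.\<close>

lemma swap_act:
 assumes w: "loc_integrable w" and Ph: "cont Ph" and P: "compact P" and H: "compact H"
  and supp: "!!p h. p ~: P | h ~: H ==> Ph (p, h) = 0"
 shows "(LI p. LI h. w h * Ph (p, h)) = (LI p. LI h. w h * Ph (act p (hinv h), h))"
proof -
 have f: "(LI p. LI h. w h * Ps (p, h)) = (LI h. w h * (LI p. Ps (p, h)))"
  if "cont Ps" "compact P'" "!!p h. p ~: P' | h ~: H ==> Ps (p, h) = 0" for Ps :: "('x * 't) * hN => complex" and P'
  using lborel_pair.Fubini_integral[OF loc_integrable_pair[OF w that(1,2) H that(3)]] by simp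
 let ?P = "(%z. act (fst z) (snd z)) ` (P \<times> H)"
 have cP: "compact ?P"
  by (intro compact_continuous_image continuous_act continuous_intros compact_Times P H)
 have c2: "cont (%z. Ph (act (fst z) (hinv (snd z)), snd z))"
  by (rule continuous_on_compose2[OF Ph]) (auto intro!: continuous_intros continuous_act continuous_hinv)
 have s2: "Ph (act p (hinv h), h) = 0" if n: "p ~: ?P | h ~: H" for p h
 proof (rule ccontr)
  assume "Ph (act p (hinv h), h) ~= 0"
  then have "act p (hinv h) : P" "h : H" using supp by blast+
  moreover from this have "act (act p (hinv h)) h : ?P" by (intro image_eqI[of _ _ "(act p (hinv h), h)"]) auto
  ultimately show False using n by simp
 qed
 have "(LI p. Ph (act p (hinv h), h)) = (LI p. Ph (p, h))" for h
 proof (rule integral_act[where f = "%p. Ph (p, h)", OF _ P])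
  show "cont (%p. Ph (p, h))" by (rule continuous_on_compose2[OF Ph]) (auto intro!: continuous_intros)
 qed (simp add: supp)
 then show ?thesis using f[OF Ph P supp] f[OF c2 cP s2] by simp
qed

lemma compact_ZZ: "compact K ==> compact ((%z. act (fst z, 0) (snd z)) ` (yy ` K \<times> {k. fR 0 k <= c}))"
 by (intro compact_continuous_image continuous_act continuous_intros compact_Times continuous_yy compact_shell)

lemma ZZ_mem: "yy p : yy ` K ==> fR 0 (kk p) <= c ==> p : (%z. act (fst z, 0) (snd z)) ` (yy ` K \<times> {k. fR 0 k <= c})"
 by (rule image_eqI[of _ _ "(yy p, kk p)"]) (auto simp: act_kk)

text \<open>By \<open>HH_mem\<close> this set contains every \<open>h\<close> that carries a
  coordinate in \<open>A\<close> to one in \<open>B\<close>; it serves as common compact support for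
  the integrals in \<open>h\<close>.\<close>

lemma compact_HH: "compact A ==> compact B ==> compact ((%z. hm (hinv (fst z)) (snd z)) ` (A \<times> B))"
 by (intro compact_continuous_image continuous_hm continuous_hinv continuous_intros compact_Times)

lemma HH_mem: "kk p : A ==> kk (act p h) : B ==> h : (%z. hm (hinv (fst z)) (snd z)) ` (A \<times> B)"
 by (rule image_eqI[of _ _ "(kk p, kk (act p h))"]) (auto simp: kk_act hm_hinv_cancel)

end

section \<open>The Mittag-Leffler kernels\<close>

definition theta :: "nat => hN => real" where
 "theta i k = smooth_step (2 - fR 0 k / 4 ^ i)"

text \<open>A partition of unity into shells: for \<open>i ~= 0\<close> the support condition is
  \<open>4 ^ (i - 1) <= fR 0 k <= 2 * 4 ^ i\<close>. It is applied to the orbit coordinate only and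
  leaves the transversal alone.\<close>

definition psi :: "nat => hN => complex" where
 "psi i k = of_real (theta i k - (if i = 0 then 0 else theta (i - 1) k))"

lemma sum_psi: "(\<Sum>i\<le>n. psi i k) = of_real (theta n k)"
 by (induction n) (auto simp: psi_def)

lemma theta_1: "fR 0 k <= 4 ^ i ==> theta i k = 1"
 by (auto simp: theta_def field_simps intro!: smooth_step_1)

lemma theta_0: "2 * 4 ^ i <= fR 0 k ==> theta i k = 0"
 by (auto simp: theta_def field_simps intro!: smooth_step_0)

lemma psi_high: "2 * 4 ^ i <= fR 0 k ==> psi i k = 0"
proof -
 assume a: "2 * 4 ^ i <= fR 0 k"
 have "theta (i - 1) k = 0" if "i ~= 0" using that a
  by (intro theta_0) (rule order_trans[OF _ a], auto intro!: power_increasing)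
 then show ?thesis using theta_0[OF a] by (auto simp: psi_def)
qed

lemma psi_low: "i ~= 0 ==> fR 0 k <= 4 ^ (i - 1) ==> psi i k = 0"
proof -
 assume a: "i ~= 0" "fR 0 k <= 4 ^ (i - 1)"
 have "theta i k = 1" by (intro theta_1, rule order_trans[OF a(2)]) (auto intro!: power_increasing)
 then show ?thesis using theta_1[OF a(2)] a(1) by (auto simp: psi_def)
qed

lemma psi_bound: "cmod (psi i k) <= 1"
 using smooth_step_range[of "2 - fR 0 k / 4 ^ i"] smooth_step_range[of "2 - fR 0 k / 4 ^ (i - 1)"]
 by (auto simp: psi_def theta_def simp del: of_real_diff of_real_add)

lemma smooth_on_psi: "open S ==> smooth_on S f ==> smooth_on S (%x. psi i (f x))"
proof -
 assume a: "open S" "smooth_on S f"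
 have t: "smooth_on S (%x. theta j (f x))" for j
  unfolding theta_def fR_def divide_inverse by (intro smooth_intros a)
 show ?thesis unfolding psi_def by (cases "i = 0") (auto intro!: smooth_intros a t)
qed

text \<open>The kernel of order \<open>m\<close>; \<open>m = 0\<close> is used for \<open>i = 0\<close>, where \<open>psi\<close> does not vanish near \<open>0\<close>.\<close>

definition tsum :: "nat => nat => hN => hN => complex" where
 "tsum i m k g = psi i k * (\<Sum>j<m. tc j k g)"

lemma smooth_on_tsum:
 assumes im: "i ~= 0 | m = 0" and S: "open S" and f: "smooth_on S f" and g: "smooth_on S g"
 shows "smooth_on S (%x. tsum i m (f x) (g x))"
proof (cases "m = 0")
 case True
 then show ?thesis by (simp add: tsum_def smooth_on_const S)
next
 case False
 then have i: "i ~= 0" using im by simp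
 have "smo (%z. tsum i m (fst z) (snd z))"
 proof (rule smooth_on_local)
  fix z :: "hN * hN"
  show "EX T. open T & z : T & smooth_on T (%z. tsum i m (fst z) (snd z))"
  proof (cases "fst z = 0")
   case True
   let ?T = "{z::hN * hN. fR 0 (fst z) < 4 ^ (i - 1)}"
   have o: "open ?T" by (intro open_Collect_less fR_continuous2 continuous_intros)
   have "smooth_on ?T (%z. tsum i m (fst z) (snd z))"
    by (rule smooth_on_cong[OF o smooth_on_const[OF o, of 0]]) (auto simp: tsum_def psi_low[OF i])
   then show ?thesis using o True by (intro exI[of _ ?T]) (auto simp: fR_def)
  next
   case False
   let ?T = "{z::hN * hN. fst z ~= 0}"
   have o: "open ?T" by (intro open_Collect_neq continuous_intros)
   have "smooth_on ?T (%z. tsum i m (fst z) (snd z))"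
    unfolding tsum_def by (intro smooth_intros smooth_on_psi smooth_on_tc o)
   then show ?thesis using o False by (intro exI[of _ ?T]) auto
  qed
 qed
 from smooth_comp[OF this S smooth_on_Pair[OF S f g]] show ?thesis by simp
qed

lemma LN_translate:
 assumes "smo f"
 shows "LN (%h. f (hm k h)) h = LN f (hm k h)"
proof -
 interpret N: line om "%x. x" "%x. x"
  by (rule line.intro) (rule bb_om bounded_linear_ident refl)+
 have "N.act k h = hm k h" for k h by (simp add: N.act_def hm_def)
 moreover have "N.LM = LN" by (intro ext) (simp add: N.LM_def LN_def)
 ultimately show ?thesis using N.LN_act[OF assms, of k h] by simp
qed

text \<open>For fixed \<open>k\<close> the cutoff \<open>psi i k\<close> is a constant factor, left
  translation by \<open>k\<close> commutes with \<open>LN\<close>, and each Taylor coefficient is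
  killed. Subtracting Taylor terms from the kernel therefore leaves the equation intact.\<close>

lemma LN_tsum: "i ~= 0 | m = 0 ==> LN (%h. tsum i m k (hm k h)) h = 0"
proof (cases "k = 0 | m = 0")
 case True
 assume "i ~= 0 | m = 0"
 then have "tsum i m k g = 0" for g using True by (auto simp: tsum_def psi_low fR_def)
 then show ?thesis by (simp add: LN_def)
next
 case False
 then have k: "k ~= 0" by simp
 have s: "smo (tc j k)" for j
 proof -
  have o: "open {z::hN * hN. fst z ~= 0}" by (intro open_Collect_neq continuous_intros)
  have "smo (%g. tc j (fst (k, g)) (snd (k, g)))"
   by (rule smooth_on_compose[OF open_UNIV o smooth_on_tc]) (use k in "auto intro!: smooth_intros")
  then show ?thesis by simp
 qed
 have bb: "bounded_bilinear om" by (rule bb_om)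
 have d: "f differentiable (at p)" if "smo f" for f :: "hN => complex" and p
  using smooth_diff[OF that] by simp
 have 1: "Xf om v (%g. psi i k * (\<Sum>j<m. f j g)) g = psi i k * (\<Sum>j<m. Xf om v (f j) g)"
  if "!!j. smo (f j)" for f :: "nat => hN => complex" and v g
  by (subst Xf_cmult[OF d[OF smooth_on_sum[OF open_UNIV that]]], subst Xf_sum[OF d[OF that]], rule refl)
 have "LN (%g. psi i k * (\<Sum>j<m. tc j k g)) g = psi i k * (\<Sum>j<m. LN (tc j k) g)" for g
 proof -
  have "Xf om v (Xf om v (%g. psi i k * (\<Sum>j<m. tc j k g))) g = psi i k * (\<Sum>j<m. Xf om v (Xf om v (tc j k)) g)" for v
   unfolding 1[OF s, abs_def] by (rule 1[OF smooth_on_Xf[OF bb open_UNIV s]])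
  then show ?thesis unfolding LN_def by (simp add: sum_distrib_left sum.swap[of _ _ UNIV])
 qed
 then have "LN (tsum i m k) g = 0" for g using LN_tc[OF k] by (simp add: tsum_def[abs_def])
 moreover have "smo (tsum i m k)" unfolding tsum_def[abs_def] by (intro smooth_intros s) auto
 ultimately show ?thesis using LN_translate by simp
qed

definition Gam_const :: complex where
 "Gam_const = (SOME c. c ~= 0 & (ALL ph:test_fun. (LI h. GamR h * LN ph h) = c * ph 0))"

lemma Gam_const: "Gam_const ~= 0" "ph : test_fun ==> (LI h. GamR h * LN ph h) = Gam_const * ph 0"
proof -
 have "EX c. c ~= 0 & (ALL ph:test_fun. (LI h. GamR h * LN ph h) = c * ph 0)"
  by (rule fundamental_solution) blast
 from someI_ex[OF this]
 show "Gam_const ~= 0" "ph : test_fun ==> (LI h. GamR h * LN ph h) = Gam_const * ph 0"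
  unfolding Gam_const_def[symmetric] by auto
qed

definition PG :: "nat => hN => hN => real => complex" where
 "PG i k g x = psi i k * GC k g (cir 2 x)"

text \<open>The factor 16 is \<open>2 ^ 4\<close> for the circle of radius 2: if \<open>k\<close>
  lies on the \<open>i\<close>-th shell, then \<open>(k, g)\<close> belongs to
  \<open>regT 2\<close>.\<close>

definition smallN :: "nat => hN set" where
 "smallN i = {g. 16 * fR 0 g < (1 / 1000) ^ 4 * 4 ^ (i - 1)}"

lemma open_smallN: "open (smallN i)"
 unfolding smallN_def by (intro open_Collect_less fR_continuous2 continuous_intros)

lemma smallN_regT: "g : smallN i ==> 4 ^ (i - 1) <= fR 0 k ==> (k, g) : regT 2"
proof -
 assume a: "g : smallN i" "4 ^ (i - 1) <= fR 0 k"
 have "(0::real) < 4 ^ (i - 1)" by simp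
 then have "fR 0 k > 0" using a(2) by (rule less_le_trans)
 then have "k ~= 0" by (auto simp: fR_def)
 moreover have "(1 / 1000) ^ 4 * 4 ^ (i - 1) <= (1 / 1000) ^ 4 * fR 0 k" using a(2) by (intro mult_left_mono) auto
 ultimately show ?thesis using a(1) unfolding regT_def smallN_def mem_Collect_eq fst_conv snd_conv
  by (intro conjI) (assumption, rule order.strict_trans2[of _ "(1 / 1000) ^ 4 * 4 ^ (i - 1)"], simp)
qed

lemma smooth_on_PG:
 assumes i: "i ~= 0" and S: "open S" and s: "smooth_on S k" "smooth_on S g" "smooth_on S x" and sm: "g ` S <= smallN i"
 shows "smooth_on S (%z. PG i (k z) (g z) (x z))"
proof -
 let ?T = "{z :: hN * hN * real. fst (snd z) : smallN i}"
 have oT: "open ?T" using open_vimage[OF open_smallN, of "%z. fst (snd z)"] by (simp add: vimage_def continuous_intros)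
 have "smooth_on ?T (%z. PG i (fst z) (fst (snd z)) (snd (snd z)))"
 proof (rule smooth_on_local)
  fix z assume z: "z : ?T"
  show "EX T. open T & z : T & smooth_on T (%z. PG i (fst z) (fst (snd z)) (snd (snd z)))"
  proof (cases "fR 0 (fst z) < 4 ^ (i - 1)")
   case True
   let ?U = "{z :: hN * hN * real. fR 0 (fst z) < 4 ^ (i - 1)}"
   have o: "open ?U" by (intro open_Collect_less fR_continuous2 continuous_intros)
   have "smooth_on ?U (%z. PG i (fst z) (fst (snd z)) (snd (snd z)))"
    by (rule smooth_on_cong[OF o smooth_on_const[OF o, of 0]]) (auto simp: PG_def psi_low[OF i])
   then show ?thesis using o True by (intro exI[of _ ?U]) auto
  next
   case False
   let ?U = "{z :: hN * hN * real. (fst z, fst (snd z)) : regT 2}"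
   have o: "open ?U" using open_vimage[OF open_regT, of "%z. (fst z, fst (snd z))" 2] by (simp add: vimage_def continuous_intros)
   have "smooth_on ?U (%z. PG i (fst z) (fst (snd z)) (snd (snd z)))"
    unfolding PG_def
    by (intro smooth_intros smooth_on_psi smooth_on_GC smooth_on_cir o) (use regT_nonzero[of 2] in "auto simp: cmod_cir")
   moreover have "z : ?U" using smallN_regT[of "fst (snd z)" i "fst z"] z False by simp
   ultimately show ?thesis using o by (intro exI[of _ ?U]) auto
  qed
 qed
 from smooth_on_compose[OF S oT this smooth_on_Pair[OF S s(1) smooth_on_Pair[OF S s(2,3)]]] sm
 show ?thesis by (simp add: image_subset_iff)
qed

lemma kernel_remainder:
 assumes i: "i ~= 0" and g: "g : smallN i"
 shows "GamR (hm (hinv k) g) * psi i k - tsum i (Suc m) k g = (LI x. rw m x * PG i k g x)"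
proof (cases "fR 0 k < 4 ^ (i - 1)")
 case True
 then show ?thesis using psi_low[OF i, of k] by (simp add: tsum_def PG_def)
next
 case False
 then have r: "(k, g) : regT 2" using smallN_regT[OF g] by simp
 have "GC k g 1 - (\<Sum>j\<le>m. tc j k g) = (LI x. rw m x * GC k g (cir 2 x))"
  by (rule remainder_integral) (rule regT_nonzero[OF _ r], auto)
 moreover have "GC k g 1 = GamR (hm (hinv k) g)" by (simp add: GC_def QC_one GamR_def GR_def)
 moreover have "(LI x. rw m x * PG i k g x) = psi i k * (LI x. rw m x * GC k g (cir 2 x))"
  unfolding PG_def by (subst mult.left_commute) simp
 ultimately show ?thesis by (simp add: tsum_def lessThan_Suc_atMost algebra_simps)
qed

lemma rw_integral_bound:
 assumes f: "cont f" and b: "!!x. x : {0..1} ==> cmod (f x) <= M"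
 shows "cmod (LI x. rw m x * f x) <= M * (1 / 2) ^ m"
proof -
 have w: "lint (rw m)" using cw_rw by (simp add: cw_def)
 have 0: "rw m x = 0" if "x ~: {0..1}" for x using that by (simp add: rw_def unit_ind_def)
 have "M >= 0" using b[of 0] norm_ge_zero[of "f 0"] by (simp, linarith)
 have "cmod (LI x. rw m x * f x) <= M * (LI x. cmod (rw m x))"
  by (rule norm_integral_mult_le[OF w lint_mult_compact[OF w 0 compact_Icc continuous_on_subset[OF f]]]) (use b 0 in auto)
 also have "... <= M * (1 / 2) ^ m" by (rule mult_left_mono[OF rw_norm \<open>M >= 0\<close>])
 finally show ?thesis .
qed

lemma compact_image_bound:
 fixes f :: "'a::topological_space => complex"
 assumes "compact K" "continuous_on K f"
 obtains M where "M >= 0" "!!x. x : K ==> cmod (f x) <= M"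
proof -
 have "bounded (f ` K)" by (rule compact_imp_bounded[OF compact_continuous_image[OF assms(2,1)]])
 then obtain M where "!!x. x : K ==> cmod (f x) <= M" unfolding bounded_iff by blast
 then show thesis by (intro that[of "\<bar>M\<bar>"]) (auto intro: order_trans[OF _ abs_ge_self])
qed

text \<open>A compact set inside the open \<open>smallN i\<close>; doubling the factor 16 yields the
  strict inequality.\<close>

definition small2 :: "nat => hN set" where
 "small2 i = {g. 32 * fR 0 g <= (1 / 1000) ^ 4 * 4 ^ (i - 1)}"

lemma compact_small2: "compact (small2 i)"
proof -
 have "small2 i = {g. fR 0 g <= (1 / 1000) ^ 4 * 4 ^ (i - 1) / 32}" by (auto simp: small2_def)
 then show ?thesis using compact_shell by metis
qed

lemma small2_smallN: "small2 i <= smallN i"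
proof
 fix g assume "g : small2 i"
 moreover have "(0::real) < (1 / 1000) ^ 4 * 4 ^ (i - 1)" by simp
 ultimately show "g : smallN i" using fR_nonneg[of 0 g] unfolding small2_def smallN_def mem_Collect_eq by linarith
qed

text \<open>On the compact product of shell, \<open>small2 i\<close> and unit interval the integrand
  \<open>PG i\<close> is bounded by some \<open>M\<close>, and the weight \<open>rw m\<close> gives
  the decay. As \<open>M\<close> does not depend on \<open>m\<close>, the degree can later be chosen
  after everything else about the \<open>i\<close>-th piece.\<close>

lemma kernel_small:
 assumes i: "i ~= 0"
 shows "EX M>=0. ALL m k g. g : small2 i --> cmod (GamR (hm (hinv k) g) * psi i k - tsum i (Suc m) k g) <= M * (1 / 2) ^ m"
proof -
 let ?A = "{k. fR 0 k <= 2 * 4 ^ i} \<times> small2 i \<times> {0..1::real}"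
 let ?T = "{z :: hN * hN * real. fst (snd z) : smallN i}"
 have oT: "open ?T" using open_vimage[OF open_smallN, of "%z. fst (snd z)"] by (simp add: vimage_def continuous_intros)
 have s: "smooth_on ?T (%z. PG i (fst z) (fst (snd z)) (snd (snd z)))"
  by (intro smooth_on_PG i oT smooth_intros) auto
 have sub: "?A <= ?T" using small2_smallN by (auto simp: subset_iff)
 obtain M where M: "M >= 0" "!!z. z : ?A ==> cmod (PG i (fst z) (fst (snd z)) (snd (snd z))) <= M"
  using compact_image_bound[of ?A "%z. PG i (fst z) (fst (snd z)) (snd (snd z))"]
   compact_Times[OF compact_shell compact_Times[OF compact_small2 compact_Icc]] continuous_on_subset[OF smooth_cont[OF s] sub] by blast
 have "cmod (GamR (hm (hinv k) g) * psi i k - tsum i (Suc m) k g) <= M * (1 / 2) ^ m" if g: "g : small2 i" for m k g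
 proof (cases "fR 0 k <= 2 * 4 ^ i")
  case True
  have gN: "g : smallN i" using g small2_smallN by blast
  have "cont (PG i k g)"
   using smooth_cont[OF smooth_on_PG[OF i open_UNIV smooth_on_const[OF open_UNIV, of k] smooth_on_const[OF open_UNIV, of g] smooth_on_ident[OF open_UNIV]]] gN by auto
  then show ?thesis unfolding kernel_remainder[OF i gN]
   by (rule rw_integral_bound) (use M(2)[of "(k, g, _)"] g True in auto)
 next
  case False
  then show ?thesis using psi_high[of i k] M(1) by (simp add: tsum_def)
 qed
 then show ?thesis using M(1) by blast
qed

section \<open>Inverses on the shells, acting on test functions\<close>

context nline
begin

text \<open>The cutoff is taken at \<open>p\<close>, outside the integration in \<open>h\<close>,
  and not at \<open>act p h\<close>. The sub-Laplacian of the argument then passes to the kernels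
  without hitting the cutoff, and \<open>W_LM\<close> holds without error terms.\<close>

definition W :: "nat => nat => ('x * 't => complex) => 'x * 't => complex" where
 "W i m ph p = (LI h. GamR h * (psi i (kk p) * ph (act p h)))
   - (LI h. tsum i m (kk p) (hm (kk p) h) * ph (act p h))"

lemma act_test_fun: "ph : test_fun ==> (%h. ph (act p h)) : test_fun"
proof -
 assume ph: "ph : test_fun"
 obtain K where K: "compact K" "!!p. p ~: K ==> ph p = 0" using test_funE[OF ph] by metis
 have cK: "compact (kk ` K)" by (intro compact_continuous_image continuous_kk continuous_intros K)
 show ?thesis
 proof (rule test_funI[OF _ compact_HH[OF compact_insert[OF compact_empty] cK, of "kk p"]])
  show "smo (%h. ph (act p h))"
   by (intro smooth_comp[OF test_funD[OF ph]] smooth_act smooth_intros open_UNIV)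
  show "ph (act p h) = 0" if "h ~: (%z. hm (hinv (fst z)) (snd z)) ` ({kk p} \<times> kk ` K)" for h
   using that HH_mem[of p "{kk p}" h "kk ` K"] K(2)[of "act p h"] by blast
 qed
qed

lemma smooth_tsum_kk: "i ~= 0 | m = 0 ==> smo (%h. tsum i m k (hm k h))"
 by (intro smooth_on_tsum smooth_hm smooth_intros) auto

lemma W_integrable:
 assumes ph: "ph : test_fun" and im: "i ~= 0 | m = 0"
 shows "lint (%h. GamR h * (c * ph (act p h)))"
  "lint (%h. tsum i m k (hm k h) * ph (act p h))"
 using cw_loc[OF loc_integrable_GamR test_fun_cmult[OF act_test_fun[OF ph]]]
  test_fun_lint[OF test_fun_mult[OF smooth_tsum_kk[OF im] act_test_fun[OF ph]]]
 by (auto simp: cw_def)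

lemma W_LM:
 assumes ph: "ph : test_fun" and im: "i ~= 0 | m = 0"
 shows "W i m (LM ph) p = Gam_const * (psi i (kk p) * ph p)"
proof -
 let ?f = "%h. ph (act p h)"
 have L: "LM ph (act p h) = LN ?f h" for h by (rule LN_act[OF test_funD[OF ph], symmetric])
 have "(LI h. tsum i m (kk p) (hm (kk p) h) * LN ?f h) = (LI h. LN (%h. tsum i m (kk p) (hm (kk p) h)) h * ?f h)"
  by (rule integral_LN_transpose[OF smooth_tsum_kk[OF im] act_test_fun[OF ph]])
 also have "... = 0" using LN_tsum[OF im] by simp
 finally have 2: "(LI h. tsum i m (kk p) (hm (kk p) h) * LN ?f h) = 0" .
 have "(LI h. GamR h * (psi i (kk p) * LN ?f h)) = psi i (kk p) * (LI h. GamR h * LN ?f h)"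
  by (subst mult.left_commute) simp
 also have "... = psi i (kk p) * (Gam_const * ph p)" using Gam_const(2)[OF act_test_fun[OF ph], of p] by simp
 finally show ?thesis unfolding W_def L 2 by (simp add: mult.left_commute)
qed

lemma W_add:
 assumes "ph : test_fun" "ps : test_fun" "i ~= 0 | m = 0"
 shows "W i m (%p. ph p + ps p) = (%p. W i m ph p + W i m ps p)"
 by (rule ext) (simp add: W_def distrib_left W_integrable[OF assms(1,3)] W_integrable[OF assms(2,3)])

lemma W_cmult: "W i m (%p. c * ph p) = (%p. c * W i m ph p)"
proof
 fix p
 have 1: "GamR h * (psi i (kk p) * (c * ph (act p h))) = c * (GamR h * (psi i (kk p) * ph (act p h)))"
  "tsum i m (kk p) (hm (kk p) h) * (c * ph (act p h)) = c * (tsum i m (kk p) (hm (kk p) h) * ph (act p h))" for h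
  by simp_all
 show "W i m (%p. c * ph p) p = c * W i m ph p" unfolding W_def 1 by (simp add: right_diff_distrib)
qed

text \<open>Supports are spread over a whole shell along the orbits, but not transversally.\<close>

definition ZZ :: "nat => ('x * 't) set => ('x * 't) set" where
 "ZZ i K = (%z. act (fst z, 0) (snd z)) ` (yy ` K \<times> {k. fR 0 k <= 2 * 4 ^ i})"

lemma W_test_in:
 assumes K: "compact K" and ph: "ph : test_in K" and im: "i ~= 0 | m = 0"
 shows "W i m ph : test_in (ZZ i K)"
proof -
 have pht: "ph : test_fun" by (rule test_in_test[OF ph])
 have cK: "compact (kk ` K)" by (intro compact_continuous_image continuous_kk continuous_intros K)
 have z: "W i m ph p = 0" if p: "p ~: ZZ i K" for p
 proof (cases "yy p : yy ` K")
  case True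
  then have "psi i (kk p) = 0" using p ZZ_mem[of p K "2 * 4 ^ i"] psi_high[of i "kk p"] unfolding ZZ_def by linarith
  then show ?thesis by (simp add: W_def tsum_def)
 next
  case False
  then have "act p h ~: K" for h using yy_act[of p h] by (metis imageI)
  then have "ph (act p h) = 0" for h by (intro test_in_zero[OF ph])
  then show ?thesis by (simp add: W_def)
 qed
 have sa: "smo (%z. ph (act (fst z) (snd z)))"
  by (intro smooth_comp[OF test_funD[OF pht]] smooth_act smooth_intros open_UNIV)
 have supp: "EX V H. open V & p : V & compact H & (ALL q:V. ALL h. h ~: H --> ph (act q h) = 0)" for p
 proof -
  let ?H = "(%z. hm (hinv (fst z)) (snd z)) ` (kk ` cball p 1 \<times> kk ` K)"
  have "compact ?H" by (intro compact_HH cK compact_continuous_image continuous_kk continuous_intros compact_cball)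
  moreover have "ph (act q h) = 0" if "q : ball p 1" "h ~: ?H" for q h
  proof (rule test_in_zero[OF ph], rule)
   assume "act q h : K"
   then have "h : ?H" using that(1) by (intro HH_mem) auto
   then show False using that(2) by blast
  qed
  ultimately show ?thesis by (intro exI[of _ "ball p 1"] exI[of _ ?H]) simp
 qed
 have "smo (%p. LI h. GamR h * (%z. psi i (kk (fst z)) * ph (act (fst z) (snd z))) (p, h))"
 proof (rule smooth_param_loc)
  show "smooth_on (UNIV \<times> UNIV) (%z. psi i (kk (fst z)) * ph (act (fst z) (snd z)))"
   unfolding UNIV_Times_UNIV by (intro smooth_intros smooth_on_psi smooth_on_kk sa open_UNIV)
  show "EX V H. open V & p : V & compact H & (ALL q:V. ALL h. h ~: H --> psi i (kk (fst (q, h))) * ph (act (fst (q, h)) (snd (q, h))) = 0)" for p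
   using supp[of p] unfolding fst_conv snd_conv by (elim ex_forward) simp
 qed (auto simp: loc_integrable_GamR)
 moreover have "smo (%p. LI h. 1 * (%z. tsum i m (kk (fst z)) (hm (kk (fst z)) (snd z)) * ph (act (fst z) (snd z))) (p, h))"
 proof (rule smooth_param_loc)
  show "smooth_on (UNIV \<times> UNIV) (%z. tsum i m (kk (fst z)) (hm (kk (fst z)) (snd z)) * ph (act (fst z) (snd z)))"
   unfolding UNIV_Times_UNIV by (intro smooth_intros smooth_on_tsum im smooth_hm smooth_on_kk sa open_UNIV)
  show "EX V H. open V & p : V & compact H & (ALL q:V. ALL h. h ~: H --> tsum i m (kk (fst (q, h))) (hm (kk (fst (q, h))) (snd (q, h))) * ph (act (fst (q, h)) (snd (q, h))) = 0)" for p
   using supp[of p] unfolding fst_conv snd_conv by (elim ex_forward) simp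
  show "loc_integrable (%h::hN. 1)" by (rule loc_integrable_continuous) simp
 qed auto
 ultimately have "smo (W i m ph)"
  unfolding W_def[abs_def] by (intro smooth_intros open_UNIV) simp_all
 then have "W i m ph : test_fun"
  by (rule test_funI[OF _ compact_ZZ[OF K]]) (rule z, simp add: ZZ_def)
 then show ?thesis using z by (auto simp: test_in_def)
qed

text \<open>Any integrable majorant of the kernel bounds the operator by the supremum norm. It is
  used with a crude majorant containing \<open>GamR\<close> and with the small constant of
  \<open>kernel_small\<close>.\<close>

lemma W_le:
 assumes ph: "ph : test_in K" and im: "i ~= 0 | m = 0"
  and H: "H = (%z. hm (hinv (fst z)) (snd z)) ` ({k. fR 0 k <= 2 * 4 ^ i} \<times> kk ` K)"
  and f: "lint (%h. indicator H h * f h)" "!!h. f h >= 0"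
  and le: "!!h. fR 0 (kk p) <= 2 * 4 ^ i ==> act p h : K ==> cmod (GamR h * psi i (kk p) - tsum i m (kk p) (hm (kk p) h)) <= f h"
 shows "cmod (W i m ph p) <= (LI h. indicator H h * f h) * Cm_norm 0 ph"
proof (cases "fR 0 (kk p) <= 2 * 4 ^ i")
 case True
 note pht = test_in_test[OF ph]
 note int = W_integrable[OF pht im]
 have F: "W i m ph p = (LI h. (GamR h * psi i (kk p) - tsum i m (kk p) (hm (kk p) h)) * ph (act p h))"
  unfolding W_def by (subst Bochner_Integration.integral_diff[OF int, symmetric]) (simp add: algebra_simps)
 have "cmod (W i m ph p) <= (LI h. cmod ((GamR h * psi i (kk p) - tsum i m (kk p) (hm (kk p) h)) * ph (act p h)))"
  unfolding F by (rule integral_norm_bound)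
 also have "... <= (LI h. (indicator H h * f h) * Cm_norm 0 ph)"
 proof (rule integral_mono)
  have "lint (%h. GamR h * (psi i (kk p) * ph (act p h)) - tsum i m (kk p) (hm (kk p) h) * ph (act p h))"
   by (rule Bochner_Integration.integrable_diff[OF int])
  then show "lint (%h. cmod ((GamR h * psi i (kk p) - tsum i m (kk p) (hm (kk p) h)) * ph (act p h)))"
   by (simp add: algebra_simps)
  show "lint (%h. (indicator H h * f h) * Cm_norm 0 ph)" using f(1) by simp
  show "cmod ((GamR h * psi i (kk p) - tsum i m (kk p) (hm (kk p) h)) * ph (act p h)) <= (indicator H h * f h) * Cm_norm 0 ph" for h
  proof (cases "act p h : K")
   case K: True
   then have "h : H" unfolding H using True by (intro HH_mem) auto
   then show ?thesis unfolding norm_mult using le[OF True K] Cm_norm_ge[OF pht, of "act p h" 0] f(2)[of h] by (auto intro!: mult_mono)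
  next
   case False
   then have "ph (act p h) = 0" by (rule test_in_zero[OF ph])
   then show ?thesis using f(2)[of h] Cm_norm_nonneg[OF pht, of 0] by simp
  qed
 qed
 finally show ?thesis by simp
next
 case False
 then have "W i m ph p = 0" using psi_high[of i "kk p"] by (simp add: W_def tsum_def)
 moreover have "(LI h. indicator H h * f h) >= 0" by (intro integral_nonneg_AE) (use f(2) in auto)
 ultimately show ?thesis using Cm_norm_nonneg[OF test_in_test[OF ph], of 0] by simp
qed

lemma W_bound:
 assumes K: "compact K" and im: "i ~= 0 | m = 0"
 shows "EX D>=0. ALL ph:test_in K. ALL p. cmod (W i m ph p) <= D * Cm_norm 0 ph"
proof -
 have cK: "compact (kk ` K)" by (intro compact_continuous_image continuous_kk continuous_intros K)
 let ?A = "{k. fR 0 k <= 2 * 4 ^ i} \<times> kk ` K"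
 define H where "H = (%z. hm (hinv (fst z)) (snd z)) ` ?A"
 have cH: "compact H" unfolding H_def by (intro compact_HH compact_shell cK)
 have s: "smo (%z. tsum i m (fst z) (snd z))" by (intro smooth_on_tsum im smooth_intros open_UNIV)
 obtain M where M: "M >= 0" "!!z. z : ?A ==> cmod (tsum i m (fst z) (snd z)) <= M"
  using compact_image_bound[OF compact_Times[OF compact_shell cK] continuous_on_subset[OF smooth_cont[OF s] subset_UNIV]] by blast
 define f where "f h = cmod (GamR h) + M" for h
 have "lint (%h. indicator H h *\<^sub>R GamR h)" using loc_integrable_GamR cH by (simp add: loc_integrable_def)
 then have "lint (%h. cmod (indicator H h *\<^sub>R GamR h))" by (rule integrable_norm)
 moreover have "lint (%h. indicator H h *\<^sub>R M)" by (rule borel_integrable_compact[OF cH]) auto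
 ultimately have "lint (%h. cmod (indicator H h *\<^sub>R GamR h) + indicator H h *\<^sub>R M)" by (rule Bochner_Integration.integrable_add)
 moreover have "(%h. cmod (indicator H h *\<^sub>R GamR h) + indicator H h *\<^sub>R M) = (%h. indicator H h * f h)"
  by (auto simp: f_def indicator_def)
 ultimately have fi: "lint (%h. indicator H h * f h)" by simp
 have f0: "f h >= 0" for h using M(1) by (simp add: f_def)
 have "cmod (W i m ph p) <= (LI h. indicator H h * f h) * Cm_norm 0 ph" if ph: "ph : test_in K" for ph p
 proof (rule W_le[OF ph im H_def fi f0])
  fix h assume h: "fR 0 (kk p) <= 2 * 4 ^ i" "act p h : K"
  have "cmod (tsum i m (kk p) (hm (kk p) h)) <= M"
   using M(2)[of "(kk p, hm (kk p) h)"] h kk_act[of p h] by (metis (mono_tags, lifting) SigmaI fst_conv imageI mem_Collect_eq snd_conv)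
  moreover have "cmod (GamR h * psi i (kk p)) <= cmod (GamR h) * 1"
   unfolding norm_mult by (intro mult_left_mono psi_bound) auto
  ultimately show "cmod (GamR h * psi i (kk p) - tsum i m (kk p) (hm (kk p) h)) <= f h"
   using norm_triangle_ineq4[of "GamR h * psi i (kk p)" "tsum i m (kk p) (hm (kk p) h)"] by (simp add: f_def)
 qed
 moreover have "(LI h. indicator H h * f h) >= 0" by (intro integral_nonneg_AE) (use f0 in auto)
 ultimately show ?thesis by blast
qed

text \<open>The exhaustion on which the small bounds for the \<open>i\<close>-th kernel are valid;
  the transversal is bounded as well, to make it compact.\<close>

definition KK :: "nat => ('x * 't) set" where
 "KK i = {p. kk p : small2 i & norm (yy p) <= real i}"

lemma compact_KK: "compact (KK i)"
proof -
 let ?A = "(%z. act (fst z, 0) (snd z)) ` (cball 0 (real i) \<times> small2 i)"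
 have "compact ?A" by (intro compact_continuous_image continuous_act continuous_intros compact_Times compact_small2 compact_cball)
 moreover have "closed (KK i)"
 proof -
  have "closed (kk -` small2 i)" by (rule continuous_closed_vimage[OF compact_imp_closed[OF compact_small2]])
    (use continuous_kk[OF continuous_on_id, of UNIV] continuous_on_eq_continuous_at[OF open_UNIV] in auto)
  moreover have "closed {p. norm (yy p) <= real i}" by (intro closed_Collect_le continuous_intros continuous_yy)
  moreover have "KK i = kk -` small2 i \<inter> {p. norm (yy p) <= real i}" by (auto simp: KK_def)
  ultimately show ?thesis by (metis closed_Int)
 qed
 moreover have "KK i <= ?A"
 proof
  fix p assume "p : KK i"
  then show "p : ?A" by (intro image_eqI[of _ _ "(yy p, kk p)"]) (auto simp: act_kk KK_def)
 qed
 ultimately have "compact (?A \<inter> KK i)" "?A \<inter> KK i = KK i" by (blast intro: compact_Int_closed)+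
 then show ?thesis by simp
qed

lemma KK_exhaust:
 assumes K: "compact K" shows "EX i0. ALL i>=i0. K <= KK i"
proof -
 have 1: "continuous_on K (%p. complex_of_real (fR 0 (kk p)))" "continuous_on K (%p. complex_of_real (norm (yy p)))"
  by (intro continuous_intros fR_continuous2 continuous_kk continuous_yy)+
 obtain A where A: "!!p. p : K ==> cmod (of_real (fR 0 (kk p))) <= A" using compact_image_bound[OF K 1(1)] by blast
 obtain B where B: "!!p. p : K ==> cmod (of_real (norm (yy p))) <= B" using compact_image_bound[OF K 1(2)] by blast
 \<comment> \<open>The number is \<open>32 * 1000 ^ 4\<close>, the constant of \<open>small2\<close>
   cleared of its denominator.\<close>
 obtain n where n: "32000000000000 * A < 4 ^ n" using real_arch_pow[of 4 "32000000000000 * A"] by auto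
 obtain l where l: "B <= real l" using real_arch_simple by blast
 have "K <= KK i" if i: "i >= max (Suc n) l" for i
 proof
  fix p assume p: "p : K"
  have "(4::real) ^ n <= 4 ^ (i - 1)" using i by (intro power_increasing) auto
  then have "32000000000000 * fR 0 (kk p) <= 4 ^ (i - 1)" using n A[OF p] fR_nonneg[of 0 "kk p"] unfolding norm_of_real by linarith
  moreover have "norm (yy p) <= real i" using B[OF p] l i by simp
  ultimately show "p : KK i" by (simp add: KK_def small2_def power_divide)
 qed
 then show ?thesis by blast
qed

lemma W_small:
 assumes i: "i ~= 0"
 shows "EX D>=0. ALL m. ALL ph:test_in (KK i). ALL p. cmod (W i (Suc m) ph p) <= D * (1 / 2) ^ m * Cm_norm 0 ph"
proof -
 obtain M where M: "M >= 0" "!!m k g. g : small2 i ==> cmod (GamR (hm (hinv k) g) * psi i k - tsum i (Suc m) k g) <= M * (1 / 2) ^ m"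
  using kernel_small[OF i] by blast
 define H where "H = (%z. hm (hinv (fst z)) (snd z)) ` ({k. fR 0 k <= 2 * 4 ^ i} \<times> kk ` KK i)"
 have cH: "compact H" unfolding H_def
  by (intro compact_HH compact_shell compact_continuous_image continuous_kk continuous_intros compact_KK)
 have fi: "lint (%h. indicator H h * (M * (1 / 2) ^ m))" for m
  using borel_integrable_compact[OF cH, of "%_. M * (1 / 2) ^ m"] by simp
 have e: "(LI h. indicator H h * (M * (1 / 2) ^ m)) = (M * (LI h. indicator H h)) * (1 / 2) ^ m" for m
  unfolding integral_mult_left_zero by simp
 have "cmod (W i (Suc m) ph p) <= (LI h. indicator H h * (M * (1 / 2) ^ m)) * Cm_norm 0 ph" if ph: "ph : test_in (KK i)" for m ph p
 proof (rule W_le[OF ph _ H_def fi])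
  fix h assume h: "act p h : KK i"
  then have "hm (kk p) h : small2 i" by (simp add: KK_def kk_act)
  from M(2)[OF this, of "kk p" m]
  show "cmod (GamR h * psi i (kk p) - tsum i (Suc m) (kk p) (hm (kk p) h)) <= M * (1 / 2) ^ m"
   by (simp add: hm_hinv_cancel)
 qed (use i M(1) in auto)
 then have "cmod (W i (Suc m) ph p) <= (M * (LI h. indicator H h)) * (1 / 2) ^ m * Cm_norm 0 ph" if "ph : test_in (KK i)" for m ph p
  using that by (simp only: e)
 moreover have "M * (LI h. indicator H h) >= 0" using M(1) by (intro mult_nonneg_nonneg integral_nonneg_AE) auto
 ultimately show ?thesis by blast
qed

lemma psi_finite:
 assumes K: "compact K" and ph: "ph : test_in K"
 obtains n where "!!i p. i ~: {..n} ==> psi i (kk p) * ph p = 0" "!!p. (\<Sum>i\<le>n. psi i (kk p) * ph p) = ph p"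
proof -
 have "continuous_on K (%p. complex_of_real (fR 0 (kk p)))"
  by (intro continuous_intros fR_continuous2 continuous_kk)
 then obtain A where A: "!!p. p : K ==> cmod (of_real (fR 0 (kk p))) <= A" using compact_image_bound[OF K] by blast
 obtain n where n: "A < 4 ^ n" using real_arch_pow[of 4 A] by auto
 have An: "fR 0 (kk p) <= 4 ^ n" if "p : K" for p using A[OF that] n fR_nonneg[of 0 "kk p"] by simp
 have "psi i (kk p) * ph p = 0" if "i ~: {..n}" for i p
 proof (cases "p : K")
  case True
  have "(4::real) ^ n <= 4 ^ (i - 1)" using that by (intro power_increasing) auto
  then have "psi i (kk p) = 0" using that by (intro psi_low order_trans[OF An[OF True]]) auto
  then show ?thesis by simp
 qed (use test_in_zero[OF ph] in simp)
 moreover have "(\<Sum>i\<le>n. psi i (kk p) * ph p) = ph p" for p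
  unfolding sum_distrib_right[symmetric] sum_psi using theta_1[OF An[of p]] test_in_zero[OF ph, of p] by (cases "p : K") auto
 ultimately show ?thesis by (rule that)
qed

end

lemma half_power_small: obtains m where "C * (1 / 2) ^ m <= (1 / 2 :: real) ^ i"
proof -
 have "(%m. C * (1 / 2 :: real) ^ m) \<longlonglongrightarrow> C * 0" by (intro tendsto_intros LIMSEQ_power_zero) simp
 then have "\<forall>\<^sub>F m in sequentially. C * (1 / 2 :: real) ^ m < (1 / 2) ^ i" by (rule order_tendstoD) simp
 then show ?thesis using that by (auto simp: eventually_sequentially intro: less_imp_le)
qed

context nline
begin

text \<open>The solution is the series of \<open>G\<close> after \<open>W i\<close>, divided by
  \<open>Gam_const\<close>. The degree of the \<open>i\<close>-th kernel makes its term at most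
  \<open>(1 / 2) ^ i\<close> times the supremum norm on \<open>KK i\<close>, so on a given compact
  set only finitely many terms need another bound. On \<open>LM ph\<close> the terms give back the
  partition of unity.\<close>

lemma mittag_leffler_order0:
 assumes G: "order0 G"
 shows "EX u:distr. ALL ph:test_fun. G ph = u (LM ph)"
proof -
 have Gd: "G : distr" using G by (simp add: order0_def)
 \<comment> \<open>Order zero enters here: a bound for the supremum of \<open>W i m ph\<close> is
   enough, and none of its derivatives has to be estimated.\<close>
 have GW: "EX B>=0. ALL ph:test_in K. ALL m D. (i ~= 0 | m = 0) --> (ALL p. cmod (W i m ph p) <= D) --> cmod (G (W i m ph)) <= B * D"
  if K: "compact K" for K i
 proof -
  have "compact (ZZ i K)" unfolding ZZ_def by (rule compact_ZZ[OF K])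
  then obtain B where B: "B >= 0" "!!ph. ph : test_in (ZZ i K) ==> cmod (G ph) <= B * Cm_norm 0 ph"
   using G unfolding order0_def by blast
  have "cmod (G (W i m ph)) <= B * D" if "ph : test_in K" "i ~= 0 | m = 0" "ALL p. cmod (W i m ph p) <= D" for ph m D
   by (rule order_trans[OF B(2)[OF W_test_in[OF K that(1,2)]] mult_left_mono[OF Cm_norm_least B(1)]]) (use that(3) in auto)
  then show ?thesis using B(1) by blast
 qed
 have "EX m. i ~= 0 --> (ALL ph:test_in (KK i). cmod (G (W i (Suc m) ph)) <= (1 / 2) ^ i * Cm_norm 0 ph)" for i
 proof (cases "i = 0")
  case False
  obtain D where D: "D >= 0" "!!m ph p. ph : test_in (KK i) ==> cmod (W i (Suc m) ph p) <= D * (1 / 2) ^ m * Cm_norm 0 ph"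
   using W_small[OF False] by blast
  obtain B where B: "!!ph m D. ph : test_in (KK i) ==> ALL p. cmod (W i (Suc m) ph p) <= D ==> cmod (G (W i (Suc m) ph)) <= B * D"
   using GW[OF compact_KK[of i], of i] False by blast
  obtain m where m: "B * D * (1 / 2) ^ m <= (1 / 2) ^ i" by (rule half_power_small)
  have "cmod (G (W i (Suc m) ph)) <= (1 / 2) ^ i * Cm_norm 0 ph" if ph: "ph : test_in (KK i)" for ph
   using B[OF ph, of m] D(2)[OF ph, of m] mult_right_mono[OF m Cm_norm_nonneg[OF test_in_test[OF ph], of 0]]
   by (fastforce simp: mult.assoc)
  then show ?thesis by blast
 qed simp
 then obtain m where m: "!!i ph. i ~= 0 ==> ph : test_in (KK i) ==> cmod (G (W i (Suc (m i)) ph)) <= (1 / 2) ^ i * Cm_norm 0 ph"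
  by metis
 define mm where "mm i = (if i = 0 then 0 else Suc (m i))" for i
 have im: "i ~= 0 | mm i = 0" for i by (simp add: mm_def)
 have bound: "EX M. summable M & (ALL i. ALL ph:test_in K. cmod (G (W i (mm i) ph)) <= M i * Cm_norm 0 ph)" if K: "compact K" for K
 proof -
  obtain i0 where i0: "!!i. i >= i0 ==> K <= KK i" using KK_exhaust[OF K] by blast
  have "EX e>=0. ALL ph:test_in K. cmod (G (W i (mm i) ph)) <= e * Cm_norm 0 ph" for i
  proof -
   obtain D where D: "D >= 0" "!!ph p. ph : test_in K ==> cmod (W i (mm i) ph p) <= D * Cm_norm 0 ph"
    using W_bound[OF K im[of i]] by blast
   obtain B where B: "B >= 0" "!!ph D. ph : test_in K ==> ALL p. cmod (W i (mm i) ph p) <= D ==> cmod (G (W i (mm i) ph)) <= B * D"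
    using GW[OF K, of i] im[of i] by blast
   show ?thesis using B D by (intro exI[of _ "B * D"]) (auto simp: mult.assoc)
  qed
  then obtain e where e: "!!i. e i >= 0" "!!i ph. ph : test_in K ==> cmod (G (W i (mm i) ph)) <= e i * Cm_norm 0 ph"
   by metis
  define M where "M i = (1 / 2) ^ i + (if i : {..i0} then e i else 0)" for i
  have "summable M" unfolding M_def by (intro summable_add summable_If_finite_set summable_geometric) auto
  moreover have "cmod (G (W i (mm i) ph)) <= M i * Cm_norm 0 ph" if ph: "ph : test_in K" for i ph
  proof (cases "i <= i0")
   case True
   have "e i * Cm_norm 0 ph <= M i * Cm_norm 0 ph"
    using True by (intro mult_right_mono Cm_norm_nonneg test_in_test[OF ph]) (auto simp: M_def)
   then show ?thesis using e(2)[OF ph, of i] by linarith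
  next
   case False
   have "ph : test_in (KK i)" using ph i0[of i] False by (auto simp: test_in_def)
   from m[OF _ this] False show ?thesis by (auto simp: mm_def M_def)
  qed
  ultimately show ?thesis by blast
 qed
 have summ: "summable (%i. G (W i (mm i) ph))" if ph: "ph : test_fun" for ph
 proof -
  obtain K where K: "compact K" "ph : test_in K" using test_fun_test_inE[OF ph] by blast
  obtain M where M: "summable M" "!!i. cmod (G (W i (mm i) ph)) <= M i * Cm_norm 0 ph"
   using bound[OF K(1)] K(2) by blast
  show ?thesis by (rule summable_comparison_test'[OF summable_mult2[OF M(1)] M(2)])
 qed
 define u where "u ph = (if ph : test_fun then inverse Gam_const * (\<Sum>i. G (W i (mm i) ph)) else 0)" for ph
 have Wt: "W i (mm i) ph : test_fun" if ph: "ph : test_fun" for i ph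
 proof -
  obtain K where K: "compact K" "ph : test_in K" using test_fun_test_inE[OF ph] by blast
  show ?thesis by (rule test_in_test[OF W_test_in[OF K im]])
 qed
 have "u : distr"
 proof (rule distrI)
  fix ph ps :: "'x * 't => complex" assume a: "ph : test_fun" "ps : test_fun"
  have "G (W i (mm i) (%p. ph p + ps p)) = G (W i (mm i) ph) + G (W i (mm i) ps)" for i
   unfolding W_add[OF a im] by (rule distrD(1)[OF Gd Wt[OF a(1)] Wt[OF a(2)]])
  then show "u (%p. ph p + ps p) = u ph + u ps"
   using a test_fun_add[OF a] suminf_add[OF summ[OF a(1)] summ[OF a(2)], symmetric]
   by (simp add: u_def distrib_left)
 next
  fix c and ph :: "'x * 't => complex" assume a: "ph : test_fun"
  have "G (W i (mm i) (%p. c * ph p)) = c * G (W i (mm i) ph)" for i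
   unfolding W_cmult by (rule distrD(2)[OF Gd Wt[OF a]])
  then show "u (%p. c * ph p) = c * u ph"
   using a test_fun_cmult[OF a] suminf_mult[OF summ[OF a], of c] by (simp add: u_def)
 next
  fix K :: "('x * 't) set" assume K: "compact K"
  obtain M where M: "summable M" "!!i ph. ph : test_in K ==> cmod (G (W i (mm i) ph)) <= M i * Cm_norm 0 ph"
   using bound[OF K(1)] by blast
  have "cmod (u ph) <= (cmod (inverse Gam_const) * (\<Sum>i. M i)) * Cm_norm 0 ph" if ph: "ph : test_in K" for ph
  proof -
   have "cmod (\<Sum>i. G (W i (mm i) ph)) <= (\<Sum>i. M i * Cm_norm 0 ph)"
    by (rule norm_suminf_le[OF M(2)[OF ph] summable_mult2[OF M(1)]])
   also have "... = (\<Sum>i. M i) * Cm_norm 0 ph" by (rule suminf_mult2[OF M(1), symmetric])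
   finally show ?thesis using test_in_test[OF ph] by (auto simp: u_def norm_mult mult.assoc intro!: mult_left_mono)
  qed
  then show "EX C m. ALL ph:test_in K. cmod (u ph) <= C * Cm_norm m ph" by blast
 qed (simp add: u_def)
 moreover have "G ph = u (LM ph)" if ph: "ph : test_fun" for ph
 proof -
  obtain K where K: "compact K" "ph : test_in K" using test_fun_test_inE[OF ph] by blast
  obtain n where n: "!!i p. i ~: {..n} ==> psi i (kk p) * ph p = 0" "!!p. (\<Sum>i\<le>n. psi i (kk p) * ph p) = ph p"
   using psi_finite[OF K] by blast
  have pt: "(%p. psi i (kk p) * ph p) : test_fun" for i
   by (intro test_fun_mult ph smooth_on_psi smooth_on_kk smooth_intros open_UNIV)
  have WL: "W i (mm i) (LM ph) = (%p. Gam_const * (psi i (kk p) * ph p))" for i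
   by (rule ext) (rule W_LM[OF ph im])
  have GW: "G (W i (mm i) (LM ph)) = Gam_const * G (%p. psi i (kk p) * ph p)" for i
   unfolding WL by (rule distrD(2)[OF Gd pt])
  have z: "(%p. psi i (kk p) * ph p) = (%p. 0 * ph p)" if "i ~: {..n}" for i
   using n(1)[OF that] by auto
  have "(\<Sum>i. G (W i (mm i) (LM ph))) = (\<Sum>i\<le>n. Gam_const * G (%p. psi i (kk p) * ph p))"
   unfolding GW by (rule suminf_finite) (use z distrD(2)[OF Gd ph, of 0] in auto)
  also have "... = Gam_const * G (%p. \<Sum>i\<le>n. psi i (kk p) * ph p)"
   by (subst distr_sum[OF Gd pt]) (simp add: sum_distrib_left)
  also have "(%p. \<Sum>i\<le>n. psi i (kk p) * ph p) = ph" using n(2) by blast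
  finally show ?thesis using test_contD(1)[OF test_cont_LM ph] Gam_const(1) by (simp add: u_def)
 qed
 ultimately show ?thesis by blast
qed

end

section \<open>Series of smooth functions with bounds on an exhaustion\<close>

lemma nd_suminf:
 fixes f :: "nat => 'a::euclidean_space => complex"
 assumes S: "open S" "convex S"
 shows "(!!i. smooth_on S (f i)) ==>
  (!!vs. set vs <= Basis ==> EX M. summable M & (ALL i. ALL x:S. cmod (iter_dird vs (f i) x) <= M i)) ==>
  nd n S (%x. \<Sum>i. f i x)"
proof (induction n arbitrary: f)
 case 0
 obtain M where "summable M" "!!i x. x : S ==> cmod (f i x) <= M i" using "0.prems"(2)[of "[]"] by auto
 then have "uniform_limit S (%n x. \<Sum>i<n. f i x) (%x. \<Sum>i. f i x) sequentially" by (intro Weierstrass_m_test)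
 then have "continuous_on S (%x. \<Sum>i. f i x)"
  by (rule uniform_limit_theorem[rotated, OF _ trivial_limit_sequentially])
    (intro always_eventually allI continuous_on_sum smooth_cont "0.prems"(1))
 then show ?case by simp
next
 case (Suc n)
 note sm = Suc.prems(1) and bd = Suc.prems(2)
 define g' where "g' x v = (\<Sum>b\<in>Basis. of_real (v \<bullet> b) * (\<Sum>i. dird b (f i) x))" for x v
 have unif: "uniform_limit S (%n x. \<Sum>i<n. dird b (f i) x) (%x. \<Sum>i. dird b (f i) x) sequentially" if b: "b : Basis" for b
 proof -
  obtain M where "summable M" "!!i x. x : S ==> cmod (dird b (f i) x) <= M i"
   using bd[of "[b]"] b by (auto simp: iter_dird_Cons)
  then show ?thesis by (intro Weierstrass_m_test)
 qed
 have der: "((%x. \<Sum>i. f i x) has_derivative g' x) (at x)" if x: "x : S" for x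
 proof -
  obtain M where M: "summable M" "!!i x. x : S ==> cmod (f i x) <= M i" using bd[of "[]"] by auto
  have su: "summable (%i. f i y)" if "y : S" for y
   by (rule summable_comparison_test'[OF M(1), of 0]) (use M(2) that in auto)
  have "EX g. ALL x:S. (%n. f n x) sums (g x) & (g has_derivative g' x) (at x within S)"
  \<comment> \<open>Termwise differentiation asks for a convex set and for uniform convergence of
    the total derivatives; the latter is assembled from the finitely many basis directions.\<close>
  proof (rule has_derivative_series[where f' = "%i x v. dird v (f i) x" and x = x and l = "\<Sum>i. f i x", OF S(2)])
   show "(f i has_derivative (%v. dird v (f i) y)) (at y within S)" if "y : S" for i y
    using has_derivative_at_withinI[OF has_derivative_dird[OF smooth_diff[OF sm that]]] .
   fix e :: real assume e: "e > 0"
   have "\<forall>\<^sub>F n in sequentially. ALL b:Basis. ALL y:S. dist (\<Sum>i<n. dird b (f i) y) (\<Sum>i. dird b (f i) y) < e / DIM('a)"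
    by (rule eventually_ball_finite[OF finite_Basis], rule ballI) (use unif e in "auto simp: uniform_limit_iff")
   then show "\<forall>\<^sub>F n in sequentially. ALL y:S. ALL h. norm ((\<Sum>i<n. dird h (f i) y) - g' y h) <= e * norm h"
   proof eventually_elim
    case (elim n)
    show ?case
    proof (intro ballI allI)
     fix y h assume y: "y : S"
     have "dird h (f i) y = (\<Sum>b\<in>Basis. of_real (h \<bullet> b) * dird b (f i) y)" for i
      using linear_Basis_expand[OF dird_linear[OF smooth_diff[OF sm[of i] y]], of h] by (simp add: scaleR_conv_of_real)
     then have "(\<Sum>i<n. dird h (f i) y) - g' y h = (\<Sum>b\<in>Basis. of_real (h \<bullet> b) * ((\<Sum>i<n. dird b (f i) y) - (\<Sum>i. dird b (f i) y)))"
      by (simp add: g'_def sum_subtractf right_diff_distrib sum_distrib_left sum.swap[of _ _ "{..<n}"])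
     also have "cmod ... <= (\<Sum>b\<in>(Basis::'a set). norm h * (e / DIM('a)))"
     proof (rule sum_norm_le)
      fix b :: 'a assume b: "b : Basis"
      show "cmod (of_real (h \<bullet> b) * ((\<Sum>i<n. dird b (f i) y) - (\<Sum>i. dird b (f i) y))) <= norm h * (e / DIM('a))"
       unfolding norm_mult norm_of_real using Basis_le_norm[OF b, of h] elim b y
       by (intro mult_mono) (auto simp: dist_norm intro: less_imp_le)
     qed
     also have "... = e * norm h" by simp
     finally show "norm ((\<Sum>i<n. dird h (f i) y) - g' y h) <= e * norm h" .
    qed
   qed
  qed (use x summable_sums[OF su[OF x]] in auto)
  then obtain g where g: "!!x. x : S ==> (%n. f n x) sums (g x)" "(g has_derivative g' x) (at x within S)" using x by blast
  have "(g has_derivative g' x) (at x)" using g(2) at_within_open[OF x S(1)] by simp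
  then show ?thesis
   by (rule has_derivative_transform_within_open[OF _ S(1) x]) (use g(1) sums_unique in blast)
 qed
 show ?case
 proof (rule nd_SucI'[OF S(1) der])
  fix v
  have "nd n S (%x. \<Sum>i. dird b (f i) x)" if b: "b : Basis" for b
  proof (rule Suc.IH)
   show "smooth_on S (dird b (f i))" for i by (intro smooth_intros sm)
   fix vs :: "'a list" assume "set vs <= Basis"
   then show "EX M. summable M & (ALL i. ALL x:S. cmod (iter_dird vs (dird b (f i)) x) <= M i)"
    using bd[of "vs @ [b]"] b by (simp add: iter_dird_append iter_dird_Cons)
  qed
  then show "nd n S (%x. g' x v)" unfolding g'_def
   by (intro nd_sum nd_bilinear[OF bounded_bilinear_mult] nd_const S(1))
 qed
qed

lemma iter_dird_cong:
 assumes "open S" "smooth_on S f" "!!x. x : S ==> f x = g x" "x : S"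
 shows "iter_dird vs f x = iter_dird vs g x"
 using assms(4)
proof (induction vs arbitrary: x)
 case (Cons v vs)
 show ?case unfolding iter_dird_Cons
  by (rule dird_cong[OF assms(1) Cons.prems Cons.IH smooth_diff[OF smooth_iter_dird[OF assms(2)] Cons.prems]])
qed (simp add: assms(3))

text \<open>The distributional equation only needs bounds on each compact set, so the derivatives of the
  \<open>i\<close>-th term have to be controlled only up to order \<open>i\<close> and only on the \<open>i\<close>-th set of an exhaustion.\<close>

lemma smooth_exhaustion_series:
 fixes f :: "nat => 'a::euclidean_space => complex"
 assumes sm: "!!i. smo (f i)"
  and ex: "!!K. compact K ==> EX i0. ALL i>=i0. K <= X i"
  and le: "!!i vs x. i ~= 0 ==> set vs <= Basis ==> length vs <= i ==> x : X i ==> cmod (iter_dird vs (f i) x) <= (1 / 2) ^ i"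
 shows "smo (%x. \<Sum>i. f i x)"
  and "compact K ==> EX M. summable M & (ALL i. ALL x:K. cmod (f i x) <= M i)"
proof -
 have bd: "EX M. summable M & (ALL i. ALL x:K. cmod (iter_dird vs (f i) x) <= M i)" if K: "compact K" and vs: "set vs <= Basis" for K vs
 proof -
  obtain i0 where i0: "!!i. i >= i0 ==> K <= X i" using ex[OF K] by blast
  have "EX e. ALL x:K. cmod (iter_dird vs (f i) x) <= e" for i
   by (rule compact_image_bound[OF K continuous_on_subset[OF smooth_cont[OF smooth_iter_dird[OF sm[of i], of vs]] subset_UNIV]]) blast
  then obtain e where e: "!!i x. x : K ==> cmod (iter_dird vs (f i) x) <= e i" by metis
  define N where "N = max i0 (length vs)"
  define M where "M i = (if i : {..N} then \<bar>e i\<bar> else 0) + (1 / 2) ^ i" for i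
  have "summable M" unfolding M_def by (intro summable_add summable_If_finite_set summable_geometric) auto
  moreover have "cmod (iter_dird vs (f i) x) <= M i" if x: "x : K" for i x
  proof (cases "i <= N")
   case True
   have "(0::real) <= (1 / 2) ^ i" by simp
   then show ?thesis using e[OF x, of i] True abs_ge_self[of "e i"] unfolding M_def by (simp only: atMost_iff if_True)
  next
   case False
   then show ?thesis using le[of i vs x] vs i0[of i] x by (auto simp: M_def N_def not_le subset_iff)
  qed
  ultimately show ?thesis by blast
 qed
 show "EX M. summable M & (ALL i. ALL x:K. cmod (f i x) <= M i)" if "compact K"
  using bd[OF that, of "[]"] by simp
 have "smooth_on (ball p 1) (%x. \<Sum>i. f i x)" for p
  unfolding smooth_on_def
 proof (rule allI, rule nd_suminf)
  show "smooth_on (ball p 1) (f i)" for i by (rule smooth_on_subset[OF sm subset_UNIV])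
  show "EX M. summable M & (ALL i. ALL x:ball p 1. cmod (iter_dird vs (f i) x) <= M i)" if "set vs <= Basis" for vs
   using bd[OF compact_cball[of p 1] that] by (meson ball_subset_cball subsetD)
 qed auto
 then show "smo (%x. \<Sum>i. f i x)"
  by (intro smooth_on_local) (metis centre_in_ball open_ball zero_less_one)
qed

context nline
begin

text \<open>The transpose of \<open>W i m\<close> on functions, found by substituting
  \<open>act p (hinv h)\<close> for \<open>p\<close>.\<close>

definition Uk :: "('x * 't => complex) => nat => nat => 'x * 't => complex" where
 "Uk G i m p = (LI h. GamR h * (psi i (kk (act p (hinv h))) * G (act p (hinv h))))
   - (LI h. tsum i m (kk (act p (hinv h))) (kk p) * G (act p (hinv h)))"

lemma kk_hinv_mem:
 assumes "kk (act p (hinv h)) : A" "kk p : B"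
 shows "h : (%z. hm (hinv (fst z)) (snd z)) ` (A \<times> B)"
 using HH_mem[of "act p (hinv h)" A h B] assms by simp

lemma smooth_Uk:
 assumes G: "smo G" and im: "i ~= 0 | m = 0"
 shows "smo (Uk G i m)"
proof -
 have supp: "EX V H. open V & p : V & compact H & (ALL q:V. ALL h. h ~: H --> psi i (kk (act q (hinv h))) = 0)" for p
 proof -
  let ?H = "(%z. hm (hinv (fst z)) (snd z)) ` ({k. fR 0 k <= 2 * 4 ^ i} \<times> kk ` cball p 1)"
  have "compact ?H" by (intro compact_HH compact_shell compact_continuous_image continuous_kk continuous_intros compact_cball)
  moreover have "psi i (kk (act q (hinv h))) = 0" if q: "q : ball p 1" "h ~: ?H" for q h
  proof (rule psi_high, rule ccontr)
   assume "\<not> 2 * 4 ^ i <= fR 0 (kk (act q (hinv h)))"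
   then have "h : ?H" using q(1) by (intro kk_hinv_mem[of q]) auto
   then show False using q(2) by blast
  qed
  ultimately show ?thesis by (intro exI[of _ "ball p 1"] exI[of _ ?H]) simp
 qed
 have sa: "smo (%z. act (fst z) (hinv (snd z)))" by (intro smooth_act smooth_hinv smooth_intros open_UNIV)
 have sG: "smo (%z. G (act (fst z) (hinv (snd z))))" by (rule smooth_comp[OF G open_UNIV sa])
 have "smo (%p. LI h. GamR h * (%z. psi i (kk (act (fst z) (hinv (snd z)))) * G (act (fst z) (hinv (snd z)))) (p, h))"
 proof (rule smooth_param_loc)
  show "smooth_on (UNIV \<times> UNIV) (%z. psi i (kk (act (fst z) (hinv (snd z)))) * G (act (fst z) (hinv (snd z))))"
   unfolding UNIV_Times_UNIV by (intro smooth_intros smooth_on_psi smooth_on_kk sa sG open_UNIV)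
  show "EX V H. open V & p : V & compact H & (ALL q:V. ALL h. h ~: H \<longrightarrow>
    psi i (kk (act (fst (q, h)) (hinv (snd (q, h))))) * G (act (fst (q, h)) (hinv (snd (q, h)))) = 0)" for p
   using supp[of p] unfolding fst_conv snd_conv by (elim ex_forward) simp
 qed (auto simp: loc_integrable_GamR)
 moreover have "smo (%p. LI h. 1 * (%z. tsum i m (kk (act (fst z) (hinv (snd z)))) (kk (fst z)) * G (act (fst z) (hinv (snd z)))) (p, h))"
 proof (rule smooth_param_loc)
  show "smooth_on (UNIV \<times> UNIV) (%z. tsum i m (kk (act (fst z) (hinv (snd z)))) (kk (fst z)) * G (act (fst z) (hinv (snd z))))"
   unfolding UNIV_Times_UNIV by (intro smooth_intros smooth_on_tsum im smooth_on_kk sa sG open_UNIV)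
  show "EX V H. open V & p : V & compact H & (ALL q:V. ALL h. h ~: H \<longrightarrow>
    tsum i m (kk (act (fst (q, h)) (hinv (snd (q, h))))) (kk (fst (q, h))) * G (act (fst (q, h)) (hinv (snd (q, h)))) = 0)" for p
   using supp[of p] unfolding fst_conv snd_conv tsum_def by (elim ex_forward) simp
  show "loc_integrable (%h::hN. 1)" by (rule loc_integrable_continuous) simp
 qed auto
 ultimately show ?thesis unfolding Uk_def[abs_def] by (intro smooth_intros open_UNIV) simp_all
qed

text \<open>For \<open>p\<close> in \<open>VV\<close> the singular part and the Taylor part combine
  into the remainder integral over the circle, whose integrand is smooth in all variables.
  Derivatives of any order can be taken under both integrals, and each keeps the factor
  \<open>(1 / 2) ^ m\<close> of the weight.\<close>

lemma Uk_small:
 assumes G: "smo G" and i: "i ~= 0"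
 shows "EX D>=0. ALL m. ALL p:KK i. cmod (iter_dird vs (Uk G i (Suc m)) p) <= D * (1 / 2) ^ m"
proof -
 define VV where "VV = {p. kk p : smallN i}"
 have oV: "open VV" unfolding VV_def
  using open_vimage[OF open_smallN continuous_kk[OF continuous_on_id]] by (simp add: vimage_def)
 have KV: "KK i <= VV" using small2_smallN unfolding VV_def KK_def by blast
 define B where "B = {g::hN. fR 0 g <= (1 / 1000) ^ 4 * 4 ^ (i - 1) / 16}"
 have NB: "smallN i <= B" by (auto simp: smallN_def B_def)
 define H where "H = (%z. hm (hinv (fst z)) (snd z)) ` ({k. fR 0 k <= 2 * 4 ^ i} \<times> B)"
 have cH: "compact H" unfolding H_def B_def by (intro compact_HH compact_shell)
 define Ph where "Ph z = PG i (kk (act (fst (fst z)) (hinv (snd (fst z))))) (kk (fst (fst z))) (snd z) * G (act (fst (fst z)) (hinv (snd (fst z))))"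
  for z :: "(('x * 't) * hN) * real"
 define R where "R m z = (LI x. rw m x * Ph (z, x))" for m z
 have oW: "open ((VV \<times> UNIV) \<times> UNIV :: ((('x * 't) * hN) * real) set)" by (intro open_Times oV open_UNIV)
 have sa: "smooth_on ((VV \<times> UNIV) \<times> UNIV) (%z::((('x * 't) * hN) * real). act (fst (fst z)) (hinv (snd (fst z))))"
  by (intro smooth_act smooth_hinv smooth_intros oW)
 have sPh: "smooth_on ((VV \<times> UNIV) \<times> UNIV) Ph"
  unfolding Ph_def[abs_def]
  by (intro smooth_on_mult smooth_comp[OF G _ sa] smooth_on_PG[OF i oW] smooth_on_kk sa smooth_intros oW) (auto simp: VV_def)
 have w: "lint (rw m)" "!!x. x ~: {0..1} ==> rw m x = 0" for m
  using cw_rw[of m] by (auto simp: cw_def rw_def unit_ind_def)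
 have sR: "smooth_on (VV \<times> UNIV) (R m)" for m
  unfolding R_def[abs_def]
  by (rule smooth_param[OF _ oW _ sPh w compact_Icc]) (auto intro!: open_Times oV)
 \<comment> \<open>\<open>GamR h\<close> is the kernel of \<open>kernel_remainder\<close> because
   \<open>h\<close> is the quotient of the orbit coordinates of \<open>act p (hinv h)\<close> and
   \<open>p\<close>.\<close>
 have Rz: "R m (p, h) = (GamR h * psi i (kk (act p (hinv h))) - tsum i (Suc m) (kk (act p (hinv h))) (kk p)) * G (act p (hinv h))"
  if p: "p : VV" for m p h
 proof -
  have e: "hm (hinv (kk (act p (hinv h)))) (kk p) = h" by (simp add: kk_act hm_hinv_cancel)
  have "R m (p, h) = (LI x. rw m x * PG i (kk (act p (hinv h))) (kk p) x) * G (act p (hinv h))"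
   by (simp add: R_def Ph_def mult.assoc[symmetric])
  then show ?thesis
   using kernel_remainder[OF i, of "kk p" "kk (act p (hinv h))" m] p by (simp add: e VV_def)
 qed
 have int: "lint (%h. indicator H h *\<^sub>R (1::complex))" by (rule borel_integrable_compact[OF cH]) auto
 then have wH: "lint (%h. indicator H h :: complex)"
  by (simp add: scaleR_conv_of_real of_real_indicator)
 have out: "psi i (kk (act p (hinv h))) = 0" if "p : VV" "h ~: H" for p h
 proof (rule psi_high, rule ccontr)
  assume "\<not> 2 * 4 ^ i <= fR 0 (kk (act p (hinv h)))"
  then have "h : H" unfolding H_def using that(1) NB by (intro kk_hinv_mem) (auto simp: VV_def)
  then show False using that(2) by blast
 qed
 have UR: "Uk G i (Suc m) p = (LI h. indicator H h * R m (p, h))" if p: "p : VV" for m p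
 proof -
  have sap: "smo (%h. act p (hinv h))" by (intro smooth_act smooth_hinv smooth_intros open_UNIV)
  have sGp: "smo (%h. G (act p (hinv h)))" by (rule smooth_comp[OF G open_UNIV sap])
  have t1: "(%h. psi i (kk (act p (hinv h))) * G (act p (hinv h))) : test_fun"
  proof (rule test_funI[OF _ cH])
   show "smo (%h. psi i (kk (act p (hinv h))) * G (act p (hinv h)))"
    by (intro smooth_intros smooth_on_psi smooth_on_kk sap sGp open_UNIV)
  qed (use out[OF p] in simp)
  have t2: "(%h. tsum i (Suc m) (kk (act p (hinv h))) (kk p) * G (act p (hinv h))) : test_fun"
  proof (rule test_funI[OF _ cH])
   show "smo (%h. tsum i (Suc m) (kk (act p (hinv h))) (kk p) * G (act p (hinv h)))"
    by (intro smooth_intros smooth_on_tsum smooth_on_kk sap sGp open_UNIV) (use i in simp)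
  qed (use out[OF p] in "simp add: tsum_def")
  have "lint (%h. GamR h * (psi i (kk (act p (hinv h))) * G (act p (hinv h))))"
   using cw_loc[OF loc_integrable_GamR t1] by (simp add: cw_def)
  from Bochner_Integration.integral_diff[OF this test_fun_lint[OF t2]]
  have "Uk G i (Suc m) p = (LI h. R m (p, h))"
   unfolding Uk_def Rz[OF p] by (simp add: algebra_simps)
  also have "... = (LI h. indicator H h * R m (p, h))"
  proof (rule Bochner_Integration.integral_cong[OF refl])
   fix h show "R m (p, h) = indicator H h * R m (p, h)"
    using out[OF p, of h] Rz[OF p, of m h] by (cases "h : H") (auto simp: tsum_def)
  qed
  finally show ?thesis .
 qed
 let ?vs = "map (%v. (v, 0::real)) (map (%v. (v, 0::hN)) vs)"
 have cA: "compact ((KK i \<times> H) \<times> {0..1::real})" by (intro compact_Times compact_KK cH compact_Icc)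
 have subA: "(KK i \<times> H) \<times> {0..1::real} <= (VV \<times> UNIV) \<times> UNIV" using KV by auto
 obtain M where M: "M >= 0" "!!z. z : (KK i \<times> H) \<times> {0..1} ==> cmod (iter_dird ?vs Ph z) <= M"
  using compact_image_bound[OF cA continuous_on_subset[OF smooth_cont[OF smooth_iter_dird[OF sPh, of ?vs]] subA]] by blast
 have le: "cmod (iter_dird vs (Uk G i (Suc m)) p) <= (M * (LI h. cmod (indicator H h))) * (1 / 2) ^ m" if p: "p : KK i" for m p
 proof -
  have pV: "p : VV" using p KV by blast
  have "iter_dird vs (Uk G i (Suc m)) p = iter_dird vs (%p. LI h. indicator H h * R m (p, h)) p"
   by (rule iter_dird_cong[OF oV smooth_on_subset[OF smooth_Uk[OF G] subset_UNIV] UR pV]) (use i in auto)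
  also have "... = (LI h. indicator H h * iter_dird (map (%v. (v, 0)) vs) (R m) (p, h))"
   by (rule iter_dird_param_integral[OF oV open_Times[OF oV open_UNIV] _ sR wH _ cH pV]) auto
  also have "cmod ... <= (M * (1 / 2) ^ m) * (LI h. cmod (indicator H h))"
  proof (rule norm_integral_mult_le[OF wH lint_mult_compact[OF wH _ cH]])
   have "continuous_on (VV \<times> UNIV) (iter_dird (map (%v. (v, 0)) vs) (R m))"
    by (rule smooth_cont[OF smooth_iter_dird[OF sR]])
   then show "continuous_on H (%h. iter_dird (map (%v. (v, 0)) vs) (R m) (p, h))"
    by (rule continuous_on_compose2) (use pV in "auto intro!: continuous_intros")
   fix h assume "(indicator H h :: complex) ~= 0"
   then have h: "h : H" by (auto simp: indicator_def split: if_splits)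
   have "iter_dird (map (%v. (v, 0)) vs) (R m) (p, h) = (LI x. rw m x * iter_dird ?vs Ph ((p, h), x))"
    unfolding R_def[abs_def]
    by (rule iter_dird_param_integral[OF open_Times[OF oV open_UNIV] oW _ sPh w compact_Icc]) (use pV in auto)
   also have "cmod ... <= M * (1 / 2) ^ m"
   proof (rule rw_integral_bound)
    show "cont (%x. iter_dird ?vs Ph ((p, h), x))"
     by (rule continuous_on_compose2[OF smooth_cont[OF smooth_iter_dird[OF sPh]]])
       (use pV in "auto intro!: continuous_intros")
   qed (use M(2) p h in auto)
   finally show "cmod (iter_dird (map (%v. (v, 0)) vs) (R m) (p, h)) <= M * (1 / 2) ^ m" .
  qed auto
  finally show ?thesis by (simp add: mult_ac)
 qed
 have "M * (LI h. cmod (indicator H h)) >= 0" using M(1) by (intro mult_nonneg_nonneg integral_nonneg_AE) auto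
 then show ?thesis using le by blast
qed

end

context nline
begin

lemma Uk_pair:
 assumes G: "smo G" and im: "i ~= 0 | m = 0" and ph: "ph : test_fun"
 shows "(LI p. Uk G i m p * ph p) = (LI p. G p * W i m ph p)"
proof -
 obtain K where K: "compact K" "ph : test_in K" using test_fun_test_inE[OF ph] by blast
 define P where "P = ZZ i K"
 have P: "compact P" unfolding P_def ZZ_def by (rule compact_ZZ[OF K(1)])
 define H where "H = (%z. hm (hinv (fst z)) (snd z)) ` ({k. fR 0 k <= 2 * 4 ^ i} \<times> kk ` K)"
 have H: "compact H" unfolding H_def by (intro compact_HH compact_shell compact_continuous_image continuous_kk continuous_intros K)
 have out: "psi i (kk p) * ph (act p h) = 0" if "p ~: P | h ~: H" for p h
 proof (rule ccontr)
  assume "psi i (kk p) * ph (act p h) ~= 0"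
  then have a: "fR 0 (kk p) <= 2 * 4 ^ i" "act p h : K"
   using psi_high[of i "kk p"] test_in_zero[OF K(2), of "act p h"] by (cases "fR 0 (kk p) <= 2 * 4 ^ i"; auto)+
  have "yy p : yy ` K" using a(2) yy_act[of p h] by (metis imageI)
  then have "p : P" unfolding P_def ZZ_def using a(1) by (intro ZZ_mem)
  moreover have "h : H" unfolding H_def using a by (intro HH_mem[of p]) auto
  ultimately show False using that by blast
 qed
 have cph: "cont (%z. ph (act (fst z) (snd z)))"
  by (rule continuous_on_compose2[OF smooth_cont[OF test_funD[OF ph]]]) (auto intro!: continuous_act continuous_intros)
 have cG: "cont (%z. G (fst z))"
  by (rule continuous_on_compose2[OF smooth_cont[OF G]]) (auto intro!: continuous_intros)
 have cpsi: "cont (%z::('x * 't) * hN. psi i (kk (fst z)))"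
  by (rule smooth_cont) (intro smooth_on_psi smooth_on_kk smooth_intros open_UNIV)
 have ct: "cont (%z. tsum i m (kk (fst z)) (hm (kk (fst z)) (snd z)))"
  by (rule smooth_cont) (intro smooth_on_tsum im smooth_hm smooth_on_kk smooth_intros open_UNIV)
 define Ph1 where "Ph1 z = G (fst z) * (psi i (kk (fst z)) * ph (act (fst z) (snd z)))" for z
 define Ph2 where "Ph2 z = G (fst z) * (tsum i m (kk (fst z)) (hm (kk (fst z)) (snd z)) * ph (act (fst z) (snd z)))" for z
 have c1: "cont Ph1" unfolding Ph1_def[abs_def] by (intro continuous_on_mult cG cpsi cph)
 have c2: "cont Ph2" unfolding Ph2_def[abs_def] by (intro continuous_on_mult cG ct cph)
 have s1: "Ph1 (p, h) = 0" if "p ~: P | h ~: H" for p h using out[OF that] by (simp add: Ph1_def)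
 have s2: "Ph2 (p, h) = 0" if "p ~: P | h ~: H" for p h using out[OF that] by (auto simp: Ph2_def tsum_def)
 have w2: "loc_integrable (%h::hN. 1)" by (rule loc_integrable_continuous) simp
 note w1 = loc_integrable_GamR
 have int: "lint (%p. LI h. w h * Ps (p, h))"
  if "loc_integrable w" "cont Ps" "compact P'" "!!p h. p ~: P' | h ~: H ==> Ps (p, h) = 0" for w Ps and P' :: "('x * 't) set"
  using lborel_pair.integrable_snd[OF loc_integrable_pair[OF that(1-3) H that(4)]] by simp
 have "G p * W i m ph p = (LI h. GamR h * Ph1 (p, h)) - (LI h. 1 * Ph2 (p, h))" for p
 proof -
  have "(LI h. GamR h * Ph1 (p, h)) = (LI h. G p * (GamR h * (psi i (kk p) * ph (act p h))))"
   by (simp add: Ph1_def mult.left_commute)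
  moreover have "(LI h. 1 * Ph2 (p, h)) = G p * (LI h. tsum i m (kk p) (hm (kk p) h) * ph (act p h))"
   by (simp add: Ph2_def)
  ultimately show ?thesis by (simp add: W_def right_diff_distrib)
 qed
 then have "(LI p. G p * W i m ph p) = (LI p. LI h. GamR h * Ph1 (p, h)) - (LI p. LI h. 1 * Ph2 (p, h))"
  using Bochner_Integration.integral_diff[OF int[OF w1 c1 P s1] int[OF w2 c2 P s2]] by simp
 also have "... = (LI p. LI h. GamR h * Ph1 (act p (hinv h), h)) - (LI p. LI h. 1 * Ph2 (act p (hinv h), h))"
  using swap_act[OF w1 c1 P H s1] swap_act[OF w2 c2 P H s2] by simp
 also have "... = (LI p. (LI h. GamR h * Ph1 (act p (hinv h), h)) - (LI h. 1 * Ph2 (act p (hinv h), h)))"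
 proof (rule Bochner_Integration.integral_diff[symmetric])
  let ?P = "(%z. act (fst z) (snd z)) ` (P \<times> H)"
  have cP: "compact ?P" by (intro compact_continuous_image continuous_act continuous_intros compact_Times P H)
  have cc: "cont (%z. Ph (act (fst z) (hinv (snd z)), snd z))" if "cont Ph" for Ph :: "('x * 't) * hN => complex"
   by (rule continuous_on_compose2[OF that]) (auto intro!: continuous_intros continuous_act continuous_hinv)
  have pre: "act p (hinv h) ~: P | h ~: H" if n: "p ~: ?P | h ~: H" for p h
  proof (rule ccontr)
   assume "\<not> ?thesis"
   then have "act p (hinv h) : P" "h : H" by auto
   moreover from this have "act (act p (hinv h)) h : ?P" by (intro image_eqI[of _ _ "(act p (hinv h), h)"]) auto
   ultimately show False using n by simp
  qed
  show "lint (%p. LI h. GamR h * Ph1 (act p (hinv h), h))"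
   using int[OF w1 cc[OF c1] cP] s1[OF pre] by simp
  show "lint (%p. LI h. 1 * Ph2 (act p (hinv h), h))"
   using int[OF w2 cc[OF c2] cP] s2[OF pre] by simp
 qed
 also have "... = (LI p. Uk G i m p * ph p)"
 proof (rule Bochner_Integration.integral_cong[OF refl])
  fix p
  have e: "hm (kk (act p (hinv h))) h = kk p" for h by (simp add: kk_act hm_hinv_cancel)
  have "(LI h. GamR h * Ph1 (act p (hinv h), h)) = (LI h. (GamR h * (psi i (kk (act p (hinv h))) * G (act p (hinv h)))) * ph p)"
   by (rule Bochner_Integration.integral_cong) (simp_all add: Ph1_def mult_ac)
  moreover have "(LI h. 1 * Ph2 (act p (hinv h), h)) = (LI h. (tsum i m (kk (act p (hinv h))) (kk p) * G (act p (hinv h))) * ph p)"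
   by (rule Bochner_Integration.integral_cong) (simp_all add: Ph2_def e mult_ac)
  ultimately show "(LI h. GamR h * Ph1 (act p (hinv h), h)) - (LI h. 1 * Ph2 (act p (hinv h), h)) = Uk G i m p * ph p"
   by (simp add: Uk_def left_diff_distrib)
 qed
 finally show ?thesis by simp
qed

text \<open>The kernels act on \<open>G\<close>, whose derivatives are available, so one
  nondegenerate line solves the equation. The degree of the \<open>i\<close>-th kernel has to serve
  all derivatives of order at most \<open>i\<close> on \<open>KK i\<close>, which are finitely many
  conditions for each \<open>i\<close>.\<close>

lemma mittag_leffler_smooth:
 assumes G: "smo G"
 shows "EX U. smo U & (ALL ph:test_fun. (LI p. G p * ph p) = (LI p. U p * LM ph p))"
proof -
 have "EX m. i ~= 0 --> (ALL vs p. set vs <= Basis & length vs <= i & p : KK i --> cmod (iter_dird vs (Uk G i (Suc m)) p) <= (1 / 2) ^ i)" for i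
 proof (cases "i = 0")
  case False
  have "EX D. ALL vs. D vs >= 0 & (ALL m. ALL p:KK i. cmod (iter_dird vs (Uk G i (Suc m)) p) <= D vs * (1 / 2) ^ m)"
   by (rule choice, rule allI) (rule Uk_small[OF G False])
  then obtain D where D: "!!vs. D vs >= 0" "!!vs m p. p : KK i ==> cmod (iter_dird vs (Uk G i (Suc m)) p) <= D vs * (1 / 2) ^ m" by blast
  let ?L = "{vs. set vs <= (Basis :: ('x * 't) set) & length vs <= i}"
  have fin: "finite ?L" by (rule finite_lists_length_le[OF finite_Basis])
  obtain m where m: "(\<Sum>vs\<in>?L. D vs) * (1 / 2) ^ m <= (1 / 2) ^ i" by (rule half_power_small)
  have "cmod (iter_dird vs (Uk G i (Suc m)) p) <= (1 / 2) ^ i" if "set vs <= Basis" "length vs <= i" "p : KK i" for vs p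
  proof -
   have "D vs <= (\<Sum>vs\<in>?L. D vs)" by (rule member_le_sum[OF _ _ fin]) (use that D(1) in auto)
   then have "D vs * (1 / 2) ^ m <= (\<Sum>vs\<in>?L. D vs) * (1 / 2) ^ m" by (intro mult_right_mono) auto
   then show ?thesis using D(2)[OF that(3), of vs m] m by linarith
  qed
  then show ?thesis by blast
 qed simp
 then obtain m where m: "!!i vs p. i ~= 0 ==> set vs <= Basis ==> length vs <= i ==> p : KK i ==>
   cmod (iter_dird vs (Uk G i (Suc (m i))) p) <= (1 / 2) ^ i" by metis
 define mm where "mm i = (if i = 0 then 0 else Suc (m i))" for i
 have im: "i ~= 0 | mm i = 0" for i by (simp add: mm_def)
 define f where "f i = Uk G i (mm i)" for i
 have sm: "smo (f i)" for i unfolding f_def by (rule smooth_Uk[OF G im])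
 have le: "cmod (iter_dird vs (f i) p) <= (1 / 2) ^ i" if "i ~= 0" "set vs <= Basis" "length vs <= i" "p : KK i" for i vs p
  using m[OF that] that(1) by (simp add: f_def mm_def)
 have series: "smo (%x. \<Sum>i. f i x)" "!!K. compact K ==> EX M. summable M & (ALL i. ALL x:K. cmod (f i x) <= M i)"
  using smooth_exhaustion_series[where f = f and X = KK, OF sm] KK_exhaust le by blast+
 define U where "U p = inverse Gam_const * (\<Sum>i. f i p)" for p
 have "smo U" unfolding U_def[abs_def] by (intro smooth_intros series(1) open_UNIV)
 moreover have "(LI p. G p * ph p) = (LI p. U p * LM ph p)" if ph: "ph : test_fun" for ph
 proof -
  have L: "LM ph : test_fun" by (rule test_contD(1)[OF test_cont_LM ph])
  obtain K where K: "compact K" "ph : test_in K" using test_fun_test_inE[OF ph] by blast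
  obtain K' where K': "compact K'" "LM ph : test_in K'" using test_fun_test_inE[OF L] by blast
  obtain M where M: "summable M" "!!i p. p : K' ==> cmod (f i p) <= M i" using series(2)[OF K'(1)] by blast
  have ft: "(%p. f i p * LM ph p) : test_fun" for i by (rule test_fun_mult[OF sm L])
  have nb: "norm (f i p * LM ph p) <= M i * cmod (LM ph p)" for i p
   using M(2)[of p i] test_in_zero[OF K'(2), of p] by (cases "p : K'") (auto simp: norm_mult intro!: mult_right_mono)
  have "(\<Sum>i. (LI p. f i p * LM ph p)) = (LI p. (\<Sum>i. f i p * LM ph p))"
  proof (rule integral_suminf[symmetric])
   show "lint (%p. f i p * LM ph p)" for i by (rule test_fun_lint[OF ft])
   show "AE p in lborel. summable (%i. norm (f i p * LM ph p))"
    by (intro AE_I2 summable_comparison_test'[OF summable_mult2[OF M(1)], of 0]) (use nb in auto)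
   show "summable (%i. LI p. norm (f i p * LM ph p))"
   proof (rule summable_comparison_test'[OF summable_mult2[OF M(1), of "LI p. cmod (LM ph p)"], of 0])
    fix i
    have "(LI p. norm (f i p * LM ph p)) <= (LI p. M i * cmod (LM ph p))"
     by (rule integral_mono[OF _ _ nb]) (use test_fun_lint[OF ft] test_fun_lint[OF L] in auto)
    then show "norm (LI p. norm (f i p * LM ph p)) <= M i * (LI p. cmod (LM ph p))"
     by simp
   qed
  qed
  also have "(%p. \<Sum>i. f i p * LM ph p) = (%p. Gam_const * (U p * LM ph p))"
  proof
   fix p show "(\<Sum>i. f i p * LM ph p) = Gam_const * (U p * LM ph p)"
   proof (cases "p : K'")
    case True
    have "summable (%i. f i p)" by (rule summable_comparison_test'[OF M(1), of 0]) (use M(2)[OF True] in auto)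
    then show ?thesis using suminf_mult2[of "%i. f i p" "LM ph p"] Gam_const(1) by (simp add: U_def mult.assoc[symmetric])
   qed (use test_in_zero[OF K'(2)] in simp)
  qed
  finally have 1: "(\<Sum>i. (LI p. f i p * LM ph p)) = Gam_const * (LI p. U p * LM ph p)" by simp
  obtain n where z: "!!i p. i ~: {..n} ==> psi i (kk p) * ph p = 0" and n: "!!p. (\<Sum>i\<le>n. psi i (kk p) * ph p) = ph p"
   using psi_finite[OF K] by blast
  have pt: "(%p. G p * (psi i (kk p) * ph p)) : test_fun" for i
   by (intro test_fun_mult ph smooth_on_psi smooth_on_kk smooth_intros open_UNIV G)
  have "(LI p. f i p * LM ph p) = Gam_const * (LI p. G p * (psi i (kk p) * ph p))" for i
   unfolding f_def Uk_pair[OF G im L] W_LM[OF ph im] by (subst mult.left_commute) simp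
  then have "(\<Sum>i. (LI p. f i p * LM ph p)) = (\<Sum>i. Gam_const * (LI p. G p * (psi i (kk p) * ph p)))" by simp
  also have "... = (\<Sum>i\<le>n. Gam_const * (LI p. G p * (psi i (kk p) * ph p)))"
  proof (rule suminf_finite)
   fix i assume i: "i ~: {..n}"
   show "Gam_const * (LI p. G p * (psi i (kk p) * ph p)) = 0" unfolding z[OF i] by simp
  qed simp
  also have "... = Gam_const * (LI p. (\<Sum>i\<le>n. G p * (psi i (kk p) * ph p)))"
   by (subst Bochner_Integration.integral_sum[OF test_fun_lint[OF pt]]) (simp add: sum_distrib_left)
  also have "(%p. \<Sum>i\<le>n. G p * (psi i (kk p) * ph p)) = (%p. G p * ph p)"
   unfolding sum_distrib_left[symmetric] n ..
  finally show ?thesis using 1 Gam_const(1) by simp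
 qed
 ultimately show ?thesis by blast
qed

end

section \<open>Distributions of arbitrary order\<close>

lemma distr_add:
 assumes u: "u : distr" and v: "v : distr"
 shows "(%ph. u ph + v ph) : distr"
proof (rule distrI)
 fix K :: "'a set" assume K: "compact K"
 obtain C m where C: "C >= 0" "!!ph. ph : test_in K ==> cmod (u ph) <= C * Cm_norm m ph" by (rule distrE[OF u K]) blast
 obtain D n where D: "D >= 0" "!!ph. ph : test_in K ==> cmod (v ph) <= D * Cm_norm n ph" by (rule distrE[OF v K]) blast
 have "cmod (u ph + v ph) <= (C + D) * Cm_norm (max m n) ph" if ph: "ph : test_in K" for ph
 proof -
  note t = test_in_test[OF ph]
  have "C * Cm_norm m ph <= C * Cm_norm (max m n) ph" "D * Cm_norm n ph <= D * Cm_norm (max m n) ph"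
   using C(1) D(1) by (auto intro!: mult_left_mono Cm_norm_mono t)
  then show ?thesis using C(2)[OF ph] D(2)[OF ph] norm_triangle_ineq[of "u ph" "v ph"] by (simp add: distrib_right)
 qed
 then show "EX C m. ALL ph:test_in K. cmod (u ph + v ph) <= C * Cm_norm m ph" by blast
qed (use distrD[OF u] distrD[OF v] in "simp_all add: distrib_left")

lemma distr_zero: "(%ph. 0) : distr"
 by (rule distrI) (auto intro!: exI[of _ 0])

lemma solve_distr:
 assumes g: "good_lines be ls" and n: "nline be (fst (hd ls)) (snd (hd ls)) Ep Ci" and G: "G : distr"
 shows "EX us. (ALL i. us i : distr) & (ALL ph:test_fun. G ph = (\<Sum>i<length ls. us i (line.LM be (fst (ls ! i)) ph)))"
proof -
 have al: "all_lines be ls" and ne: "ls ~= []" using g by (auto simp: good_lines_def)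
 obtain us T where us: "length us = length ls" "set us <= distr" "RR be ls T"
  "!!ph. ph : test_fun ==> G ph = (\<Sum>i<length ls. (us ! i) (line.LM be (fst (ls ! i)) ph)) + dist_pull T G ph"
  using reduce_to_order0[OF al G] by blast
 have "order0 (dist_pull T G)" by (rule order0_pull[OF g us(3) G])
 from nline.mittag_leffler_order0[OF n this]
 obtain u where u: "u : distr" "!!ph. ph : test_fun ==> dist_pull T G ph = u (line.LM be (fst (hd ls)) ph)" by blast
 define vs where "vs i = (if i < length ls then us ! i else (%ph. 0))" for i
 have vs: "vs i : distr" for i using us(1,2) distr_zero by (auto simp: vs_def)
 \<comment> \<open>The nondegenerate line is the first one, so the solution for the part of order
   zero is added to its coefficient.\<close>
 define ws where "ws i = (if i = 0 then (%ph. vs i ph + u ph) else vs i)" for i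
 have "ws i : distr" for i using vs distr_add[OF vs u(1)] by (simp add: ws_def)
 moreover have "G ph = (\<Sum>i<length ls. ws i (line.LM be (fst (ls ! i)) ph))" if ph: "ph : test_fun" for ph
 proof -
  obtain n where n: "length ls = Suc n" using ne by (cases ls) auto
  have "ls ! 0 = hd ls" using ne by (simp add: hd_conv_nth)
  then have "(\<Sum>i<length ls. ws i (line.LM be (fst (ls ! i)) ph)) = (\<Sum>i<length ls. vs i (line.LM be (fst (ls ! i)) ph)) + u (line.LM be (fst (hd ls)) ph)"
   unfolding n sum.lessThan_Suc_shift by (simp add: ws_def)
  also have "(\<Sum>i<length ls. vs i (line.LM be (fst (ls ! i)) ph)) = (\<Sum>i<length ls. (us ! i) (line.LM be (fst (ls ! i)) ph))"
   by (rule sum.cong) (auto simp: vs_def)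
  finally show ?thesis using us(4)[OF ph] u(2)[OF ph] by simp
 qed
 ultimately show ?thesis by blast
qed

section \<open>Commutators\<close>

lemma dird_difference_integral:
 fixes f :: "'a::euclidean_space => complex"
 assumes f: "smo f"
 shows "f (p + w) - f p = (LI s. unit_ind s * dird w f (p + s *\<^sub>R w))"
proof -
 have d: "((%s. f (p + s *\<^sub>R w)) has_vector_derivative dird w f (p + s *\<^sub>R w)) (at s within {0..1})" for s
 proof -
  have "((%s. p + s *\<^sub>R w) has_derivative (%r. r *\<^sub>R w)) (at s within {0..1})"
   by (auto intro!: derivative_eq_intros)
  from has_derivative_compose[OF this has_derivative_dird[OF smooth_diff[OF f]]]
  have "((%s. f (p + s *\<^sub>R w)) has_derivative (%r. dird (r *\<^sub>R w) f (p + s *\<^sub>R w))) (at s within {0..1})" by simp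
  moreover have "dird (r *\<^sub>R w) f (p + s *\<^sub>R w) = r *\<^sub>R dird w f (p + s *\<^sub>R w)" for r
   using dird_dir_scale[OF smooth_diff[OF f]] by (simp add: scaleR_conv_of_real)
  ultimately show ?thesis by (simp add: has_vector_derivative_def)
 qed
 from fundamental_theorem_of_calculus[of 0 1, OF _ d]
 have HI: "((%s. dird w f (p + s *\<^sub>R w)) has_integral (f (p + w) - f p)) {0..1}" by simp
 have c: "continuous_on {0..1} (%s. dird w f (p + s *\<^sub>R w))"
  by (rule continuous_on_compose2[OF smooth_cont[OF smooth_on_dird[OF f]]]) (auto intro!: continuous_intros)
 have "set_integrable lborel {0..1} (%s. dird w f (p + s *\<^sub>R w))"
  unfolding set_integrable_def by (rule borel_integrable_compact[OF _ c]) auto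
 from set_borel_integral_eq_integral(2)[OF this] HI show ?thesis
  by (simp add: set_lebesgue_integral_def unit_ind_def scaleR_conv_of_real integral_unique)
qed

text \<open>The increment of \<open>dird v f\<close> from \<open>p\<close> to
  \<open>p + t *\<^sub>R w\<close> is \<open>t\<close> times a mean value \<open>g t\<close> of
  \<open>dird v (dird w f)\<close>, by differentiating under the integral. As \<open>g\<close> is
  smooth, the derivative at \<open>t = 0\<close> is \<open>g 0\<close>.\<close>

lemma dird_commute:
 fixes f :: "'a::euclidean_space => complex"
 assumes f: "smo f"
 shows "dird w (dird v f) p = dird v (dird w f) p"
proof -
 have int: "lint unit_ind" using cw_unit_ind[of "%_. 1"] by (simp add: cw_def)
 have z: "s ~: {0..1} ==> unit_ind s = 0" for s by (simp add: unit_ind_def)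
 define Ph where "Ph z = dird v (dird w f) (p + fst z *\<^sub>R (snd z *\<^sub>R w))" for z :: "real * real"
 have sPh: "smo Ph"
  unfolding Ph_def[abs_def] by (rule smooth_comp[where f = "dird v (dird w f)", OF smooth_on_dird[OF smooth_on_dird[OF f]] open_UNIV]) (intro smooth_intros open_UNIV)
 define g where "g t = (LI s. unit_ind s * Ph (t, s))" for t
 have gs: "smo g" unfolding g_def[abs_def]
  by (rule smooth_param[OF _ _ _ sPh int z compact_Icc]) auto
 have int1: "(LI s. unit_ind s) = 1"
  by (simp add: unit_ind_def[abs_def] integral_complex_of_real)
 have g0: "g 0 = dird v (dird w f) p" using int1 by (simp add: g_def Ph_def)
 have eq: "dird v f (p + t *\<^sub>R w) - dird v f p = of_real t * g t" for t
 proof -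
  let ?Ps = "%z::'a * real. dird w f (fst z + snd z *\<^sub>R (t *\<^sub>R w))"
  have sPs: "smo ?Ps" by (rule smooth_comp[where f = "dird w f", OF smooth_on_dird[OF f] open_UNIV]) (intro smooth_intros open_UNIV)
  have "f (q + t *\<^sub>R w) - f q = of_real t * (LI s. unit_ind s * ?Ps (q, s))" for q
  proof -
   have "dird (t *\<^sub>R w) f x = of_real t * dird w f x" for x by (rule dird_dir_scale[OF smooth_diff[OF f]]) simp
   then have "f (q + t *\<^sub>R w) - f q = (LI s. of_real t * (unit_ind s * ?Ps (q, s)))"
    using dird_difference_integral[OF f, of q "t *\<^sub>R w"] by (simp only: fst_conv snd_conv mult.left_commute)
   then show ?thesis by simp
  qed
  then have e: "(%q. f (q + t *\<^sub>R w) - f q) = (%q. of_real t * (LI s. unit_ind s * ?Ps (q, s)))" by blast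
  have sI: "smo (%q. LI s. unit_ind s * ?Ps (q, s))"
   by (rule smooth_param[OF _ _ _ sPs int z compact_Icc]) auto
  have ft: "smo (%q. f (q + t *\<^sub>R w))" by (intro smooth_comp[OF f] smooth_intros open_UNIV)
  have df: "g differentiable at x" if "smo g" for g :: "'a => complex" and x
   using smooth_diff[OF that] by simp
  have tr: "dird v (%q. g (q + c)) q = dird v g (q + c)" if "smo g" for g :: "'a => complex" and c q
   by (rule dird_compose[OF df[OF that], where g' = "%x. x", of "%q. q + c"]) (auto intro!: derivative_eq_intros)
  have "dird v (%q. f (q + t *\<^sub>R w) - f q) p = dird v f (p + t *\<^sub>R w) - dird v f p"
   using dird_diff[OF df[OF ft] df[OF f], of v p] tr[OF f] by simp
  moreover have "dird v (%q. of_real t * (LI s. unit_ind s * ?Ps (q, s))) p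
    = of_real t * (LI s. unit_ind s * dird (v, 0) ?Ps (p, s))"
   unfolding dird_cmult[OF df[OF sI]]
   by (subst dird_param_integral[OF open_UNIV open_UNIV _ sPs int z compact_Icc]) auto
  moreover have "dird (v, 0) ?Ps (p, s) = Ph (t, s)" for s
  proof -
   have "((%z::'a * real. fst z + snd z *\<^sub>R (t *\<^sub>R w)) has_derivative (%z. fst z + snd z *\<^sub>R (t *\<^sub>R w))) (at (p, s))"
    by (auto intro!: derivative_eq_intros)
   from dird_compose[OF _ this, of "dird w f" "(v, 0)"] show ?thesis
    using df[OF smooth_on_dird[OF f]] by (simp add: Ph_def mult.commute)
  qed
  ultimately show ?thesis using e by (simp add: g_def)
 qed
 have D: "F differentiable at q" if "smo F" for F :: "'c::real_normed_vector => complex" and q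
  using smooth_diff[OF that] by simp
 have "((%t::real. p + t *\<^sub>R w) has_derivative (%r. r *\<^sub>R w)) (at 0)" by (auto intro!: derivative_eq_intros)
 from dird_compose[OF D[OF smooth_on_dird[OF f]] this, of 1 v]
 have "dird w (dird v f) p = dird 1 (%t. dird v f (p + t *\<^sub>R w)) 0" by simp
 also have "(%t. dird v f (p + t *\<^sub>R w)) = (%t. of_real t * g t + dird v f p)" using eq by (simp add: diff_eq_eq)
 also have "dird 1 ... 0 = g 0"
  by (rule dird_eqI[where f' = "%r. of_real 0 * dird r g 0 + of_real r * g 0", THEN trans])
    (auto intro!: derivative_eq_intros has_derivative_dird[OF D[OF gs]])
 finally show ?thesis unfolding g0 .
qed

text \<open>Freezing the coefficients at \<open>p\<close> separates the second derivative, symmetric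
  in the two fields, from the central term that comes from differentiating the coefficients. Only
  the latter survives in a commutator.\<close>

lemma Xf_Xf:
 fixes f :: "'a::euclidean_space \<times> 'b::euclidean_space => complex"
 assumes bb: "bounded_bilinear be" and f: "smo f"
 shows "Xf be v (Xf be w f) p
  = dird (v, 2 *\<^sub>R be (fst p) v) (dird (w, 2 *\<^sub>R be (fst p) w) f) p + dird (0, 2 *\<^sub>R be v w) f p"
proof -
 have df: "g differentiable at x" if "smo g" for g :: "'a * 'b => complex" and x
  using smooth_diff[OF that] by simp
 have l: "linear (%z. dird (0, z) f q)" for q
  using dird_linear[OF df[OF f], of q] unfolding linear_iff
  by (metis (no_types, lifting) add.right_neutral add_Pair scaleR_Pair scaleR_zero_right)
 have ex: "dird (w, z) f q = dird (w, 0) f q + (\<Sum>b\<in>Basis. of_real (z \<bullet> b) * dird (0, b) f q)" for z q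
 proof -
  have "dird (w, z) f q = dird ((w, 0) + (0, z)) f q" by simp
  also have "... = dird (w, 0) f q + dird (0, z) f q" by (rule dird_dir_add[OF df[OF f]])
  finally show ?thesis using linear_Basis_expand[OF l, of z q] by (simp add: scaleR_conv_of_real)
 qed
 define c where "c b q = complex_of_real (2 * (be (fst q) w \<bullet> b))" for b and q :: "'a * 'b"
 let ?V = "(v, 2 *\<^sub>R be (fst p) v)"
 have cs: "smo (c b)" for b unfolding c_def[abs_def]
  by (intro smooth_intros smooth_bl[OF bounded_bilinear.bounded_linear_left[OF bb]] open_UNIV)
 have dc: "dird ?V (c b) p = of_real (2 * (be v w \<bullet> b))" for b
 proof -
  have "(c b has_derivative (%u. of_real (2 * (be (fst u) w \<bullet> b)))) (at p)"
   unfolding c_def[abs_def]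
   by (intro has_derivative_of_real has_derivative_mult_right has_derivative_inner_left
     bounded_linear.has_derivative[OF bounded_bilinear.bounded_linear_left[OF bb]] has_derivative_fst has_derivative_ident)
  from dird_eqI[OF this] show ?thesis by simp
 qed
 note S = smooth_on_dird[OF f]
 have sum_d: "dird u (%q. dird (w, 0) f q + (\<Sum>b\<in>Basis. g b q * dird (0, b) f q)) p
   = dird u (dird (w, 0) f) p + (\<Sum>b\<in>Basis. dird u (g b) p * dird (0, b) f p + g b p * dird u (dird (0, b) f) p)"
  if g: "!!b. smo (g b)" for u and g :: "'b => 'a * 'b => complex"
 proof -
  have s: "smo (%q. g b q * dird (0, b) f q)" for b by (intro smooth_intros g f open_UNIV)
  show ?thesis
   by (subst dird_add[OF df[OF S] df[OF smooth_on_sum[OF open_UNIV s]]], subst dird_sum[OF df[OF s]], subst dird_mult[OF df[OF g] df[OF S]]) (rule refl)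
 qed
 have "Xf be w f = (%q. dird (w, 0) f q + (\<Sum>b\<in>Basis. c b q * dird (0, b) f q))"
  by (rule ext) (subst Xf_def, subst ex, simp add: c_def)
 then have "Xf be v (Xf be w f) p = dird ?V (dird (w, 0) f) p + (\<Sum>b\<in>Basis. of_real (2 * (be v w \<bullet> b)) * dird (0, b) f p + c b p * dird ?V (dird (0, b) f) p)"
  by (simp only: Xf_def[of be v] sum_d[OF cs] dc)
 moreover have "dird ?V (dird (w, 2 *\<^sub>R be (fst p) w) f) p = dird ?V (dird (w, 0) f) p + (\<Sum>b\<in>Basis. c b p * dird ?V (dird (0, b) f) p)"
 proof -
  have "dird (w, 2 *\<^sub>R be (fst p) w) f = (%q. dird (w, 0) f q + (\<Sum>b\<in>Basis. (%q. c b p) q * dird (0, b) f q))"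
   by (rule ext) (subst ex, simp add: c_def)
  then show ?thesis by (simp only: sum_d[OF smooth_on_const[OF open_UNIV]]) simp
 qed
 moreover have "dird (0, 2 *\<^sub>R be v w) f p = (\<Sum>b\<in>Basis. of_real (2 * (be v w \<bullet> b)) * dird (0, b) f p)"
  using linear_Basis_expand[OF l, of "2 *\<^sub>R be v w" p] by (simp add: scaleR_conv_of_real)
 ultimately show ?thesis by (simp add: sum.distrib)
qed

lemma Xf_commutator:
 fixes f :: "'a::euclidean_space \<times> 'b::euclidean_space => complex"
 assumes bb: "bounded_bilinear be" and f: "smo f" and sk: "be w v = - be v w"
 shows "Xf be v (Xf be w f) p - Xf be w (Xf be v f) p = 4 * dird (0, be v w) f p"
proof -
 have df: "f differentiable at x" for x using smooth_diff[OF f] by simp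
 have "(0, 2 *\<^sub>R be v w) = 2 *\<^sub>R (0, be v w)" "(0, 2 *\<^sub>R be w v) = (- 2) *\<^sub>R (0, be v w)" using sk by simp_all
 then show ?thesis
  unfolding Xf_Xf[OF bb f] dird_commute[OF f, of "(v, 2 *\<^sub>R be (fst p) v)"]
  using dird_dir_scale[OF df, of 2 "(0, be v w)"] dird_dir_scale[OF df, of "-2" "(0, be v w)"] by simp
qed

section \<open>The group law of \<open>\<N>\<^sub>S\<close>\<close>

definition Bv :: "real^('n::finite \<times> 4)^('n * 4) => real^('n * 4) => real^('n * 4) => real^3" where
 "Bv S x y = (\<chi> be. x \<bullet> (B_mat S be *v y))"

lemma bb_Bv: "bounded_bilinear (Bv S)"
proof -
 have "bilinear (Bv S)"
  unfolding bilinear_def linear_iff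
  by (auto simp: vec_eq_iff Bv_def inner_add_left inner_add_right matrix_vector_right_distrib matrix_vector_mult_scaleR)
 then show ?thesis by (simp add: bilinear_conv_bounded_bilinear)
qed

lemma inner_matrix: "x \<bullet> (M *v y) = (\<Sum>a\<in>UNIV. \<Sum>b\<in>UNIV. M $ a $ b * x $ a * y $ b)"
 for M :: "real^'a::finite^'b::finite"
 by (simp add: inner_vec_def matrix_vector_mult_def sum_distrib_left mult_ac)

lemma Xfield_Bv: "Xfield S b p = (axis b 1, 2 *\<^sub>R Bv S (fst p) (axis b 1))"
proof -
 have "fst p \<bullet> (B_mat S be *v axis b 1) = (\<Sum>a\<in>UNIV. B_mat S be $ a $ b * fst p $ a)" for be
  by (simp add: matrix_vector_mul_component inner_vec_def matrix_vector_mult_basis column_def mult.commute)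
 then show ?thesis by (simp add: Xfield_def Bv_def vec_eq_iff)
qed

lemma dird_Xfield: "dird (Xfield S b p) f p = Xf (Bv S) (axis b 1) f p"
 by (simp add: Xf_def Xfield_Bv)

definition JJ :: "3 => real^('n::finite \<times> 4) => real^('n * 4)" where
 "JJ ga v = II_mat ga *v v"

lemma linear_JJ: "linear (JJ ga)"
 unfolding JJ_def[abs_def] by (rule matrix_vector_mul_linear)

lemmas JJ_simps = linear_add[OF linear_JJ] linear_diff[OF linear_JJ] linear_scale[OF linear_JJ] linear_neg[OF linear_JJ] linear_0[OF linear_JJ]

lemma sum_pair4: "(\<Sum>a\<in>UNIV. f a) = (\<Sum>l\<in>UNIV. f (l, 1) + f (l, 2) + f (l, 3) + f (l, 4))" for f :: "'n::finite \<times> 4 => 'b::comm_monoid_add"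
proof -
 have "(\<Sum>a\<in>UNIV. f a) = (\<Sum>l\<in>UNIV. \<Sum>i\<in>UNIV. f (l, i))"
  unfolding UNIV_Times_UNIV[symmetric] by (simp add: sum.cartesian_product)
 then show ?thesis by (simp add: sum_4)
qed

lemma JJ_nth:
 "JJ 1 v $ (l, 1) = v $ (l, 2)" "JJ 1 v $ (l, 2) = - v $ (l, 1)" "JJ 1 v $ (l, 3) = - v $ (l, 4)" "JJ 1 v $ (l, 4) = v $ (l, 3)"
 "JJ 2 v $ (l, 1) = v $ (l, 3)" "JJ 2 v $ (l, 2) = v $ (l, 4)" "JJ 2 v $ (l, 3) = - v $ (l, 1)" "JJ 2 v $ (l, 4) = - v $ (l, 2)"
 "JJ 3 v $ (l, 1) = v $ (l, 4)" "JJ 3 v $ (l, 2) = - v $ (l, 3)" "JJ 3 v $ (l, 3) = v $ (l, 2)" "JJ 3 v $ (l, 4) = - v $ (l, 1)"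
proof -
 have d: "(\<Sum>m\<in>UNIV. (if l = m then f m else 0)) = f l" for f :: "'n::finite => real" and l by simp
 have e: "JJ ga v $ (l, i) = I_mat ga $ i $ 1 * v $ (l, 1) + I_mat ga $ i $ 2 * v $ (l, 2) + I_mat ga $ i $ 3 * v $ (l, 3) + I_mat ga $ i $ 4 * v $ (l, 4)" for ga i
 proof -
  have "JJ ga v $ (l, i) = (\<Sum>m\<in>UNIV. if l = m then I_mat ga $ i $ 1 * v $ (m, 1) + I_mat ga $ i $ 2 * v $ (m, 2) + I_mat ga $ i $ 3 * v $ (m, 3) + I_mat ga $ i $ 4 * v $ (m, 4) else 0)"
  proof -
   have "JJ ga v $ (l, i) = (\<Sum>a\<in>UNIV. (if l = fst a then I_mat ga $ i $ snd a else 0) * v $ a)"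
    by (simp add: JJ_def matrix_vector_mult_def II_mat_def cong: if_cong)
   then show ?thesis unfolding sum_pair4 fst_conv snd_conv by (simp only:) (rule sum.cong, auto)
  qed
  then show ?thesis by (simp only: d)
 qed
 show "JJ 1 v $ (l, 1) = v $ (l, 2)" "JJ 1 v $ (l, 2) = - v $ (l, 1)" "JJ 1 v $ (l, 3) = - v $ (l, 4)" "JJ 1 v $ (l, 4) = v $ (l, 3)"
  "JJ 2 v $ (l, 1) = v $ (l, 3)" "JJ 2 v $ (l, 2) = v $ (l, 4)" "JJ 2 v $ (l, 3) = - v $ (l, 1)" "JJ 2 v $ (l, 4) = - v $ (l, 2)"
  "JJ 3 v $ (l, 1) = v $ (l, 4)" "JJ 3 v $ (l, 2) = - v $ (l, 3)" "JJ 3 v $ (l, 3) = v $ (l, 2)" "JJ 3 v $ (l, 4) = - v $ (l, 1)"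
  unfolding e by (simp_all add: I_mat_def skew_unit_def)
qed

lemma vec_eq4: "x = y \<longleftrightarrow> (ALL l. x $ (l, 1) = y $ (l, 1) & x $ (l, 2) = y $ (l, 2) & x $ (l, 3) = y $ (l, 3) & x $ (l, 4) = y $ (l, 4))"
 for x y :: "real^('n::finite \<times> 4)"
 by (auto simp: vec_eq_iff forall_4)

lemma JJ_JJ:
 "JJ 1 (JJ 1 v) = - v" "JJ 2 (JJ 2 v) = - v" "JJ 3 (JJ 3 v) = - v"
 "JJ 1 (JJ 2 v) = JJ 3 v" "JJ 2 (JJ 3 v) = JJ 1 v" "JJ 3 (JJ 1 v) = JJ 2 v"
 "JJ 2 (JJ 1 v) = - JJ 3 v" "JJ 3 (JJ 2 v) = - JJ 1 v" "JJ 1 (JJ 3 v) = - JJ 2 v"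
 unfolding vec_eq4 by (simp_all add: JJ_nth)

lemma JJ_skew: "x \<bullet> JJ ga y = - (JJ ga x \<bullet> y)"
proof -
 have "ga = 1 | ga = 2 | ga = 3" by (rule exhaust_3)
 then show ?thesis
  unfolding inner_vec_def sum_pair4 sum_negf[symmetric] by (elim disjE) (auto simp: JJ_nth intro!: sum.cong)
qed

lemma JJ_inner_self: "v \<bullet> JJ ga v = 0" "JJ ga v \<bullet> v = 0"
 using JJ_skew[of v ga v] by (simp_all add: inner_commute)

lemma JJ_inner: "JJ ga v \<bullet> JJ de v = (if ga = de then v \<bullet> v else 0)"
proof -
 have "ga = 1 | ga = 2 | ga = 3" "de = 1 | de = 2 | de = 3" by (rule exhaust_3)+
 then show ?thesis
  unfolding JJ_skew[of "JJ ga v" de v] by (elim disjE) (simp_all add: JJ_JJ JJ_inner_self)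
qed

definition sig :: "real^('n::finite \<times> 4)^('n * 4) => real^('n * 4) => real^('n * 4) => real" where
 "sig S x y = x \<bullet> (S *v y)"

lemma sig_simps: "sig S (- x) y = - sig S x y" "sig S x (- y) = - sig S x y"
 by (simp_all add: sig_def linear_neg[OF matrix_vector_mul_linear])

lemma Bv_sig: "Bv S x y $ be = sig S x (JJ be y) - sig S (JJ be x) y"
proof -
 have "x \<bullet> (II_mat be *v (S *v y)) = - ((II_mat be *v x) \<bullet> (S *v y))"
  using JJ_skew[of x be "S *v y"] by (simp add: JJ_def)
 then show ?thesis
  by (simp add: Bv_def B_mat_def sig_def JJ_def matrix_vector_mult_add_rdistrib inner_add_right matrix_vector_mul_assoc[symmetric])
qed

lemma sig_sym: "transpose S = S ==> sig S x y = sig S y x"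
 unfolding sig_def by (metis dot_lmul_matrix inner_commute transpose_matrix_vector)

lemma Bv_skew: "transpose S = S ==> Bv S y x = - Bv S x y"
 by (simp add: vec_eq_iff Bv_sig sig_sym[of S y] sig_sym[of S "JJ _ y"])

section \<open>The right-type condition as invariance of the brackets\<close>

lemma wedge_omega:
 "wedge (omega A) g K = (if A : K then wsign {A} (K - {A}) * g (K - {A}) else 0)"
 for K :: "('n::{finite,linorder} \<times> 2) set"
proof -
 have "wedge (omega A) g K = (\<Sum>I\<in>Pow K. if I = {A} then wsign {A} (K - {A}) * g (K - {A}) else 0)"
  unfolding wedge_by_def by (rule sum.cong) (auto simp: omega_def)
 then show ?thesis by (simp add: finite_subset[OF subset_UNIV])
qed

lemma wsign_single: "A ~= B ==> wsign {B} {A} = - wsign {A} {B}" "wsign {A} {B} ~= 0" "wsign I {} = 1" "wsign {} I = 1"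
proof -
 have 1: "wsign {A} {B} = (if idx_less B A then -1 else 1)" for A B
 proof -
  have "{(i, j). i : {A} & j : {B} & idx_less j i} = (if idx_less B A then {(A, B)} else {})" by auto
  then show ?thesis unfolding wsign_def by simp
 qed
 show "wsign {A} {B} ~= 0" by (simp add: 1)
 show "wsign {B} {A} = - wsign {A} {B}" if "A ~= B"
 proof -
  have "snd A = 0 | snd A = 1" "snd B = 0 | snd B = 1" using exhaust_2[of "snd A"] exhaust_2[of "snd B"] by auto
  then have "idx_less A B ~= idx_less B A" using that
   by (cases A; cases B) (auto simp: idx_less_def)
  then show ?thesis by (auto simp: 1)
 qed
 show "wsign I {} = 1" "wsign {} I = 1" by (simp_all add: wsign_def)
qed

lemma dird_qcomb:
 assumes "!!b. g b differentiable at x"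
 shows "dird v (%x. qcomb (%b. g b x) A A') x = qcomb (%b. dird v (g b) x) A A'"
 unfolding qcomb_def Let_def
 by (cases "snd A = 0"; cases "A' = 0")
   (simp_all add: dird_add dird_diff dird_minus dird_cmult assms)

definition MAB :: "real^('n::finite \<times> 4)^('n * 4) => 'n * 2 => 'n * 2 => complex" where
 "MAB S A B = qcomb (%a. qcomb (%b. of_real (2 * S $ a $ b)) B 1) A 0"

lemma nabla_quadratic:
 assumes S: "transpose S = S"
 shows "nabla A 0 (nabla B 1 (%x. complex_of_real (\<Sum>a\<in>UNIV. \<Sum>b\<in>UNIV. S $ a $ b * x $ a * x $ b))) x = MAB S A B"
proof -
 let ?q = "%x. complex_of_real (\<Sum>a\<in>UNIV. \<Sum>b\<in>UNIV. S $ a $ b * x $ a * x $ b)"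
 have sq: "?q = (%x. of_real (sig S x x))" by (rule ext) (simp add: sig_def inner_matrix)
 have D1: "dird v ?q = (%x. of_real (2 * sig S v x))" for v
 proof
  fix x
  have "(?q has_derivative (%v. of_real (x \<bullet> (S *v v) + v \<bullet> (S *v x)))) (at x)"
   unfolding sq sig_def
   by (intro has_derivative_of_real has_derivative_inner has_derivative_ident bounded_linear.has_derivative[OF matrix_vector_mul_bounded_linear])
  from dird_eqI[OF this, of v] show "dird v ?q x = of_real (2 * sig S v x)"
   using sig_sym[OF S, of x v] by (simp add: sig_def)
 qed
 have hd: "((%x. complex_of_real (2 * sig S v x)) has_derivative (%w. of_real (2 * sig S v w))) (at x)" for v x
  unfolding sig_def
  by (intro has_derivative_of_real has_derivative_mult_right has_derivative_inner_right bounded_linear.has_derivative[OF matrix_vector_mul_bounded_linear] has_derivative_ident)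
 have n1: "nabla B 1 ?q = (%x. qcomb (%b. of_real (2 * sig S (axis b 1) x)) B 1)"
  by (rule ext) (simp only: nabla_def D1)
 have df: "(%x. complex_of_real (2 * sig S v x)) differentiable at x" for v x using hd by (rule differentiableI)
 have "nabla A 0 (nabla B 1 ?q) x = qcomb (%a. qcomb (%b. of_real (2 * sig S (axis b 1) (axis a 1))) B 1) A 0"
  unfolding nabla_def[of A] n1 by (subst dird_qcomb[OF df]) (simp only: dird_eqI[OF hd])
 moreover have "sig S (axis b 1) (axis a 1) = S $ a $ b" for a b
  unfolding sig_sym[OF S, of "axis b 1"] by (simp add: sig_def inner_axis' matrix_vector_mult_basis column_def)
 ultimately show ?thesis by (simp add: MAB_def)
qed

text \<open>The coefficient of the 2-form at \<open>{A, B}\<close> is, up to sign, the difference of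
  the two entries.\<close>

lemma right_type_MAB:
 fixes S :: "real^('n::{finite,linorder} \<times> 4)^('n * 4)"
 assumes S: "transpose S = S" and rt: "right_type S"
 shows "MAB S A B = MAB S B A"
proof (cases "A = B")
 case False
 have "(\<Sum>C\<in>UNIV. \<Sum>D\<in>UNIV. MAB S C D * wedge (omega C) (omega D) {A, B}) = 0"
  using rt unfolding right_type_def Let_def nabla_quadratic[OF S] by blast
 moreover have "MAB S C D * wedge (omega C) (omega D) {A, B}
   = (if D = B then (if C = A then MAB S A B * wsign {A} {B} else 0) else 0) + (if D = A then (if C = B then MAB S B A * wsign {B} {A} else 0) else 0)" for C D
 proof -
  have "{A, B} - {A} = {B}" "{A, B} - {B} = {A}" using False by auto
  then show ?thesis using False unfolding wedge_omega by (auto simp: omega_def)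
 qed
 ultimately have "MAB S A B * wsign {A} {B} + MAB S B A * wsign {B} {A} = 0"
  by (simp add: sum.distrib)
 then show ?thesis using wsign_single(1)[OF False] wsign_single(2)[of A B] by (simp add: left_diff_distrib[symmetric])
qed simp

text \<open>Right-type means that the average of \<open>S\<close> over 1 and the three complex
  structures vanishes, that is, \<open>S\<close> has no part commuting with all
  \<open>JJ ga\<close>.\<close>

lemma right_type_sig:
 fixes S :: "real^('n::{finite,linorder} \<times> 4)^('n * 4)"
 assumes S: "transpose S = S" and rt: "right_type S"
 shows "sig S x y + sig S (JJ 1 x) (JJ 1 y) + sig S (JJ 2 x) (JJ 2 y) + sig S (JJ 3 x) (JJ 3 y) = 0"
proof -
 have "transpose S $ b $ a = S $ a $ b" for a b by (simp add: transpose_def)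
 then have sym: "S $ b $ a = S $ a $ b" for a b using S by simp
 define s where "s l m i j = S $ (l, i) $ (m, j)" for l m i j
 \<comment> \<open>For each pair of blocks the symmetry of \<open>MAB\<close> amounts to four real
   linear equations, two from each of the complex identities for the indices (0, 0) and (0, 1). They
   are solved for four entries.\<close>
 have c: "s l m 4 4 = - s l m 1 1 - s l m 2 2 - s l m 3 3 & s l m 3 4 = s l m 2 1 - s l m 1 2 + s l m 4 3
   & s l m 4 2 = s l m 3 1 - s l m 1 3 + s l m 2 4 & s l m 1 4 = s l m 3 2 - s l m 2 3 + s l m 4 1" for l m
 proof -
  have "MAB S (l, 0) (m, 0) = MAB S (m, 0) (l, 0)" "MAB S (l, 0) (m, 1) = MAB S (m, 1) (l, 0)"
   by (rule right_type_MAB[OF S rt])+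
  then have "S $ (l, 3) $ (m, 1) - S $ (l, 4) $ (m, 2) = S $ (m, 3) $ (l, 1) - S $ (m, 4) $ (l, 2)"
   "S $ (l, 3) $ (m, 2) + S $ (l, 4) $ (m, 1) = S $ (m, 3) $ (l, 2) + S $ (m, 4) $ (l, 1)"
   "S $ (l, 3) $ (m, 3) + S $ (l, 4) $ (m, 4) = - S $ (m, 1) $ (l, 1) - S $ (m, 2) $ (l, 2)"
   "S $ (l, 4) $ (m, 3) - S $ (l, 3) $ (m, 4) = S $ (m, 2) $ (l, 1) - S $ (m, 1) $ (l, 2)"
   by (simp_all add: MAB_def qcomb_def complex_eq_iff) 
  then show ?thesis unfolding s_def
   using sym[of "(l, 1)" "(m, 3)"] sym[of "(l, 2)" "(m, 4)"] sym[of "(l, 2)" "(m, 3)"] sym[of "(l, 1)" "(m, 4)"]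
    sym[of "(l, 1)" "(m, 1)"] sym[of "(l, 2)" "(m, 2)"] sym[of "(l, 1)" "(m, 2)"] sym[of "(l, 2)" "(m, 1)"] by linarith
 qed
 have ex: "sig S x y = (\<Sum>l\<in>UNIV. \<Sum>m\<in>UNIV. \<Sum>i\<in>UNIV. \<Sum>j\<in>UNIV. s l m i j * x $ (l, i) * y $ (m, j))" for x y
 proof -
  have "(\<Sum>b\<in>UNIV. g b) = (\<Sum>m\<in>UNIV. \<Sum>j\<in>UNIV. g (m, j))" for g :: "'n * 4 => real"
   unfolding UNIV_Times_UNIV[symmetric] by (simp add: sum.cartesian_product)
  then show ?thesis unfolding sig_def inner_matrix s_def by (simp add: sum.swap[of _ "UNIV::'n set" "UNIV::4 set"])
 qed
 have "(\<Sum>i\<in>UNIV. \<Sum>j\<in>UNIV. s l m i j * x $ (l, i) * y $ (m, j)) + (\<Sum>i\<in>UNIV. \<Sum>j\<in>UNIV. s l m i j * JJ 1 x $ (l, i) * JJ 1 y $ (m, j))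
   + (\<Sum>i\<in>UNIV. \<Sum>j\<in>UNIV. s l m i j * JJ 2 x $ (l, i) * JJ 2 y $ (m, j)) + (\<Sum>i\<in>UNIV. \<Sum>j\<in>UNIV. s l m i j * JJ 3 x $ (l, i) * JJ 3 y $ (m, j)) = 0" for l m
  unfolding sum_4 JJ_nth conjunct1[OF c[of l m]] conjunct1[OF conjunct2[OF c[of l m]]]
   conjunct1[OF conjunct2[OF conjunct2[OF c[of l m]]]] conjunct2[OF conjunct2[OF conjunct2[OF c[of l m]]]]
  by (simp add: algebra_simps)
 then show ?thesis unfolding ex by (simp add: sum.distrib[symmetric])
qed

text \<open>Right-type enters the bracket here: \<open>right_type_sig\<close> for \<open>x\<close>
  and \<open>JJ be y\<close> makes the three forms invariant under the complex structures. This
  turns the span of \<open>v\<close> and the \<open>JJ ga v\<close> into an image of the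
  quaternionic Heisenberg group.\<close>

lemma Bv_JJ:
 fixes S :: "real^('n::{finite,linorder} \<times> 4)^('n * 4)"
 assumes S: "transpose S = S" and rt: "right_type S"
 shows "Bv S (JJ de x) (JJ de y) = Bv S x y"
proof -
 note r = right_type_sig[OF S rt]
 have "Bv S (JJ de x) (JJ de y) $ be = Bv S x y $ be" for be
 proof -
  have "de = 1 | de = 2 | de = 3" "be = 1 | be = 2 | be = 3" by (rule exhaust_3)+
  then show ?thesis using r[of x "JJ be y"] by (elim disjE) (auto simp: Bv_sig JJ_JJ sig_simps)
 qed
 then show ?thesis by (simp add: vec_eq_iff)
qed

section \<open>Lines in \<open>\<N>\<^sub>S\<close>\<close>

text \<open>The minus signs make the brackets of these vectors follow the structure constants of
  \<open>om\<close>.\<close>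

definition yv :: "real^('n::finite \<times> 4) => 4 => real^('n * 4)" where
 "yv v j = (if j = 1 then v else if j = 2 then - JJ 1 v else if j = 3 then - JJ 2 v else - JJ 3 v)"

definition Ev :: "real^('n::finite \<times> 4) => real^4 => real^('n * 4)" where
 "Ev v \<xi> = (\<Sum>j\<in>UNIV. \<xi> $ j *\<^sub>R yv v j)"

definition Cv :: "real^('n::finite \<times> 4)^('n * 4) => real^('n * 4) => real^3 => real^3" where
 "Cv S v s = (\<Sum>ga\<in>UNIV. s $ ga *\<^sub>R (- Bv S v (JJ ga v)))"

lemma yv_simps [simp]: "yv v 1 = v" "yv v 2 = - JJ 1 v" "yv v 3 = - JJ 2 v" "yv v 4 = - JJ 3 v"
 by (simp_all add: yv_def)

lemma Ev_axis: "Ev v (axis j 1) = yv v j"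
 unfolding Ev_def by (simp add: axis_def if_distrib[of "%c. c *\<^sub>R _"] cong: if_cong)

lemma linear_Ev: "linear (Ev v)"
 by (rule linearI) (simp_all add: Ev_def sum.distrib scaleR_add_left scaleR_sum_right)

lemma linear_Cv: "linear (Cv S v)"
 unfolding linear_iff Cv_def by (simp add: sum_subtractf sum_negf sum.distrib scaleR_add_left scaleR_diff_left scaleR_sum_right)

lemma yv_inner: "yv v i \<bullet> yv v j = (if i = j then v \<bullet> v else 0)"
proof -
 have "i = 1 | i = 2 | i = 3 | i = 4" "j = 1 | j = 2 | j = 3 | j = 4" by (rule exhaust_4)+
 then show ?thesis by (elim disjE) (simp_all add: JJ_inner JJ_inner_self)
qed

text \<open>By \<open>Bv_JJ\<close> and skewness the six brackets of the four vectors reduce to the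
  three values \<open>Bv S v (JJ ga v)\<close>.\<close>

lemma Bv_yv:
 fixes S :: "real^('n::{finite,linorder} \<times> 4)^('n * 4)"
 assumes S: "transpose S = S" and rt: "right_type S"
 shows "Bv S (Ev v x) (Ev v y) = Cv S v (om x y)"
proof -
 note ms = bounded_bilinear.minus_left[OF bb_Bv] bounded_bilinear.minus_right[OF bb_Bv]
  bounded_bilinear.add_left[OF bb_Bv] bounded_bilinear.add_right[OF bb_Bv]
  bounded_bilinear.diff_left[OF bb_Bv] bounded_bilinear.diff_right[OF bb_Bv]
  bounded_bilinear.scaleR_left[OF bb_Bv] bounded_bilinear.scaleR_right[OF bb_Bv]
 have z: "Bv S w w = 0" for w using Bv_skew[OF S, of w w] by (simp add: vec_eq_iff)
 have J: "Bv S (JJ 1 v) (JJ 2 v) = - Bv S v (JJ 3 v)" "Bv S (JJ 2 v) (JJ 3 v) = - Bv S v (JJ 1 v)" "Bv S (JJ 3 v) (JJ 1 v) = - Bv S v (JJ 2 v)"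
  using Bv_JJ[OF S rt, of 1 "JJ 1 v" "JJ 2 v"] Bv_JJ[OF S rt, of 2 "JJ 2 v" "JJ 3 v"] Bv_JJ[OF S rt, of 3 "JJ 3 v" "JJ 1 v"]
  by (simp_all add: JJ_JJ ms)
 have J': "Bv S (JJ ga v) v = - Bv S v (JJ ga v)" "Bv S (JJ 2 v) (JJ 1 v) = Bv S v (JJ 3 v)"
  "Bv S (JJ 3 v) (JJ 2 v) = Bv S v (JJ 1 v)" "Bv S (JJ 1 v) (JJ 3 v) = Bv S v (JJ 2 v)" for ga
  using Bv_skew[OF S, of v] Bv_skew[OF S, of "JJ 1 v" "JJ 2 v"] Bv_skew[OF S, of "JJ 2 v" "JJ 3 v"] Bv_skew[OF S, of "JJ 3 v" "JJ 1 v"] J by simp_all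
 define b1 b2 b3 where "b1 = Bv S v (JJ 1 v)" and "b2 = Bv S v (JJ 2 v)" and "b3 = Bv S v (JJ 3 v)"
 show ?thesis
  unfolding Ev_def Cv_def sum_4 sum_3 yv_simps ms J J' z om_nth omv_def b1_def[symmetric] b2_def[symmetric] b3_def[symmetric]
  by (simp add: vec_eq_iff algebra_simps)
qed

lemma line_v:
 fixes S :: "real^('n::{finite,linorder} \<times> 4)^('n * 4)"
 assumes S: "transpose S = S" and rt: "right_type S"
 shows "line (Bv S) (Ev v) (Cv S v)"
 by (rule line.intro) (use Bv_yv[OF S rt] in "auto simp: bb_Bv linear_Ev linear_Cv linear_conv_bounded_linear[symmetric]")

text \<open>At the origin the bracket of the fields belonging to \<open>y\<close> and
  \<open>x\<close> is four times \<open>Bv S y x\<close>; (H) is applied to the functional given by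
  the inner product with \<open>a\<close>.\<close>

lemma cond_H_nondeg:
 fixes S :: "real^('n::{finite,linorder} \<times> 4)^('n * 4)"
 assumes S: "transpose S = S" and H: "cond_H S" and a: "a ~= 0" and z: "!!x. a \<bullet> Bv S y x = 0"
 shows "y = 0"
proof -
 define Y where "Y y = (%p. \<Sum>b\<in>UNIV. y $ b *\<^sub>R Xfield S b p)" for y
 have Ye: "Y y p = (y, 2 *\<^sub>R Bv S (fst p) y)" for y p
 proof -
  have y: "y = (\<Sum>b\<in>UNIV. y $ b *\<^sub>R axis b 1)" for y :: "real^('n * 4)"
   using basis_expansion[of y] by (simp add: scalar_mult_eq_scaleR)
  have l: "linear (%y. (y, 2 *\<^sub>R Bv S (fst p) y))"
   by (rule linearI) (simp_all add: bounded_bilinear.add_right[OF bb_Bv] bounded_bilinear.scaleR_right[OF bb_Bv] scaleR_add_right)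
  have "(y, 2 *\<^sub>R Bv S (fst p) y) = (\<Sum>b\<in>UNIV. y $ b *\<^sub>R (axis b 1, 2 *\<^sub>R Bv S (fst p) (axis b 1)))"
   using linear_sum[OF l, of "%b. y $ b *\<^sub>R axis b 1" UNIV] linear_scale[OF l] y[of y] by simp
  then show ?thesis by (simp only: Y_def Xfield_Bv)
 qed
 have fd: "frechet_derivative (Y y) (at 0) u = (0, 2 *\<^sub>R Bv S (fst u) y)" for y u
 proof -
  have "(Y y has_derivative (%u. (0, 2 *\<^sub>R Bv S (fst u) y))) (at 0)"
   unfolding Ye[abs_def]
   by (intro has_derivative_Pair has_derivative_const has_derivative_scaleR_right
     bounded_linear.has_derivative[OF bounded_bilinear.bounded_linear_left[OF bb_Bv]] has_derivative_fst has_derivative_ident)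
  from frechet_derivative_at[OF this] show ?thesis by metis
 qed
 define lam where "lam c = a \<bullet> c" for c :: "real^3"
 have "linear lam" unfolding lam_def[abs_def] by (rule linearI) (simp_all add: inner_add_right)
 moreover have "lam ~= (%c. 0)" using a by (auto simp: lam_def fun_eq_iff intro!: exI[of _ a])
 moreover have "Y y : g1 S" for y by (auto simp: g1_def Y_def)
 moreover have "ALL Y':g1 S. lam (snd (lie_bracket (Y y) Y' 0)) = 0"
 proof
  fix Y' assume "Y' : g1 S"
  then obtain x where "Y' = Y x" by (auto simp: g1_def Y_def)
  then have "snd (lie_bracket (Y y) Y' 0) = 4 *\<^sub>R Bv S y x"
   using Bv_skew[OF S, of y x] by (simp add: lie_bracket_def fd Ye)
  then show "lam (snd (lie_bracket (Y y) Y' 0)) = 0" using z[of x] by (simp add: lam_def)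
 qed
 ultimately have "Y y = (%p. 0)" using H unfolding cond_H_def by blast
 then have "fst (Y y 0) = 0" by simp
 then show ?thesis by (simp add: Ye)
qed

section \<open>A nondegenerate line\<close>

lemma nonzero_by_derivative:
 fixes f :: "real => real"
 assumes "(f has_real_derivative d) (at 0)" "d ~= 0" "f 0 = 0"
 shows "\<forall>\<^sub>F e in at 0. f e ~= 0"
proof -
 have "((%h. f h / h) \<longlongrightarrow> d) (at 0)" using assms(1,3) unfolding DERIV_def by simp
 from tendsto_imp_eventually_ne[OF this assms(2)] show ?thesis by eventually_elim auto
qed

lemma nonzero_by_continuity:
 fixes f :: "real => real"
 assumes "(f has_real_derivative d) (at 0)" "f 0 ~= 0"
 shows "\<forall>\<^sub>F e in at 0. f e ~= 0"
 using tendsto_imp_eventually_ne[of f "f 0" "at 0"] assms DERIV_isCont isContD by blast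

text \<open>If the leading minor of order \<open>r\<close> of \<open>m\<close> is nonzero and that of order \<open>r + 1\<close> vanishes, the left
  kernel of the latter block is spanned by the vector of its cofactors in the last column; a
  perturbation that this vector maps to the last unit vector changes the minor to first order.\<close>

lemma minor2_step:
 fixes m p :: "3 => 3 => real"
 assumes "m 1 1 ~= 0" "m 1 1 * m 2 2 - m 1 2 * m 2 1 = 0"
  and p: "m 1 1 * p 2 1 - m 2 1 * p 1 1 = 0" "m 1 1 * p 2 2 - m 2 1 * p 1 2 = 1"
 shows "p 1 1 * m 2 2 + m 1 1 * p 2 2 - p 1 2 * m 2 1 - m 1 2 * p 2 1 ~= 0"
proof -
 have "m 1 1 * (p 1 1 * m 2 2 + m 1 1 * p 2 2 - p 1 2 * m 2 1 - m 1 2 * p 2 1)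
   = m 1 1 * (m 1 1 * p 2 2 - m 2 1 * p 1 2) - m 1 2 * (m 1 1 * p 2 1 - m 2 1 * p 1 1) + p 1 1 * (m 1 1 * m 2 2 - m 1 2 * m 2 1)"
  by (simp add: algebra_simps)
 then show ?thesis using assms by auto
qed

lemma minor3_step:
 fixes m p :: "3 => 3 => real"
 defines "a1 \<equiv> m 2 1 * m 3 2 - m 2 2 * m 3 1" and "a2 \<equiv> m 1 2 * m 3 1 - m 1 1 * m 3 2" and "a3 \<equiv> m 1 1 * m 2 2 - m 1 2 * m 2 1"
 assumes "a3 ~= 0" "a1 * m 1 3 + a2 * m 2 3 + a3 * m 3 3 = 0"
  and p: "a1 * p 1 1 + a2 * p 2 1 + a3 * p 3 1 = 0" "a1 * p 1 2 + a2 * p 2 2 + a3 * p 3 2 = 0" "a1 * p 1 3 + a2 * p 2 3 + a3 * p 3 3 = 1"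
 shows "a1 * p 1 3 + a2 * p 2 3 + a3 * p 3 3
  + (p 2 1 * m 3 2 + m 2 1 * p 3 2 - p 2 2 * m 3 1 - m 2 2 * p 3 1) * m 1 3
  + (p 1 2 * m 3 1 + m 1 2 * p 3 1 - p 1 1 * m 3 2 - m 1 1 * p 3 2) * m 2 3
  + (p 1 1 * m 2 2 + m 1 1 * p 2 2 - p 1 2 * m 2 1 - m 1 2 * p 2 1) * m 3 3 ~= 0" (is "?X ~= 0")
proof -
 \<comment> \<open>Multiplied by the nonzero minor \<open>a3\<close>, the first-order change is a
   combination of the products of the cofactor row with the columns of \<open>p\<close> and of the
   vanishing determinant; of these only the last column contributes.\<close>
 have "a3 * ?X = a3 * (a1 * p 1 3 + a2 * p 2 3 + a3 * p 3 3)
   + (m 1 2 * m 2 3 - m 2 2 * m 1 3) * (a1 * p 1 1 + a2 * p 2 1 + a3 * p 3 1)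
   + (m 2 1 * m 1 3 - m 1 1 * m 2 3) * (a1 * p 1 2 + a2 * p 2 2 + a3 * p 3 2)
   + (a1 * m 1 3 + a2 * m 2 3 + a3 * m 3 3) * (m 2 2 * p 1 1 - m 1 2 * p 2 1 - m 2 1 * p 1 2 + m 1 1 * p 2 2)"
  unfolding a1_def a2_def a3_def by (simp add: algebra_simps)
 then show ?thesis using assms(4-8) by auto
qed

text \<open>For \<open>w = v\<close> this is minus the matrix of \<open>Cv S v\<close>; the second
  argument polarises it, so that perturbations of \<open>v\<close> can be expanded.\<close>

definition mv :: "real^('n::finite \<times> 4)^('n * 4) => real^('n * 4) => real^('n * 4) => 3 => 3 => real" where
 "mv S v w be ga = Bv S v (JJ ga w) $ be"

context
 fixes S :: "real^('n::{finite,linorder} \<times> 4)^('n * 4)"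
 assumes S: "transpose S = S" and rt: "right_type S" and H: "cond_H S"
begin

lemma mv_sym: "mv S v w be ga = mv S w v be ga"
proof -
 have "ga = 1 | ga = 2 | ga = 3" by (rule exhaust_3)
 then have "JJ ga (JJ ga w) = - w" by (elim disjE) (simp_all add: JJ_JJ)
 then have "Bv S v (JJ ga w) = - Bv S (JJ ga v) w"
  using Bv_JJ[OF S rt, of ga v "JJ ga w"] by (simp add: bounded_bilinear.minus_right[OF bb_Bv])
 also have "... = Bv S w (JJ ga v)" using Bv_skew[OF S, of w "JJ ga v"] by simp
 finally show ?thesis by (simp add: mv_def)
qed

lemma mv_perturb: "mv S (v + e *\<^sub>R w) (v + e *\<^sub>R w) be ga = mv S v v be ga + 2 * mv S v w be ga * e + mv S w w be ga * e\<^sup>2"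
proof -
 have "mv S (v + e *\<^sub>R w) (v + e *\<^sub>R w) be ga = mv S v v be ga + mv S v w be ga * e + mv S w v be ga * e + mv S w w be ga * e\<^sup>2"
  by (simp add: mv_def JJ_simps bounded_bilinear.add_left[OF bb_Bv] bounded_bilinear.add_right[OF bb_Bv]
    bounded_bilinear.scaleR_left[OF bb_Bv] bounded_bilinear.scaleR_right[OF bb_Bv] power2_eq_square algebra_simps)
 then show ?thesis using mv_sym[of w v] by simp
qed

text \<open>By (H) the combination \<open>N\<close> of the three matrices with coefficients
  \<open>a\<close> is invertible. A vector \<open>w\<close> with \<open>N w\<close> proportional to
  \<open>JJ de v\<close> does what is wanted, because the vectors \<open>JJ ga v\<close> are
  orthogonal of equal length.\<close>

lemma mv_surj:
 assumes v: "v ~= 0" and a: "a ~= 0"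
 obtains w where "!!ga. (\<Sum>be\<in>UNIV. a $ be * mv S v w be ga) = (if ga = de then 1 else 0)"
proof -
 define N where "N w = (\<Sum>be\<in>UNIV. a $ be *\<^sub>R (B_mat S be *v w))" for w
 have Nx: "x \<bullet> N w = a \<bullet> Bv S x w" for x w
  by (simp add: N_def inner_sum_right Bv_def inner_vec_def[of a])
 have lin: "linear N"
  by (rule linearI) (simp_all add: N_def matrix_vector_right_distrib matrix_vector_mult_scaleR sum.distrib scaleR_add_right scaleR_sum_right mult.commute)
 have "inj N"
 proof (rule linear_injective_0[OF lin, THEN iffD2], intro allI impI)
  fix w assume "N w = 0"
  then have "a \<bullet> Bv S w x = 0" for x using Nx[of x w] Bv_skew[OF S, of w x] by simp
  then show "w = 0" by (rule cond_H_nondeg[OF S H a])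
 qed
 then have "surj N" by (rule linear_inj_imp_surj[OF lin])
 then obtain w where w: "N w = - (inverse (v \<bullet> v) *\<^sub>R JJ de v)" by (metis surjD)
 show thesis
 proof (rule that)
  fix ga
  have "(\<Sum>be\<in>UNIV. a $ be * mv S v w be ga) = a \<bullet> Bv S w (JJ ga v)"
   unfolding mv_sym[of v w] by (simp add: mv_def inner_vec_def)
  also have "... = - (JJ ga v \<bullet> N w)" unfolding Nx Bv_skew[OF S, of "JJ ga v" w] by simp
  also have "... = (if ga = de then 1 else 0)" unfolding w using v by (simp add: JJ_inner)
  finally show "(\<Sum>be\<in>UNIV. a $ be * mv S v w be ga) = (if ga = de then 1 else 0)" .
 qed
qed

lemma deriv_mv: "((%e. mv S (v + e *\<^sub>R w) (v + e *\<^sub>R w) be ga) has_real_derivative 2 * mv S v w be ga) (at 0)"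
 unfolding mv_perturb by (auto intro!: derivative_eq_intros)

lemma mv_zero: "mv S 0 0 be ga = 0"
 by (simp add: mv_def bounded_bilinear.zero_left[OF bb_Bv])

text \<open>If the quadratic form vanished identically, so would its polarisation, against
  \<open>mv_surj\<close>.\<close>

lemma minor1: "EX v. mv S v v 1 1 ~= 0"
proof (rule ccontr)
 assume "\<not> ?thesis"
 then have z: "mv S v v 1 1 = 0" for v by simp
 have "axis undefined 1 ~= (0 :: real^('n * 4))" "axis 1 1 ~= (0 :: real^3)" by (simp_all add: axis_eq_0_iff)
 then obtain w where w: "!!ga. (\<Sum>be\<in>UNIV. axis 1 1 $ be * mv S (axis undefined 1) w be ga) = (if ga = 1 then 1 else 0)"
  using mv_surj[of "axis undefined 1" "axis 1 1" 1] by blast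
 have "mv S (axis undefined 1) w 1 1 = 1" using w[of 1] by (simp add: sum_3 axis_def)
 then show False using mv_perturb[of "axis undefined 1" 1 w 1 1] z[of "axis undefined 1 + 1 *\<^sub>R w"] z[of "axis undefined 1"] z[of w] by simp
qed

text \<open>If the minor vanishes at \<open>v\<close>, moving along the vector from
  \<open>mv_surj\<close> changes it to first order, while the entry that is already nonzero stays so
  by continuity.\<close>

lemma minor2: "EX v. mv S v v 1 1 ~= 0 & mv S v v 1 1 * mv S v v 2 2 - mv S v v 1 2 * mv S v v 2 1 ~= 0"
proof -
 obtain v where v: "mv S v v 1 1 ~= 0" using minor1 by blast
 show ?thesis
 proof (cases "mv S v v 1 1 * mv S v v 2 2 - mv S v v 1 2 * mv S v v 2 1 = 0")
  case True
  define a :: "real^3" where "a = vector [- mv S v v 2 1, mv S v v 1 1, 0]"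
  have "a $ 2 ~= 0" using v by (simp add: a_def)
  then have a: "a ~= 0" by auto
  have v0: "v ~= 0" using v mv_zero by auto
  obtain w where w: "!!ga. (\<Sum>be\<in>UNIV. a $ be * mv S v w be ga) = (if ga = 2 then 1 else 0)"
   using mv_surj[OF v0 a, of 2] by blast
  have n: "mv S v w 1 1 * mv S v v 2 2 + mv S v v 1 1 * mv S v w 2 2 - mv S v w 1 2 * mv S v v 2 1 - mv S v v 1 2 * mv S v w 2 1 ~= 0"
   by (rule minor2_step[where m = "mv S v v", OF v True]) (use w[of 1] w[of 2] in "simp_all add: sum_3 a_def algebra_simps")
  let ?q = "%be ga e. mv S (v + e *\<^sub>R w) (v + e *\<^sub>R w) be ga"
  have "((%e. ?q 1 1 e * ?q 2 2 e - ?q 1 2 e * ?q 2 1 e) has_real_derivative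
    2 * (mv S v w 1 1 * mv S v v 2 2 + mv S v v 1 1 * mv S v w 2 2 - mv S v w 1 2 * mv S v v 2 1 - mv S v v 1 2 * mv S v w 2 1)) (at 0)"
   by (rule derivative_eq_intros deriv_mv refl)+ (simp add: algebra_simps)
  then have "\<forall>\<^sub>F e in at 0. ?q 1 1 e * ?q 2 2 e - ?q 1 2 e * ?q 2 1 e ~= 0"
   by (rule nonzero_by_derivative) (use n True in auto)
  moreover have "\<forall>\<^sub>F e in at 0. ?q 1 1 e ~= 0" by (rule nonzero_by_continuity[OF deriv_mv]) (use v in simp)
  ultimately have "\<forall>\<^sub>F e in at 0. ?q 1 1 e ~= 0 & ?q 1 1 e * ?q 2 2 e - ?q 1 2 e * ?q 2 1 e ~= 0" by eventually_elim blast
  then show ?thesis using eventually_happens[of _ "at (0::real)"] by fastforce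
 qed (use v in blast)
qed

definition det3 :: "(3 => 3 => real) => real" where
 "det3 m = (m 2 1 * m 3 2 - m 2 2 * m 3 1) * m 1 3 + (m 1 2 * m 3 1 - m 1 1 * m 3 2) * m 2 3 + (m 1 1 * m 2 2 - m 1 2 * m 2 1) * m 3 3"

lemma minor3: "EX v. det3 (mv S v v) ~= 0"
proof -
 obtain v where v: "mv S v v 1 1 * mv S v v 2 2 - mv S v v 1 2 * mv S v v 2 1 ~= 0" using minor2 by blast
 show ?thesis
 proof (cases "det3 (mv S v v) = 0")
  case True
  let ?m = "mv S v v"
  define a :: "real^3" where "a = vector [?m 2 1 * ?m 3 2 - ?m 2 2 * ?m 3 1, ?m 1 2 * ?m 3 1 - ?m 1 1 * ?m 3 2, ?m 1 1 * ?m 2 2 - ?m 1 2 * ?m 2 1]"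
  have "a $ 3 ~= 0" using v by (simp add: a_def)
  then have a: "a ~= 0" by auto
  have v0: "v ~= 0" using v mv_zero by auto
  obtain w where w: "!!ga. (\<Sum>be\<in>UNIV. a $ be * mv S v w be ga) = (if ga = 3 then 1 else 0)"
   using mv_surj[OF v0 a, of 3] by blast
  let ?q = "%be ga e. mv S (v + e *\<^sub>R w) (v + e *\<^sub>R w) be ga"
  let ?p = "mv S v w"
  note n = minor3_step[where m = ?m and p = ?p, OF v]
  have n: "(?m 2 1 * ?m 3 2 - ?m 2 2 * ?m 3 1) * ?p 1 3 + (?m 1 2 * ?m 3 1 - ?m 1 1 * ?m 3 2) * ?p 2 3 + (?m 1 1 * ?m 2 2 - ?m 1 2 * ?m 2 1) * ?p 3 3
  + (?p 2 1 * ?m 3 2 + ?m 2 1 * ?p 3 2 - ?p 2 2 * ?m 3 1 - ?m 2 2 * ?p 3 1) * ?m 1 3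
  + (?p 1 2 * ?m 3 1 + ?m 1 2 * ?p 3 1 - ?p 1 1 * ?m 3 2 - ?m 1 1 * ?p 3 2) * ?m 2 3
  + (?p 1 1 * ?m 2 2 + ?m 1 1 * ?p 2 2 - ?p 1 2 * ?m 2 1 - ?m 1 2 * ?p 2 1) * ?m 3 3 ~= 0"
   by (rule minor3_step[OF v]) (use w[of 1] w[of 2] w[of 3] True in "simp_all add: sum_3 a_def det3_def")
  have "((%e. det3 (mv S (v + e *\<^sub>R w) (v + e *\<^sub>R w))) has_real_derivative 2 * ((?m 2 1 * ?m 3 2 - ?m 2 2 * ?m 3 1) * ?p 1 3 + (?m 1 2 * ?m 3 1 - ?m 1 1 * ?m 3 2) * ?p 2 3 + (?m 1 1 * ?m 2 2 - ?m 1 2 * ?m 2 1) * ?p 3 3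
  + (?p 2 1 * ?m 3 2 + ?m 2 1 * ?p 3 2 - ?p 2 2 * ?m 3 1 - ?m 2 2 * ?p 3 1) * ?m 1 3
  + (?p 1 2 * ?m 3 1 + ?m 1 2 * ?p 3 1 - ?p 1 1 * ?m 3 2 - ?m 1 1 * ?p 3 2) * ?m 2 3
  + (?p 1 1 * ?m 2 2 + ?m 1 1 * ?p 2 2 - ?p 1 2 * ?m 2 1 - ?m 1 2 * ?p 2 1) * ?m 3 3)) (at 0)"
   unfolding det3_def by (rule derivative_eq_intros deriv_mv refl)+ (simp add: algebra_simps)
  then have "\<forall>\<^sub>F e in at 0. det3 (mv S (v + e *\<^sub>R w) (v + e *\<^sub>R w)) ~= 0"
   by (rule nonzero_by_derivative) (use n True in auto)
  then show ?thesis using eventually_happens[of _ "at (0::real)"] by fastforce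
 qed blast
qed

text \<open>\<open>Ep\<close> reads off coefficients with respect to the orthogonal vectors
  \<open>yv v j\<close> of equal length, and \<open>Ci\<close> inverts the matrix of
  \<open>Cv S v\<close>, whose determinant is \<open>det3\<close> up to sign.\<close>

lemma nline_exists: "EX v Ep Ci. nline (Bv S) (Ev v) (Cv S v) Ep Ci"
proof -
 obtain v where v: "det3 (mv S v v) ~= 0" using minor3 by blast
 have v0: "v ~= 0" using v mv_zero by (auto simp: det3_def)
 define M :: "real^3^3" where "M = (\<chi> be ga. mv S v v be ga)"
 have "det M = det3 (mv S v v)" by (simp add: det_3 M_def det3_def algebra_simps)
 then have "invertible M" using v by (simp add: invertible_det_nz)
 then obtain M' where inv: "M ** M' = mat 1" "M' ** M = mat 1" unfolding invertible_def by blast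
 have CM: "Cv S v s = - (M *v s)" for s
  by (simp add: Cv_def M_def mv_def vec_eq_iff matrix_vector_mult_def sum_negf mult.commute)
 define Ci where "Ci t = - (M' *v t)" for t
 define Ep where "Ep x = (\<chi> j. inverse (v \<bullet> v) * (yv v j \<bullet> x))" for x
 have "nline (Bv S) (Ev v) (Cv S v) Ep Ci"
 proof (rule nline.intro[OF line_v[OF S rt] nline_axioms.intro])
  have "linear Ep" by (rule linearI) (simp_all add: Ep_def vec_eq_iff inner_add_right algebra_simps)
  then show "bounded_linear Ep" by (simp add: linear_conv_bounded_linear)
  have "linear Ci" unfolding Ci_def[abs_def] by (intro linear_compose_neg matrix_vector_mul_linear)
  then show "bounded_linear Ci" by (simp add: linear_conv_bounded_linear)
  show "Ep (Ev v x) = x" for x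
   using v0 by (simp add: Ep_def Ev_def vec_eq_iff inner_sum_right yv_inner if_distrib[of "%z. _ * z"] cong: if_cong)
  show "Ci (Cv S v s) = s" for s
   using inv by (simp add: Ci_def CM linear_neg[OF matrix_vector_mul_linear] matrix_vector_mul_assoc)
  show "Cv S v (Ci t) = t" for t
   using inv by (simp add: Ci_def CM linear_neg[OF matrix_vector_mul_linear] matrix_vector_mul_assoc)
 qed
 then show ?thesis by blast
qed

lemma good_lines_exist:
 "EX vs Ep Ci. vs ~= [] & good_lines (Bv S) (map (%v. (Ev v, Cv S v)) vs) & nline (Bv S) (Ev (hd vs)) (Cv S (hd vs)) Ep Ci"
proof -
 obtain v Ep Ci where n: "nline (Bv S) (Ev v) (Cv S v) Ep Ci" using nline_exists by blast
 obtain xs :: "'n list" where xs: "set xs = UNIV" using finite_list[OF finite[of "UNIV :: 'n set"]] by blast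
 \<comment> \<open>The nondegenerate line comes first, as \<open>good_lines\<close> demands; the
   other vectors generate the coordinate blocks, so that the lines span together.\<close>
 define vs where "vs = v # map (%l. axis (l, 1) 1) xs"
 have "axis b 1 : (\<Union>l\<in>set (map (%v. (Ev v, Cv S v)) vs). range (fst l))" for b :: "'n * 4"
 proof -
  have "axis b 1 : range (Ev (axis (fst b, 1) 1))"
  proof -
   have e: "yv (axis (l, 1) 1) j = axis (l, j) 1" for l :: 'n and j
   proof -
    have "j = 1 | j = 2 | j = 3 | j = 4" by (rule exhaust_4)
    then show ?thesis unfolding vec_eq4 by (elim disjE) (auto simp: JJ_nth axis_def)
   qed
   show ?thesis by (rule range_eqI[of _ _ "axis (snd b) 1"]) (simp add: Ev_axis e)
  qed
  then show ?thesis using xs by (auto simp: vs_def)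
 qed
 then have "Basis <= (\<Union>l\<in>set (map (%v. (Ev v, Cv S v)) vs). range (fst l))"
  unfolding Basis_vec_def by auto
 then have "span (\<Union>l\<in>set (map (%v. (Ev v, Cv S v)) vs). range (fst l)) = UNIV"
  using span_mono[of Basis] unfolding span_Basis by blast
 moreover have "surj (Cv S v)" using nline.CCi[OF n] by (metis surjI)
 ultimately have "good_lines (Bv S) (map (%v. (Ev v, Cv S v)) vs)"
  by (auto simp: good_lines_def bb_Bv all_lines_def line_v[OF S rt] vs_def)
 then show ?thesis using n by (intro exI[of _ vs] exI[of _ Ep] exI[of _ Ci]) (simp add: vs_def)
qed

end

section \<open>The operators \<open>Z\<^sub>A\<close> along a line\<close>

lemma linear_Xf: "bounded_bilinear be ==> f differentiable (at p) ==> linear (%w. Xf be w f p)"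
 unfolding linear_iff Xf_def
 by (auto simp: bounded_bilinear.add_right bounded_bilinear.scaleR_right scaleR_add_right
   linear_add[OF dird_linear, symmetric] linear_scale[OF dird_linear, symmetric] mult.commute)

lemma Xf_axis_expand:
 assumes "f differentiable (at p)"
 shows "Xf (Bv S) w f p = (\<Sum>b\<in>UNIV. of_real (w $ b) * Xf (Bv S) (axis b 1) f p)"
proof -
 note l = linear_Xf[OF bb_Bv assms, of S]
 have "w = (\<Sum>b\<in>UNIV. w $ b *\<^sub>R axis b 1)"
  using basis_expansion[of w] by (simp add: scalar_mult_eq_scaleR)
 then have "Xf (Bv S) w f p = Xf (Bv S) (\<Sum>b\<in>UNIV. w $ b *\<^sub>R axis b 1) f p" by metis
 also have "... = (\<Sum>b\<in>UNIV. of_real (w $ b) * Xf (Bv S) (axis b 1) f p)"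
  unfolding linear_sum[OF l] linear_scale[OF l] by (simp add: scaleR_conv_of_real)
 finally show ?thesis .
qed

lemma Z_op_Xf: "Z_op S A A' f p = qcomb (%b. Xf (Bv S) (axis b 1) f p) A A'"
 by (simp add: Z_op_def dird_Xfield)

lemma Z_op_sum:
 assumes "!!i. i : I ==> f i differentiable (at p)"
 shows "Z_op S A A' (%x. \<Sum>i\<in>I. c i * f i x) p = (\<Sum>i\<in>I. c i * Z_op S A A' (f i) p)"
proof -
 have d: "(%x. c i * f i x) differentiable (at p)" if "i : I" for i using assms[OF that] by simp
 have "Xf (Bv S) w (%x. \<Sum>i\<in>I. c i * f i x) p = (\<Sum>i\<in>I. c i * Xf (Bv S) w (f i) p)" for w
  by (simp add: Xf_sum[OF d] Xf_cmult assms)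
 then show ?thesis
  unfolding Z_op_Xf qcomb_def Let_def
  by (simp add: sum_subtractf sum.distrib sum_negf sum_distrib_left algebra_simps)
qed

definition Zc :: "real^('n::finite \<times> 4)^('n * 4) => ('n * 2 => complex) => 2 => ('n pt => complex) => 'n pt => complex" where
 "Zc S c A' f p = (\<Sum>A\<in>UNIV. c A * Z_op S A A' f p)"

lemma smooth_on_Z_op:
 assumes "smo f" shows "smo (Z_op S A A' f)"
proof -
 have X: "smo (%p. Xf (Bv S) w f p)" for w
  using smooth_on_Xf[OF bb_Bv open_UNIV assms] by simp
 show ?thesis unfolding Z_op_Xf[abs_def] qcomb_def Let_def
  by (cases "snd A = 0"; cases "A' = 0"; simp only: simp_thms if_True if_False) (intro smooth_intros X open_UNIV)+
qed

lemma Zc_Zc: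
 assumes f: "smo f"
 shows "Zc S d B' (Zc S c A' f) p = (\<Sum>A\<in>UNIV. \<Sum>B\<in>UNIV. c A * d B * Z_op S B B' (Z_op S A A' f) p)"
proof -
 have d: "Z_op S A A' f differentiable (at p)" for A using smooth_diff[OF smooth_on_Z_op[OF f]] by simp
 have "Zc S d B' (Zc S c A' f) p = (\<Sum>B\<in>UNIV. \<Sum>A\<in>UNIV. c A * d B * Z_op S B B' (Z_op S A A' f) p)"
  unfolding Zc_def[of S d] Zc_def[of S c, abs_def] by (simp add: Z_op_sum[OF d] sum_distrib_left mult_ac)
 then show ?thesis by (subst sum.swap)
qed

text \<open>The coefficients for which contraction of the \<open>Z_op\<close> gives combinations of
  the four fields \<open>yv v j\<close>, see \<open>Zc_line\<close>.\<close>

definition alp :: "real^('n::finite \<times> 4) => 'n * 2 => complex" where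
 "alp v A = (if snd A = 0 then of_real (v $ (fst A, 1)) - \<i> * of_real (v $ (fst A, 2))
   else of_real (v $ (fst A, 3)) + \<i> * of_real (v $ (fst A, 4)))"

text \<open>The quaternionic conjugate of \<open>alp\<close>.\<close>

definition bet :: "real^('n::finite \<times> 4) => 'n * 2 => complex" where
 "bet v A = (if snd A = 0 then - cnj (alp v (fst A, 1)) else cnj (alp v (fst A, 0)))"

definition EE :: "real^('n::finite \<times> 4) => 'n * 2 => 'n * 2 => complex" where
 "EE v A B = alp v A * bet v B - bet v A * alp v B"

lemma sum_pair2: "(\<Sum>A\<in>UNIV. f A) = (\<Sum>l\<in>UNIV. f (l, 0) + f (l, 1))" for f :: "'n::finite \<times> 2 => 'b::comm_monoid_add"
proof -
 have "(\<Sum>a\<in>UNIV. f a) = (\<Sum>l\<in>UNIV. \<Sum>i\<in>UNIV. f (l, i))"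
  unfolding UNIV_Times_UNIV[symmetric] by (simp add: sum.cartesian_product)
 moreover have "(2::2) = 0" by simp
 ultimately show ?thesis by (simp add: sum_2 add.commute)
qed

lemma Zc_line:
 assumes f: "smo f"
 shows "Zc S (alp v) 0 f p = (- 1) * Xf (Bv S) (yv v 3) f p + (- \<i>) * Xf (Bv S) (yv v 4) f p"
  "Zc S (alp v) 1 f p = (- 1) * Xf (Bv S) (yv v 1) f p + (- \<i>) * Xf (Bv S) (yv v 2) f p"
  "Zc S (bet v) 0 f p = 1 * Xf (Bv S) (yv v 1) f p + (- \<i>) * Xf (Bv S) (yv v 2) f p"
  "Zc S (bet v) 1 f p = (- 1) * Xf (Bv S) (yv v 3) f p + \<i> * Xf (Bv S) (yv v 4) f p"
proof -
 have d: "f differentiable (at p)" using smooth_diff[OF f] by simp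
 define X where "X b = Xf (Bv S) (axis b 1) f p" for b
 note e = Xf_axis_expand[OF d, of S, folded X_def] sum_pair4 sum_pair2 Zc_def Z_op_Xf[of S _ _ f p, folded X_def] qcomb_def Let_def
 note s = alp_def bet_def JJ_nth JJ_simps
 show "Zc S (alp v) 0 f p = (- 1) * Xf (Bv S) (yv v 3) f p + (- \<i>) * Xf (Bv S) (yv v 4) f p"
  unfolding e sum_distrib_left sum.distrib[symmetric] by (rule sum.cong) (simp_all add: s algebra_simps)
 show "Zc S (alp v) 1 f p = (- 1) * Xf (Bv S) (yv v 1) f p + (- \<i>) * Xf (Bv S) (yv v 2) f p"
  unfolding e sum_distrib_left sum.distrib[symmetric] by (rule sum.cong) (simp_all add: s algebra_simps)
 show "Zc S (bet v) 0 f p = 1 * Xf (Bv S) (yv v 1) f p + (- \<i>) * Xf (Bv S) (yv v 2) f p"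
  unfolding e sum_distrib_left sum.distrib[symmetric] by (rule sum.cong) (simp_all add: s algebra_simps)
 show "Zc S (bet v) 1 f p = (- 1) * Xf (Bv S) (yv v 3) f p + \<i> * Xf (Bv S) (yv v 4) f p"
  unfolding e sum_distrib_left sum.distrib[symmetric] by (rule sum.cong) (simp_all add: s algebra_simps)
qed

text \<open>The contraction leaves compositions of the four fields of the line. The squares add up
  to the sub-Laplacian or are absent, and the commutators cancel in pairs, because by
  \<open>o\<close> that of the fields 1 and 2 equals that of 3 and 4, and cyclically in 2, 3,
  4.\<close>

lemma EE_Z_Z:
 fixes S :: "real^('n::{finite,linorder} \<times> 4)^('n * 4)" and v p
 assumes S: "transpose S = S" and rt: "right_type S" and f: "smo f"
 defines "Q B' A' \<equiv> (\<Sum>A\<in>UNIV. \<Sum>B\<in>UNIV. EE v A B * Z_op S B B' (Z_op S A A' f) p)"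
 shows "Q 1 0 = line.LM (Bv S) (Ev v) f p" "Q 0 1 = - line.LM (Bv S) (Ev v) f p" "Q 0 0 = 0" "Q 1 1 = 0"
proof -
 interpret line "Bv S" "Ev v" "Cv S v" by (rule line_v[OF S rt])
 define Y where "Y j = Xf (Bv S) (yv v j)" for j
 have sY: "smo (Y j g)" if "smo g" for j g
  unfolding Y_def by (rule smooth_on_Xf[OF bb_Bv open_UNIV that])
 have df: "g differentiable (at x)" if "smo g" for g :: "'n pt => complex" and x
  using smooth_diff[OF that] by simp
 have lin: "Y k (%p. a * Y i f p + b * Y j f p) p = a * Y k (Y i f) p + b * Y k (Y j f) p" for a b i j k
  using df[OF sY[OF f]] unfolding Y_def[of k] by (subst Xf_add) (simp_all add: Xf_cmult)
 have sl: "smo (%p. a * Y i f p + b * Y j f p)" for a b i j by (intro smooth_intros sY f open_UNIV)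
 have L: "LM f p = Y 1 (Y 1 f) p + Y 2 (Y 2 f) p + Y 3 (Y 3 f) p + Y 4 (Y 4 f) p"
  unfolding LM_def Ev_axis sum_4 Y_def ..
 have cm: "Y i (Y j f) p = Y j (Y i f) p + 4 * dird (0, Cv S v (om (axis i 1) (axis j 1))) f p" for i j
  using Xf_commutator[OF bb_Bv f Bv_skew[OF S], of "yv v i" "yv v j" p] Bv_yv[OF S rt, of v "axis i 1" "axis j 1"]
  unfolding Ev_axis Y_def by (simp add: algebra_simps)
 have o: "om (axis 3 1) (axis 4 1) = om (axis 1 1) (axis 2 1)" "om (axis 4 1) (axis 2 1) = om (axis 1 1) (axis 3 1)"
  "om (axis 2 1) (axis 3 1) = om (axis 1 1) (axis 4 1)"
  by (simp_all add: vec_eq_iff om_nth omv_def axis_def)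
 note c = cm[of 1 2] cm[of 3 4, unfolded o] cm[of 1 3] cm[of 4 2, unfolded o] cm[of 1 4] cm[of 2 3, unfolded o]
 note z = Zc_line[where S = S and v = v, folded Y_def]
 have zf: "Zc S (alp v) 0 f = (%p. (- 1) * Y 3 f p + (- \<i>) * Y 4 f p)" "Zc S (alp v) 1 f = (%p. (- 1) * Y 1 f p + (- \<i>) * Y 2 f p)"
  "Zc S (bet v) 0 f = (%p. 1 * Y 1 f p + (- \<i>) * Y 2 f p)" "Zc S (bet v) 1 f = (%p. (- 1) * Y 3 f p + \<i> * Y 4 f p)"
  by (rule ext, rule z[OF f])+
 have Q: "Q B' A' = Zc S (bet v) B' (Zc S (alp v) A' f) p - Zc S (alp v) B' (Zc S (bet v) A' f) p" for A' B'
  unfolding Q_def Zc_Zc[OF f] EE_def by (simp add: left_diff_distrib sum_subtractf)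
 show "Q 1 0 = LM f p" unfolding Q zf z[OF sl] lin L by (simp add: c algebra_simps)
 show "Q 0 1 = - LM f p" unfolding Q zf z[OF sl] lin L by (simp add: c algebra_simps)
 show "Q 0 0 = 0" unfolding Q zf z[OF sl] lin L by (simp add: c algebra_simps)
 show "Q 1 1 = 0" unfolding Q zf z[OF sl] lin L by (simp add: c algebra_simps)
qed

section \<open>Transposes of the operators\<close>

text \<open>\<open>Cc\<close> stands for the distributions or for the smooth functions among them.\<close>

locale fclass =
 fixes S :: "real^('n::{finite,linorder} \<times> 4)^('n * 4)" and k :: nat and Cc :: "(('n pt => complex) => complex) set"
 assumes C_distr: "Cc <= distr" and C_zero: "(%ph. 0) : Cc"
  and C_add: "u : Cc ==> v : Cc ==> (%ph. u ph + v ph) : Cc"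
  and C_cmult: "u : Cc ==> (%ph. c * u ph) : Cc"
  and C_Xf: "u : Cc ==> dist_pull (Xf (Bv S) w) u : Cc"
  and C_dt: "u : Cc ==> dist_pull (dt be) u : Cc"
begin

lemma C_sum: "finite I ==> (!!i. i : I ==> u i : Cc) ==> (%ph. \<Sum>i\<in>I. u i ph) : Cc"
 by (induction I rule: finite_induct) (auto intro: C_zero C_add)

lemma C_if: "u : Cc ==> v : Cc ==> (if b then u else v) : Cc"
 by simp

definition good :: "(('n pt => complex) => 'n pt => complex) => bool" where
 "good P \<longleftrightarrow> test_linear P & (ALL u:Cc. dist_pull P u : Cc)"

lemma test_cont_linear: "test_cont P ==> test_linear P"
 by (simp add: test_cont_def)

lemma goodD:
 assumes "good P"
 shows "ph : test_fun ==> P ph : test_fun"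
  "ph : test_fun ==> ps : test_fun ==> P (%p. ph p + ps p) = (%p. P ph p + P ps p)"
  "ph : test_fun ==> P (%p. c * ph p) = (%p. c * P ph p)"
  "u : Cc ==> dist_pull P u : Cc"
 using assms by (auto simp: good_def test_linear_def)

lemma good_zero: "good (%ph p. 0)"
proof -
 have "dist_pull (%(ph :: 'n pt => complex) (p :: 'n pt). 0) u = (%ph. 0)" if "u : Cc" for u
 proof
  fix ph :: "'n pt => complex" show "dist_pull (%ph (p :: 'n pt). 0) u ph = 0"
   using distrD(2)[of u "%p. 0" 0] that C_distr test_fun_zero by (auto simp: dist_pull_def)
 qed
 then show ?thesis using C_zero by (simp add: good_def test_linear_def test_fun_zero)
qed

lemma good_ident: "good (%ph. ph)"
proof -
 have "dist_pull (%ph. ph) u = u" if "u : Cc" for u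
  using distrD(3)[of u] that C_distr by (intro ext) (auto simp: dist_pull_def)
 then show ?thesis by (simp add: good_def test_linear_def)
qed

lemma good_add: "good P ==> good Q ==> good (%ph p. P ph p + Q ph p)"
proof -
 assume P: "good P" and Q: "good Q"
 have "dist_pull (%ph p. P ph p + Q ph p) u = (%ph. dist_pull P u ph + dist_pull Q u ph)" if "u : Cc" for u
  using distrD(1)[of u] that C_distr goodD(1)[OF P] goodD(1)[OF Q] by (intro ext) (auto simp: dist_pull_def)
 then show ?thesis
  using goodD[OF P] goodD[OF Q] by (simp add: good_def test_linear_def test_fun_add C_add distrib_left add_ac)
qed

lemma good_cmult: "good P ==> good (%ph p. c * P ph p)"
proof -
 assume P: "good P"
 have "dist_pull (%ph p. c * P ph p) u = (%ph. c * dist_pull P u ph)" if "u : Cc" for u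
  using distrD(2)[of u] that C_distr goodD(1)[OF P] by (intro ext) (auto simp: dist_pull_def)
 then show ?thesis
  using goodD[OF P] by (simp add: good_def test_linear_def test_fun_cmult C_cmult distrib_left mult.left_commute)
qed

lemma good_comp: "good P ==> good Q ==> good (%ph. P (Q ph))"
proof -
 assume P: "good P" and Q: "good Q"
 have "dist_pull (%ph. P (Q ph)) u = dist_pull Q (dist_pull P u)" for u
  using goodD(1)[OF Q] by (auto simp: dist_pull_def)
 then show ?thesis
  using goodD[OF P] goodD[OF Q] by (simp add: good_def test_linear_def)
qed

lemma good_Xf: "good (Xf (Bv S) w)"
 using test_cont_linear[OF test_cont_Xf[OF bb_Bv]] C_Xf by (simp add: good_def)

lemma good_dt: "good (dt be)"
proof -
 have "test_cont (dird (0::real^('n * 4), axis be 1 :: real^3))"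
  by (rule test_cont_dird_Basis) (auto simp: Basis_prod_def Basis_vec_def)
 then have "test_cont (dt be :: ('n pt => complex) => _)" by (simp add: dt_def[abs_def])
 then show ?thesis using test_cont_linear C_dt by (auto simp: good_def)
qed

lemma good_lin2:
 assumes "good P" "good Q" shows "good (%ph p. a * P ph p + b * Q ph p)"
 by (intro good_add good_cmult assms)

lemma good_Z_op: "good (Z_op S A A')"
proof -
 have "good (%ph p. a * Xf (Bv S) v ph p + b * Xf (Bv S) w ph p)" for a b v w by (rule good_lin2[OF good_Xf good_Xf])
 from this[of "-1" "axis (fst A, 3) 1" "- \<i>" "axis (fst A, 4) 1"] this[of "-1" "axis (fst A, 1) 1" "- \<i>" "axis (fst A, 2) 1"]
  this[of 1 "axis (fst A, 1) 1" "- \<i>" "axis (fst A, 2) 1"] this[of "-1" "axis (fst A, 3) 1" "\<i>" "axis (fst A, 4) 1"]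
 show ?thesis
  unfolding Z_op_Xf[abs_def] qcomb_def Let_def
  by (cases "snd A = 0"; cases "A' = 0"; simp only: simp_thms if_True if_False) (simp_all add: algebra_simps)
qed

lemma good_T_mix: "good (T_mix A' B')"
proof -
 have "good (%ph p. a * dt be ph p + b * dt ga ph p)" for a b be ga by (rule good_lin2[OF good_dt good_dt])
 from this[of "- \<i>" 1 0 1] this[of "-1" 2 \<i> 3] this[of 1 2 \<i> 3] this[of \<i> 1 0 1]
 show ?thesis
  unfolding T_mix_def[abs_def]
  by (cases "A' = 0"; cases "B' = 0"; simp only: simp_thms if_True if_False) simp_all
qed

lemma good_T_up: "good (T_up A' B')"
 using good_T_mix[of 1 A'] good_cmult[OF good_T_mix[of 0 A'], of "-1"]
 unfolding T_up_def[abs_def] by (cases "B' = 0") simp_all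

text \<open>Operators on the tuple of \<open>k + 1\<close> coefficient functions with one summand
  per coefficient. Every component of \<open>D0\<close> is of this kind, and pairing it with
  elements of \<open>Cc\<close> gives functionals as in \<open>mfun\<close>, from whose coefficients
  the transpose is read off.\<close>

definition mop :: "((nat => 'n pt => complex) => 'n pt => complex) => bool" where
 "mop Q \<longleftrightarrow> (EX P. (ALL c. good (P c)) & (ALL fs. (ALL c. fs c : test_fun) --> Q fs = (%p. \<Sum>c\<le>k. P c (fs c) p)))"

definition mfun :: "((nat => 'n pt => complex) => complex) => bool" where
 "mfun \<Lambda> \<longleftrightarrow> (EX u. (ALL c. u c : Cc) & (ALL fs. (ALL c. fs c : test_fun) --> \<Lambda> fs = (\<Sum>c\<le>k. u c (fs c))))"

lemma mop_zero: "mop (%fs p. 0)"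
 unfolding mop_def by (rule exI[of _ "%c ph p. 0"]) (simp add: good_zero)

lemma mop_proj:
 assumes "a <= k" shows "mop (%fs. fs a)"
proof -
 have "good (%ph p. if c = a then ph p else 0)" for c using good_ident good_zero by (cases "c = a") simp_all
 moreover have "fs a = (%p. \<Sum>c\<le>k. if c = a then fs c p else 0)" for fs :: "nat => 'n pt => complex"
  using assms by (intro ext) simp
 ultimately show ?thesis unfolding mop_def by (intro exI[of _ "%c ph p. if c = a then ph p else 0"]) blast
qed

lemma mop_add: "mop P ==> mop Q ==> mop (%fs p. P fs p + Q fs p)"
proof -
 assume "mop P" "mop Q"
 then obtain P' Q' where a: "!!c. good (P' c)" "!!fs. (!!c. fs c : test_fun) ==> P fs = (%p. \<Sum>c\<le>k. P' c (fs c) p)"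
  "!!c. good (Q' c)" "!!fs. (!!c. fs c : test_fun) ==> Q fs = (%p. \<Sum>c\<le>k. Q' c (fs c) p)"
  unfolding mop_def by blast
 show ?thesis unfolding mop_def
  by (rule exI[of _ "%c ph p. P' c ph p + Q' c ph p"]) (simp add: a good_add sum.distrib)
qed

lemma mop_if: "mop P ==> mop Q ==> mop (%fs p. if b then P fs p else Q fs p)"
 by (cases b) simp_all

lemma mop_sum: "finite I ==> (!!i. i : I ==> mop (P i)) ==> mop (%fs p. \<Sum>i\<in>I. P i fs p)"
 by (induction I rule: finite_induct) (auto intro: mop_zero mop_add)

lemma good_sum_fun:
 assumes P: "good P" and f: "!!i. i : I ==> f i : test_fun" and I: "finite I"
 shows "P (%p. \<Sum>i\<in>I. f i p) = (%p. \<Sum>i\<in>I. P (f i) p)"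
 using I f
proof (induction I rule: finite_induct)
 case empty
 show ?case using goodD(3)[OF P test_fun_zero, of 0] by simp
next
 case (insert i I)
 have "(%p. \<Sum>i\<in>I. f i p) : test_fun" by (rule test_fun_sum) (use insert in auto)
 then have "P (%p. f i p + (\<Sum>i\<in>I. f i p)) = (%p. P (f i) p + P (%p. \<Sum>i\<in>I. f i p) p)"
  using goodD(2)[OF P, of "f i" "%p. \<Sum>i\<in>I. f i p"] insert by simp
 then show ?case using insert by simp
qed

lemma mop_good: "good P ==> mop Q ==> mop (%fs. P (Q fs))"
proof -
 assume P: "good P" and "mop Q"
 then obtain Q' where Q: "!!c. good (Q' c)" "!!fs. (!!c. fs c : test_fun) ==> Q fs = (%p. \<Sum>c\<le>k. Q' c (fs c) p)"
  unfolding mop_def by blast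
 have "P (Q fs) = (%p. \<Sum>c\<le>k. P (Q' c (fs c)) p)" if "!!c. fs c : test_fun" for fs
  unfolding Q(2)[OF that] by (rule good_sum_fun[OF P goodD(1)[OF Q(1) that]]) simp
 then show ?thesis unfolding mop_def
  by (intro exI[of _ "%c ph. P (Q' c ph)"]) (simp add: good_comp[OF P Q(1)])
qed

lemma mop_cmult: "mop Q ==> mop (%fs p. c * Q fs p)"
 using mop_good[OF good_cmult[OF good_ident]] .

lemma mop_test: "mop Q ==> (!!c. fs c : test_fun) ==> Q fs : test_fun"
 unfolding mop_def using goodD(1) by (auto intro!: test_fun_sum)

lemma mfun_zero: "mfun (%fs. 0)"
 unfolding mfun_def by (rule exI[of _ "%c ph. 0"]) (simp add: C_zero)

lemma mfun_add: "mfun P ==> mfun Q ==> mfun (%fs. P fs + Q fs)"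
proof -
 assume "mfun P" "mfun Q"
 then obtain u v where a: "!!c. u c : Cc" "!!fs. (!!c. fs c : test_fun) ==> P fs = (\<Sum>c\<le>k. u c (fs c))"
  "!!c. v c : Cc" "!!fs. (!!c. fs c : test_fun) ==> Q fs = (\<Sum>c\<le>k. v c (fs c))"
  unfolding mfun_def by blast
 show ?thesis unfolding mfun_def
  by (rule exI[of _ "%c ph. u c ph + v c ph"]) (simp add: a C_add sum.distrib)
qed

lemma mfun_cmult: "mfun P ==> mfun (%fs. d * P fs)"
proof -
 assume "mfun P"
 then obtain u where a: "!!c. u c : Cc" "!!fs. (!!c. fs c : test_fun) ==> P fs = (\<Sum>c\<le>k. u c (fs c))"
  unfolding mfun_def by blast
 show ?thesis unfolding mfun_def
  by (rule exI[of _ "%c ph. d * u c ph"]) (simp add: a C_cmult sum_distrib_left)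
qed

lemma mfun_sum: "finite I ==> (!!i. i : I ==> mfun (P i)) ==> mfun (%fs. \<Sum>i\<in>I. P i fs)"
 by (induction I rule: finite_induct) (auto intro: mfun_zero mfun_add)

lemma mfun_mop: "u : Cc ==> mop Q ==> mfun (%fs. u (Q fs))"
proof -
 assume u: "u : Cc" and "mop Q"
 then obtain P where P: "!!c. good (P c)" "!!fs. (!!c. fs c : test_fun) ==> Q fs = (%p. \<Sum>c\<le>k. P c (fs c) p)"
  unfolding mop_def by blast
 have "u (Q fs) = (\<Sum>c\<le>k. dist_pull (P c) u (fs c))" if t: "!!c. fs c : test_fun" for fs
  unfolding P(2)[OF t] using u C_distr distr_sum[of u "{..k}" "%c. P c (fs c)"] goodD(1)[OF P(1) t]
  by (auto simp: dist_pull_def t)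
 then show ?thesis unfolding mfun_def
  by (intro exI[of _ "%c. dist_pull (P c) u"]) (simp add: goodD(4)[OF P(1) u])
qed

text \<open>The section whose coefficient at the monomial with exponents \<open>a\<close> and
  \<open>k - a\<close> is \<open>fs a\<close>; every test section of \<open>V0 k\<close> arises in
  this way.\<close>

definition mk :: "(nat => 'n pt => complex) => 'n pt => 'n vec_el" where
 "mk fs p r a b I = (if r = 0 & a + b = k & I = {} then fs a p else 0)"

definition msec :: "((nat => 'n pt => complex) => 'n pt => 'n spform) => bool" where
 "msec s \<longleftrightarrow> (ALL a b I. mop (%fs p. s fs p a b I))"

lemma msec_mk: "msec (%fs p. mk fs p 0)"
 unfolding msec_def mk_def
proof (intro allI)
 fix a b and I :: "('n * 2) set"
 show "mop (%fs p. if 0 = 0 & a + b = k & I = {} then fs a p else 0)"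
  using mop_proj[of a] mop_zero by (cases "a + b = k"; cases "I = {}"; simp)
qed

lemma msec_lift: "good P ==> msec s ==> msec (%fs. lift_op P (s fs))"
proof -
 assume P: "good P" and "msec s"
 then have "mop (%fs p. s fs p a b I)" for a b I by (simp add: msec_def)
 from mop_good[OF P this] show ?thesis by (simp add: msec_def lift_op_def)
qed

lemma msec_ds: "msec s ==> msec (%fs. ds A' (s fs))"
proof -
 assume "msec s"
 then have m: "mop (%fs p. s fs p a b I)" for a b I by (simp add: msec_def)
 show ?thesis unfolding msec_def ds_def by (intro allI mop_if mop_cmult[OF m])
qed

lemma dd_expand: "dd S A' f p a b K = (\<Sum>A\<in>K. wsign {A} (K - {A}) * Z_op S A A' (%q. f q a b (K - {A})) p)"
 unfolding dd_def wedge_omega lift_op_def by (simp add: sum.If_cases)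

lemma msec_dd: "msec s ==> msec (%fs. dd S A' (s fs))"
proof -
 assume "msec s"
 then have m: "mop (%fs p. s fs p a b I)" for a b I by (simp add: msec_def)
 show ?thesis unfolding msec_def dd_expand
  by (intro allI mop_sum[OF finite] mop_cmult[OF mop_good[OF good_Z_op m]])
qed

lemma mop_D0: "mop (%fs p. D0 S k (mk fs) p r a b I)"
proof -
 have m: "mop (%fs p. s fs p a b I)" if "msec s" for s using that by (simp add: msec_def)
 have neg: "mop (%fs p. - Q fs p)" if "mop Q" for Q using mop_cmult[OF that, of "-1"] by simp
 have 1: "mop (%fs p. \<Sum>A'\<in>UNIV. ds A' (dd S A' (%q. mk fs q 0)) p a b I)"
  by (rule mop_sum[OF finite]) (rule m[OF msec_ds[OF msec_dd[OF msec_mk]]])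
 have 2: "mop (%fs p. - (\<Sum>A'\<in>UNIV. \<Sum>B'\<in>UNIV. ds A' (ds B' (lift_op (T_up A' B') (%q. mk fs q 0))) p a b I))"
  by (rule neg, rule mop_sum[OF finite], rule mop_sum[OF finite]) (rule m[OF msec_ds[OF msec_ds[OF msec_lift[OF good_T_up msec_mk]]]])
 have 3: "mop (%fs p. - (\<Sum>A'\<in>UNIV. \<Sum>B'\<in>UNIV. ds A' (dd S B' (lift_op (T_mix B' A') (%q. mk fs q 0))) p a b I))"
  by (rule neg, rule mop_sum[OF finite], rule mop_sum[OF finite]) (rule m[OF msec_ds[OF msec_dd[OF msec_lift[OF good_T_mix msec_mk]]]])
 have 4: "mop (%fs p. dd S 0 (dd S 1 (%q. mk fs q 0)) p a b I)"
  by (rule m[OF msec_dd[OF msec_dd[OF msec_mk]]])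
 show ?thesis
  unfolding D0_def Let_def by (intro mop_if 1 2 3 4 mop_zero)
qed

lemma mfun_pair:
 assumes F: "!!r a b I. F r a b I : Cc"
 shows "mfun (%fs. pair_dist vs F (D0 S k (mk fs)))"
proof -
 have w: "mfun (%fs. wedge_by (%u ph. u ph) (F r a b) (%I p. D0 S k (mk fs) p r a b I) UNIV)" for r a b
  unfolding wedge_by_def by (rule mfun_sum[OF finite]) (rule mfun_cmult[OF mfun_mop[OF F mop_D0]])
 have d: "mfun (%fs. P fs / c)" if "mfun P" for P c
  using mfun_cmult[OF that, of "inverse c"] by (simp add: divide_inverse mult.commute)
 show ?thesis
  unfolding pair_dist_def contract_def Let_def
  by (rule mfun_sum[OF finite_lessThan]) (rule mfun_sum[OF finite_atMost], rule d[OF w])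
qed

definition sec :: "shape => 'n dist_el set" where
 "sec vs = {u. ALL r a b I. u r a b I : Cc & (\<not> in_shape vs r a b I --> u r a b I = (%ph. 0))}"

end

section \<open>Existence and uniqueness of the transpose\<close>

context fclass
begin

lemma full_card: "card I = CARD('n * 2) \<longleftrightarrow> I = UNIV" for I :: "('n * 2) set"
 using card_subset_eq[of UNIV I] by auto

lemma in_shape_hat0: "in_shape (hat CARD('n * 2) (V0 k)) r a b (I :: ('n * 2) set) \<longleftrightarrow> r = 0 & a + b = k & I = UNIV"
 using full_card[of I] by (auto simp: in_shape_def hat_def V0_def)

lemma pair_V0:
 fixes G :: "'n dist_el"
 assumes z: "!!r a b I. \<not> in_shape (hat CARD('n * 2) (V0 k)) r a b I ==> G r a b I = (%ph. 0)"
 shows "pair_dist (V0 k) G f = (\<Sum>a\<le>k. G 0 a (k - a) UNIV (%p. f p 0 a (k - a) {}) / of_nat (k choose a))"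
proof -
 have "wedge_by (%u ph. u ph) (G 0 a (k - a)) (%I p. f p 0 a (k - a) I) UNIV = G 0 a (k - a) UNIV (%p. f p 0 a (k - a) {})" for a
 proof -
  have "wedge_by (%u ph. u ph) (G 0 a (k - a)) (%I p. f p 0 a (k - a) I) UNIV
    = (\<Sum>I\<in>Pow (UNIV :: ('n * 2) set). if I = UNIV then G 0 a (k - a) UNIV (%p. f p 0 a (k - a) {}) else 0)"
   unfolding wedge_by_def
  proof (rule sum.cong[OF refl])
   fix I :: "('n * 2) set"
   show "wsign I (UNIV - I) * G 0 a (k - a) I (%p. f p 0 a (k - a) (UNIV - I))
     = (if I = UNIV then G 0 a (k - a) UNIV (%p. f p 0 a (k - a) {}) else 0)"
    using z[of 0 a "k - a" I, unfolded in_shape_hat0] by (cases "I = UNIV") (simp_all add: wsign_single)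
  qed
  then show ?thesis by simp
 qed
 then show ?thesis by (simp add: pair_dist_def contract_def V0_def Let_def)
qed

lemma in_shape_V0: "in_shape (V0 k) r a b (I :: ('n * 2) set) \<longleftrightarrow> r = 0 & a + b = k & I = {}"
proof -
 have "card I = 0 \<longleftrightarrow> I = {}" by simp
 then show ?thesis by (auto simp: in_shape_def V0_def)
qed

lemma test_sec_mk:
 assumes "f : test_sec (V0 k)"
 obtains fs where "!!c. fs c : test_fun" "f = mk fs"
proof -
 define fs where "fs c = (%p. f p 0 c (k - c) {})" for c
 let ?K = "closure {p. EX r a b I. f p r a b I ~= 0}"
 have f: "!!p. f p : vspace (V0 k)" "!!r a b I. smooth (%p. f p r a b I)" "compact ?K"
 proof -
  have "f : smooth_sec (V0 k)" "compact ?K" using assms unfolding test_sec_def by blast+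
  then show "!!p. f p : vspace (V0 k)" "!!r a b I. smooth (%p. f p r a b I)" "compact ?K"
   unfolding smooth_sec_def by blast+
 qed
 have "fs c : test_fun" for c
 proof (rule test_funI[OF _ f(3)])
  show "smo (fs c)" using f(2) unfolding smooth_iff fs_def .
  show "fs c p = 0" if "p ~: ?K" for p
   using that closure_subset[of "{p. EX r a b I. f p r a b I ~= 0}"] unfolding fs_def by blast
 qed
 moreover have "f = mk fs"
 proof (intro ext)
  fix p r a b I
  show "f p r a b I = mk fs p r a b I"
  proof (cases "in_shape (V0 k) r a b I")
   case True
   then show ?thesis unfolding in_shape_V0 mk_def fs_def by auto
  next
   case False
   moreover have "f p r a b I = 0" using f(1)[of p] False unfolding vspace_def by blast
   ultimately show ?thesis unfolding in_shape_V0 mk_def by (simp only: if_False)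
  qed
 qed
 ultimately show thesis by (rule that)
qed

lemma mk_test_sec:
 assumes fs: "!!c. fs c : test_fun"
 shows "mk fs : test_sec (V0 k)"
proof -
 have "EX K. compact K & (ALL p. p ~: K --> fs c p = 0)" for c using test_funE[OF fs] by metis
 then obtain K where K: "!!c. compact (K c)" "!!c p. p ~: K c ==> fs c p = 0" by metis
 have cK: "compact (\<Union>c\<le>k. K c)" by (intro compact_UN) (use K in auto)
 have "{p. EX r a b I. mk fs p r a b I ~= 0} <= (\<Union>c\<le>k. K c)"
 proof
  fix p assume "p : {p. EX r a b I. mk fs p r a b I ~= 0}"
  then obtain r a b I where "mk fs p r a b I ~= 0" by blast
  then have "a <= k" "fs a p ~= 0" by (auto simp: mk_def split: if_splits)
  then show "p : (\<Union>c\<le>k. K c)" using K(2)[of p a] by auto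
 qed
 then have c: "compact (closure {p. EX r a b I. mk fs p r a b I ~= 0})"
  unfolding compact_closure by (rule bounded_subset[OF compact_imp_bounded[OF cK]])
 have "smooth (%p. mk fs p r a b I)" for r a b I
 proof -
  have "smo (%p. if c then fs a p else 0)" for c
   using test_funD[OF fs, of a] by (cases c) (simp_all add: smooth_on_const)
  then show ?thesis unfolding smooth_iff mk_def .
 qed
 moreover have "mk fs p : vspace (V0 k)" for p unfolding vspace_def in_shape_V0 mk_def by simp
 ultimately show ?thesis using c by (simp add: test_sec_def smooth_sec_def)
qed

lemma secD: "u : sec vs ==> u r a b I : Cc" "u : sec vs ==> \<not> in_shape vs r a b I ==> u r a b I = (%ph. 0)"
 by (auto simp: sec_def)

lemma pair_mk:
 assumes "G : sec (hat CARD('n * 2) (V0 k))"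
 shows "pair_dist (V0 k) G (mk fs) = (\<Sum>a\<le>k. G 0 a (k - a) UNIV (fs a) / of_nat (k choose a))"
proof -
 have "pair_dist (V0 k) G (mk fs) = (\<Sum>a\<le>k. G 0 a (k - a) UNIV (%p. mk fs p 0 a (k - a) {}) / of_nat (k choose a))"
  by (rule pair_V0[OF secD(2)[OF assms]])
 then show ?thesis by (simp add: mk_def)
qed

lemma transpose_exists:
 assumes F: "F : sec vs"
 shows "EX G:sec (hat CARD('n * 2) (V0 k)). ALL f:test_sec (V0 k). pair_dist (V0 k) G f = pair_dist ws F (D0 S k f)"
proof -
 have "mfun (%fs. pair_dist ws F (D0 S k (mk fs)))" by (rule mfun_pair[OF secD(1)[OF F]])
 then obtain u where u: "!!c. u c : Cc" "!!fs. (!!c. fs c : test_fun) ==> pair_dist ws F (D0 S k (mk fs)) = (\<Sum>c\<le>k. u c (fs c))"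
  unfolding mfun_def by blast
 \<comment> \<open>The binomial coefficient undoes the division in \<open>contract\<close>.\<close>
 define G where "G r a b I = (if r = 0 & a + b = k & I = UNIV then (%ph. of_nat (k choose a) * u a ph) else (%ph. 0))"
  for r a b :: nat and I :: "('n * 2) set"
 have G: "G : sec (hat CARD('n * 2) (V0 k))"
  unfolding sec_def mem_Collect_eq in_shape_hat0 G_def using C_zero C_cmult[OF u(1)] by auto
 moreover have "pair_dist (V0 k) G f = pair_dist ws F (D0 S k f)" if f: "f : test_sec (V0 k)" for f
 proof -
  obtain fs where fs: "!!c. fs c : test_fun" "f = mk fs" using test_sec_mk[OF f] by blast
  have "pair_dist (V0 k) G f = (\<Sum>a\<le>k. u a (fs a))"
   unfolding fs(2) pair_mk[OF G] by (rule sum.cong) (auto simp: G_def)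
  then show ?thesis using u(2)[OF fs(1)] fs(2) by simp
 qed
 ultimately show ?thesis by blast
qed

text \<open>Sections with a single nonzero coefficient detect each component; off the test functions
  all distributions are 0 by convention.\<close>

lemma transpose_unique:
 assumes G: "G : sec (hat CARD('n * 2) (V0 k))" and G': "G' : sec (hat CARD('n * 2) (V0 k))"
  and eq: "!!f. f : test_sec (V0 k) ==> pair_dist (V0 k) G f = pair_dist (V0 k) G' f"
 shows "G = G'"
proof (intro ext)
 fix r a b :: nat and I :: "('n * 2) set" and ph :: "'n pt => complex"
 show "G r a b I ph = G' r a b I ph"
 proof (cases "in_shape (hat CARD('n * 2) (V0 k)) r a b I & ph : test_fun")
  case True
  then have i: "r = 0" "a + b = k" "I = UNIV" and ph: "ph : test_fun" unfolding in_shape_hat0 by blast+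
  define fs where "fs c = (if c = a then ph else (%p. 0))" for c
  have fs: "fs c : test_fun" for c using ph test_fun_zero unfolding fs_def by (cases "c = a") simp_all
  have "pair_dist (V0 k) H (mk fs) = H 0 a b UNIV ph / of_nat (k choose a)" if H: "H : sec (hat CARD('n * 2) (V0 k))" for H
  proof -
   have z: "H 0 c (k - c) UNIV (%p. 0) = 0" for c
   proof -
    have "H 0 c (k - c) UNIV : distr" using secD(1)[OF H] C_distr by blast
    from distrD(2)[OF this test_fun_zero, of 0] show ?thesis by simp
   qed
   have "pair_dist (V0 k) H (mk fs) = (\<Sum>c\<le>k. if c = a then H 0 a b UNIV ph / of_nat (k choose a) else 0)"
    unfolding pair_mk[OF H] by (rule sum.cong) (use i z in "auto simp: fs_def")
   then show ?thesis using i by simp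
  qed
  from this[OF G] this[OF G'] eq[OF mk_test_sec[OF fs]] i show ?thesis by simp
 next
  case False
  have z: "G r a b I ph = 0" if "G : sec (hat CARD('n * 2) (V0 k))" for G
   using False secD(2)[OF that] distrD(3)[of "G r a b I" ph] secD(1)[OF that] C_distr by (metis subsetD)
  show ?thesis by (simp only: z[OF G] z[OF G'])
 qed
qed

end

section \<open>The solution of the transposed equation\<close>

lemma sum_UNIV2: "(\<Sum>i\<in>UNIV. g i) = g 0 + g (1 :: 2)"
proof -
 have "g (2 :: 2) = g 0" by (rule arg_cong[of _ _ g]) simp
 then show ?thesis by (simp add: sum_2 add.commute)
qed

text \<open>The analysis enters through \<open>solv\<close> alone, solvability along finitely many
  lines within the class \<open>Cc\<close>; the rest is algebra with \<open>EE\<close>.\<close>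

locale fsolve = fclass S k Cc for S :: "real^('n::{finite,linorder} \<times> 4)^('n * 4)" and k Cc +
 fixes vs :: "(real^('n * 4)) list"
 assumes S: "transpose S = S" and rt: "right_type S"
  and solv: "G : Cc ==> EX us. (ALL i. us i : Cc) \<and>
   (ALL ph:test_fun. G ph = (\<Sum>i<length vs. us i (line.LM (Bv S) (Ev (vs ! i)) ph)))"
begin

lemma EE_pull:
 fixes v :: "real^('n * 4)"
 assumes u: "u : Cc" and ph: "ph : test_fun"
 defines "Q B' A' \<equiv> (\<Sum>A\<in>UNIV. \<Sum>B\<in>UNIV. EE v A B * u (Z_op S B B' (Z_op S A A' ph)))"
 shows "Q 1 0 = u (line.LM (Bv S) (Ev v) ph)" "Q 0 1 = - u (line.LM (Bv S) (Ev v) ph)" "Q 0 0 = 0" "Q 1 1 = 0"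
proof -
 have ud: "u : distr" using u C_distr by blast
 have t: "Z_op S B B' (Z_op S A A' ph) : test_fun" for A B A' B' by (intro goodD(1)[OF good_Z_op] ph)
 have "Q B' A' = u (%p. \<Sum>A\<in>UNIV. \<Sum>B\<in>UNIV. EE v A B * Z_op S B B' (Z_op S A A' ph) p)" for A' B'
 proof -
  have "u (%p. \<Sum>A\<in>UNIV. \<Sum>B\<in>UNIV. EE v A B * Z_op S B B' (Z_op S A A' ph) p)
    = (\<Sum>A\<in>UNIV. u (%p. \<Sum>B\<in>UNIV. EE v A B * Z_op S B B' (Z_op S A A' ph) p))"
   by (rule distr_sum[OF ud]) (intro test_fun_sum test_fun_cmult t)
  also have "... = (\<Sum>A\<in>UNIV. \<Sum>B\<in>UNIV. u (%p. EE v A B * Z_op S B B' (Z_op S A A' ph) p))"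
   by (rule sum.cong[OF refl], rule distr_sum[OF ud]) (intro test_fun_cmult t)
  finally show ?thesis unfolding Q_def distrD(2)[OF ud t] by simp
 qed
 note e = this EE_Z_Z[OF S rt test_funD[OF ph], of v]
 have L: "line.LM (Bv S) (Ev v) ph : test_fun"
  using test_contD(1)[OF line.test_cont_LM[OF line_v[OF S rt]] ph] .
 have "u (%p. - line.LM (Bv S) (Ev v) ph p) = - u (line.LM (Bv S) (Ev v) ph)" "u (%p. 0) = 0"
  using distrD(2)[OF ud L, of "-1"] distrD(2)[OF ud L, of 0] by simp_all
 then show "Q 1 0 = u (line.LM (Bv S) (Ev v) ph)" "Q 0 1 = - u (line.LM (Bv S) (Ev v) ph)" "Q 0 0 = 0" "Q 1 1 = 0"
  unfolding e by simp_all
qed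

lemma wsign_nonzero: "wsign I J ~= 0"
 by (simp add: wsign_def)

text \<open>The first summand of the dual of \<open>V1 k\<close> is enough. Its component
  \<open>a\<close> meets \<open>fs a\<close> through the primed index 1 and
  \<open>fs (a + 1)\<close> through 0. By \<open>EE_pull\<close> a term built with one primed index
  is seen only by the other, so \<open>U\<close> serves the coefficients below \<open>k\<close>
  through 1, and \<open>V\<close> serves the coefficient \<open>k\<close> through 0 in the component
  \<open>k - 1\<close>.\<close>

lemma surj_pos:
 assumes k: "k >= 1" and G: "G : sec (hat CARD('n * 2) (V0 k))"
 shows "EX F:sec (hat CARD('n * 2) (V1 k)). ALL f:test_sec (V0 k). pair_dist (V0 k) G f = pair_dist (V1 k) F (D0 S k f)"
proof -
 define L where "L i = line.LM (Bv S) (Ev (vs ! i))" for i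
 have "EX us. (ALL i. us i : Cc) & (ALL ph:test_fun. G 0 a (k - a) UNIV ph = (\<Sum>i<length vs. us i (L i ph)))" for a
  unfolding L_def by (rule solv[OF secD(1)[OF G]])
 then have "EX w. ALL a. (ALL i. w a i : Cc) & (ALL ph:test_fun. G 0 a (k - a) UNIV ph = (\<Sum>i<length vs. w a i (L i ph)))"
  by (intro choice allI)
 then obtain w where w: "!!a i. w a i : Cc" "!!a ph. ph : test_fun ==> G 0 a (k - a) UNIV ph = (\<Sum>i<length vs. w a i (L i ph))"
  by blast
 \<comment> \<open>The sign is that of \<open>Q 0 1\<close> in \<open>EE_pull\<close>; the factor
   \<open>1 / k\<close> balances the binomial weights of the two symmetric powers, see
   \<open>bin\<close>.\<close>
 define U where "U a i = (if a < k then (%ph. - inverse (of_nat k) * w a i ph) else (%ph. 0))" for a i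
 define V where "V a i = (if a = k - 1 then (%ph. inverse (of_nat k) * w k i ph) else (%ph. 0))" for a i
 have U: "U a i : Cc" and V: "V a i : Cc" for a i
  unfolding U_def V_def by (intro C_if C_zero C_cmult w)+
 define H where "H a A = (%ph. \<Sum>i<length vs. \<Sum>B\<in>UNIV. EE (vs ! i) A B * (dist_pull (Z_op S B 0) (U a i) ph + dist_pull (Z_op S B 1) (V a i) ph))" for a A
 have H: "H a A : Cc" for a A
  unfolding H_def by (intro C_sum finite_lessThan finite C_cmult C_add goodD(4)[OF good_Z_op] U V)
 have HZ: "(\<Sum>A\<in>UNIV. H a A (Z_op S A A' ph))
   = (\<Sum>i<length vs. (\<Sum>A\<in>UNIV. \<Sum>B\<in>UNIV. EE (vs ! i) A B * U a i (Z_op S B 0 (Z_op S A A' ph)))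
     + (\<Sum>A\<in>UNIV. \<Sum>B\<in>UNIV. EE (vs ! i) A B * V a i (Z_op S B 1 (Z_op S A A' ph))))" if ph: "ph : test_fun" for a A' ph
  unfolding H_def using goodD(1)[OF good_Z_op ph]
  by (subst sum.swap) (simp add: dist_pull_def distrib_left sum.distrib)
 have H0: "(\<Sum>A\<in>UNIV. H a A (Z_op S A 0 ph)) = (if a = k - 1 then inverse (of_nat k) * G 0 k 0 UNIV ph else 0)"
  and H1: "a < k ==> (\<Sum>A\<in>UNIV. H a A (Z_op S A 1 ph)) = inverse (of_nat k) * G 0 a (k - a) UNIV ph" if ph: "ph : test_fun" for a ph
  unfolding HZ[OF ph] EE_pull[OF U ph] EE_pull[OF V ph] L_def[symmetric]
  using w(2)[OF ph, of k] w(2)[OF ph, of a] by (simp_all add: U_def V_def sum_distrib_left)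
 \<comment> \<open>Dividing by the sign lets the wedge product with the component at
   \<open>{A}\<close> return \<open>H a A\<close> itself.\<close>
 define F where "F r a b I = (if r = 0 & a + b = k - 1 then (%ph. \<Sum>A\<in>UNIV. (if I = - {A} then inverse (wsign (- {A}) {A}) else 0) * H a A ph) else (%ph. 0))"
  for r a b :: nat and I :: "('n * 2) set"
 have V1: "V1 k = (k - 1, 1) # (if k >= 2 then [(k - 2, 0)] else [(0, 1)])" using k by (auto simp: V1_def)
 have F: "F : sec (hat CARD('n * 2) (V1 k))"
  unfolding sec_def mem_Collect_eq
 proof (intro allI conjI impI)
  fix r a b :: nat and I :: "('n * 2) set"
  show "F r a b I : Cc" unfolding F_def using C_zero C_sum[OF finite[of UNIV] C_cmult[OF H]] by auto
  assume n: "\<not> in_shape (hat CARD('n * 2) (V1 k)) r a b I"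
  show "F r a b I = (%ph. 0)"
  proof (cases "r = 0 & a + b = k - 1")
   case True
   then have "card I ~= CARD('n * 2) - 1" using n unfolding V1 by (auto simp: in_shape_def hat_def)
   moreover have "card (- {A}) = CARD('n * 2) - 1" for A :: "'n * 2" by (simp add: Compl_eq_Diff_UNIV card_Diff_singleton)
   ultimately have "I ~= - {A}" for A by metis
   then show ?thesis by (simp add: F_def)
  qed (auto simp: F_def)
 qed
 moreover have "pair_dist (V0 k) G f = pair_dist (V1 k) F (D0 S k f)" if f: "f : test_sec (V0 k)" for f
 proof -
  obtain fs where fs: "!!c. fs c : test_fun" "f = mk fs" using test_sec_mk[OF f] by blast
  let ?D = "%a I p. D0 S k f p 0 a (k - 1 - a) I" and ?g = "%a. G 0 a (k - a) UNIV (fs a)"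
  let ?W = "%a. wedge_by (%u ph. u ph) (F 0 a (k - 1 - a)) (?D a) UNIV" and ?Z = "%a. if a = k - 1 then G 0 k 0 UNIV (fs k) else 0"
  let ?X = "%a. if a = k - 1 then inverse (of_nat k) * G 0 k 0 UNIV (fs (a + 1)) else 0"
  let ?Y = "%a. of_nat (a + 1) * ?X a + of_nat (k - a) * (inverse (of_nat k) * ?g a)"
  have D0: "(?D a {A}) = (%p. of_nat (a + 1) * Z_op S A 0 (fs (a + 1)) p + of_nat (k - a) * Z_op S A 1 (fs a) p)"
   if a: "a < k" for a A
  proof -
   have "D0 S k f p 0 a b {A} = (\<Sum>A'\<in>UNIV. ds A' (dd S A' (%q. mk fs q 0)) p a b {A})" for p b
    using k fs(2) by (auto simp: D0_def Let_def)
   also have "(\<Sum>A'\<in>UNIV. ds A' (dd S A' (%q. mk fs q 0)) p a (k - 1 - a) {A})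
     = of_nat (a + 1) * Z_op S A 0 (%q. mk fs q 0 (a + 1) (k - 1 - a) {}) p + of_nat (k - 1 - a + 1) * Z_op S A 1 (%q. mk fs q 0 a (k - 1 - a + 1) {}) p" for p
    by (simp add: sum_UNIV2 ds_def dd_expand wsign_single)
   finally show ?thesis using a by (simp add: mk_def)
  qed
  have Hd: "H a A : distr" for a A using H C_distr by blast
  have HD: "H a A (?D a {A}) = of_nat (a + 1) * H a A (Z_op S A 0 (fs (a + 1))) + of_nat (k - a) * H a A (Z_op S A 1 (fs a))" if a: "a < k" for a A
   unfolding D0[OF a]
   by (subst distrD(1)[OF Hd]) (simp_all add: distrD(2)[OF Hd] goodD(1)[OF good_Z_op fs(1)] test_fun_cmult)
  have wd: "?W a = (\<Sum>A\<in>UNIV. H a A (?D a {A}))" if a: "a < k" for a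
  proof -
   have "wsign I (UNIV - I) * F 0 a (k - 1 - a) I (?D a (UNIV - I))
     = (\<Sum>A\<in>UNIV. if I = - {A} then H a A (?D a {A}) else 0)" for I
    using a wsign_nonzero unfolding F_def sum_distrib_left
    by (simp add: sum_distrib_left) (rule sum.cong, auto simp: Compl_eq_Diff_UNIV[symmetric] right_inverse[OF wsign_nonzero])
   then show ?thesis unfolding wedge_by_def by (simp add: sum.swap[of _ UNIV])
  qed
  have bin: "of_nat (k - a) / of_nat ((k - 1) choose a) * inverse (of_nat k) = (1 / of_nat (k choose a) :: complex)" if a: "a < k" for a
  proof -
   have "(k - a) * (k choose a) = k * ((k - 1) choose a)" by (rule binomial_absorb_comp)
   then have "of_nat (k - a) * of_nat (k choose a) = (of_nat k * of_nat ((k - 1) choose a) :: complex)" by (metis of_nat_mult)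
   moreover have "(k choose a) ~= 0" "((k - 1) choose a) ~= 0" using a by auto
   ultimately show ?thesis using k by (simp add: field_simps)
  qed
  have "pair_dist (V1 k) F (D0 S k f) = (\<Sum>a\<le>k - 1. ?W a / of_nat ((k - 1) choose a))"
  proof -
   have z: "wedge_by (%u ph. u ph) (F 1 a b) g UNIV = 0" for a b and g :: "('n * 2) set => 'n pt => complex"
    by (simp add: wedge_by_def F_def)
   have l: "{..<length (V1 k)} = {0, 1}" by (auto simp: V1)
   show ?thesis unfolding pair_dist_def contract_def Let_def l using z by (simp add: V1)
  qed
  also have "... = (\<Sum>a\<in>{..<k}. ?Y a / of_nat ((k - 1) choose a))"
  proof (rule sum.cong)
   show "{..k - 1} = {..<k}" using k by auto
   fix a assume "a : {..<k}"
   then have a: "a < k" by simp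
   show "?W a / of_nat ((k - 1) choose a)
    = ?Y a / of_nat ((k - 1) choose a)"
    unfolding wd[OF a] HD[OF a] sum.distrib sum_distrib_left[symmetric] H0[OF fs(1)] H1[OF fs(1) a] ..
  qed
  also have "... = (\<Sum>a<k. ?Z a + ?g a / of_nat (k choose a))"
  proof (rule sum.cong[OF refl])
   fix a assume "a : {..<k}"
   then have a: "a < k" by simp
   have "of_nat (k - a) * (inverse (of_nat k) * ?g a) / of_nat ((k - 1) choose a) = ?g a / of_nat (k choose a)"
    using arg_cong[OF bin[OF a], of "%z. z * ?g a"] by (simp add: mult.assoc)
   moreover have "of_nat (a + 1) * ?X a / of_nat ((k - 1) choose a)
     = ?Z a"
   proof (cases "a = k - 1")
    case True
    then have "a + 1 = k" "(k - 1) choose a = 1" using k by auto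
    then show ?thesis using k True by simp
   qed simp
   ultimately show "?Y a / of_nat ((k - 1) choose a)
    = ?Z a + ?g a / of_nat (k choose a)"
    by (simp only: add_divide_distrib)
  qed
  also have "... = (\<Sum>a\<le>k. ?g a / of_nat (k choose a))"
   using k by (simp add: sum.distrib lessThan_Suc_atMost[symmetric])
  also have "... = pair_dist (V0 k) G f" unfolding fs(2) pair_mk[OF G] ..
  finally show ?thesis ..
 qed
 ultimately show ?thesis by blast
qed

text \<open>With no symmetric index to contract, the second-order operator is paired directly with
  \<open>EE\<close>, whose antisymmetry matches that of a 2-form.\<close>

lemma surj_zero:
 assumes k: "k = 0" and G: "G : sec (hat CARD('n * 2) (V0 k))"
 shows "EX F:sec (hat CARD('n * 2) (V1 k)). ALL f:test_sec (V0 k). pair_dist (V0 k) G f = pair_dist (V1 k) F (D0 S k f)"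
proof -
 define L where "L i = line.LM (Bv S) (Ev (vs ! i))" for i
 have "EX us. (ALL i. us i : Cc) & (ALL ph:test_fun. G 0 0 0 UNIV ph = (\<Sum>i<length vs. us i (L i ph)))"
  unfolding L_def by (rule solv[OF secD(1)[OF G]])
 then obtain w where w: "!!i. w i : Cc" "!!ph. ph : test_fun ==> G 0 0 0 UNIV ph = (\<Sum>i<length vs. w i (L i ph))"
  by blast
 have wd: "w i : distr" for i using w(1) C_distr by blast
 define H where "H A B = (%ph. \<Sum>i<length vs. wsign {A} {B} / 2 * EE (vs ! i) A B * w i ph)" for A B
 have H: "H A B : Cc" for A B unfolding H_def by (intro C_sum finite_lessThan C_cmult w)
 define c where "c I A B = (if A ~= B & I = - {A, B} then inverse (wsign (- {A, B}) {A, B}) else 0)" for I and A B :: "'n * 2"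
  text \<open>Both orders of a pair contribute to the component at \<open>- {A, B}\<close>, whence the factor \<open>1 / 2\<close>.\<close>
 define F where "F r a b I = (if r = 0 & a + b = 0 then (%ph. \<Sum>A\<in>UNIV. \<Sum>B\<in>UNIV.
   c I A B * H A B ph) else (%ph. 0))"
  for r a b :: nat and I :: "('n * 2) set"
 have V1: "V1 k = [(0, 2)]" using k by (simp add: V1_def)
 have F: "F : sec (hat CARD('n * 2) (V1 k))"
  unfolding sec_def mem_Collect_eq
 proof (intro allI conjI impI)
  fix r a b :: nat and I :: "('n * 2) set"
  show "F r a b I : Cc" unfolding F_def by (intro C_if C_zero C_sum finite C_cmult H)
  assume n: "\<not> in_shape (hat CARD('n * 2) (V1 k)) r a b I"
  show "F r a b I = (%ph. 0)"
  proof (cases "r = 0 & a + b = 0")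
   case True
   then have "card I ~= CARD('n * 2) - 2" using n unfolding V1 by (auto simp: in_shape_def hat_def)
   moreover have "card (- {A, B}) = CARD('n * 2) - 2" if "A ~= B" for A B :: "'n * 2"
    using that card_Diff_subset[of "{A, B}" UNIV] by (simp add: Compl_eq_Diff_UNIV)
   ultimately have "\<not> (A ~= B & I = - {A, B})" for A B by metis
   then have "c I A B = 0" for A B by (simp only: c_def if_False)
   then show ?thesis by (simp add: F_def c_def)
  qed (auto simp: F_def)
 qed
 moreover have "pair_dist (V0 k) G f = pair_dist (V1 k) F (D0 S k f)" if f: "f : test_sec (V0 k)" for f
 proof -
  obtain fs where fs: "!!c. fs c : test_fun" "f = mk fs" using test_sec_mk[OF f] by blast
  let ?ph = "fs 0" and ?D = "%I p. D0 S k f p 0 0 0 I"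
  let ?P = "%A B i. EE (vs ! i) A B * w i (Z_op S A 0 (Z_op S B 1 ?ph))"
   and ?Q = "%A B i. EE (vs ! i) A B * w i (Z_op S B 0 (Z_op S A 1 ?ph))"
  let ?R = "%A B i. 1 / 2 * ?P A B i - 1 / 2 * ?Q A B i" and ?H = "%A B. if A ~= B then H A B (?D {A, B}) else 0"
  let ?SP = "%i. \<Sum>A\<in>UNIV. \<Sum>B\<in>UNIV. ?P A B i" and ?SQ = "%i. \<Sum>A\<in>UNIV. \<Sum>B\<in>UNIV. ?Q A B i"
  have ph: "?ph : test_fun" by (rule fs(1))
  have t: "Z_op S A A' (Z_op S B B' ?ph) : test_fun" for A A' B B' by (intro goodD(1)[OF good_Z_op] ph)
  have mk0: "(%q. mk fs q 0 0 0 {}) = fs 0" unfolding mk_def by (simp add: k)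
  have D0: "?D {A, B} = (%p. wsign {A} {B} * Z_op S A 0 (Z_op S B 1 ?ph) p + wsign {B} {A} * Z_op S B 0 (Z_op S A 1 ?ph) p)"
   if AB: "A ~= B" for A B
  proof -
   have s: "{A, B} - {A} = {B}" "{A, B} - {B} = {A}" using AB by auto
   have i: "dd S 1 (%q. mk fs q 0) q 0 0 {C} = Z_op S C 1 ?ph q" for C q
    by (simp add: dd_expand wsign_single mk0)
   have "D0 S k f p 0 0 0 {A, B} = dd S 0 (dd S 1 (%q. mk fs q 0)) p 0 0 {A, B}" for p
    using k fs(2) by (simp add: D0_def Let_def)
   also have "dd S 0 (dd S 1 (%q. mk fs q 0)) p 0 0 {A, B} = wsign {A} {B} * Z_op S A 0 (Z_op S B 1 ?ph) p + wsign {B} {A} * Z_op S B 0 (Z_op S A 1 ?ph) p" for p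
    unfolding dd_expand[of 0] using AB by (simp add: s i)
   finally show ?thesis by blast
  qed
  have sq: "wsign {A} {B} * wsign {A} {B} = 1" for A B :: "'n * 2" by (simp add: wsign_def power_add[symmetric] mult_2[symmetric])
  have HD: "?H A B = (\<Sum>i<length vs. ?R A B i)" for A B
  proof (cases "A = B")
   case False
   have "w i (?D {A, B}) = wsign {A} {B} * w i (Z_op S A 0 (Z_op S B 1 ?ph)) - wsign {A} {B} * w i (Z_op S B 0 (Z_op S A 1 ?ph))" for i
    unfolding D0[OF False] distrD(1)[OF wd test_fun_cmult[OF t] test_fun_cmult[OF t]] distrD(2)[OF wd t] wsign_single(1)[OF False]
    by simp
   then have "H A B (?D {A, B}) = (\<Sum>i<length vs. (wsign {A} {B} * wsign {A} {B}) * (?R A B i))"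
    unfolding H_def by (simp only:) (simp add: algebra_simps)
   then show ?thesis using False unfolding sq by simp
  qed (simp add: EE_def)
  have "pair_dist (V1 k) F (D0 S k f) = (\<Sum>I\<in>UNIV. wsign I (UNIV - I) * F 0 0 0 I (?D (UNIV - I)))"
   by (simp add: pair_dist_def contract_def V1 Let_def wedge_by_def)
  also have "... = (\<Sum>I\<in>UNIV. \<Sum>A\<in>UNIV. \<Sum>B\<in>UNIV. if I = - {A, B} then ?H A B else 0)"
  proof (rule sum.cong[OF refl])
   fix I :: "('n * 2) set"
   have e: "wsign I (UNIV - I) * (c I A B * H A B (?D (UNIV - I)))
     = (if I = - {A, B} then ?H A B else 0)" for A B
   proof (cases "A ~= B & I = - {A, B}")
    case True
    then have "I = - {A, B}" "UNIV - I = {A, B}" "A ~= B" by auto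
    then show ?thesis using wsign_nonzero[of "- {A, B}" "{A, B}"] by (simp add: c_def)
   qed (auto simp: c_def)
   show "wsign I (UNIV - I) * F 0 0 0 I (?D (UNIV - I))
     = (\<Sum>A\<in>UNIV. \<Sum>B\<in>UNIV. if I = - {A, B} then ?H A B else 0)"
    unfolding F_def using e by (simp add: sum_distrib_left)
  qed
  also have "... = (\<Sum>A\<in>UNIV. \<Sum>B\<in>UNIV. ?H A B)"
   by (subst sum.swap, rule sum.cong[OF refl], subst sum.swap, rule sum.cong[OF refl]) (simp only: sum.delta finite UNIV_I if_True)
  also have "... = (\<Sum>A\<in>UNIV. \<Sum>B\<in>UNIV. \<Sum>i<length vs. ?R A B i)"
   unfolding HD ..
  also have "... = (\<Sum>i<length vs. \<Sum>A\<in>UNIV. \<Sum>B\<in>UNIV. ?R A B i)"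
   by (simp only: sum.swap[of _ "{..<length vs}" UNIV])
  also have "... = (\<Sum>i<length vs. 1 / 2 * ?SP i - 1 / 2 * ?SQ i)"
   by (simp only: sum_subtractf sum_distrib_left)
  also have "... = (\<Sum>i<length vs. w i (L i ?ph))"
  proof (rule sum.cong[OF refl])
   fix i
   \<comment> \<open>Exchanging the names \<open>A\<close> and \<open>B\<close> turns one sum into
     the other up to the sign of \<open>EE\<close>, so both halves contribute the same
     amount.\<close>
   have "?SP i = - ?SQ i"
    unfolding sum_negf[symmetric] by (subst sum.swap) (simp add: EE_def algebra_simps)
   then show "1 / 2 * ?SP i - 1 / 2 * ?SQ i = w i (L i ?ph)"
    using EE_pull(2)[OF w(1) ph, of "vs ! i" i] by (simp add: L_def)
  qed
  also have "... = pair_dist (V0 k) G f" unfolding fs(2) pair_mk[OF G] using w(2)[OF ph] k by simp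
  finally show ?thesis ..
 qed
 ultimately show ?thesis by blast
qed

lemma surj_pair:
 assumes "G : sec (hat CARD('n * 2) (V0 k))"
 shows "EX F:sec (hat CARD('n * 2) (V1 k)). ALL f:test_sec (V0 k). pair_dist (V0 k) G f = pair_dist (V1 k) F (D0 S k f)"
 using surj_pos[OF _ assms] surj_zero[OF _ assms] by (cases "k = 0") auto

end

section \<open>The two classes: distributions and smooth functions\<close>

lemma distr_cmult:
 assumes u: "u : distr"
 shows "(%ph. c * u ph) : distr"
proof -
 have "dist_pull (%ph p. c * ph p) u = (%ph. c * u ph)" using distrD(2,3)[OF u] by (auto simp: dist_pull_def fun_eq_iff)
 then show ?thesis using dist_pull_distr[OF test_cont_mult[OF smooth_on_const[of UNIV c]] u] by simp
qed

definition TU :: "('a::euclidean_space => complex) => ('a => complex) => complex" where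
 "TU U ph = (if ph : test_fun then LI p. U p * ph p else 0)"

lemma TU_integrable: "smo U ==> ph : test_fun ==> lint (%p. U p * ph p)"
 by (intro test_fun_lint test_fun_mult)

lemma TU_distr:
 assumes U: "smo U" shows "TU U : distr"
proof (rule distrI)
 show "TU U (%p. ph p + ps p) = TU U ph + TU U ps" if "ph : test_fun" "ps : test_fun" for ph ps
  using that TU_integrable[OF U] by (simp add: TU_def test_fun_add distrib_left)
 show "TU U (%p. c * ph p) = c * TU U ph" if "ph : test_fun" for c ph
  using that by (simp add: TU_def test_fun_cmult mult.left_commute)
 fix K :: "'a set" assume K: "compact K"
 have c: "cont U" by (rule smooth_cont[OF U])
 have i: "lint (%p. indicator K p *\<^sub>R U p)"
  by (rule borel_integrable_compact[OF K continuous_on_subset[OF c]]) simp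
 have "cmod (TU U ph) <= (LI p. cmod (indicator K p *\<^sub>R U p)) * Cm_norm 0 ph" if ph: "ph : test_in K" for ph
 proof -
  note t = test_in_test[OF ph]
  have e: "(%p. (indicator K p *\<^sub>R U p) * ph p) = (%p. U p * ph p)"
  proof
   fix p show "(indicator K p *\<^sub>R U p) * ph p = U p * ph p" using test_in_zero[OF ph, of p] by (cases "p : K") auto
  qed
  have "cmod (LI p. (indicator K p *\<^sub>R U p) * ph p) <= Cm_norm 0 ph * (LI p. cmod (indicator K p *\<^sub>R U p))"
  proof (rule norm_integral_mult_le[OF i])
   show "lint (%p. (indicator K p *\<^sub>R U p) * ph p)" unfolding e by (rule TU_integrable[OF U t])
  qed (rule Cm_norm_ge[OF t])
  then show ?thesis using t unfolding e TU_def by (simp only: if_True mult.commute)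
 qed
 then show "EX C m. ALL ph:test_in K. cmod (TU U ph) <= C * Cm_norm m ph" by blast
qed (simp add: TU_def)

text \<open>Smooth functions are treated as distributions, so that one argument about transposes
  covers both cases; \<open>TU_inj\<close> allows the way back.\<close>

definition smooth_distr :: "(('a::euclidean_space => complex) => complex) set" where
 "smooth_distr = TU ` {U. smo U}"

lemma smooth_distrI: "smo U ==> u = TU U ==> u : smooth_distr"
 by (auto simp: smooth_distr_def)

lemma smooth_distrE: "u : smooth_distr ==> (!!U. smo U ==> u = TU U ==> P) ==> P"
 by (auto simp: smooth_distr_def)

lemma test_cont_dt: "test_cont (dt be :: ('n::finite pt => complex) => _)"
proof -
 have "test_cont (dird (0::real^('n * 4), axis be 1 :: real^3))"
  by (rule test_cont_dird_Basis) (auto simp: Basis_prod_def Basis_vec_def)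
 then show ?thesis by (simp add: dt_def[abs_def])
qed

lemma fclass_distr: "fclass S distr"
proof
 show "dist_pull (Xf (Bv S) w) u : distr" if "u : distr" for u w
  by (rule dist_pull_distr[OF test_cont_Xf[OF bb_Bv] that])
 show "dist_pull (dt be) u : distr" if "u : distr" for u be
  by (rule dist_pull_distr[OF test_cont_dt that])
qed (auto intro: distr_zero distr_add distr_cmult)

lemma TU_zero: "TU (%p. 0) = (%ph. 0)"
 by (rule ext) (simp add: TU_def)

lemma fclass_smooth: "fclass S smooth_distr"
proof
 show "smooth_distr <= distr" using TU_distr by (auto elim!: smooth_distrE)
 show "(%ph. 0) : smooth_distr" by (rule smooth_distrI[OF smooth_on_const[OF open_UNIV, of 0]]) (simp add: TU_zero)
 show "(%ph. u ph + v ph) : smooth_distr" if uv: "u : smooth_distr" "v : smooth_distr" for u v :: "('a pt => complex) => complex"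
 proof -
  obtain U V where UV: "smo U" "u = TU U" "smo V" "v = TU V" using uv by (blast elim: smooth_distrE)
  show ?thesis
   by (rule smooth_distrI[OF smooth_on_add[OF open_UNIV UV(1,3)]], rule ext)
     (simp add: UV TU_def distrib_right TU_integrable)
 qed
 show "(%ph. c * u ph) : smooth_distr" if u: "u : smooth_distr" for u :: "('a pt => complex) => complex" and c
 proof -
  obtain U where U: "smo U" "u = TU U" using u by (blast elim: smooth_distrE)
  show ?thesis
   by (rule smooth_distrI[OF smooth_on_mult[OF open_UNIV smooth_on_const[OF open_UNIV, of c] U(1)]], rule ext)
     (simp add: U TU_def mult.assoc)
 qed
 show "dist_pull (Xf (Bv S) w) u : smooth_distr" if u: "u : smooth_distr" for u :: "('a pt => complex) => complex" and w
 proof -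
  obtain U where U: "smo U" "u = TU U" using u by (blast elim: smooth_distrE)
  show ?thesis
   by (rule smooth_distrI[OF smooth_on_minus[OF open_UNIV smooth_on_Xf[OF bb_Bv[of S] open_UNIV U(1), of w]]], rule ext)
     (simp add: U TU_def dist_pull_def test_fun_Xf[OF bb_Bv] integral_by_parts_Xf[OF bb_Bv U(1)])
 qed
 show "dist_pull (dt be) u : smooth_distr" if u: "u : smooth_distr" for u :: "('a pt => complex) => complex" and be
 proof -
  obtain U where U: "smo U" "u = TU U" using u by (blast elim: smooth_distrE)
  show ?thesis unfolding dt_def[abs_def]
   by (rule smooth_distrI[OF smooth_on_minus[OF open_UNIV smooth_on_dird[OF U(1), of "(0, axis be 1)"]]], rule ext)
     (simp add: U TU_def dist_pull_def test_fun_dird integral_by_parts[OF U(1)])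
 qed
qed

lemma TU_inj:
 assumes "smo U" "smo V" "TU U = TU V"
 shows "U = V"
proof
 fix p
 have "(LI p. (U p - V p) * ph p) = 0" if "ph : test_fun" for ph
 proof -
  have "TU U ph = TU V ph" using assms(3) by simp
  then show ?thesis using that by (simp add: TU_def left_diff_distrib TU_integrable assms(1,2))
 qed
 then have "U p - V p = 0"
  by (intro continuous_zero_if_test_integrals_zero[of "%p. U p - V p"] continuous_intros smooth_cont assms(1,2))
 then show "U p = V p" by simp
qed

definition TT :: "('n::finite pt => 'n vec_el) => 'n dist_el" where
 "TT F r a b I = TU (%p. F p r a b I)"

lemma smooth_secD: "F : smooth_sec vs ==> smo (%p. F p r a b I)"
  "F : smooth_sec vs ==> \<not> in_shape vs r a b I ==> F p r a b I = 0"
 unfolding smooth_sec_def vspace_def smooth_iff by blast+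

lemma smooth_secI:
 assumes "!!r a b I. smo (%p. F p r a b I)" "!!p r a b I. \<not> in_shape vs r a b I ==> F p r a b I = 0"
 shows "F : smooth_sec vs"
 unfolding smooth_sec_def vspace_def smooth_iff using assms by blast

lemma pair_smooth_TT:
 assumes F: "!!r a b I. smo (%p. F p r a b I)" and f: "!!r a b I. (%p. f p r a b I) : test_fun"
 shows "pair_smooth vs F f = pair_dist vs (TT F) f"
proof -
 have i: "lint (%p. F p r a b I * f p r a b J)" for r a b I J by (rule TU_integrable[OF F f])
 have iw: "lint (%p. wedge_by (*) (F p r a b) (f p r a b) UNIV)"
  and w: "(LI p. wedge_by (*) (F p r a b) (f p r a b) UNIV) = wedge_by (%u ph. u ph) (TT F r a b) (%I p. f p r a b I) UNIV" for r a b
  unfolding wedge_by_def using i f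
  by (simp_all add: Bochner_Integration.integral_sum TT_def TU_def)
 show ?thesis
  unfolding pair_smooth_def pair_dist_def contract_def Let_def
  using iw by (simp add: Bochner_Integration.integral_sum w)
qed

lemma quotient_single:
 assumes "X ~= {}" "!!F G. F : X ==> G : X ==> d F G : X"
 shows "X // {(F, G). F : X & G : X & d F G : X} = {X}"
proof -
 have "{(F, G). F : X & G : X & d F G : X} `` {F} = X" if "F : X" for F using assms(2) that by auto
 then show ?thesis using assms(1) unfolding quotient_def by auto
qed

context fsolve
begin

lemma ex1_pair:
 assumes "F : sec (hat CARD('n * 2) (V1 k))"
 shows "EX! G. G : sec (hat CARD('n * 2) (V0 k)) & (ALL f:test_sec (V0 k). pair_dist (V0 k) G f = pair_dist (V1 k) F (D0 S k f))"
 using transpose_exists[OF assms, of "V1 k"] transpose_unique by metis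

end

text \<open>Existence and uniqueness of the transpose give meaning to the descriptions by
  \<open>THE\<close>, and once the images are everything, the quotients have a single class. The
  smooth statements are transported through \<open>TT\<close>, injective on smooth sections.\<close>

theorem theorem1p3:
  fixes S :: "real^('n::{finite,linorder} \<times> 4)^('n \<times> 4)" and k :: nat
  assumes "transpose S = S"
    and "right_type S"
    and "cond_H S"
  shows "H0_smooth S k = {D0_hat_smooth S k ` E_hat1 k} \<and>
    H0_dist S k = {D0_hat_dist S k ` D'_hat1 k} \<and>
    D0_hat_smooth S k ` E_hat1 k = E_hat0 k \<and>
    D0_hat_dist S k ` D'_hat1 k = D'_hat0 k"
proof -
 obtain vs Ep Ci where vs: "vs ~= []" "good_lines (Bv S) (map (%v. (Ev v, Cv S v)) vs)"
  and n: "nline (Bv S) (Ev (hd vs)) (Cv S (hd vs)) Ep Ci"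
  using good_lines_exist[OF assms] by blast
 interpret D: fsolve S k distr vs
 proof (rule fsolve.intro[OF fclass_distr fsolve_axioms.intro[OF assms(1,2)]])
  fix G :: "('n pt => complex) => complex" assume G: "G : distr"
  have n': "nline (Bv S) (fst (hd (map (%v. (Ev v, Cv S v)) vs))) (snd (hd (map (%v. (Ev v, Cv S v)) vs))) Ep Ci"
   using n vs(1) by (simp add: hd_map)
  obtain us where us: "!!i. us i : distr"
   "!!ph. ph : test_fun ==> G ph = (\<Sum>i<length (map (%v. (Ev v, Cv S v)) vs). us i (line.LM (Bv S) (fst (map (%v. (Ev v, Cv S v)) vs ! i)) ph))"
   using solve_distr[OF vs(2) n' G] by blast
  have "G ph = (\<Sum>i<length vs. us i (line.LM (Bv S) (Ev (vs ! i)) ph))" if "ph : test_fun" for ph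
   using us(2)[OF that] by (simp cong: sum.cong_simp)
  then show "EX us. (ALL i. us i : distr) & (ALL ph:test_fun. G ph = (\<Sum>i<length vs. us i (line.LM (Bv S) (Ev (vs ! i)) ph)))"
   using us(1) by blast
 qed
 interpret E: fsolve S k smooth_distr vs
 proof (rule fsolve.intro[OF fclass_smooth fsolve_axioms.intro[OF assms(1,2)]])
  fix G :: "('n pt => complex) => complex" assume "G : smooth_distr"
  then obtain g where g: "smo g" "G = TU g" by (rule smooth_distrE)
  obtain U where U: "smo U" "!!ph. ph : test_fun ==> (LI p. g p * ph p) = (LI p. U p * line.LM (Bv S) (Ev (hd vs)) ph p)"
   using nline.mittag_leffler_smooth[OF n g(1)] by blast
  \<comment> \<open>A smooth right-hand side is solved on the nondegenerate line, the first of the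
    list; the other coefficients are 0.\<close>
  define us where "us i = TU (if i = 0 then U else (%p. 0))" for i :: nat
  have "us i : smooth_distr" for i
   unfolding us_def by (rule smooth_distrI[OF _ refl]) (simp add: U(1) smooth_on_const)
  moreover have "G ph = (\<Sum>i<length vs. us i (line.LM (Bv S) (Ev (vs ! i)) ph))" if ph: "ph : test_fun" for ph
  proof -
   have L: "line.LM (Bv S) (Ev (hd vs)) ph : test_fun"
    using test_contD(1)[OF line.test_cont_LM[OF line_v[OF assms(1,2)]] ph] .
   obtain l where l: "length vs = Suc l" using vs(1) by (cases vs) auto
   have "vs ! 0 = hd vs" using vs(1) by (simp add: hd_conv_nth)
   then show ?thesis
    unfolding l sum.lessThan_Suc_shift using U(2)[OF ph] ph L by (simp add: us_def g(2) TU_zero) (simp add: TU_def)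
  qed
  ultimately show "EX us. (ALL i. us i : smooth_distr) & (ALL ph:test_fun. G ph = (\<Sum>i<length vs. us i (line.LM (Bv S) (Ev (vs ! i)) ph)))"
   by blast
 qed
 let ?h = "hat CARD('n * 2)"
 have dsec: "D.sec ss = dist_sec ss" for ss by (simp add: D.sec_def dist_sec_def)
 have Dimg: "D0_hat_dist S k ` D'_hat1 k = D'_hat0 k"
 proof
  have "D0_hat_dist S k F : D'_hat0 k" if F: "F : D'_hat1 k" for F
   using theI'[OF D.ex1_pair[of F]] F unfolding dsec D0_hat_dist_def D'_hat0_def D'_hat1_def by blast
  then show "D0_hat_dist S k ` D'_hat1 k <= D'_hat0 k" by blast
  show "D'_hat0 k <= D0_hat_dist S k ` D'_hat1 k"
  proof
   fix G :: "'n dist_el" assume "G : D'_hat0 k"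
   then have G: "G : D.sec (?h (V0 k))" by (simp only: dsec D'_hat0_def)
   obtain F where F: "F : D.sec (?h (V1 k))" "ALL f:test_sec (V0 k). pair_dist (V0 k) G f = pair_dist (V1 k) F (D0 S k f)"
    using D.surj_pair[OF G] by blast
   have "D0_hat_dist S k F = G"
    unfolding D0_hat_dist_def D'_hat0_def dsec[symmetric] by (rule the1_equality[OF D.ex1_pair[OF F(1)]]) (use F(2) G in blast)
   then show "G : D0_hat_dist S k ` D'_hat1 k" using F(1) unfolding D'_hat1_def dsec by blast
  qed
 qed
 have TT: "TT F : E.sec ss" if F: "F : smooth_sec ss" for F :: "'n pt => 'n vec_el" and ss
  unfolding E.sec_def mem_Collect_eq
 proof (intro allI conjI impI)
  fix r a b I
  show "TT F r a b I : smooth_distr" unfolding TT_def by (rule smooth_distrI[OF smooth_secD(1)[OF F] refl])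
  show "TT F r a b I = (%ph. 0)" if "\<not> in_shape ss r a b I"
   unfolding TT_def smooth_secD(2)[OF F that] by (rule TU_zero)
 qed
 have TTs: "EX F:smooth_sec ss. u = TT F" if u: "u : E.sec ss" for u ss
 proof -
  have "EX U. smo U & u r a b I = TU U" for r a b I
   using E.secD(1)[OF u, of r a b I] by (blast elim: smooth_distrE)
  then have "EX U. ALL r a b I. smo (U r a b I) & u r a b I = TU (U r a b I)" by metis
  then obtain U where U: "!!r a b I. smo (U r a b I)" "!!r a b I. u r a b I = TU (U r a b I)" by blast
  define F where "F p r a b I = (if in_shape ss r a b I then U r a b I p else 0)" for p r a b I
  have "F : smooth_sec ss"
  proof (rule smooth_secI)
   show "smo (%p. F p r a b I)" for r a b I
    unfolding F_def using U(1)[of r a b I] by (cases "in_shape ss r a b I") (simp_all add: smooth_on_const)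
  qed (simp add: F_def)
  moreover have "u = TT F"
  proof (intro ext)
   fix r a b I ph
   show "u r a b I ph = TT F r a b I ph"
    using U(2)[of r a b I] E.secD(2)[OF u, of r a b I] by (cases "in_shape ss r a b I") (simp_all add: TT_def F_def TU_zero)
  qed
  ultimately show ?thesis by blast
 qed
 have TTi: "F = F'" if F: "F : smooth_sec ss" "F' : smooth_sec ss" and e: "TT F = TT F'" for F F' :: "'n pt => 'n vec_el" and ss
 proof (intro ext)
  fix p r a b I
  have "(%p. F p r a b I) = (%p. F' p r a b I)"
   by (rule TU_inj[OF smooth_secD(1)[OF F(1)] smooth_secD(1)[OF F(2)]]) (use e in "simp add: TT_def[symmetric]")
  then show "F p r a b I = F' p r a b I" by metis
 qed
 have tf: "(%p. f p r a b I) : test_fun" "(%p. D0 S k f p r a b I) : test_fun" if f: "f : test_sec (V0 k)" for f r a b I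
 proof -
  obtain fs where fs: "!!c. fs c : test_fun" "f = D.mk fs" using D.test_sec_mk[OF f] by blast
  have "D.mop (%fs p. D.mk fs p r a b I)"
  proof (cases "r = 0")
   case True
   then show ?thesis using D.msec_mk by (simp add: D.msec_def)
  qed (simp add: D.mk_def D.mop_zero)
  then show "(%p. f p r a b I) : test_fun" unfolding fs(2) by (rule D.mop_test[OF _ fs(1)])
  show "(%p. D0 S k f p r a b I) : test_fun" unfolding fs(2) by (rule D.mop_test[OF D.mop_D0 fs(1)])
 qed
 have iff: "(ALL f:test_sec (V0 k). pair_smooth (V0 k) G f = pair_smooth (V1 k) F (D0 S k f))
   \<longleftrightarrow> (ALL f:test_sec (V0 k). pair_dist (V0 k) (TT G) f = pair_dist (V1 k) (TT F) (D0 S k f))"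
  if GF: "G : smooth_sec ss" "F : smooth_sec ss'" for F G ss ss'
 proof (rule ball_cong[OF refl])
  fix f :: "'n pt => 'n vec_el" assume f: "f : test_sec (V0 k)"
  have "pair_smooth (V0 k) G f = pair_dist (V0 k) (TT G) f"
   by (rule pair_smooth_TT) (rule smooth_secD(1)[OF GF(1)], rule tf(1)[OF f])
  moreover have "pair_smooth (V1 k) F (D0 S k f) = pair_dist (V1 k) (TT F) (D0 S k f)"
   by (rule pair_smooth_TT) (rule smooth_secD(1)[OF GF(2)], rule tf(2)[OF f])
  ultimately show "(pair_smooth (V0 k) G f = pair_smooth (V1 k) F (D0 S k f))
    \<longleftrightarrow> (pair_dist (V0 k) (TT G) f = pair_dist (V1 k) (TT F) (D0 S k f))" by simp
 qed
 have ex1: "EX! G. G : E_hat0 k & (ALL f:test_sec (V0 k). pair_smooth (V0 k) G f = pair_smooth (V1 k) F (D0 S k f))" if F: "F : E_hat1 k" for F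
 proof -
  have F1: "F : smooth_sec (?h (V1 k))" using F by (simp only: E_hat1_def)
  obtain u where u: "u : E.sec (?h (V0 k))" "ALL f:test_sec (V0 k). pair_dist (V0 k) u f = pair_dist (V1 k) (TT F) (D0 S k f)"
   using E.transpose_exists[OF TT[OF F1], of "V1 k"] by blast
  obtain G where G: "G : smooth_sec (?h (V0 k))" "u = TT G" using TTs[OF u(1)] by blast
  show ?thesis
  proof (rule ex1I[of _ G])
   show "G : E_hat0 k & (ALL f:test_sec (V0 k). pair_smooth (V0 k) G f = pair_smooth (V1 k) F (D0 S k f))"
    using iff[OF G(1) F1] u(2) G by (simp only: E_hat0_def)
   fix G' assume "G' : E_hat0 k & (ALL f:test_sec (V0 k). pair_smooth (V0 k) G' f = pair_smooth (V1 k) F (D0 S k f))"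
   then have G': "G' : smooth_sec (?h (V0 k))" "ALL f:test_sec (V0 k). pair_smooth (V0 k) G' f = pair_smooth (V1 k) F (D0 S k f)"
    unfolding E_hat0_def by blast+
   have "TT G' = TT G"
    by (rule E.transpose_unique[OF TT[OF G'(1)] TT[OF G(1)]]) (use iff[OF G'(1) F1] G'(2) u(2) G(2) in simp)
   then show "G' = G" by (rule TTi[OF G'(1) G(1)])
  qed
 qed
 have Eimg: "D0_hat_smooth S k ` E_hat1 k = E_hat0 k"
 proof
  have "D0_hat_smooth S k F : E_hat0 k" if F: "F : E_hat1 k" for F
   using theI'[OF ex1[OF F]] unfolding D0_hat_smooth_def by blast
  then show "D0_hat_smooth S k ` E_hat1 k <= E_hat0 k" by blast
  show "E_hat0 k <= D0_hat_smooth S k ` E_hat1 k"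
  proof
   fix G :: "'n pt => 'n vec_el" assume G0: "G : E_hat0 k"
   then have G: "G : smooth_sec (?h (V0 k))" by (simp only: E_hat0_def)
   obtain u where u: "u : E.sec (?h (V1 k))" "ALL f:test_sec (V0 k). pair_dist (V0 k) (TT G) f = pair_dist (V1 k) u (D0 S k f)"
    using E.surj_pair[OF TT[OF G]] by blast
   obtain F where F: "F : smooth_sec (?h (V1 k))" "u = TT F" using TTs[OF u(1)] by blast
   then have F1: "F : E_hat1 k" by (simp only: E_hat1_def)
   have "D0_hat_smooth S k F = G"
    unfolding D0_hat_smooth_def by (rule the1_equality[OF ex1[OF F1]]) (use iff[OF G F(1)] u(2) F(2) G0 in simp)
   then show "G : D0_hat_smooth S k ` E_hat1 k" using F1 by blast
  qed
 qed
 have "H0_smooth S k = {E_hat0 k}"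
  unfolding H0_smooth_def Eimg
 proof (rule quotient_single)
  have "(%p r a b I. 0) : (E_hat0 k :: ('n pt => 'n vec_el) set)"
   unfolding E_hat0_def by (rule smooth_secI) (simp_all add: smooth_on_const)
  then show "E_hat0 k ~= ({} :: ('n pt => 'n vec_el) set)" by blast
  show "(%p r a b I. F p r a b I - G p r a b I) : E_hat0 k" if "F : E_hat0 k" "G : E_hat0 k" for F G :: "'n pt => 'n vec_el"
  proof -
   have F: "F : smooth_sec (?h (V0 k))" and G: "G : smooth_sec (?h (V0 k))" using that by (simp_all only: E_hat0_def)
   show ?thesis unfolding E_hat0_def
   proof (rule smooth_secI)
    show "smo (%p. F p r a b I - G p r a b I)" for r a b I
     by (intro smooth_on_diff open_UNIV smooth_secD(1)[OF F] smooth_secD(1)[OF G])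
    show "F p r a b I - G p r a b I = 0" if "\<not> in_shape (?h (V0 k)) r a b I" for p r a b I
     unfolding smooth_secD(2)[OF F that] smooth_secD(2)[OF G that] by simp
   qed
  qed
 qed
 moreover have "H0_dist S k = {D'_hat0 k}"
  unfolding H0_dist_def Dimg
 proof (rule quotient_single)
  have "(%r a b I ph. 0) : (D'_hat0 k :: 'n dist_el set)" by (simp add: D'_hat0_def dist_sec_def distr_zero)
  then show "D'_hat0 k ~= ({} :: 'n dist_el set)" by blast
  show "(%r a b I ph. F r a b I ph - G r a b I ph) : D'_hat0 k" if FG: "F : D'_hat0 k" "G : D'_hat0 k" for F G :: "'n dist_el"
  proof -
   have "(%ph. F r a b I ph - G r a b I ph) : distr" for r a b I
    using distr_add[of "F r a b I", OF _ distr_cmult[of "G r a b I" "-1"]] FG unfolding D'_hat0_def dist_sec_def by simp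
   then show ?thesis using FG unfolding D'_hat0_def dist_sec_def by simp
  qed
 qed
 ultimately show ?thesis using Dimg Eimg by simp
qed

end
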